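(* If $(\mathcal{Q},\mathrm{Ind},\mathrm{Res})$ is a categorification of the $\mathcal{A}$-bialgebra ${}_{\mathcal{A}}\mathbf{f}$, where $\mathcal A=\mathbb Z[v^{\pm1}]$, then $(\mathfrak{Q},\mathfrak{Ind},\mathfrak{Res})$ is a categorification of the $\mathfrak{A}$-bialgebra ${}_{\mathfrak{A}}\mathfrak{f}$, where $\mathfrak A=\mathbb Z[v^{\pm1},t^{\pm1}]$.
   Context: **Datum.** $I$ is a finite set and $\Omega=(\Omega_{ij})_{i,j\in I}$ an integer matrix such that (a) $\Omega_{ii}\in\mathbb{Z}_{>0}$ and $\Omega_{ij}\in\mathbb{Z}_{\le0}$ for $i\neq j$; (b) $\frac{\Omega_{ij}+\Omega_{ji}}{\Omega_{ii}}\in\mathbb{Z}_{\le0}$ for $i\ne j$; (c) $\gcd_i(\Omega_{ii})=1$. Bilinear forms on $\mathbb{Z}^I$: $\langle i,j\rangle=\Omega_{ij}$, $[i,j]=2\delta_{ij}\Omega_{ii}-\Omega_{ij}$, $i\cdot j=\langle i,j\rangle+\langle j,i\rangle$. For indeterminates $v,t$: $v_i=v^{i\cdot i/2}$, $t_i=t^{i\cdot i/2}$, $[n]_v=\frac{v^n-v^{-n}}{v-v^{-1}}$, $[n]_{v,t}=t^{n-1}[n]_v$, $[n]^!_{v,t}=\prod_{k=1}^n[k]_{v,t}$, and $[n]^!_{v_i,t_i}$, $[n]^!_{v_i}$ are obtained by substitution. **The bialgebras.** ${}'\mathfrak{f}$ is the free unital associative $\mathbb{Q}(v,t)$-algebra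 on $\theta_i$ ($i\in I$), $\mathbb{N}^I$-graded with $|\theta_i|=i$. ${}'\mathfrak{f}\otimes{}'\mathfrak{f}$ has multiplication $(x_1\otimes x_2)(y_1\otimes y_2)=v^{-|y_1|\cdot|x_2|}t^{\langle|y_1|,|x_2|\rangle-\langle|x_2|,|y_1|\rangle}x_1y_1\otimes x_2y_2$, and $r:{}'\mathfrak{f}\to{}'\mathfrak{f}\otimes{}'\mathfrak{f}$ is the algebra homomorphism with $r(\theta_i)=\theta_i\otimes1+1\otimes\theta_i$. There is a unique (symmetric) bilinear form $(,)$ on ${}'\mathfrak{f}$ with $(1,1)=1$, $(\theta_i,\theta_j)=\delta_{ij}(1-v_i^{-2})^{-1}$, $(x,y'y'')=(r(x),y'\otimes y'')$, $(x'x'',y)=(x'\otimes x'',r(y))$, where $(x_1\otimes x_2,y_1\otimes y_2)=t^{2[|x_1|,|x_2|]}(x_1,y_1)(x_2,y_2)$. $\mathfrak{f}$ is the quotient of ${}'\mathfrak{f}$ by the radical (a two-sided ideal) of $(,)$, with induced $r$. $\mathfrak{A}=\mathbb{Z}[v^{\pm1},t^{\pm1}]$; ${}_{\mathfrak{A}}\mathfrak{f}$ is the $\mathfrak{A}$-subalgebra of $\mathfrak{f}$ generated by all $\theta_i^n/[n]^!_{v_i,t_i}$, with (twisted) bialgebra structure given by its product and $r$. Lusztig's algebra $\mathbf{f}$ over $\mathbb{Q}(v)$ is obtained by the same construction over $\mathbb Q(v)$ with $t=1$; $\mathcal{A}=\mathbb{Z}[v^{\pm1}]$, and ${}_{\mathcal{A}}\mathbf{f}$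 is the $\mathcal{A}$-subalgebra generated by all $\theta_i^n/[n]^!_{v_i}$, with its product and comultiplication. **Categorification.** A categorification of ${}_{\mathcal{A}}\mathbf{f}$ is a triple $(\mathcal{Q}=\bigoplus_{\nu\in\mathbb{N}^I}\mathcal{Q}_\nu,\mathrm{Ind},\mathrm{Res})$ of additive categories $\mathcal{Q}_\nu$ whose split Grothendieck groups $K_0(\mathcal{Q}_\nu)$ carry $\mathcal{A}$-module structures, together with additive functors $\mathrm{Ind}$ (with components $\mathrm{Ind}^{\nu,0}_{\tau,\omega}:\mathcal{Q}_\tau\times\mathcal{Q}_\omega\to\mathcal{Q}_\nu$, $\nu=\tau+\omega$) and $\mathrm{Res}$ (with components $\mathrm{Res}^{\nu,0}_{\tau,\omega}$ from $\mathcal{Q}_\nu$ to the product of $\mathcal{Q}_\tau$ and $\mathcal{Q}_\omega$, the product being understood so that its Grothendieck group is $K_0(\mathcal{Q}_\tau)\otimes_{\mathcal{A}}K_0(\mathcal{Q}_\omega)$), such that there is an isomorphism of $\mathbb N^I$-graded (twisted) bialgebras ${}_{\mathcal{A}}\mathbf{f}\simeq(K_0(\mathcal{Q}),[\mathrm{Ind}],[\mathrm{Res}])$, where $[\cdot]$ denotes the maps induced on Grothendieck groups. A categorification of ${}_{\mathfrak{A}}\mathfrak{f}$ is defined in the same way with $\mathfrak{A}$, ${}_{\mathfrak{A}}\mathfrak{f}$ in place of $\mathcal{A}$, ${}_{\mathcal{A}}\mathbf{f}$. **Construction of $\mathfrak{Q}$.** For $n\in\mathbb{Z}$ let $\mathcal{Q}_{n,\nu}$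 be a copy of $\mathcal{Q}_\nu$, with $\mathcal{Q}_{0,\nu}=\mathcal{Q}_\nu$, and let $\mathcal{T}:\mathcal{Q}_{n-1,\nu}\to\mathcal{Q}_{n,\nu}$ be the identity functor, with iterates $\mathcal{T}^n:\mathcal{Q}_{k,\nu}\to\mathcal{Q}_{n+k,\nu}$ ($n\in\mathbb{Z}$). Put $\mathfrak{Q}_\nu=\bigoplus_{n\in\mathbb{Z}}\mathcal{Q}_{n,\nu}$, $\mathfrak{Q}=\bigoplus_\nu\mathfrak{Q}_\nu$; $K_0(\mathfrak{Q}_\nu)$ is an $\mathfrak{A}$-module via the given $\mathcal{A}$-action on each $K_0(\mathcal{Q}_{n,\nu})$ and $t\cdot[L]=[\mathcal{T}(L)]$. For $\nu=\tau+\omega$ define $\mathrm{Ind}^{\nu,n,m}_{\tau,\omega}:\mathcal{Q}_{n,\tau}\times\mathcal{Q}_{m,\omega}\to\mathcal{Q}_{n+m,\nu}$, $(L,M)\mapsto\mathcal{T}^{n+m}\mathrm{Ind}^{\nu,0}_{\tau,\omega}(\mathcal{T}^{-n}L,\mathcal{T}^{-m}M)$, and $\mathrm{Res}^{\nu,n,m}_{\tau,\omega}$ from $\mathcal{Q}_{n+m,\nu}$ to the product of $\mathcal{Q}_{n,\tau}$ and $\mathcal{Q}_{m,\omega}$, $L\mapsto(\mathcal{T}^n\times\mathcal{T}^m)\mathrm{Res}^{\nu,0}_{\tau,\omega}(\mathcal{T}^{-(n+m)}L)$. On $\mathcal{Q}_{n,\tau}\times\mathcal{Q}_{m,\omega}$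 the functor $\mathfrak{Ind}$ is $\mathcal{T}^{[\tau,\omega]}\circ\mathrm{Ind}^{\nu,n,m}_{\tau,\omega}$; on $\mathcal{Q}_{n+m,\nu}$ the functor $\mathfrak{Res}$ is $\bigoplus_{\tau+\omega=\nu}\mathcal{T}^{-[\tau,\omega]}\circ\mathrm{Res}^{\nu,n,m}_{\tau,\omega}$. Here, for an object of $\mathcal{Q}_{k,\nu}$, one uses any one choice of $(n,m)$ with $n+m=k$; since $t$ acts through either tensor factor, the resulting class in $K_0(\mathfrak{Q}_\tau)\otimes_{\mathfrak{A}}K_0(\mathfrak{Q}_\omega)$ does not depend on the choice. *)

theory Defs
  imports
    "HOL-Algebra.Free_Abelian_Groups"
    "HOL-Algebra.Module"
    "HOL-Algebra.QuotRing"
    "HOL-Computational_Algebra.Polynomial"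
    "HOL-Computational_Algebra.Fraction_Field"
    "HOL-Library.Function_Algebras"
    "HOL-Library.Poly_Mapping"
begin

section \<open>Generalities\<close>

subsection \<open>Coefficients\<close>

text \<open>
  The field \<open>\<rat>(v,t)\<close> is realised as \<open>\<rat>(v)(t)\<close>.
\<close>

type_synonym Qv = "rat poly fract"
type_synonym Qvt = "rat poly fract poly fract"

definition emb :: "Qv \<Rightarrow> Qvt" where
  "emb a = Fract [:a:] 1"

definition qv :: Qv where
  "qv = Fract [:0, 1:] 1"

definition qt :: Qvt where
  "qt = Fract [:0, 1:] 1"

text \<open>
  \<open>laurent v t\<close> is \<open>\<int>[v\<^sup>\<plusminus>\<^sup>1, t\<^sup>\<plusminus>\<^sup>1]\<close> inside the ambient field; \<open>laurent v 1\<close> is \<open>\<int>[v\<^sup>\<plusminus>\<^sup>1]\<close>.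
\<close>

definition laurent :: "'k::field \<Rightarrow> 'k \<Rightarrow> 'k set" where
  "laurent v t =
     {\<Sum>(a, b)\<in>Poly_Mapping.keys p. of_int (Poly_Mapping.lookup p (a, b)) * v powi a * t powi b
      | p :: int \<times> int \<Rightarrow>\<^sub>0 int. True}"

definition subring_of :: "'k::comm_ring_1 set \<Rightarrow> 'k ring" where
  "subring_of S = \<lparr>carrier = S, monoid.mult = (*), one = 1, zero = 0, add = (+)\<rparr>"

subsection \<open>Abelian groups by generators and relations, tensor products\<close>

definition pres_class :: "'a set \<Rightarrow> ('a \<Rightarrow>\<^sub>0 int) set \<Rightarrow> ('a \<Rightarrow>\<^sub>0 int) \<Rightarrow> ('a \<Rightarrow>\<^sub>0 int) set" where
  "pres_class S rels p =
     generate (free_Abelian_group S) rels #>\<^bsub>free_Abelian_group S\<^esub> p"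

definition pres :: "'a set \<Rightarrow> ('a \<Rightarrow>\<^sub>0 int) set \<Rightarrow> ('a \<Rightarrow>\<^sub>0 int) set monoid" where
  "pres S rels = free_Abelian_group S Mod generate (free_Abelian_group S) rels"

definition tensor_rels ::
  "'r ring \<Rightarrow> ('r, 'a) module \<Rightarrow> ('r, 'b) module \<Rightarrow> ('a \<times> 'b \<Rightarrow>\<^sub>0 int) set" where
  "tensor_rels R M N =
     {frag_of (x \<oplus>\<^bsub>M\<^esub> x', y) - frag_of (x, y) - frag_of (x', y)
        | x x' y. x \<in> carrier M \<and> x' \<in> carrier M \<and> y \<in> carrier N}
   \<union> {frag_of (x, y \<oplus>\<^bsub>N\<^esub> y') - frag_of (x, y) - frag_of (x, y')
        | x y y'. x \<in> carrier M \<and> y \<in> carrier N \<and> y' \<in> carrier N}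
   \<union> {frag_of (a \<odot>\<^bsub>M\<^esub> x, y) - frag_of (x, a \<odot>\<^bsub>N\<^esub> y)
        | a x y. a \<in> carrier R \<and> x \<in> carrier M \<and> y \<in> carrier N}"

definition tensor ::
  "'r ring \<Rightarrow> ('r, 'a) module \<Rightarrow> ('r, 'b) module \<Rightarrow> ('a \<times> 'b \<Rightarrow>\<^sub>0 int) set monoid" where
  "tensor R M N = pres (carrier M \<times> carrier N) (tensor_rels R M N)"

text \<open>The element of \<open>M \<otimes>\<^sub>R N\<close> represented by a formal integer combination of pairs.\<close>

definition tensor_class ::
  "'r ring \<Rightarrow> ('r, 'a) module \<Rightarrow> ('r, 'b) module \<Rightarrow> ('a \<times> 'b \<Rightarrow>\<^sub>0 int) \<Rightarrow> ('a \<times> 'b \<Rightarrow>\<^sub>0 int) set" where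
  "tensor_class R M N p = pres_class (carrier M \<times> carrier N) (tensor_rels R M N) p"

section \<open>The bialgebras\<close>

subsection \<open>The datum\<close>

definition cartan_datum :: "('i::finite \<Rightarrow> 'i \<Rightarrow> int) \<Rightarrow> bool" where
  "cartan_datum \<Omega> \<longleftrightarrow>
     (\<forall>i. 0 < \<Omega> i i) \<and>
     (\<forall>i j. i \<noteq> j \<longrightarrow> \<Omega> i j \<le> 0) \<and>
     (\<forall>i j. i \<noteq> j \<longrightarrow> (\<exists>m\<le>0. \<Omega> i j + \<Omega> j i = m * \<Omega> i i)) \<and>
     Gcd (range (\<lambda>i. \<Omega> i i)) = 1"

text \<open>The three forms are only evaluated on \<open>\<nat>\<^sup>I\<close>; \<open>sq_form\<close> is \<open>[-,-]\<close> and \<open>ang_form\<close> is \<open>\<langle>-,-\<rangle>\<close>.\<close>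

definition ang_form :: "('i::finite \<Rightarrow> 'i \<Rightarrow> int) \<Rightarrow> ('i \<Rightarrow> nat) \<Rightarrow> ('i \<Rightarrow> nat) \<Rightarrow> int" where
  "ang_form \<Omega> a b = (\<Sum>i\<in>UNIV. \<Sum>j\<in>UNIV. int (a i) * int (b j) * \<Omega> i j)"

definition sq_form :: "('i::finite \<Rightarrow> 'i \<Rightarrow> int) \<Rightarrow> ('i \<Rightarrow> nat) \<Rightarrow> ('i \<Rightarrow> nat) \<Rightarrow> int" where
  "sq_form \<Omega> a b =
     (\<Sum>i\<in>UNIV. \<Sum>j\<in>UNIV. int (a i) * int (b j) * ((if i = j then 2 * \<Omega> i i else 0) - \<Omega> i j))"

definition dot_form :: "('i::finite \<Rightarrow> 'i \<Rightarrow> int) \<Rightarrow> ('i \<Rightarrow> nat) \<Rightarrow> ('i \<Rightarrow> nat) \<Rightarrow> int" where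
  "dot_form \<Omega> a b = ang_form \<Omega> a b + ang_form \<Omega> b a"

definition qint :: "'k::field \<Rightarrow> 'k \<Rightarrow> nat \<Rightarrow> 'k" where
  "qint v t n = t powi (int n - 1) * ((v ^ n - v powi (- int n)) / (v - inverse v))"

definition qfact :: "'k::field \<Rightarrow> 'k \<Rightarrow> nat \<Rightarrow> 'k" where
  "qfact v t n = (\<Prod>k = 1..n. qint v t k)"

text \<open>\<open>sub_i \<Omega> v i\<close> is \<open>v\<^sub>i = v\<^bsup>i\<cdot>i/2\<^esup>\<close>; note \<open>i\<cdot>i = 2\<Omega>\<^sub>i\<^sub>i\<close>.\<close>

definition sub_i :: "('i \<Rightarrow> 'i \<Rightarrow> int) \<Rightarrow> 'k::field \<Rightarrow> 'i \<Rightarrow> 'k" where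
  "sub_i \<Omega> v i = v powi (\<Omega> i i)"

subsection \<open>The free algebra, its comultiplication and its form\<close>

text \<open>
  The free algebra is the monoid algebra (with the convolution product of
  finitely supported functions) of the free monoid of words.
  All constructions are made over an arbitrary field with two distinguished elements \<open>v\<close>, \<open>t\<close>.
  They are used for \<open>\<rat>(v,t)\<close> with the two indeterminates, and for \<open>\<rat>(v)\<close> with \<open>t = 1\<close>.
\<close>

datatype 'i word = Word (letters: "'i list")

instantiation word :: (type) monoid_add
begin
definition "0 = Word []"
definition "x + y = Word (letters x @ letters y)"
instance by standard (simp_all add: zero_word_def plus_word_def)
end

type_synonym ('i, 'k) free_alg = "'i word \<Rightarrow>\<^sub>0 'k"
type_synonym ('i, 'k) free_alg2 = "'i word \<times> 'i word \<Rightarrow>\<^sub>0 'k"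

definition deg :: "'i word \<Rightarrow> 'i \<Rightarrow> nat" where
  "deg w i = count_list (letters w) i"

definition scal :: "'k::field \<Rightarrow> ('a \<Rightarrow>\<^sub>0 'k) \<Rightarrow> ('a \<Rightarrow>\<^sub>0 'k)" where
  "scal c = Poly_Mapping.map ((*) c)"

definition \<theta> :: "'i \<Rightarrow> ('i, 'k::field) free_alg" where
  "\<theta> i = Poly_Mapping.single (Word [i]) 1"

definition ptensor :: "('i, 'k::field) free_alg \<Rightarrow> ('i, 'k) free_alg \<Rightarrow> ('i, 'k) free_alg2" where
  "ptensor x y =
     (\<Sum>a\<in>Poly_Mapping.keys x. \<Sum>b\<in>Poly_Mapping.keys y.
        Poly_Mapping.single (a, b) (Poly_Mapping.lookup x a * Poly_Mapping.lookup y b))"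

text \<open>The twisted product on \<open>{}'\<ff> \<otimes> {}'\<ff>\<close>.\<close>

definition tmult ::
  "('i::finite \<Rightarrow> 'i \<Rightarrow> int) \<Rightarrow> 'k::field \<Rightarrow> 'k
    \<Rightarrow> ('i, 'k) free_alg2 \<Rightarrow> ('i, 'k) free_alg2 \<Rightarrow> ('i, 'k) free_alg2" where
  "tmult \<Omega> v t z z' =
     (\<Sum>(x1, x2)\<in>Poly_Mapping.keys z. \<Sum>(y1, y2)\<in>Poly_Mapping.keys z'.
        Poly_Mapping.single (x1 + y1, x2 + y2)
          (v powi (- dot_form \<Omega> (deg y1) (deg x2))
           * t powi (ang_form \<Omega> (deg y1) (deg x2) - ang_form \<Omega> (deg x2) (deg y1))
           * Poly_Mapping.lookup z (x1, x2) * Poly_Mapping.lookup z' (y1, y2)))"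

definition is_comult ::
  "('i::finite \<Rightarrow> 'i \<Rightarrow> int) \<Rightarrow> 'k::field \<Rightarrow> 'k \<Rightarrow> (('i, 'k) free_alg \<Rightarrow> ('i, 'k) free_alg2) \<Rightarrow> bool" where
  "is_comult \<Omega> v t r \<longleftrightarrow>
     (\<forall>x y. r (x + y) = r x + r y) \<and> (\<forall>c x. r (scal c x) = scal c (r x)) \<and>
     r 1 = ptensor 1 1 \<and> (\<forall>x y. r (x * y) = tmult \<Omega> v t (r x) (r y)) \<and>
     (\<forall>i. r (\<theta> i) = ptensor (\<theta> i) 1 + ptensor 1 (\<theta> i))"

definition comult ::
  "('i::finite \<Rightarrow> 'i \<Rightarrow> int) \<Rightarrow> 'k::field \<Rightarrow> 'k \<Rightarrow> ('i, 'k) free_alg \<Rightarrow> ('i, 'k) free_alg2" where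
  "comult \<Omega> v t = (THE r. is_comult \<Omega> v t r)"

text \<open>\<open>(x\<^sub>1\<otimes>x\<^sub>2, y\<^sub>1\<otimes>y\<^sub>2) = t\<^bsup>2[|x\<^sub>1|,|x\<^sub>2|]\<^esup>(x\<^sub>1,y\<^sub>1)(x\<^sub>2,y\<^sub>2)\<close>, extended bilinearly from words.\<close>

definition tform ::
  "('i::finite \<Rightarrow> 'i \<Rightarrow> int) \<Rightarrow> 'k::field \<Rightarrow> (('i, 'k) free_alg \<Rightarrow> ('i, 'k) free_alg \<Rightarrow> 'k)
    \<Rightarrow> ('i, 'k) free_alg2 \<Rightarrow> ('i, 'k) free_alg2 \<Rightarrow> 'k" where
  "tform \<Omega> t B z z' =
     (\<Sum>(x1, x2)\<in>Poly_Mapping.keys z. \<Sum>(y1, y2)\<in>Poly_Mapping.keys z'.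
        Poly_Mapping.lookup z (x1, x2) * Poly_Mapping.lookup z' (y1, y2)
        * t powi (2 * sq_form \<Omega> (deg x1) (deg x2))
        * B (Poly_Mapping.single x1 1) (Poly_Mapping.single y1 1)
        * B (Poly_Mapping.single x2 1) (Poly_Mapping.single y2 1))"

definition is_form ::
  "('i::finite \<Rightarrow> 'i \<Rightarrow> int) \<Rightarrow> 'k::field \<Rightarrow> 'k
    \<Rightarrow> (('i, 'k) free_alg \<Rightarrow> ('i, 'k) free_alg \<Rightarrow> 'k) \<Rightarrow> bool" where
  "is_form \<Omega> v t B \<longleftrightarrow>
     (\<forall>x x' y. B (x + x') y = B x y + B x' y) \<and> (\<forall>c x y. B (scal c x) y = c * B x y) \<and>
     (\<forall>x y y'. B x (y + y') = B x y + B x y') \<and> (\<forall>c x y. B x (scal c y) = c * B x y) \<and>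
     B 1 1 = 1 \<and>
     (\<forall>i j. B (\<theta> i) (\<theta> j) = (if i = j then inverse (1 - sub_i \<Omega> v i powi (-2)) else 0)) \<and>
     (\<forall>x y' y''. B x (y' * y'') = tform \<Omega> t B (comult \<Omega> v t x) (ptensor y' y'')) \<and>
     (\<forall>x' x'' y. B (x' * x'') y = tform \<Omega> t B (ptensor x' x'') (comult \<Omega> v t y))"

definition bform ::
  "('i::finite \<Rightarrow> 'i \<Rightarrow> int) \<Rightarrow> 'k::field \<Rightarrow> 'k \<Rightarrow> ('i, 'k) free_alg \<Rightarrow> ('i, 'k) free_alg \<Rightarrow> 'k" where
  "bform \<Omega> v t = (THE B. is_form \<Omega> v t B)"

definition radical ::
  "('i::finite \<Rightarrow> 'i \<Rightarrow> int) \<Rightarrow> 'k::field \<Rightarrow> 'k \<Rightarrow> ('i, 'k) free_alg set" where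
  "radical \<Omega> v t = {x. \<forall>y. bform \<Omega> v t x y = 0}"

subsection \<open>The quotient and its integral form\<close>

definition free_ring :: "('i, 'k::field) free_alg ring" where
  "free_ring = \<lparr>carrier = UNIV, monoid.mult = (*), one = 1, zero = 0, add = (+)\<rparr>"

definition f_ring ::
  "('i::finite \<Rightarrow> 'i \<Rightarrow> int) \<Rightarrow> 'k::field \<Rightarrow> 'k \<Rightarrow> ('i, 'k) free_alg set ring" where
  "f_ring \<Omega> v t = free_ring Quot radical \<Omega> v t"

definition f_proj ::
  "('i::finite \<Rightarrow> 'i \<Rightarrow> int) \<Rightarrow> 'k::field \<Rightarrow> 'k \<Rightarrow> ('i, 'k) free_alg \<Rightarrow> ('i, 'k) free_alg set" where
  "f_proj \<Omega> v t x = radical \<Omega> v t +>\<^bsub>free_ring\<^esub> x"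

definition f_scal ::
  "('i::finite \<Rightarrow> 'i \<Rightarrow> int) \<Rightarrow> 'k::field \<Rightarrow> 'k
    \<Rightarrow> 'k \<Rightarrow> ('i, 'k) free_alg set \<Rightarrow> ('i, 'k) free_alg set" where
  "f_scal \<Omega> v t c X = (\<Union>x\<in>X. f_proj \<Omega> v t (scal c x))"

text \<open>The homogeneous component of degree \<open>\<nu>\<close>, over the whole field.\<close>

definition f_comp ::
  "('i::finite \<Rightarrow> 'i \<Rightarrow> int) \<Rightarrow> 'k::field \<Rightarrow> 'k \<Rightarrow> ('i \<Rightarrow> nat) \<Rightarrow> ('k, ('i, 'k) free_alg set) module" where
  "f_comp \<Omega> v t \<nu> =
     \<lparr>carrier = f_proj \<Omega> v t ` {x. \<forall>w\<in>Poly_Mapping.keys x. deg w = \<nu>},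
      monoid.mult = monoid.mult (f_ring \<Omega> v t), one = one (f_ring \<Omega> v t),
      zero = zero (f_ring \<Omega> v t), add = add (f_ring \<Omega> v t),
      module.smult = f_scal \<Omega> v t\<rparr>"

inductive_set int_form ::
  "('i::finite \<Rightarrow> 'i \<Rightarrow> int) \<Rightarrow> 'k::field \<Rightarrow> 'k \<Rightarrow> ('i, 'k) free_alg set set"
  for \<Omega> :: "'i::finite \<Rightarrow> 'i \<Rightarrow> int" and v t :: "'k::field" where
  one: "\<one>\<^bsub>f_ring \<Omega> v t\<^esub> \<in> int_form \<Omega> v t"
| divided_power:
    "f_proj \<Omega> v t (scal (inverse (qfact (sub_i \<Omega> v i) (sub_i \<Omega> t i) n)) (\<theta> i ^ n)) \<in> int_form \<Omega> v t"
| mult: "X \<in> int_form \<Omega> v t \<Longrightarrow> Y \<in> int_form \<Omega> v t \<Longrightarrow> X \<otimes>\<^bsub>f_ring \<Omega> v t\<^esub> Y \<in> int_form \<Omega> v t"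
| add: "X \<in> int_form \<Omega> v t \<Longrightarrow> Y \<in> int_form \<Omega> v t \<Longrightarrow> X \<oplus>\<^bsub>f_ring \<Omega> v t\<^esub> Y \<in> int_form \<Omega> v t"
| smult: "a \<in> laurent v t \<Longrightarrow> X \<in> int_form \<Omega> v t \<Longrightarrow> f_scal \<Omega> v t a X \<in> int_form \<Omega> v t"

definition int_comp ::
  "('i::finite \<Rightarrow> 'i \<Rightarrow> int) \<Rightarrow> 'k::field \<Rightarrow> 'k \<Rightarrow> ('i \<Rightarrow> nat) \<Rightarrow> ('k, ('i, 'k) free_alg set) module" where
  "int_comp \<Omega> v t \<nu> = (f_comp \<Omega> v t \<nu>)\<lparr>carrier := int_form \<Omega> v t \<inter> carrier (f_comp \<Omega> v t \<nu>)\<rparr>"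

text \<open>
  The \<open>(\<tau>,\<omega>)\<close>-component of the comultiplication of the quotient, with values in the tensor
  product over the field of the components of degrees \<open>\<tau>\<close> and \<open>\<omega>\<close>.
  As for \<^const>\<open>rcoset_mult\<close>, the union over representatives has all its members equal.
\<close>

definition f_comult_comp ::
  "('i::finite \<Rightarrow> 'i \<Rightarrow> int) \<Rightarrow> 'k::field \<Rightarrow> 'k \<Rightarrow> ('i \<Rightarrow> nat) \<Rightarrow> ('i \<Rightarrow> nat)
    \<Rightarrow> ('i, 'k) free_alg set \<Rightarrow> (('i, 'k) free_alg set \<times> ('i, 'k) free_alg set \<Rightarrow>\<^sub>0 int) set" where
  "f_comult_comp \<Omega> v t \<tau> \<omega> X =
     (\<Union>x\<in>X. tensor_class (subring_of UNIV) (f_comp \<Omega> v t \<tau>) (f_comp \<Omega> v t \<omega>)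
        (\<Sum>(a, b)\<in>{(a, b)\<in>Poly_Mapping.keys (comult \<Omega> v t x). deg a = \<tau> \<and> deg b = \<omega>}.
           frag_of (f_proj \<Omega> v t (Poly_Mapping.single a (Poly_Mapping.lookup (comult \<Omega> v t x) (a, b))),
                    f_proj \<Omega> v t (Poly_Mapping.single b 1))))"

section \<open>Additive categories\<close>

text \<open>
  \<open>Hom C X Y\<close> is the group of morphisms \<open>X \<rightarrow> Y\<close>; its addition is written multiplicatively.
  Different morphism sets may overlap, so composition carries its objects:
  \<open>cmp C X Y Z g f\<close> is \<open>g \<circ> f\<close> for \<open>f : X \<rightarrow> Y\<close> and \<open>g : Y \<rightarrow> Z\<close>.
\<close>

record ('o, 'm) cat =
  obj :: "'o set"
  Hom :: "'o \<Rightarrow> 'o \<Rightarrow> 'm monoid"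
  idt :: "'o \<Rightarrow> 'm"
  cmp :: "'o \<Rightarrow> 'o \<Rightarrow> 'o \<Rightarrow> 'm \<Rightarrow> 'm \<Rightarrow> 'm"

definition preadditive :: "('o, 'm) cat \<Rightarrow> bool" where
  "preadditive C \<longleftrightarrow>
     (\<forall>X\<in>obj C. \<forall>Y\<in>obj C. comm_group (Hom C X Y)) \<and>
     (\<forall>X\<in>obj C. idt C X \<in> carrier (Hom C X X)) \<and>
     (\<forall>X\<in>obj C. \<forall>Y\<in>obj C. \<forall>Z\<in>obj C. \<forall>f\<in>carrier (Hom C X Y). \<forall>g\<in>carrier (Hom C Y Z).
        cmp C X Y Z g f \<in> carrier (Hom C X Z)) \<and>
     (\<forall>X\<in>obj C. \<forall>Y\<in>obj C. \<forall>f\<in>carrier (Hom C X Y).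
        cmp C X Y Y (idt C Y) f = f \<and> cmp C X X Y f (idt C X) = f) \<and>
     (\<forall>W\<in>obj C. \<forall>X\<in>obj C. \<forall>Y\<in>obj C. \<forall>Z\<in>obj C.
        \<forall>f\<in>carrier (Hom C W X). \<forall>g\<in>carrier (Hom C X Y). \<forall>h\<in>carrier (Hom C Y Z).
        cmp C W Y Z h (cmp C W X Y g f) = cmp C W X Z (cmp C X Y Z h g) f) \<and>
     (\<forall>X\<in>obj C. \<forall>Y\<in>obj C. \<forall>Z\<in>obj C.
        \<forall>f\<in>carrier (Hom C X Y). \<forall>f'\<in>carrier (Hom C X Y). \<forall>g\<in>carrier (Hom C Y Z). \<forall>g'\<in>carrier (Hom C Y Z).
        cmp C X Y Z g (f \<otimes>\<^bsub>Hom C X Y\<^esub> f') = cmp C X Y Z g f \<otimes>\<^bsub>Hom C X Z\<^esub> cmp C X Y Z g f' \<and>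
        cmp C X Y Z (g \<otimes>\<^bsub>Hom C Y Z\<^esub> g') f = cmp C X Y Z g f \<otimes>\<^bsub>Hom C X Z\<^esub> cmp C X Y Z g' f)"

definition zero_obj :: "('o, 'm) cat \<Rightarrow> 'o \<Rightarrow> bool" where
  "zero_obj C Z \<longleftrightarrow> Z \<in> obj C \<and>
     (\<forall>X\<in>obj C. (\<exists>!f. f \<in> carrier (Hom C X Z)) \<and> (\<exists>!f. f \<in> carrier (Hom C Z X)))"

definition is_biproduct ::
  "('o, 'm) cat \<Rightarrow> 'j set \<Rightarrow> ('j \<Rightarrow> 'o) \<Rightarrow> 'o \<Rightarrow> ('j \<Rightarrow> 'm) \<Rightarrow> ('j \<Rightarrow> 'm) \<Rightarrow> bool" where
  "is_biproduct C J X Z \<iota> \<pi> \<longleftrightarrow>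
     finite J \<and> (\<forall>j\<in>J. X j \<in> obj C) \<and> Z \<in> obj C \<and>
     (\<forall>j\<in>J. \<iota> j \<in> carrier (Hom C (X j) Z) \<and> \<pi> j \<in> carrier (Hom C Z (X j))) \<and>
     (\<forall>j\<in>J. cmp C (X j) Z (X j) (\<pi> j) (\<iota> j) = idt C (X j)) \<and>
     (\<forall>j\<in>J. \<forall>k\<in>J. j \<noteq> k \<longrightarrow> cmp C (X j) Z (X k) (\<pi> k) (\<iota> j) = \<one>\<^bsub>Hom C (X j) (X k)\<^esub>) \<and>
     finprod (Hom C Z Z) (\<lambda>j. cmp C Z (X j) Z (\<iota> j) (\<pi> j)) J = idt C Z"

definition additive_category :: "('o, 'm) cat \<Rightarrow> bool" where
  "additive_category C \<longleftrightarrow> preadditive C \<and> (\<exists>Z. zero_obj C Z) \<and>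
     (\<forall>X\<in>obj C. \<forall>Y\<in>obj C. \<exists>Z \<iota> \<pi>. is_biproduct C UNIV (case_bool X Y) Z \<iota> \<pi>)"

definition prod_cat :: "('o, 'm) cat \<Rightarrow> ('p, 'n) cat \<Rightarrow> ('o \<times> 'p, 'm \<times> 'n) cat" where
  "prod_cat C D =
     \<lparr>obj = obj C \<times> obj D,
      Hom = (\<lambda>X Y. Hom C (fst X) (fst Y) \<times>\<times> Hom D (snd X) (snd Y)),
      idt = (\<lambda>X. (idt C (fst X), idt D (snd X))),
      cmp = (\<lambda>X Y Z g f. (cmp C (fst X) (fst Y) (fst Z) (fst g) (fst f),
                          cmp D (snd X) (snd Y) (snd Z) (snd g) (snd f)))\<rparr>"

record ('o, 'm, 'p, 'n) ftor =
  onobj :: "'o \<Rightarrow> 'p"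
  onmor :: "'o \<Rightarrow> 'o \<Rightarrow> 'm \<Rightarrow> 'n"

definition is_ftor :: "('o, 'm) cat \<Rightarrow> ('p, 'n) cat \<Rightarrow> ('o, 'm, 'p, 'n) ftor \<Rightarrow> bool" where
  "is_ftor C D F \<longleftrightarrow>
     (\<forall>X\<in>obj C. onobj F X \<in> obj D \<and> onmor F X X (idt C X) = idt D (onobj F X)) \<and>
     (\<forall>X\<in>obj C. \<forall>Y\<in>obj C. \<forall>f\<in>carrier (Hom C X Y).
        onmor F X Y f \<in> carrier (Hom D (onobj F X) (onobj F Y))) \<and>
     (\<forall>X\<in>obj C. \<forall>Y\<in>obj C. \<forall>Z\<in>obj C. \<forall>f\<in>carrier (Hom C X Y). \<forall>g\<in>carrier (Hom C Y Z).
        onmor F X Z (cmp C X Y Z g f) =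
          cmp D (onobj F X) (onobj F Y) (onobj F Z) (onmor F Y Z g) (onmor F X Y f))"

definition additive_ftor :: "('o, 'm) cat \<Rightarrow> ('p, 'n) cat \<Rightarrow> ('o, 'm, 'p, 'n) ftor \<Rightarrow> bool" where
  "additive_ftor C D F \<longleftrightarrow> is_ftor C D F \<and>
     (\<forall>X\<in>obj C. \<forall>Y\<in>obj C. onmor F X Y \<in> hom (Hom C X Y) (Hom D (onobj F X) (onobj F Y)))"

text \<open>A functor of two variables is required to be additive in each variable separately.\<close>

definition biadditive_ftor ::
  "('o, 'm) cat \<Rightarrow> ('p, 'n) cat \<Rightarrow> ('r, 's) cat \<Rightarrow> ('o \<times> 'p, 'm \<times> 'n, 'r, 's) ftor \<Rightarrow> bool" where
  "biadditive_ftor C D E F \<longleftrightarrow> is_ftor (prod_cat C D) E F \<and>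
     (\<forall>X\<in>obj C. \<forall>X'\<in>obj C. \<forall>Y\<in>obj D. \<forall>Y'\<in>obj D.
        (\<forall>g\<in>carrier (Hom D Y Y'). (\<lambda>f. onmor F (X, Y) (X', Y') (f, g))
           \<in> hom (Hom C X X') (Hom E (onobj F (X, Y)) (onobj F (X', Y')))) \<and>
        (\<forall>f\<in>carrier (Hom C X X'). (\<lambda>g. onmor F (X, Y) (X', Y') (f, g))
           \<in> hom (Hom D Y Y') (Hom E (onobj F (X, Y)) (onobj F (X', Y')))))"

definition ftor_comp ::
  "('p, 'n, 'r, 's) ftor \<Rightarrow> ('o, 'm, 'p, 'n) ftor \<Rightarrow> ('o, 'm, 'r, 's) ftor" where
  "ftor_comp G F =
     \<lparr>onobj = (\<lambda>X. onobj G (onobj F X)),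
      onmor = (\<lambda>X Y f. onmor G (onobj F X) (onobj F Y) (onmor F X Y f))\<rparr>"

subsection \<open>Split Grothendieck groups\<close>

text \<open>The relation for a biproduct of \<open>X\<close> with a zero object identifies isomorphic objects.\<close>

definition K0_rels :: "('o, 'm) cat \<Rightarrow> ('o \<Rightarrow>\<^sub>0 int) set" where
  "K0_rels C =
     {frag_of Z - frag_of X - frag_of Y | X Y Z. X \<in> obj C \<and> Y \<in> obj C \<and>
        (\<exists>\<iota> \<pi>. is_biproduct C UNIV (case_bool X Y) Z \<iota> \<pi>)}"

definition K0 :: "('o, 'm) cat \<Rightarrow> ('o \<Rightarrow>\<^sub>0 int) set monoid" where
  "K0 C = pres (obj C) (K0_rels C)"

definition K0_class :: "('o, 'm) cat \<Rightarrow> ('o \<Rightarrow>\<^sub>0 int) \<Rightarrow> ('o \<Rightarrow>\<^sub>0 int) set" where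
  "K0_class C p = pres_class (obj C) (K0_rels C) p"

text \<open>
  Induced maps on Grothendieck groups; all members of the unions coincide when the
  functors are additive, respectively biadditive.
\<close>

definition K0_map ::
  "('p, 'n) cat \<Rightarrow> ('o, 'm, 'p, 'n) ftor \<Rightarrow> ('o \<Rightarrow>\<^sub>0 int) set \<Rightarrow> ('p \<Rightarrow>\<^sub>0 int) set" where
  "K0_map D F X = (\<Union>x\<in>X. K0_class D (frag_extend (\<lambda>a. frag_of (onobj F a)) x))"

definition K0_bimap ::
  "('r, 's) cat \<Rightarrow> ('o \<times> 'p, 'm \<times> 'n, 'r, 's) ftor
    \<Rightarrow> ('o \<Rightarrow>\<^sub>0 int) set \<Rightarrow> ('p \<Rightarrow>\<^sub>0 int) set \<Rightarrow> ('r \<Rightarrow>\<^sub>0 int) set" where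
  "K0_bimap E F X Y = (\<Union>x\<in>X. \<Union>y\<in>Y.
     K0_class E (frag_extend (\<lambda>a. frag_extend (\<lambda>b. frag_of (onobj F (a, b))) y) x))"

text \<open>The fields \<open>mult\<close> and \<open>one\<close> are irrelevant for the underlying module.\<close>

definition K0_module ::
  "('o, 'm) cat \<Rightarrow> ('k \<Rightarrow> ('o \<Rightarrow>\<^sub>0 int) set \<Rightarrow> ('o \<Rightarrow>\<^sub>0 int) set) \<Rightarrow> ('k, ('o \<Rightarrow>\<^sub>0 int) set) module" where
  "K0_module C act =
     \<lparr>carrier = carrier (K0 C), monoid.mult = undefined, one = undefined,
      zero = \<one>\<^bsub>K0 C\<^esub>, add = monoid.mult (K0 C), module.smult = act\<rparr>"

section \<open>Categorifications\<close>

text \<open>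
  \<open>Prod \<tau> \<omega>\<close> is the product of \<open>Cat \<tau>\<close> and \<open>Cat \<omega>\<close> that is the target of the restriction functor,
  and \<open>Ext \<tau> \<omega>\<close> is its structure functor \<open>Cat \<tau> \<times> Cat \<omega> \<rightarrow> Prod \<tau> \<omega>\<close>, \<open>(L,M) \<mapsto> L \<boxtimes> M\<close>;
  it is not the cartesian product, but has to satisfy \<open>K\<^sub>0(Prod \<tau> \<omega>) = K\<^sub>0(Cat \<tau>) \<otimes> K\<^sub>0(Cat \<omega>)\<close>
  via \<open>[L \<boxtimes> M] \<leftrightarrow> [L] \<otimes> [M]\<close>.  The functors \<open>Ind \<tau> \<omega>\<close>, \<open>Res \<tau> \<omega>\<close> have source, respectively
  target, determined by \<open>\<nu> = \<tau> + \<omega>\<close>.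
\<close>

record ('i, 'k, 'o, 'm, 'p, 'n) categ =
  Cat :: "('i \<Rightarrow> nat) \<Rightarrow> ('o, 'm) cat"
  Act :: "('i \<Rightarrow> nat) \<Rightarrow> 'k \<Rightarrow> ('o \<Rightarrow>\<^sub>0 int) set \<Rightarrow> ('o \<Rightarrow>\<^sub>0 int) set"
  Prod :: "('i \<Rightarrow> nat) \<Rightarrow> ('i \<Rightarrow> nat) \<Rightarrow> ('p, 'n) cat"
  Ext :: "('i \<Rightarrow> nat) \<Rightarrow> ('i \<Rightarrow> nat) \<Rightarrow> ('o \<times> 'o, 'm \<times> 'm, 'p, 'n) ftor"
  Ind :: "('i \<Rightarrow> nat) \<Rightarrow> ('i \<Rightarrow> nat) \<Rightarrow> ('o \<times> 'o, 'm \<times> 'm, 'o, 'm) ftor"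
  Res :: "('i \<Rightarrow> nat) \<Rightarrow> ('i \<Rightarrow> nat) \<Rightarrow> ('o, 'm, 'p, 'n) ftor"

abbreviation K0_of ::
  "('i, 'k, 'o, 'm, 'p, 'n) categ \<Rightarrow> ('i \<Rightarrow> nat) \<Rightarrow> ('k, ('o \<Rightarrow>\<^sub>0 int) set) module" where
  "K0_of Q \<nu> \<equiv> K0_module (Cat Q \<nu>) (Act Q \<nu>)"

definition categ_data :: "'k::field set \<Rightarrow> ('i, 'k, 'o, 'm, 'p, 'n) categ \<Rightarrow> bool" where
  "categ_data A Q \<longleftrightarrow>
     (\<forall>\<nu>. additive_category (Cat Q \<nu>) \<and> Module.module (subring_of A) (K0_of Q \<nu>)) \<and>
     (\<forall>\<tau> \<omega>. additive_category (Prod Q \<tau> \<omega>) \<and>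
        biadditive_ftor (Cat Q \<tau>) (Cat Q \<omega>) (Prod Q \<tau> \<omega>) (Ext Q \<tau> \<omega>) \<and>
        biadditive_ftor (Cat Q \<tau>) (Cat Q \<omega>) (Cat Q (\<tau> + \<omega>)) (Ind Q \<tau> \<omega>) \<and>
        additive_ftor (Cat Q (\<tau> + \<omega>)) (Prod Q \<tau> \<omega>) (Res Q \<tau> \<omega>))"

text \<open>\<open>\<kappa>\<close> is the identification \<open>K\<^sub>0(Cat \<tau>) \<otimes>\<^sub>A K\<^sub>0(Cat \<omega>) \<cong> K\<^sub>0(Prod \<tau> \<omega>)\<close>; it is unique if it exists.\<close>

definition is_kappa ::
  "'k::field set \<Rightarrow> ('i, 'k, 'o, 'm, 'p, 'n) categ
    \<Rightarrow> (('i \<Rightarrow> nat) \<Rightarrow> ('i \<Rightarrow> nat) \<Rightarrow> (('o \<Rightarrow>\<^sub>0 int) set \<times> ('o \<Rightarrow>\<^sub>0 int) set \<Rightarrow>\<^sub>0 int) set \<Rightarrow> ('p \<Rightarrow>\<^sub>0 int) set)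
    \<Rightarrow> bool" where
  "is_kappa A Q \<kappa> \<longleftrightarrow>
     (\<forall>\<tau> \<omega>. \<kappa> \<tau> \<omega> \<in> iso (tensor (subring_of A) (K0_of Q \<tau>) (K0_of Q \<omega>)) (K0 (Prod Q \<tau> \<omega>)) \<and>
        (\<forall>X\<in>carrier (K0 (Cat Q \<tau>)). \<forall>Y\<in>carrier (K0 (Cat Q \<omega>)).
           \<kappa> \<tau> \<omega> (tensor_class (subring_of A) (K0_of Q \<tau>) (K0_of Q \<omega>) (frag_of (X, Y)))
             = K0_bimap (Prod Q \<tau> \<omega>) (Ext Q \<tau> \<omega>) X Y))"

text \<open>
  A graded isomorphism of twisted bialgebras, given by its homogeneous components.
  In the last clause \<open>p\<close> represents the element \<open>r(X)\<close> of the tensor square of the integral form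
  (its image in the tensor square over the field is the \<open>(\<tau>,\<omega>)\<close>-component of \<open>r(X)\<close>), and the
  clause reads \<open>[Res](\<phi> X) = (\<phi> \<otimes> \<phi>)(r(X))\<close>.  There is no clause for unit and counit:
  an algebra isomorphism for \<open>[Ind]\<close> carries the unit to a unit of \<open>K\<^sub>0\<close>, and likewise for the counit.
\<close>

definition bialgebra_iso ::
  "('i::finite \<Rightarrow> 'i \<Rightarrow> int) \<Rightarrow> 'k::field \<Rightarrow> 'k \<Rightarrow> ('i, 'k, 'o, 'm, 'p, 'n) categ
    \<Rightarrow> (('i \<Rightarrow> nat) \<Rightarrow> ('i \<Rightarrow> nat) \<Rightarrow> (('o \<Rightarrow>\<^sub>0 int) set \<times> ('o \<Rightarrow>\<^sub>0 int) set \<Rightarrow>\<^sub>0 int) set \<Rightarrow> ('p \<Rightarrow>\<^sub>0 int) set)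
    \<Rightarrow> (('i \<Rightarrow> nat) \<Rightarrow> ('i, 'k) free_alg set \<Rightarrow> ('o \<Rightarrow>\<^sub>0 int) set) \<Rightarrow> bool" where
  "bialgebra_iso \<Omega> v t Q \<kappa> \<phi> \<longleftrightarrow>
     (\<forall>\<nu>. bij_betw (\<phi> \<nu>) (carrier (int_comp \<Omega> v t \<nu>)) (carrier (K0_of Q \<nu>)) \<and>
        (\<forall>X\<in>carrier (int_comp \<Omega> v t \<nu>). \<forall>Y\<in>carrier (int_comp \<Omega> v t \<nu>).
           \<phi> \<nu> (X \<oplus>\<^bsub>int_comp \<Omega> v t \<nu>\<^esub> Y) = \<phi> \<nu> X \<oplus>\<^bsub>K0_of Q \<nu>\<^esub> \<phi> \<nu> Y) \<and>
        (\<forall>a\<in>laurent v t. \<forall>X\<in>carrier (int_comp \<Omega> v t \<nu>).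
           \<phi> \<nu> (a \<odot>\<^bsub>int_comp \<Omega> v t \<nu>\<^esub> X) = a \<odot>\<^bsub>K0_of Q \<nu>\<^esub> \<phi> \<nu> X)) \<and>
     (\<forall>\<tau> \<omega>. \<forall>X\<in>carrier (int_comp \<Omega> v t \<tau>). \<forall>Y\<in>carrier (int_comp \<Omega> v t \<omega>).
        \<phi> (\<tau> + \<omega>) (X \<otimes>\<^bsub>f_ring \<Omega> v t\<^esub> Y) = K0_bimap (Cat Q (\<tau> + \<omega>)) (Ind Q \<tau> \<omega>) (\<phi> \<tau> X) (\<phi> \<omega> Y)) \<and>
     (\<forall>\<tau> \<omega>. \<forall>X\<in>carrier (int_comp \<Omega> v t (\<tau> + \<omega>)).
        \<exists>p. Poly_Mapping.keys p \<subseteq> carrier (int_comp \<Omega> v t \<tau>) \<times> carrier (int_comp \<Omega> v t \<omega>) \<and>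
            tensor_class (subring_of UNIV) (f_comp \<Omega> v t \<tau>) (f_comp \<Omega> v t \<omega>) p
              = f_comult_comp \<Omega> v t \<tau> \<omega> X \<and>
            K0_map (Prod Q \<tau> \<omega>) (Res Q \<tau> \<omega>) (\<phi> (\<tau> + \<omega>) X)
              = \<kappa> \<tau> \<omega> (tensor_class (subring_of (laurent v t)) (K0_of Q \<tau>) (K0_of Q \<omega>)
                  (frag_extend (\<lambda>(x, y). frag_of (\<phi> \<tau> x, \<phi> \<omega> y)) p)))"

definition categorification ::
  "('i::finite \<Rightarrow> 'i \<Rightarrow> int) \<Rightarrow> 'k::field \<Rightarrow> 'k \<Rightarrow> ('i, 'k, 'o, 'm, 'p, 'n) categ \<Rightarrow> bool" where
  "categorification \<Omega> v t Q \<longleftrightarrow> categ_data (laurent v t) Q \<and>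
     (\<exists>\<kappa> \<phi>. is_kappa (laurent v t) Q \<kappa> \<and> bialgebra_iso \<Omega> v t Q \<kappa> \<phi>)"

section \<open>The construction\<close>

text \<open>
  \<open>copies C\<close> is \<open>\<Oplus>\<^bsub>n\<in>\<int>\<^esub> C\<^sub>n\<close> with all \<open>C\<^sub>n\<close> equal to \<open>C\<close>: an object is a family \<open>(L\<^sub>n)\<close> with
  \<open>L\<^sub>n\<close> zero for almost all \<open>n\<close>.  As all \<open>C\<^sub>n\<close> are the same category, the identity
  functor from \<open>C\<^sub>n\<close> to \<open>C\<^sub>n\<^sub>+\<^sub>1\<close> is the shift of families by one.
\<close>

definition copies :: "('o, 'm) cat \<Rightarrow> (int \<Rightarrow> 'o, int \<Rightarrow> 'm) cat" where
  "copies C =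
     \<lparr>obj = {L. (\<forall>n. L n \<in> obj C) \<and> finite {n. \<not> zero_obj C (L n)}},
      Hom = (\<lambda>L M. \<lparr>carrier = {f. \<forall>n. f n \<in> carrier (Hom C (L n) (M n))},
                    monoid.mult = (\<lambda>f g n. f n \<otimes>\<^bsub>Hom C (L n) (M n)\<^esub> g n),
                    one = (\<lambda>n. \<one>\<^bsub>Hom C (L n) (M n)\<^esub>)\<rparr>),
      idt = (\<lambda>L n. idt C (L n)),
      cmp = (\<lambda>L M N g f n. cmp C (L n) (M n) (N n) (g n) (f n))\<rparr>"

text \<open>\<open>shift s\<close> is the \<open>s\<close>-th iterate of this functor.\<close>

definition shift :: "int \<Rightarrow> (int \<Rightarrow> 'o, int \<Rightarrow> 'm, int \<Rightarrow> 'o, int \<Rightarrow> 'm) ftor" where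
  "shift s = \<lparr>onobj = (\<lambda>L n. L (n - s)), onmor = (\<lambda>L M f n. f (n - s))\<rparr>"

definition copy_proj :: "int \<Rightarrow> (int \<Rightarrow> 'o, int \<Rightarrow> 'm, 'o, 'm) ftor" where
  "copy_proj n = \<lparr>onobj = (\<lambda>L. L n), onmor = (\<lambda>L M f. f n)\<rparr>"

text \<open>
  The functor \<open>copies C \<rightarrow> copies D\<close> that is \<open>F\<close> from the \<open>n\<close>-th copy to the \<open>n\<close>-th copy.
\<close>

definition ftor_copies :: "('o, 'm, 'p, 'n) ftor \<Rightarrow> (int \<Rightarrow> 'o, int \<Rightarrow> 'm, int \<Rightarrow> 'p, int \<Rightarrow> 'n) ftor" where
  "ftor_copies F =
     \<lparr>onobj = (\<lambda>L n. onobj F (L n)), onmor = (\<lambda>L M f n. onmor F (L n) (M n) (f n))\<rparr>"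

text \<open>
  The biadditive functor \<open>copies C \<times> copies D \<rightarrow> copies E\<close> that is \<open>F\<close> from the \<open>n\<close>-th copy of \<open>C\<close>
  and the \<open>m\<close>-th copy of \<open>D\<close> to the \<open>(n+m)\<close>-th copy of \<open>E\<close>.  Its \<open>k\<close>-th component at \<open>(L,M)\<close> is thus
  the direct sum of all \<open>F(L\<^sub>n, M\<^sub>k\<^sub>-\<^sub>n)\<close>; summands with a zero argument are zero and omitted.
\<close>

definition chosen_biproduct ::
  "('o, 'm) cat \<Rightarrow> 'j set \<Rightarrow> ('j \<Rightarrow> 'o) \<Rightarrow> 'o \<times> ('j \<Rightarrow> 'm) \<times> ('j \<Rightarrow> 'm)" where
  "chosen_biproduct C J X = (SOME (Z, \<iota>, \<pi>). is_biproduct C J X Z \<iota> \<pi>)"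

definition conv_index :: "('o, 'm) cat \<Rightarrow> ('p, 'n) cat \<Rightarrow> (int \<Rightarrow> 'o) \<times> (int \<Rightarrow> 'p) \<Rightarrow> int \<Rightarrow> int set" where
  "conv_index C D P k = {n. \<not> zero_obj C (fst P n) \<and> \<not> zero_obj D (snd P (k - n))}"

definition conv_sum ::
  "('o, 'm) cat \<Rightarrow> ('p, 'n) cat \<Rightarrow> ('r, 's) cat \<Rightarrow> ('o \<times> 'p, 'm \<times> 'n, 'r, 's) ftor
    \<Rightarrow> (int \<Rightarrow> 'o) \<times> (int \<Rightarrow> 'p) \<Rightarrow> int \<Rightarrow> 'r \<times> (int \<Rightarrow> 's) \<times> (int \<Rightarrow> 's)" where
  "conv_sum C D E F P k =
     chosen_biproduct E (conv_index C D P k) (\<lambda>n. onobj F (fst P n, snd P (k - n)))"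

definition conv ::
  "('o, 'm) cat \<Rightarrow> ('p, 'n) cat \<Rightarrow> ('r, 's) cat \<Rightarrow> ('o \<times> 'p, 'm \<times> 'n, 'r, 's) ftor
    \<Rightarrow> ((int \<Rightarrow> 'o) \<times> (int \<Rightarrow> 'p), (int \<Rightarrow> 'm) \<times> (int \<Rightarrow> 'n), int \<Rightarrow> 'r, int \<Rightarrow> 's) ftor" where
  "conv C D E F =
     \<lparr>onobj = (\<lambda>P k. fst (conv_sum C D E F P k)),
      onmor = (\<lambda>P P' f k.
        let (Z, \<iota>, \<pi>) = conv_sum C D E F P k; (Z', \<iota>', \<pi>') = conv_sum C D E F P' k;
            X = (\<lambda>n. (fst P n, snd P (k - n))); X' = (\<lambda>n. (fst P' n, snd P' (k - n)))
        in finprod (Hom E Z Z')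
             (\<lambda>n. cmp E Z (onobj F (X' n)) Z' (\<iota>' n)
                    (cmp E Z (onobj F (X n)) (onobj F (X' n))
                       (onmor F (X n) (X' n) (fst f n, snd f (k - n))) (\<pi> n)))
             (conv_index C D P k \<inter> conv_index C D P' k))\<rparr>"

text \<open>
  The action on \<open>K\<^sub>0(copies C)\<close>: \<open>t\<close> acts by the shift, and \<open>\<int>[v\<^sup>\<plusminus>\<^sup>1]\<close> by the given action on the
  Grothendieck group of each copy.
\<close>

definition is_copies_action ::
  "('o, 'm) cat \<Rightarrow> (Qv \<Rightarrow> ('o \<Rightarrow>\<^sub>0 int) set \<Rightarrow> ('o \<Rightarrow>\<^sub>0 int) set)
    \<Rightarrow> (Qvt \<Rightarrow> ((int \<Rightarrow> 'o) \<Rightarrow>\<^sub>0 int) set \<Rightarrow> ((int \<Rightarrow> 'o) \<Rightarrow>\<^sub>0 int) set) \<Rightarrow> bool" where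
  "is_copies_action C act act' \<longleftrightarrow>
     Module.module (subring_of (laurent (emb qv) qt)) (K0_module (copies C) act') \<and>
     (\<forall>L\<in>obj (copies C). act' qt (K0_class (copies C) (frag_of L))
        = K0_class (copies C) (frag_of (onobj (shift 1 :: (_, int \<Rightarrow> 'm, _, int \<Rightarrow> 'm) ftor) L))) \<and>
     (\<forall>a\<in>laurent qv 1. \<forall>X\<in>carrier (K0 (copies C)). \<forall>n.
        K0_map C (copy_proj n :: (_, int \<Rightarrow> 'm, _, 'm) ftor) (act' (emb a) X)
          = act a (K0_map C (copy_proj n :: (_, int \<Rightarrow> 'm, _, 'm) ftor) X))"

text \<open>
  In \<open>Prod\<close>, the products of the \<open>n\<close>-th copy of \<open>Cat \<tau>\<close> and the \<open>m\<close>-th copy of \<open>Cat \<omega>\<close> for all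
  \<open>(n,m)\<close> with \<open>n + m = k\<close> are identified with one \<open>k\<close>-th copy of \<open>Prod Q \<tau> \<omega>\<close>.  This is the
  balancing of \<open>t\<close> over the two tensor factors: shifting by \<open>n\<close> in the first
  factor and by \<open>m\<close> in the second is \<open>shift (n + m)\<close>.
\<close>

definition frak ::
  "('i::finite \<Rightarrow> 'i \<Rightarrow> int) \<Rightarrow> ('i, Qv, 'o, 'm, 'p, 'n) categ
    \<Rightarrow> ('i, Qvt, int \<Rightarrow> 'o, int \<Rightarrow> 'm, int \<Rightarrow> 'p, int \<Rightarrow> 'n) categ" where
  "frak \<Omega> Q =
     \<lparr>Cat = (\<lambda>\<nu>. copies (Cat Q \<nu>)),
      Act = (\<lambda>\<nu>. SOME act'. is_copies_action (Cat Q \<nu>) (Act Q \<nu>) act'),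
      Prod = (\<lambda>\<tau> \<omega>. copies (Prod Q \<tau> \<omega>)),
      Ext = (\<lambda>\<tau> \<omega>. conv (Cat Q \<tau>) (Cat Q \<omega>) (Prod Q \<tau> \<omega>) (Ext Q \<tau> \<omega>)),
      Ind = (\<lambda>\<tau> \<omega>. ftor_comp (shift (sq_form \<Omega> \<tau> \<omega>))
               (conv (Cat Q \<tau>) (Cat Q \<omega>) (Cat Q (\<tau> + \<omega>)) (Ind Q \<tau> \<omega>))),
      Res = (\<lambda>\<tau> \<omega>. ftor_comp (shift (- sq_form \<Omega> \<tau> \<omega>)) (ftor_copies (Res Q \<tau> \<omega>)))\<rparr>"

end

theory Submission
  imports Defs
begin

text \<open>
  Rescale a word \<open>i\<^sub>1\<dots>i\<^sub>n\<close> in the generators by the power of \<open>t\<close> whose exponent is minus the sum of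
  \<open>[i\<^sub>a, i\<^sub>b]\<close> over \<open>a < b\<close>. Since \<open>[,]\<close> is bilinear, the rescaling turns the product, the
  comultiplication and the form over \<open>\<rat>(v, t)\<close> into those for \<open>t = 1\<close>, up to powers of \<open>t\<close> that
  depend only on the degrees, and divided powers into divided powers. Hence it preserves the radical and
  identifies the integral form over \<open>\<int>[v\<^sup>\<plusminus>\<^sup>1, t\<^sup>\<plusminus>\<^sup>1]\<close> with the Laurent polynomials in \<open>t\<close> over the
  integral form for \<open>t = 1\<close>. On the other side, the Grothendieck group of the copies of a category
  consists of the Laurent polynomials in \<open>t\<close> over its Grothendieck group, and the shifts in the
  definition of the new induction and restriction functors produce exactly the same powers of \<open>t\<close>.
\<close>

text \<open>What makes the rescaling work is the identity [a,b] - [b,a] = <b,a> - <a,b>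
  (\<open>sq_ang\<close>): reordering two letters changes the exponent by exactly the power of t in
  the twisted product on the tensor square, while the factor t^(2[a,b]) in the form is shared
  between its two rescaled arguments. The minus sign is chosen so that the product of two rescaled
  elements of degrees tau and omega is t^[tau,omega] times the rescaled product, the power that the
  shift in the new induction functor contributes. As this power depends on the degrees, the
  rescaling is no algebra homomorphism, and products have to be split into homogeneous parts before
  it is applied. A second obstacle is that Q(v,t) contains far more than Laurent polynomials in t
  over Q(v), so statements on the quotient over Q(v,t) are reached by clearing denominators,
  together with the linear independence of the powers of t over Q(v). Finally, r, the form and the
  new action are introduced by description or choice operators; explicit models and uniqueness have
  to be supplied before anything can be computed.\<close>

section \<open>Presentations\<close>

text \<open>The subgroup generated by \<open>R\<close>, described in the additive type itself and
  without mention of the generators of a free group. Equality of classes then becomes membership of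
  a difference, which is easier to chain than equality of cosets; \<open>generate_eq_spn\<close>
  connects the two.\<close>

inductive_set spn :: "'a::ab_group_add set \<Rightarrow> 'a set" for R where
  spn_zero: "0 \<in> spn R"
| spn_incl: "r \<in> R \<Longrightarrow> r \<in> spn R"
| spn_diff: "x \<in> spn R \<Longrightarrow> y \<in> spn R \<Longrightarrow> x - y \<in> spn R"

lemma spn_uminus: "x \<in> spn R \<Longrightarrow> - x \<in> spn R"
  using spn_diff[OF spn_zero] by fastforce

lemma spn_add: "x \<in> spn R \<Longrightarrow> y \<in> spn R \<Longrightarrow> x + y \<in> spn R"
  using spn_diff[OF _ spn_uminus] by fastforce

lemma spn_sum: "(\<And>i. i \<in> I \<Longrightarrow> f i \<in> spn R) \<Longrightarrow> sum f I \<in> spn R"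
  by (induction I rule: infinite_finite_induct) (auto intro: spn_add spn_zero)

text \<open>Well-definedness of the induced maps on Grothendieck groups and tensor products rests on
  this: it suffices to inspect the generating relations.\<close>

lemma spn_hom:
  assumes x: "x \<in> spn R" and diff: "\<And>x y. h (x - y) = h x - h y"
    and incl: "\<And>r. r \<in> R \<Longrightarrow> h r \<in> spn R'"
  shows "h x \<in> spn R'"
  using x
proof induction
  case spn_zero
  have "h 0 = 0" using diff[of 0 0] by simp
  then show ?case by (simp add: spn.spn_zero)
qed (auto simp: diff intro: incl spn_diff)

lemma spn_diff_trans: "x - y \<in> spn R \<Longrightarrow> y - z \<in> spn R \<Longrightarrow> x - z \<in> spn R"
  using spn_add by fastforce

lemma spn_diff_sym: "x - y \<in> spn R \<Longrightarrow> y - x \<in> spn R"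
  using spn_uminus by fastforce

lemma spn_diff_add: "x - y \<in> spn R \<Longrightarrow> x' - y' \<in> spn R \<Longrightarrow> (x + x') - (y + y') \<in> spn R"
  using spn_add[of "x - y" R "x' - y'"] by (simp add: algebra_simps)

lemma spn_diff_diff: "x - y \<in> spn R \<Longrightarrow> x' - y' \<in> spn R \<Longrightarrow> (x - x') - (y - y') \<in> spn R"
  using spn_diff[of "x - y" R "x' - y'"] by (simp add: algebra_simps)

lemma spn_diff_mem: "x - y \<in> spn R \<Longrightarrow> y \<in> spn R \<Longrightarrow> x \<in> spn R"
  using spn_add by fastforce

definition cls :: "'a::ab_group_add set \<Rightarrow> 'a \<Rightarrow> 'a set" where
  "cls R p = {q. q - p \<in> spn R}"

lemma self_in_cls [simp]: "p \<in> cls R p"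
  by (simp add: cls_def spn_zero)

lemma cls_eq_iff: "cls R p = cls R q \<longleftrightarrow> p - q \<in> spn R"
proof
  assume "cls R p = cls R q"
  then have "p \<in> cls R q" by (metis self_in_cls)
  then show "p - q \<in> spn R" by (simp add: cls_def)
next
  assume "p - q \<in> spn R"
  then show "cls R p = cls R q"
    unfolding cls_def by (auto intro: spn_diff_trans spn_diff_sym)
qed

lemma in_cls_iff: "q \<in> cls R p \<longleftrightarrow> q - p \<in> spn R"
  by (simp add: cls_def)

lemma cls_zero: "cls R 0 = spn R"
  by (simp add: cls_def)

text \<open>Induced maps are defined as unions over all representatives; once the members agree, the
  union collapses to the common value.\<close>

lemma UN_cls_const:
  assumes "\<And>x. x \<in> X \<Longrightarrow> f x = c" and "X \<noteq> {}"
  shows "(\<Union>x\<in>X. f x) = c"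
  using assms by auto

text \<open>Classes are disjoint or equal, so a union that is a single class has equal members. This
  extracts well-definedness from an equation that a hypothesis provides.\<close>

lemma UN_cls_eqD:
  assumes "(\<Union>x\<in>X. cls R (f x)) = cls R p" and "x \<in> X"
  shows "f x - p \<in> spn R"
  using assms self_in_cls[of "f x" R] in_cls_iff by blast

lemma keys_spn:
  assumes "x \<in> spn R" and "R \<subseteq> {r. Poly_Mapping.keys r \<subseteq> S}"
  shows "Poly_Mapping.keys x \<subseteq> S"
  using assms(1) by induction (use assms(2) keys_diff in \<open>fastforce+\<close>)

context
  fixes S :: "'a set" and R :: "('a \<Rightarrow>\<^sub>0 int) set"
  assumes R: "R \<subseteq> {r. Poly_Mapping.keys r \<subseteq> S}"
begin

lemma generate_eq_spn: "generate (free_Abelian_group S) R = spn R"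
proof
  show "generate (free_Abelian_group S) R \<subseteq> spn R"
  proof
    fix x assume "x \<in> generate (free_Abelian_group S) R"
    then show "x \<in> spn R"
      by induction (use R inv_free_Abelian_group in \<open>auto simp: subset_iff intro: spn_zero spn_incl spn_uminus spn_add\<close>)
  qed
  show "spn R \<subseteq> generate (free_Abelian_group S) R"
  proof
    fix x assume "x \<in> spn R"
    then show "x \<in> generate (free_Abelian_group S) R"
    proof induction
      case spn_zero
      then show ?case using generate.one[of "free_Abelian_group S" R] by simp
    next
      case (spn_diff x y)
      have k: "Poly_Mapping.keys y \<subseteq> S" using keys_spn[OF spn_diff(2)] R by blast
      have "inv\<^bsub>free_Abelian_group S\<^esub> y \<in> generate (free_Abelian_group S) R"
        by (rule group.generate_m_inv_closed) (use spn_diff R in auto)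
      then show ?case using generate.eng[OF spn_diff(3), of "-y"] k by simp
    qed (rule generate.incl)
  qed
qed

lemma pres_class_eq_cls: "pres_class S R p = cls R p"
proof -
  have "pres_class S R p = {h + p |h. h \<in> spn R}"
    unfolding pres_class_def r_coset_def generate_eq_spn by auto
  also have "\<dots> = cls R p"
    unfolding cls_def by (auto simp: algebra_simps) (metis add_diff_cancel_left' diff_add_cancel)
  finally show ?thesis .
qed

lemma carrier_pres: "carrier (pres S R) = {cls R p |p. Poly_Mapping.keys p \<subseteq> S}"
  unfolding pres_def carrier_FactGroup
  by (auto simp: pres_class_def[symmetric] pres_class_eq_cls image_def)

lemma mult_pres: "cls R p \<otimes>\<^bsub>pres S R\<^esub> cls R q = cls R (p + q)"
proof -
  have "cls R p \<otimes>\<^bsub>pres S R\<^esub> cls R q = {x + y |x y. x \<in> cls R p \<and> y \<in> cls R q}"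
    by (auto simp: pres_def set_mult_def)
  also have "\<dots> = cls R (p + q)"
  proof (intro equalityI subsetI)
    fix z assume "z \<in> {x + y |x y. x \<in> cls R p \<and> y \<in> cls R q}"
    then show "z \<in> cls R (p + q)" by (auto simp: in_cls_iff intro: spn_diff_add)
  next
    fix z assume "z \<in> cls R (p + q)"
    then have "z = (z - q) + q" "z - q \<in> cls R p" by (auto simp: in_cls_iff algebra_simps)
    then show "z \<in> {x + y |x y. x \<in> cls R p \<and> y \<in> cls R q}" using self_in_cls by blast
  qed
  finally show ?thesis .
qed

lemma one_pres: "\<one>\<^bsub>pres S R\<^esub> = cls R 0"
  by (simp add: pres_def generate_eq_spn cls_zero)

lemma comm_group_pres: "comm_group (pres S R)"
  unfolding pres_def
  by (intro comm_group.abelian_FactGroup abelian_free_Abelian_group group.generate_is_subgroup)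
     (use R in auto)

end

lemma keys_frag_extend_subset:
  "Poly_Mapping.keys p \<subseteq> S \<Longrightarrow> (\<And>a. a \<in> S \<Longrightarrow> Poly_Mapping.keys (f a) \<subseteq> T)
    \<Longrightarrow> Poly_Mapping.keys (frag_extend f p) \<subseteq> T"
  using keys_frag_extend[of f p] by blast

lemma frag_induct [case_names zero one diff]:
  fixes p :: "'a \<Rightarrow>\<^sub>0 int"
  assumes "P 0" and "\<And>a. P (frag_of a)" and "\<And>a b. P a \<Longrightarrow> P b \<Longrightarrow> P (a - b)"
  shows "P p"
  by (rule frag_induction[of p UNIV P]) (auto intro: assms)

lemma frag_extend_pointwise_diff:
  "frag_extend (\<lambda>a. f a - g a) p = frag_extend f p - frag_extend g p"
  by (induction p rule: frag_induct) (auto simp: frag_extend_diff)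

lemma frag_extend_swap:
  "frag_extend (\<lambda>a. frag_extend (\<lambda>b. G a b) y) x = frag_extend (\<lambda>b. frag_extend (\<lambda>a. G a b) x) y"
proof (induction x rule: frag_induct)
  case zero
  then show ?case by (simp add: frag_extend_eq_0)
next
  case (diff a b)
  then show ?case by (simp add: frag_extend_diff frag_extend_pointwise_diff)
qed auto

lemma frag_extend_pointwise_spn:
  assumes "Poly_Mapping.keys p \<subseteq> S" and "\<And>a. a \<in> S \<Longrightarrow> f a \<in> spn R"
  shows "frag_extend f p \<in> spn R"
  using assms(1)
  by (rule free_Abelian_group_induct)
     (auto simp: frag_extend_diff intro: spn_zero spn_diff assms(2))

subsection \<open>Tensor products\<close>

text \<open>Closure of the carriers keeps the relations supported on pairs of module elements. The
  same treatment covers the homogeneous components over a field and the Grothendieck groups over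
  Laurent polynomials.\<close>

locale tensor_pair =
  fixes R :: "'r ring" and M :: "('r, 'a) module" and N :: "('r, 'b) module"
  assumes add_M: "\<And>x y. x \<in> carrier M \<Longrightarrow> y \<in> carrier M \<Longrightarrow> x \<oplus>\<^bsub>M\<^esub> y \<in> carrier M"
    and add_N: "\<And>x y. x \<in> carrier N \<Longrightarrow> y \<in> carrier N \<Longrightarrow> x \<oplus>\<^bsub>N\<^esub> y \<in> carrier N"
    and smult_M: "\<And>a x. a \<in> carrier R \<Longrightarrow> x \<in> carrier M \<Longrightarrow> a \<odot>\<^bsub>M\<^esub> x \<in> carrier M"
    and smult_N: "\<And>a x. a \<in> carrier R \<Longrightarrow> x \<in> carrier N \<Longrightarrow> a \<odot>\<^bsub>N\<^esub> x \<in> carrier N"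
begin

abbreviation "rels \<equiv> tensor_rels R M N"

lemma rels_keys: "rels \<subseteq> {r. Poly_Mapping.keys r \<subseteq> carrier M \<times> carrier N}"
  unfolding tensor_rels_def
  by (auto dest!: subsetD[OF keys_diff] simp: add_M add_N smult_M smult_N)

lemmas tensor_class_eq = pres_class_eq_cls[OF rels_keys, folded tensor_class_def]
lemmas carrier_tensor = carrier_pres[OF rels_keys, folded tensor_def]
lemmas mult_tensor = mult_pres[OF rels_keys, folded tensor_def]

lemma tensor_add_left:
  "x \<in> carrier M \<Longrightarrow> x' \<in> carrier M \<Longrightarrow> y \<in> carrier N
    \<Longrightarrow> frag_of (x \<oplus>\<^bsub>M\<^esub> x', y) - (frag_of (x, y) + frag_of (x', y)) \<in> spn rels"
  by (rule spn_incl) (auto simp: tensor_rels_def)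

lemma tensor_add_right:
  "x \<in> carrier M \<Longrightarrow> y \<in> carrier N \<Longrightarrow> y' \<in> carrier N
    \<Longrightarrow> frag_of (x, y \<oplus>\<^bsub>N\<^esub> y') - (frag_of (x, y) + frag_of (x, y')) \<in> spn rels"
  by (rule spn_incl) (auto simp: tensor_rels_def)

lemma tensor_smult:
  "a \<in> carrier R \<Longrightarrow> x \<in> carrier M \<Longrightarrow> y \<in> carrier N
    \<Longrightarrow> frag_of (a \<odot>\<^bsub>M\<^esub> x, y) - frag_of (x, a \<odot>\<^bsub>N\<^esub> y) \<in> spn rels"
  by (rule spn_incl) (auto simp: tensor_rels_def)

text \<open>The universal property of the tensor product. The target relations \<open>R'\<close> are
  arbitrary because the targets below are other tensor products as well as Grothendieck groups, and
  bilinearity is available there only modulo relations.\<close>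

lemma rels_hom:
  assumes "x \<in> spn rels"
    and "\<And>x x' y. x \<in> carrier M \<Longrightarrow> x' \<in> carrier M \<Longrightarrow> y \<in> carrier N
      \<Longrightarrow> f (x \<oplus>\<^bsub>M\<^esub> x', y) - (f (x, y) + f (x', y)) \<in> spn R'"
    and "\<And>x y y'. x \<in> carrier M \<Longrightarrow> y \<in> carrier N \<Longrightarrow> y' \<in> carrier N
      \<Longrightarrow> f (x, y \<oplus>\<^bsub>N\<^esub> y') - (f (x, y) + f (x, y')) \<in> spn R'"
    and "\<And>a x y. a \<in> carrier R \<Longrightarrow> x \<in> carrier M \<Longrightarrow> y \<in> carrier N
      \<Longrightarrow> f (a \<odot>\<^bsub>M\<^esub> x, y) - f (x, a \<odot>\<^bsub>N\<^esub> y) \<in> spn R'"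
  shows "frag_extend f x \<in> spn R'"
  using assms(1)
proof (rule spn_hom)
  fix r assume "r \<in> rels"
  then show "frag_extend f r \<in> spn R'"
    using assms(2-4) by (auto simp: tensor_rels_def frag_extend_diff frag_extend_add diff_diff_eq)
qed (rule frag_extend_diff)

end

section \<open>Zero objects and finite biproducts in preadditive categories\<close>

section \<open>Preadditive categories\<close>

lemma hom_finprod:
  assumes "comm_group G" "comm_group K" "h \<in> hom G K" "f \<in> J \<rightarrow> carrier G"
  shows "h (finprod G f J) = finprod K (\<lambda>j. h (f j)) J"
proof -
  interpret G: comm_group G by fact
  interpret K: comm_group K by fact
  have one: "h \<one>\<^bsub>G\<^esub> = \<one>\<^bsub>K\<^esub>"
    using hom_one[OF assms(3)] G.is_group K.is_group by blast
  have clo: "\<And>x. x \<in> carrier G \<Longrightarrow> h x \<in> carrier K"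
    using assms(3) by (auto simp: hom_def)
  show ?thesis
    using assms(4)
  proof (induction J rule: infinite_finite_induct)
    case (insert j J)
    have "h (finprod G f (insert j J)) = h (f j \<otimes>\<^bsub>G\<^esub> finprod G f J)"
      using insert by (subst G.finprod_insert) auto
    also have "\<dots> = h (f j) \<otimes>\<^bsub>K\<^esub> h (finprod G f J)"
      using insert by (intro hom_mult[OF assms(3)]) (auto intro: G.finprod_closed)
    also have "\<dots> = finprod K (\<lambda>j. h (f j)) (insert j J)"
      using insert clo by (subst K.finprod_insert) auto
    finally show ?case .
  qed (simp_all add: one)
qed

lemma (in comm_monoid) finprod_delta:
  assumes "finite J" "a \<in> carrier G"
  shows "finprod G (\<lambda>k. if k = j then a else \<one>) J = (if j \<in> J then a else \<one>)"
proof (cases "j \<in> J")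
  case True
  have "finprod G (\<lambda>k. if k = j then a else \<one>) J = finprod G (\<lambda>k. if j = k then (\<lambda>_. a) k else \<one>) J"
    by (rule finprod_cong') (use assms in auto)
  also have "\<dots> = a" by (rule finprod_singleton) (use assms True in auto)
  finally show ?thesis using True by simp
qed (auto intro!: finprod_one_eqI)

locale preadd =
  fixes C :: "('o, 'm) cat"
  assumes preadd: "preadditive C"
begin

lemma hom_group: "X \<in> obj C \<Longrightarrow> Y \<in> obj C \<Longrightarrow> comm_group (Hom C X Y)"
  using preadd by (simp add: preadditive_def)

lemma idt_closed: "X \<in> obj C \<Longrightarrow> idt C X \<in> carrier (Hom C X X)"
  using preadd by (simp add: preadditive_def)

lemma cmp_closed: "X \<in> obj C \<Longrightarrow> Y \<in> obj C \<Longrightarrow> Z \<in> obj C \<Longrightarrow> f \<in> carrier (Hom C X Y)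
    \<Longrightarrow> g \<in> carrier (Hom C Y Z) \<Longrightarrow> cmp C X Y Z g f \<in> carrier (Hom C X Z)"
  using preadd by (simp add: preadditive_def)

lemma idt_left: "X \<in> obj C \<Longrightarrow> Y \<in> obj C \<Longrightarrow> f \<in> carrier (Hom C X Y) \<Longrightarrow> cmp C X Y Y (idt C Y) f = f"
  using preadd by (simp add: preadditive_def)

lemma idt_right: "X \<in> obj C \<Longrightarrow> Y \<in> obj C \<Longrightarrow> f \<in> carrier (Hom C X Y) \<Longrightarrow> cmp C X X Y f (idt C X) = f"
  using preadd by (simp add: preadditive_def)

lemma assoc: "W \<in> obj C \<Longrightarrow> X \<in> obj C \<Longrightarrow> Y \<in> obj C \<Longrightarrow> Z \<in> obj C \<Longrightarrow> f \<in> carrier (Hom C W X)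
    \<Longrightarrow> g \<in> carrier (Hom C X Y) \<Longrightarrow> h \<in> carrier (Hom C Y Z)
    \<Longrightarrow> cmp C W Y Z h (cmp C W X Y g f) = cmp C W X Z (cmp C X Y Z h g) f"
  using preadd by (simp add: preadditive_def)

lemma cmp_mult_right: "X \<in> obj C \<Longrightarrow> Y \<in> obj C \<Longrightarrow> Z \<in> obj C \<Longrightarrow> f \<in> carrier (Hom C X Y)
    \<Longrightarrow> f' \<in> carrier (Hom C X Y) \<Longrightarrow> g \<in> carrier (Hom C Y Z)
    \<Longrightarrow> cmp C X Y Z g (f \<otimes>\<^bsub>Hom C X Y\<^esub> f') = cmp C X Y Z g f \<otimes>\<^bsub>Hom C X Z\<^esub> cmp C X Y Z g f'"
  using preadd by (simp add: preadditive_def)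

lemma cmp_mult_left: "X \<in> obj C \<Longrightarrow> Y \<in> obj C \<Longrightarrow> Z \<in> obj C \<Longrightarrow> f \<in> carrier (Hom C X Y)
    \<Longrightarrow> g \<in> carrier (Hom C Y Z) \<Longrightarrow> g' \<in> carrier (Hom C Y Z)
    \<Longrightarrow> cmp C X Y Z (g \<otimes>\<^bsub>Hom C Y Z\<^esub> g') f = cmp C X Y Z g f \<otimes>\<^bsub>Hom C X Z\<^esub> cmp C X Y Z g' f"
  using preadd by (simp add: preadditive_def)

lemma hom_monoid: "X \<in> obj C \<Longrightarrow> Y \<in> obj C \<Longrightarrow> comm_monoid (Hom C X Y)"
  using hom_group comm_group.axioms(1) by blast

lemma hom_grp: "X \<in> obj C \<Longrightarrow> Y \<in> obj C \<Longrightarrow> group (Hom C X Y)"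
  using hom_group comm_group.axioms(2) by blast

lemma one_closed: "X \<in> obj C \<Longrightarrow> Y \<in> obj C \<Longrightarrow> \<one>\<^bsub>Hom C X Y\<^esub> \<in> carrier (Hom C X Y)"
  using hom_grp group.is_monoid monoid.one_closed by blast

lemma cmp_hom_right: "X \<in> obj C \<Longrightarrow> Y \<in> obj C \<Longrightarrow> Z \<in> obj C \<Longrightarrow> g \<in> carrier (Hom C Y Z)
    \<Longrightarrow> cmp C X Y Z g \<in> hom (Hom C X Y) (Hom C X Z)"
  by (intro homI) (auto simp: cmp_closed cmp_mult_right)

lemma cmp_hom_left: "X \<in> obj C \<Longrightarrow> Y \<in> obj C \<Longrightarrow> Z \<in> obj C \<Longrightarrow> f \<in> carrier (Hom C X Y)
    \<Longrightarrow> (\<lambda>g. cmp C X Y Z g f) \<in> hom (Hom C Y Z) (Hom C X Z)"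
  by (intro homI) (auto simp: cmp_closed cmp_mult_left)

lemma cmp_one_right: "X \<in> obj C \<Longrightarrow> Y \<in> obj C \<Longrightarrow> Z \<in> obj C \<Longrightarrow> g \<in> carrier (Hom C Y Z)
    \<Longrightarrow> cmp C X Y Z g \<one>\<^bsub>Hom C X Y\<^esub> = \<one>\<^bsub>Hom C X Z\<^esub>"
  using hom_one[OF cmp_hom_right] hom_grp by blast

lemma cmp_one_left: "X \<in> obj C \<Longrightarrow> Y \<in> obj C \<Longrightarrow> Z \<in> obj C \<Longrightarrow> f \<in> carrier (Hom C X Y)
    \<Longrightarrow> cmp C X Y Z \<one>\<^bsub>Hom C Y Z\<^esub> f = \<one>\<^bsub>Hom C X Z\<^esub>"
  using hom_one[OF cmp_hom_left] hom_grp by blast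

lemma cmp_finprod_right: "X \<in> obj C \<Longrightarrow> Y \<in> obj C \<Longrightarrow> Z \<in> obj C \<Longrightarrow> g \<in> carrier (Hom C Y Z)
    \<Longrightarrow> (\<And>j. j \<in> J \<Longrightarrow> f j \<in> carrier (Hom C X Y))
    \<Longrightarrow> cmp C X Y Z g (finprod (Hom C X Y) f J) = finprod (Hom C X Z) (\<lambda>j. cmp C X Y Z g (f j)) J"
  by (rule hom_finprod) (auto simp: hom_group cmp_hom_right)

lemma cmp_finprod_left: "X \<in> obj C \<Longrightarrow> Y \<in> obj C \<Longrightarrow> Z \<in> obj C \<Longrightarrow> f \<in> carrier (Hom C X Y)
    \<Longrightarrow> (\<And>j. j \<in> J \<Longrightarrow> g j \<in> carrier (Hom C Y Z))
    \<Longrightarrow> cmp C X Y Z (finprod (Hom C Y Z) g J) f = finprod (Hom C X Z) (\<lambda>j. cmp C X Y Z (g j) f) J"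
  by (rule hom_finprod[where h = "\<lambda>g. cmp C X Y Z g f"]) (auto simp: hom_group cmp_hom_left)

lemma finprod_hom_cong:
  "X \<in> obj C \<Longrightarrow> Y \<in> obj C \<Longrightarrow> (\<And>j. j \<in> J \<Longrightarrow> g j \<in> carrier (Hom C X Y))
    \<Longrightarrow> (\<And>j. j \<in> J \<Longrightarrow> f j = g j) \<Longrightarrow> finprod (Hom C X Y) f J = finprod (Hom C X Y) g J"
  by (rule comm_monoid.finprod_cong'[OF hom_monoid]) auto

lemma finprod_hom_closed:
  "X \<in> obj C \<Longrightarrow> Y \<in> obj C \<Longrightarrow> (\<And>j. j \<in> J \<Longrightarrow> g j \<in> carrier (Hom C X Y))
    \<Longrightarrow> finprod (Hom C X Y) g J \<in> carrier (Hom C X Y)"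
  by (rule comm_monoid.finprod_closed[OF hom_monoid]) auto

lemma zero_hom_to:
  "zero_obj C Z \<Longrightarrow> X \<in> obj C \<Longrightarrow> f \<in> carrier (Hom C X Z) \<Longrightarrow> f = \<one>\<^bsub>Hom C X Z\<^esub>"
  unfolding zero_obj_def using one_closed by blast

lemma zero_hom_from:
  "zero_obj C Z \<Longrightarrow> X \<in> obj C \<Longrightarrow> f \<in> carrier (Hom C Z X) \<Longrightarrow> f = \<one>\<^bsub>Hom C Z X\<^esub>"
  unfolding zero_obj_def using one_closed by blast

text \<open>Every morphism into or out of \<open>Z\<close> is a composite with the identity of
  \<open>Z\<close>, so it vanishes once that identity does. The equational form is the one that
  additive functors visibly preserve.\<close>

lemma zero_obj_iff: "zero_obj C Z \<longleftrightarrow> Z \<in> obj C \<and> idt C Z = \<one>\<^bsub>Hom C Z Z\<^esub>"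
proof
  assume "zero_obj C Z"
  then show "Z \<in> obj C \<and> idt C Z = \<one>\<^bsub>Hom C Z Z\<^esub>"
    by (metis zero_hom_to idt_closed zero_obj_def)
next
  assume Z: "Z \<in> obj C \<and> idt C Z = \<one>\<^bsub>Hom C Z Z\<^esub>"
  have "f = \<one>\<^bsub>Hom C X Z\<^esub>" if "X \<in> obj C" "f \<in> carrier (Hom C X Z)" for X f
    using idt_left[of X Z f] cmp_one_left[of X Z Z f] that Z by simp
  moreover have "f = \<one>\<^bsub>Hom C Z X\<^esub>" if "X \<in> obj C" "f \<in> carrier (Hom C Z X)" for X f
    using idt_right[of Z X f] cmp_one_right[of Z Z X f] that Z by simp
  ultimately show "zero_obj C Z"
    unfolding zero_obj_def using Z one_closed by metis
qed

lemma zero_obj_obj: "zero_obj C Z \<Longrightarrow> Z \<in> obj C"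
  by (simp add: zero_obj_def)

subsection \<open>Biproducts\<close>

context
  fixes J :: "'j set" and X Z \<iota> \<pi>
  assumes bip: "is_biproduct C J X Z \<iota> \<pi>"
begin

lemma bip_fin: "finite J"
  and bip_X: "j \<in> J \<Longrightarrow> X j \<in> obj C"
  and bip_Z: "Z \<in> obj C"
  and bip_in: "j \<in> J \<Longrightarrow> \<iota> j \<in> carrier (Hom C (X j) Z)"
  and bip_pr: "j \<in> J \<Longrightarrow> \<pi> j \<in> carrier (Hom C Z (X j))"
  and bip_sum: "finprod (Hom C Z Z) (\<lambda>j. cmp C Z (X j) Z (\<iota> j) (\<pi> j)) J = idt C Z"
  and bip_idt: "j \<in> J \<Longrightarrow> cmp C (X j) Z (X j) (\<pi> j) (\<iota> j) = idt C (X j)"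
  and bip_one: "j \<in> J \<Longrightarrow> k \<in> J \<Longrightarrow> j \<noteq> k \<Longrightarrow> cmp C (X j) Z (X k) (\<pi> k) (\<iota> j) = \<one>\<^bsub>Hom C (X j) (X k)\<^esub>"
  using bip unfolding is_biproduct_def by blast+

text \<open>Coordinates of a morphism assembled from components: cross terms vanish by orthogonality
  of projections and inclusions. The sum runs over a subset \<open>K\<close> because the convolution
  functor sums over the intersection of two index sets.\<close>

lemma bip_proj_finprod:
  assumes "K \<subseteq> J" "W \<in> obj C" "\<And>k. k \<in> K \<Longrightarrow> f k \<in> carrier (Hom C W (X k))" "j \<in> J"
  shows "cmp C W Z (X j) (\<pi> j) (finprod (Hom C W Z) (\<lambda>k. cmp C W (X k) Z (\<iota> k) (f k)) K)
    = (if j \<in> K then f j else \<one>\<^bsub>Hom C W (X j)\<^esub>)"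
proof -
  have KJ: "k \<in> J" if "k \<in> K" for k using that assms(1) by blast
  note c = bip_X[OF KJ] bip_X bip_Z assms cmp_closed[OF _ _ _ assms(3) bip_in] bip_pr bip_in KJ
  define a where "a = (if j \<in> K then f j else \<one>\<^bsub>Hom C W (X j)\<^esub>)"
  have a: "a \<in> carrier (Hom C W (X j))" using c one_closed by (auto simp: a_def)
  have "cmp C W Z (X j) (\<pi> j) (finprod (Hom C W Z) (\<lambda>k. cmp C W (X k) Z (\<iota> k) (f k)) K)
    = finprod (Hom C W (X j)) (\<lambda>k. cmp C W Z (X j) (\<pi> j) (cmp C W (X k) Z (\<iota> k) (f k))) K"
    by (rule cmp_finprod_right) (use c in auto)
  also have "\<dots> = finprod (Hom C W (X j)) (\<lambda>k. if k = j then a else \<one>\<^bsub>Hom C W (X j)\<^esub>) K"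
  proof (rule finprod_hom_cong)
    fix k assume k: "k \<in> K"
    have "cmp C W Z (X j) (\<pi> j) (cmp C W (X k) Z (\<iota> k) (f k)) =
      cmp C W (X k) (X j) (cmp C (X k) Z (X j) (\<pi> j) (\<iota> k)) (f k)"
      by (rule assoc) (use c k in auto)
    also have "\<dots> = (if k = j then a else \<one>\<^bsub>Hom C W (X j)\<^esub>)"
    proof (cases "k = j")
      case True
      then show ?thesis using k c(4) bip_idt[of k] by (auto simp: a_def idt_left c)
    next
      case False
      then show ?thesis using k bip_one[of k j] by (auto simp: cmp_one_left c)
    qed
    finally show "cmp C W Z (X j) (\<pi> j) (cmp C W (X k) Z (\<iota> k) (f k))
      = (if k = j then a else \<one>\<^bsub>Hom C W (X j)\<^esub>)" .
  qed (use c a one_closed in auto)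
  also have "\<dots> = (if j \<in> K then a else \<one>\<^bsub>Hom C W (X j)\<^esub>)"
    by (rule comm_monoid.finprod_delta) (use c a hom_monoid bip_fin finite_subset in auto)
  finally show ?thesis by (simp add: a_def)
qed

lemma bip_finprod_incl:
  assumes "K \<subseteq> J" "W \<in> obj C" "\<And>k. k \<in> K \<Longrightarrow> g k \<in> carrier (Hom C (X k) W)" "j \<in> J"
  shows "cmp C (X j) Z W (finprod (Hom C Z W) (\<lambda>k. cmp C Z (X k) W (g k) (\<pi> k)) K) (\<iota> j)
    = (if j \<in> K then g j else \<one>\<^bsub>Hom C (X j) W\<^esub>)"
proof -
  have KJ: "k \<in> J" if "k \<in> K" for k using that assms(1) by blast
  note c = bip_X[OF KJ] bip_X bip_Z assms cmp_closed[OF _ _ _ bip_pr assms(3)] bip_pr bip_in KJ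
  define a where "a = (if j \<in> K then g j else \<one>\<^bsub>Hom C (X j) W\<^esub>)"
  have a: "a \<in> carrier (Hom C (X j) W)" using c one_closed by (auto simp: a_def)
  have "cmp C (X j) Z W (finprod (Hom C Z W) (\<lambda>k. cmp C Z (X k) W (g k) (\<pi> k)) K) (\<iota> j)
    = finprod (Hom C (X j) W) (\<lambda>k. cmp C (X j) Z W (cmp C Z (X k) W (g k) (\<pi> k)) (\<iota> j)) K"
    by (rule cmp_finprod_left) (use c in auto)
  also have "\<dots> = finprod (Hom C (X j) W) (\<lambda>k. if k = j then a else \<one>\<^bsub>Hom C (X j) W\<^esub>) K"
  proof (rule finprod_hom_cong)
    fix k assume k: "k \<in> K"
    have "cmp C (X j) Z W (cmp C Z (X k) W (g k) (\<pi> k)) (\<iota> j) =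
      cmp C (X j) (X k) W (g k) (cmp C (X j) Z (X k) (\<pi> k) (\<iota> j))"
      by (rule assoc[symmetric]) (use c k in auto)
    also have "\<dots> = (if k = j then a else \<one>\<^bsub>Hom C (X j) W\<^esub>)"
    proof (cases "k = j")
      case True
      then show ?thesis using k c(4) bip_idt[of k] by (auto simp: a_def idt_right c)
    next
      case False
      then show ?thesis using k bip_one[of j k] by (auto simp: cmp_one_right c)
    qed
    finally show "cmp C (X j) Z W (cmp C Z (X k) W (g k) (\<pi> k)) (\<iota> j)
      = (if k = j then a else \<one>\<^bsub>Hom C (X j) W\<^esub>)" .
  qed (use c a one_closed in auto)
  also have "\<dots> = (if j \<in> K then a else \<one>\<^bsub>Hom C (X j) W\<^esub>)"
    by (rule comm_monoid.finprod_delta) (use c a hom_monoid bip_fin finite_subset in auto)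
  finally show ?thesis by (simp add: a_def)
qed

end

lemma finprod_bool:
  assumes "X \<in> obj C" "Y \<in> obj C" "\<And>b. f b \<in> carrier (Hom C X Y)"
  shows "finprod (Hom C X Y) f (UNIV :: bool set) = f True \<otimes>\<^bsub>Hom C X Y\<^esub> f False"
proof -
  interpret comm_group "Hom C X Y" using assms hom_group by blast
  show ?thesis using assms by (simp add: UNIV_bool finprod_insert m_comm)
qed

lemma biproduct_empty_iff: "is_biproduct C {} X Z \<iota> \<pi> \<longleftrightarrow> zero_obj C Z"
  unfolding is_biproduct_def zero_obj_iff
  by (auto simp: comm_monoid.finprod_empty[OF hom_monoid])

lemma biproduct_boolI:
  assumes o: "X \<in> obj C" "Y \<in> obj C" "Z \<in> obj C"
    and m: "i \<in> carrier (Hom C X Z)" "i' \<in> carrier (Hom C Y Z)"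
      "p \<in> carrier (Hom C Z X)" "p' \<in> carrier (Hom C Z Y)"
    and "cmp C X Z X p i = idt C X" "cmp C Y Z Y p' i' = idt C Y"
      "cmp C X Z Y p' i = \<one>\<^bsub>Hom C X Y\<^esub>" "cmp C Y Z X p i' = \<one>\<^bsub>Hom C Y X\<^esub>"
    and "cmp C Z X Z i p \<otimes>\<^bsub>Hom C Z Z\<^esub> cmp C Z Y Z i' p' = idt C Z"
  shows "is_biproduct C UNIV (case_bool X Y) Z (case_bool i i') (case_bool p p')"
  unfolding is_biproduct_def
proof (intro conjI ballI impI)
  have "cmp C Z (case b of True \<Rightarrow> X | False \<Rightarrow> Y) Z (case b of True \<Rightarrow> i | False \<Rightarrow> i')
     (case b of True \<Rightarrow> p | False \<Rightarrow> p') \<in> carrier (Hom C Z Z)" for b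
    using o m by (cases b) (auto intro: cmp_closed)
  then show "finprod (Hom C Z Z) (\<lambda>j. cmp C Z (case j of True \<Rightarrow> X | False \<Rightarrow> Y) Z
      (case j of True \<Rightarrow> i | False \<Rightarrow> i') (case j of True \<Rightarrow> p | False \<Rightarrow> p')) UNIV = idt C Z"
    using assms by (subst finprod_bool) auto
qed (use assms in \<open>auto split: bool.splits\<close>)

text \<open>The relations of the Grothendieck group know only binary biproducts, so larger ones are
  peeled one summand at a time. The complement of \<open>X j\<close> in \<open>Z\<close> is
  identified with any given biproduct \<open>Z'\<close> of the rest.\<close>

lemma biproduct_insert_split:
  assumes b: "is_biproduct C (insert j J) X Z \<iota> \<pi>" and j: "j \<notin> J"
    and b': "is_biproduct C J X Z' \<iota>' \<pi>'"
  shows "\<exists>\<iota>'' \<pi>''. is_biproduct C UNIV (case_bool (X j) Z') Z \<iota>'' \<pi>''"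
proof -
  \<comment> \<open>Comparison morphisms between \<open>Z'\<close> and \<open>Z\<close>, matching
    each coordinate over \<open>J\<close> with itself.\<close>
  define i where "i = finprod (Hom C Z' Z) (\<lambda>k. cmp C Z' (X k) Z (\<iota> k) (\<pi>' k)) J"
  define p where "p = finprod (Hom C Z Z') (\<lambda>k. cmp C Z (X k) Z' (\<iota>' k) (\<pi> k)) J"
  note c = bip_X[OF b'] bip_X[OF b] bip_Z[OF b'] bip_Z[OF b] bip_in[OF b] bip_in[OF b'] bip_pr[OF b] bip_pr[OF b']
  have ic: "i \<in> carrier (Hom C Z' Z)"
    unfolding i_def by (rule finprod_hom_closed) (auto intro!: cmp_closed simp: c)
  have pc: "p \<in> carrier (Hom C Z Z')"
    unfolding p_def by (rule finprod_hom_closed) (auto intro!: cmp_closed simp: c)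
  have pi: "cmp C Z' Z (X k) (\<pi> k) i = (if k \<in> J then \<pi>' k else \<one>\<^bsub>Hom C Z' (X k)\<^esub>)" if "k \<in> insert j J" for k
    unfolding i_def by (rule bip_proj_finprod[OF b]) (use c that in auto)
  have pj: "cmp C (X k) Z Z' p (\<iota> k) = (if k \<in> J then \<iota>' k else \<one>\<^bsub>Hom C (X k) Z'\<^esub>)" if "k \<in> insert j J" for k
    unfolding p_def by (rule bip_finprod_incl[OF b]) (use c that in auto)
  have pp: "cmp C Z Z' (X k) (\<pi>' k) p = \<pi> k" if "k \<in> J" for k
    unfolding p_def by (subst bip_proj_finprod[OF b']) (use c that in auto)
  have 1: "cmp C Z' Z Z' p i = idt C Z'"
  proof -
    have "cmp C Z' Z Z' p i = finprod (Hom C Z' Z') (\<lambda>k. cmp C Z' Z Z' (cmp C Z (X k) Z' (\<iota>' k) (\<pi> k)) i) J"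
      unfolding p_def by (rule cmp_finprod_left) (auto intro!: cmp_closed simp: c ic)
    also have "\<dots> = finprod (Hom C Z' Z') (\<lambda>k. cmp C Z' (X k) Z' (\<iota>' k) (\<pi>' k)) J"
    proof (rule finprod_hom_cong)
      fix k assume k: "k \<in> J"
      have "cmp C Z' Z Z' (cmp C Z (X k) Z' (\<iota>' k) (\<pi> k)) i = cmp C Z' (X k) Z' (\<iota>' k) (cmp C Z' Z (X k) (\<pi> k) i)"
        by (rule assoc[symmetric]) (use c ic k in auto)
      then show "cmp C Z' Z Z' (cmp C Z (X k) Z' (\<iota>' k) (\<pi> k)) i = cmp C Z' (X k) Z' (\<iota>' k) (\<pi>' k)"
        using pi k by simp
    qed (auto intro!: cmp_closed simp: c)
    also have "\<dots> = idt C Z'" by (rule bip_sum[OF b'])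
    finally show ?thesis .
  qed
  have 2: "cmp C Z Z' Z i p = finprod (Hom C Z Z) (\<lambda>k. cmp C Z (X k) Z (\<iota> k) (\<pi> k)) J"
  proof -
    have "cmp C Z Z' Z i p = finprod (Hom C Z Z) (\<lambda>k. cmp C Z Z' Z (cmp C Z' (X k) Z (\<iota> k) (\<pi>' k)) p) J"
      unfolding i_def by (rule cmp_finprod_left) (auto intro!: cmp_closed simp: c pc)
    also have "\<dots> = finprod (Hom C Z Z) (\<lambda>k. cmp C Z (X k) Z (\<iota> k) (\<pi> k)) J"
    proof (rule finprod_hom_cong)
      fix k assume k: "k \<in> J"
      have "cmp C Z Z' Z (cmp C Z' (X k) Z (\<iota> k) (\<pi>' k)) p = cmp C Z (X k) Z (\<iota> k) (cmp C Z Z' (X k) (\<pi>' k) p)"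
        by (rule assoc[symmetric]) (use c pc k in auto)
      then show "cmp C Z Z' Z (cmp C Z' (X k) Z (\<iota> k) (\<pi>' k)) p = cmp C Z (X k) Z (\<iota> k) (\<pi> k)"
        using pp k by simp
    qed (auto intro!: cmp_closed simp: c)
    finally show ?thesis .
  qed
  have "finprod (Hom C Z Z) (\<lambda>j. cmp C Z (X j) Z (\<iota> j) (\<pi> j)) (insert j J)
    = cmp C Z (X j) Z (\<iota> j) (\<pi> j) \<otimes>\<^bsub>Hom C Z Z\<^esub> finprod (Hom C Z Z) (\<lambda>k. cmp C Z (X k) Z (\<iota> k) (\<pi> k)) J"
    by (rule comm_monoid.finprod_insert[OF hom_monoid])
      (use j c bip_fin[OF b'] in \<open>auto intro!: cmp_closed\<close>)
  then have 3: "cmp C Z (X j) Z (\<iota> j) (\<pi> j) \<otimes>\<^bsub>Hom C Z Z\<^esub> cmp C Z Z' Z i p = idt C Z"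
    using bip_sum[OF b] 2 by simp
  show ?thesis
    by (intro exI, rule biproduct_boolI[of "X j" Z' Z "\<iota> j" i "\<pi> j" p])
      (use c ic pc 1 3 pi[of j] pj[of j] bip_idt[OF b, of j] j in auto)
qed

end

subsection \<open>Additive categories\<close>

locale additive_cat = preadd C for C :: "('o, 'm) cat" +
  assumes zero_ex: "\<exists>Z. zero_obj C Z"
    and bip_ex: "X \<in> obj C \<Longrightarrow> Y \<in> obj C \<Longrightarrow> \<exists>Z \<iota> \<pi>. is_biproduct C UNIV (case_bool X Y) Z \<iota> \<pi>"

lemma additive_category_iff: "additive_category C \<longleftrightarrow> additive_cat C"
  unfolding additive_category_def additive_cat_def additive_cat_axioms_def preadd_def by blast

context additive_cat
begin

lemma biproduct_exists:
  assumes "finite J" "\<And>j. j \<in> J \<Longrightarrow> X j \<in> obj C"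
  shows "\<exists>Z \<iota> \<pi>. is_biproduct C J X Z \<iota> \<pi>"
  using assms
proof (induction J)
  case empty
  then show ?case using zero_ex biproduct_empty_iff by blast
next
  case (insert j J)
  then obtain Z' \<iota>' \<pi>' where b': "is_biproduct C J X Z' \<iota>' \<pi>'" by auto
  have j: "X j \<in> obj C" using insert by auto
  obtain Z i p where b: "is_biproduct C UNIV (case_bool (X j) Z') Z i p"
    using bip_ex[OF j bip_Z[OF b']] by blast
  note c = bip_X[OF b'] bip_Z[OF b'] bip_Z[OF b] bip_in[OF b'] bip_pr[OF b'] j
    bip_in[OF b, of True] bip_in[OF b, of False] bip_pr[OF b, of True] bip_pr[OF b, of False]
  note c' = c[simplified]
  \<comment> \<open>\<open>True\<close> marks the new summand and \<open>False\<close> the biproduct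
    \<open>Z'\<close> of the old ones, through which the old inclusions and projections are
    routed.\<close>
  define \<iota> where "\<iota> k = (if k = j then i True else cmp C (X k) Z' Z (i False) (\<iota>' k))" for k
  define \<pi> where "\<pi> k = (if k = j then p True else cmp C Z Z' (X k) (\<pi>' k) (p False))" for k
  have ne: "k \<noteq> j" if "k \<in> J" for k using that insert by auto
  have TF: "cmp C Z' Z (X j) (p True) (i False) = \<one>\<^bsub>Hom C Z' (X j)\<^esub>"
    "cmp C (X j) Z Z' (p False) (i True) = \<one>\<^bsub>Hom C (X j) Z'\<^esub>"
    "cmp C (X j) Z (X j) (p True) (i True) = idt C (X j)" "cmp C Z' Z Z' (p False) (i False) = idt C Z'"
    using bip_one[OF b, of True False] bip_one[OF b, of False True] bip_idt[OF b, of True] bip_idt[OF b, of False]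
    by auto
  have ic: "\<iota> k \<in> carrier (Hom C (X k) Z)" "\<pi> k \<in> carrier (Hom C Z (X k))" if "k \<in> insert j J" for k
    using that c' ne by (auto simp: \<iota>_def \<pi>_def intro!: cmp_closed)
  have jk: "cmp C (X j) Z (X k) (\<pi> k) (\<iota> j) = \<one>\<^bsub>Hom C (X j) (X k)\<^esub>" if k: "k \<in> J" for k
  proof -
    have "cmp C (X j) Z (X k) (\<pi> k) (\<iota> j) = cmp C (X j) Z' (X k) (\<pi>' k) (cmp C (X j) Z Z' (p False) (i True))"
      using ne[OF k] by (simp add: \<iota>_def \<pi>_def) (rule assoc[symmetric], use c' k in auto)
    then show ?thesis using k c' by (simp add: TF cmp_one_right)
  qed
  have kj: "cmp C (X k) Z (X j) (\<pi> j) (\<iota> k) = \<one>\<^bsub>Hom C (X k) (X j)\<^esub>" if k: "k \<in> J" for k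
  proof -
    have "cmp C (X k) Z (X j) (\<pi> j) (\<iota> k) = cmp C (X k) Z' (X j) (cmp C Z' Z (X j) (p True) (i False)) (\<iota>' k)"
      using ne[OF k] by (simp add: \<iota>_def \<pi>_def) (rule assoc, use c' k in auto)
    then show ?thesis using k c' by (simp add: TF cmp_one_left)
  qed
  have kl: "cmp C (X k) Z (X l) (\<pi> l) (\<iota> k) = cmp C (X k) Z' (X l) (\<pi>' l) (\<iota>' k)" if k: "k \<in> J" "l \<in> J" for k l
  proof -
    have "cmp C (X k) Z (X l) (\<pi> l) (\<iota> k)
      = cmp C (X k) Z' (X l) (\<pi>' l) (cmp C (X k) Z Z' (p False) (cmp C (X k) Z' Z (i False) (\<iota>' k)))"
      using ne k by (simp add: \<iota>_def \<pi>_def) (rule assoc[symmetric], use c' k in \<open>auto intro!: cmp_closed\<close>)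
    also have "cmp C (X k) Z Z' (p False) (cmp C (X k) Z' Z (i False) (\<iota>' k))
      = cmp C (X k) Z' Z' (cmp C Z' Z Z' (p False) (i False)) (\<iota>' k)"
      by (rule assoc) (use c' k in auto)
    finally show ?thesis using k c' by (simp add: TF idt_left)
  qed
  have sm: "finprod (Hom C Z Z) (\<lambda>k. cmp C Z (X k) Z (\<iota> k) (\<pi> k)) J = cmp C Z Z' Z (i False) (p False)"
  proof -
    have "cmp C Z Z' Z (i False) (p False) = cmp C Z Z' Z (i False) (cmp C Z Z' Z' (idt C Z') (p False))"
      using c' by (simp add: idt_left)
    also have "idt C Z' = finprod (Hom C Z' Z') (\<lambda>k. cmp C Z' (X k) Z' (\<iota>' k) (\<pi>' k)) J"
      using bip_sum[OF b'] by simp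
    also have "cmp C Z Z' Z' (finprod (Hom C Z' Z') (\<lambda>k. cmp C Z' (X k) Z' (\<iota>' k) (\<pi>' k)) J) (p False)
       = finprod (Hom C Z Z') (\<lambda>k. cmp C Z Z' Z' (cmp C Z' (X k) Z' (\<iota>' k) (\<pi>' k)) (p False)) J"
      by (rule cmp_finprod_left) (use c' in \<open>auto intro!: cmp_closed\<close>)
    also have "\<dots> = finprod (Hom C Z Z') (\<lambda>k. cmp C Z (X k) Z' (\<iota>' k) (\<pi> k)) J"
    proof (rule finprod_hom_cong)
      fix k assume k: "k \<in> J"
      show "cmp C Z Z' Z' (cmp C Z' (X k) Z' (\<iota>' k) (\<pi>' k)) (p False) = cmp C Z (X k) Z' (\<iota>' k) (\<pi> k)"
        using ne[OF k] by (simp add: \<pi>_def) (rule assoc[symmetric], use c' k in auto)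
    qed (use c' ic in \<open>auto intro!: cmp_closed\<close>)
    also have "cmp C Z Z' Z (i False) \<dots> = finprod (Hom C Z Z) (\<lambda>k. cmp C Z Z' Z (i False) (cmp C Z (X k) Z' (\<iota>' k) (\<pi> k))) J"
      by (rule cmp_finprod_right) (use c' ic in \<open>auto intro!: cmp_closed\<close>)
    also have "\<dots> = finprod (Hom C Z Z) (\<lambda>k. cmp C Z (X k) Z (\<iota> k) (\<pi> k)) J"
    proof (rule finprod_hom_cong)
      fix k assume k: "k \<in> J"
      show "cmp C Z Z' Z (i False) (cmp C Z (X k) Z' (\<iota>' k) (\<pi> k)) = cmp C Z (X k) Z (\<iota> k) (\<pi> k)"
        using ne[OF k] by (simp add: \<iota>_def) (rule assoc, use c' ic k in auto)
    qed (use c' ic in \<open>auto intro!: cmp_closed\<close>)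
    finally show ?thesis by simp
  qed
  have "is_biproduct C (insert j J) X Z \<iota> \<pi>"
    unfolding is_biproduct_def
  proof (intro conjI ballI impI)
    have "finprod (Hom C Z Z) (\<lambda>k. cmp C Z (X k) Z (\<iota> k) (\<pi> k)) (insert j J)
      = cmp C Z (X j) Z (\<iota> j) (\<pi> j) \<otimes>\<^bsub>Hom C Z Z\<^esub> finprod (Hom C Z Z) (\<lambda>k. cmp C Z (X k) Z (\<iota> k) (\<pi> k)) J"
      by (rule comm_monoid.finprod_insert[OF hom_monoid])
        (use insert c' ic in \<open>auto intro!: cmp_closed\<close>)
    also have "\<dots> = cmp C Z (X j) Z (i True) (p True) \<otimes>\<^bsub>Hom C Z Z\<^esub> cmp C Z Z' Z (i False) (p False)"
      unfolding sm by (simp add: \<iota>_def \<pi>_def)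
    also have "\<dots> = finprod (Hom C Z Z) (\<lambda>a. cmp C Z (case_bool (X j) Z' a) Z (i a) (p a)) UNIV"
      using c' by (subst finprod_bool) (auto intro!: cmp_closed split: bool.split)
    also have "\<dots> = idt C Z" by (rule bip_sum[OF b])
    finally show "finprod (Hom C Z Z) (\<lambda>k. cmp C Z (X k) Z (\<iota> k) (\<pi> k)) (insert j J) = idt C Z" .
    show "cmp C (X k) Z (X k) (\<pi> k) (\<iota> k) = idt C (X k)" if "k \<in> insert j J" for k
    proof (cases "k = j")
      case True
      then show ?thesis using TF by (simp add: \<iota>_def \<pi>_def)
    qed (use that kl bip_idt[OF b'] in auto)
    show "cmp C (X k) Z (X l) (\<pi> l) (\<iota> k) = \<one>\<^bsub>Hom C (X k) (X l)\<^esub>"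
      if "k \<in> insert j J" "l \<in> insert j J" "k \<noteq> l" for k l
      using that kl jk kj bip_one[OF b'] by auto
  qed (use insert c' ic in auto)
  then show ?case by blast
qed

end

section \<open>Split Grothendieck groups and the maps induced by functors\<close>

subsection \<open>Split Grothendieck groups\<close>

lemma K0_rels_keys: "K0_rels C \<subseteq> {r. Poly_Mapping.keys r \<subseteq> obj C}"
  unfolding K0_rels_def is_biproduct_def by (auto dest!: subsetD[OF keys_diff])

lemmas K0_class_eq = pres_class_eq_cls[OF K0_rels_keys, folded K0_class_def]
lemmas carrier_K0 = carrier_pres[OF K0_rels_keys, folded K0_def]
lemmas mult_K0 = mult_pres[OF K0_rels_keys, folded K0_def]
lemmas one_K0 = one_pres[OF K0_rels_keys, folded K0_def]
lemmas comm_group_K0 = comm_group_pres[OF K0_rels_keys, folded K0_def]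
lemmas keys_K0_spn = keys_spn[OF _ K0_rels_keys]

lemma K0_rel:
  "X \<in> obj C \<Longrightarrow> Y \<in> obj C \<Longrightarrow> is_biproduct C UNIV (case_bool X Y) Z \<iota> \<pi>
    \<Longrightarrow> frag_of Z - frag_of X - frag_of Y \<in> spn (K0_rels C)"
  unfolding K0_rels_def by (rule spn_incl) blast

lemma cls_in_K0: "Poly_Mapping.keys p \<subseteq> obj C \<Longrightarrow> cls (K0_rels C) p \<in> carrier (K0 C)"
  by (auto simp: carrier_K0)

lemma K0_E:
  assumes "X \<in> carrier (K0 C)"
  obtains p where "Poly_Mapping.keys p \<subseteq> obj C" "X = cls (K0_rels C) p"
  using assms by (auto simp: carrier_K0)

context preadd
begin

text \<open>A zero object is a biproduct of two copies of itself, and that relation reads -[Z] =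
  0.\<close>

lemma K0_zero:
  assumes "zero_obj C Z"
  shows "frag_of Z \<in> spn (K0_rels C)"
proof -
  have Z: "Z \<in> obj C" "idt C Z = \<one>\<^bsub>Hom C Z Z\<^esub>" using assms zero_obj_iff by auto
  have "is_biproduct C UNIV (case_bool Z Z) Z (case_bool (idt C Z) (idt C Z)) (case_bool (idt C Z) (idt C Z))"
    by (rule biproduct_boolI)
      (use Z idt_closed idt_left one_closed monoid.r_one[OF group.is_monoid[OF hom_grp]] in \<open>simp_all add: cmp_one_left\<close>)
  then have "frag_of Z - frag_of Z - frag_of Z \<in> spn (K0_rels C)"
    by (rule K0_rel[rotated 2]) (use Z in auto)
  then show ?thesis using spn_uminus by fastforce
qed

end

text \<open>Induction on the index set: one summand is split off against a biproduct of the others,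
  which exists and whose class is known by induction.\<close>

lemma (in additive_cat) K0_biproduct:
  assumes "is_biproduct C J X Z \<iota> \<pi>"
  shows "frag_of Z - (\<Sum>j\<in>J. frag_of (X j)) \<in> spn (K0_rels C)"
  using bip_fin[OF assms] assms
proof (induction J arbitrary: Z \<iota> \<pi>)
  case empty
  then show ?case by (simp add: biproduct_empty_iff K0_zero)
next
  case (insert j J)
  have X: "\<And>k. k \<in> insert j J \<Longrightarrow> X k \<in> obj C" using bip_X[OF insert.prems] .
  obtain Z' \<iota>' \<pi>' where b': "is_biproduct C J X Z' \<iota>' \<pi>'"
    using biproduct_exists[of J X] insert(1) X by auto
  obtain \<iota>'' \<pi>'' where "is_biproduct C UNIV (case_bool (X j) Z') Z \<iota>'' \<pi>''"
    using biproduct_insert_split[OF insert.prems insert(2) b'] by blast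
  then have 1: "frag_of Z - frag_of (X j) - frag_of Z' \<in> spn (K0_rels C)"
    by (rule K0_rel[rotated 2]) (use X[of j] bip_Z[OF b'] in auto)
  have "frag_of Z' - (\<Sum>j\<in>J. frag_of (X j)) \<in> spn (K0_rels C)" using insert.IH b' by blast
  from spn_add[OF 1 this] show ?case using insert(1,2) by (simp add: algebra_simps)
qed

subsection \<open>Additive functors\<close>

definition fobj :: "('o, 'm, 'p, 'n) ftor \<Rightarrow> ('o \<Rightarrow>\<^sub>0 int) \<Rightarrow> ('p \<Rightarrow>\<^sub>0 int)" where
  "fobj F = frag_extend (\<lambda>a. frag_of (onobj F a))"

lemma fobj_simps [simp]: "fobj F 0 = 0" "fobj F (frag_of a) = frag_of (onobj F a)"
  "fobj F (x + y) = fobj F x + fobj F y" "fobj F (x - y) = fobj F x - fobj F y"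
  by (simp_all add: fobj_def frag_extend_add frag_extend_diff)

lemma fobj_sum: "fobj F (sum f I) = (\<Sum>i\<in>I. fobj F (f i))"
  by (induction I rule: infinite_finite_induct) auto

locale add_ftor = C: preadd C + D: preadd D
  for C :: "('o, 'm) cat" and D :: "('p, 'n) cat" +
  fixes F :: "('o, 'm, 'p, 'n) ftor"
  assumes add_ftor: "additive_ftor C D F"
begin

lemma onobj_closed: "X \<in> obj C \<Longrightarrow> onobj F X \<in> obj D"
  and onmor_idt: "X \<in> obj C \<Longrightarrow> onmor F X X (idt C X) = idt D (onobj F X)"
  and onmor_closed: "X \<in> obj C \<Longrightarrow> Y \<in> obj C \<Longrightarrow> f \<in> carrier (Hom C X Y)
    \<Longrightarrow> onmor F X Y f \<in> carrier (Hom D (onobj F X) (onobj F Y))"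
  and onmor_cmp: "X \<in> obj C \<Longrightarrow> Y \<in> obj C \<Longrightarrow> Z \<in> obj C \<Longrightarrow> f \<in> carrier (Hom C X Y)
    \<Longrightarrow> g \<in> carrier (Hom C Y Z) \<Longrightarrow> onmor F X Z (cmp C X Y Z g f) =
          cmp D (onobj F X) (onobj F Y) (onobj F Z) (onmor F Y Z g) (onmor F X Y f)"
  and onmor_hom: "X \<in> obj C \<Longrightarrow> Y \<in> obj C \<Longrightarrow> onmor F X Y \<in> hom (Hom C X Y) (Hom D (onobj F X) (onobj F Y))"
  using add_ftor unfolding additive_ftor_def is_ftor_def by blast+

lemma onmor_one: "X \<in> obj C \<Longrightarrow> Y \<in> obj C \<Longrightarrow> onmor F X Y \<one>\<^bsub>Hom C X Y\<^esub> = \<one>\<^bsub>Hom D (onobj F X) (onobj F Y)\<^esub>"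
  using hom_one[OF onmor_hom] C.hom_grp D.hom_grp onobj_closed by blast

lemma ftor_zero: "zero_obj C Z \<Longrightarrow> zero_obj D (onobj F Z)"
  unfolding C.zero_obj_iff D.zero_obj_iff by (metis onobj_closed onmor_idt onmor_one)

text \<open>A biproduct is characterised by equations involving only composition, identities, zero
  and sums of morphisms, all of which an additive functor respects.\<close>

lemma ftor_biproduct:
  assumes b: "is_biproduct C J X Z \<iota> \<pi>"
  shows "is_biproduct D J (\<lambda>j. onobj F (X j)) (onobj F Z) (\<lambda>j. onmor F (X j) Z (\<iota> j)) (\<lambda>j. onmor F Z (X j) (\<pi> j))"
  unfolding is_biproduct_def
proof (intro conjI ballI impI)
  note c = C.bip_X[OF b] C.bip_Z[OF b] C.bip_in[OF b] C.bip_pr[OF b]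
  have "finprod (Hom D (onobj F Z) (onobj F Z))
     (\<lambda>j. cmp D (onobj F Z) (onobj F (X j)) (onobj F Z) (onmor F (X j) Z (\<iota> j)) (onmor F Z (X j) (\<pi> j))) J
    = finprod (Hom D (onobj F Z) (onobj F Z)) (\<lambda>j. onmor F Z Z (cmp C Z (X j) Z (\<iota> j) (\<pi> j))) J"
    by (rule D.finprod_hom_cong) (use c in \<open>auto simp: onmor_cmp intro!: onmor_closed onobj_closed C.cmp_closed\<close>,
        use c onmor_closed onobj_closed in \<open>auto intro!: D.cmp_closed\<close>)
  also have "\<dots> = onmor F Z Z (finprod (Hom C Z Z) (\<lambda>j. cmp C Z (X j) Z (\<iota> j) (\<pi> j)) J)"
    by (rule hom_finprod[symmetric])
      (use c in \<open>auto intro!: C.hom_group D.hom_group onmor_hom onobj_closed C.cmp_closed\<close>)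
  also have "\<dots> = idt D (onobj F Z)"
    using C.bip_sum[OF b] c onmor_idt by simp
  finally show "finprod (Hom D (onobj F Z) (onobj F Z))
     (\<lambda>j. cmp D (onobj F Z) (onobj F (X j)) (onobj F Z) (onmor F (X j) Z (\<iota> j)) (onmor F Z (X j) (\<pi> j))) J
    = idt D (onobj F Z)" .
  show "cmp D (onobj F (X j)) (onobj F Z) (onobj F (X j)) (onmor F Z (X j) (\<pi> j)) (onmor F (X j) Z (\<iota> j))
    = idt D (onobj F (X j))" if "j \<in> J" for j
    using onmor_cmp[of "X j" Z "X j" "\<iota> j" "\<pi> j"] that c(1,3,4)[of j] c(2) C.bip_idt[OF b, of j] onmor_idt[of "X j"] by simp
  show "cmp D (onobj F (X j)) (onobj F Z) (onobj F (X k)) (onmor F Z (X k) (\<pi> k)) (onmor F (X j) Z (\<iota> j))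
    = \<one>\<^bsub>Hom D (onobj F (X j)) (onobj F (X k))\<^esub>" if "j \<in> J" "k \<in> J" "j \<noteq> k" for j k
    using onmor_cmp[of "X j" Z "X k" "\<iota> j" "\<pi> k"] that c(1,3,4)[of j] c(1,3,4)[of k] c(2) C.bip_one[OF b, of j k]
      onmor_one[of "X j" "X k"] by simp
qed (use C.bip_X[OF b] C.bip_Z[OF b] C.bip_in[OF b] C.bip_pr[OF b] C.bip_fin[OF b]
      in \<open>auto intro: onobj_closed onmor_closed\<close>)

lemma fobj_spn:
  assumes "p \<in> spn (K0_rels C)"
  shows "fobj F p \<in> spn (K0_rels D)"
  using assms
proof (rule spn_hom)
  fix r assume "r \<in> K0_rels C"
  then obtain X Y Z \<iota> \<pi> where r: "r = frag_of Z - frag_of X - frag_of Y" "X \<in> obj C" "Y \<in> obj C"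
    and b: "is_biproduct C UNIV (case_bool X Y) Z \<iota> \<pi>"
    unfolding K0_rels_def by blast
  have "(\<lambda>j. onobj F (case j of True \<Rightarrow> X | False \<Rightarrow> Y)) = case_bool (onobj F X) (onobj F Y)"
    by (auto split: bool.split)
  then show "fobj F r \<in> spn (K0_rels D)"
    using ftor_biproduct[OF b] r onobj_closed K0_rel[of "onobj F X" D "onobj F Y"] by simp
qed simp

lemma keys_fobj: "Poly_Mapping.keys p \<subseteq> obj C \<Longrightarrow> Poly_Mapping.keys (fobj F p) \<subseteq> obj D"
  unfolding fobj_def by (erule keys_frag_extend_subset) (simp add: onobj_closed)

lemma fobj_cong: "p - q \<in> spn (K0_rels C) \<Longrightarrow> fobj F p - fobj F q \<in> spn (K0_rels D)"
  using fobj_spn by fastforce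

lemma K0_map_cls: "K0_map D F (cls (K0_rels C) p) = cls (K0_rels D) (fobj F p)"
  unfolding K0_map_def K0_class_eq fobj_def[symmetric]
proof (rule UN_cls_const)
  fix x assume "x \<in> cls (K0_rels C) p"
  then show "cls (K0_rels D) (fobj F x) = cls (K0_rels D) (fobj F p)"
    using fobj_cong by (simp add: cls_eq_iff in_cls_iff)
qed (use self_in_cls in blast)

lemma K0_map_closed: "X \<in> carrier (K0 C) \<Longrightarrow> K0_map D F X \<in> carrier (K0 D)"
  by (erule K0_E) (simp add: K0_map_cls cls_in_K0 keys_fobj)

lemma K0_map_mult: "X \<in> carrier (K0 C) \<Longrightarrow> Y \<in> carrier (K0 C)
    \<Longrightarrow> K0_map D F (X \<otimes>\<^bsub>K0 C\<^esub> Y) = K0_map D F X \<otimes>\<^bsub>K0 D\<^esub> K0_map D F Y"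
  by (elim K0_E) (simp add: K0_map_cls mult_K0)

end

subsection \<open>Biadditive functors\<close>

definition bobj :: "('o \<times> 'p, 'm, 'r, 's) ftor \<Rightarrow> ('o \<Rightarrow>\<^sub>0 int) \<Rightarrow> ('p \<Rightarrow>\<^sub>0 int) \<Rightarrow> ('r \<Rightarrow>\<^sub>0 int)" where
  "bobj F x y = frag_extend (\<lambda>a. frag_extend (\<lambda>b. frag_of (onobj F (a, b))) y) x"

lemma bobj_swap: "bobj F x y = frag_extend (\<lambda>b. frag_extend (\<lambda>a. frag_of (onobj F (a, b))) x) y"
  unfolding bobj_def by (rule frag_extend_swap)

lemma bobj_simps [simp]: "bobj F 0 y = 0" "bobj F x 0 = 0"
  "bobj F (x + x') y = bobj F x y + bobj F x' y" "bobj F x (y + y') = bobj F x y + bobj F x y'"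
  "bobj F (x - x') y = bobj F x y - bobj F x' y" "bobj F x (y - y') = bobj F x y - bobj F x y'"
  "bobj F (frag_of a) (frag_of b) = frag_of (onobj F (a, b))"
       apply (simp add: bobj_def)
      apply (simp add: bobj_swap)
     apply (simp add: bobj_def frag_extend_add)
    apply (simp add: bobj_swap frag_extend_add)
   apply (simp add: bobj_def frag_extend_diff)
  apply (simp add: bobj_swap frag_extend_diff)
  apply (simp add: bobj_def)
  done

locale biadd_ftor = C: preadd C + D: preadd D + E: preadd E
  for C :: "('o, 'm) cat" and D :: "('p, 'n) cat" and E :: "('r, 's) cat" +
  fixes F :: "('o \<times> 'p, 'm \<times> 'n, 'r, 's) ftor"
  assumes biadd_ftor: "biadditive_ftor C D E F"
begin

lemma onobj_closed: "X \<in> obj C \<Longrightarrow> Y \<in> obj D \<Longrightarrow> onobj F (X, Y) \<in> obj E"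
  and onmor_idt: "X \<in> obj C \<Longrightarrow> Y \<in> obj D \<Longrightarrow> onmor F (X, Y) (X, Y) (idt C X, idt D Y) = idt E (onobj F (X, Y))"
  and onmor_closed: "X \<in> obj C \<Longrightarrow> Y \<in> obj D \<Longrightarrow> X' \<in> obj C \<Longrightarrow> Y' \<in> obj D \<Longrightarrow> f \<in> carrier (Hom C X X')
    \<Longrightarrow> g \<in> carrier (Hom D Y Y')
    \<Longrightarrow> onmor F (X, Y) (X', Y') (f, g) \<in> carrier (Hom E (onobj F (X, Y)) (onobj F (X', Y')))"
  using biadd_ftor unfolding biadditive_ftor_def is_ftor_def prod_cat_def by (auto simp: DirProd_def)

lemma onmor_cmp: "X \<in> obj C \<Longrightarrow> Y \<in> obj D \<Longrightarrow> X' \<in> obj C \<Longrightarrow> Y' \<in> obj D \<Longrightarrow> X'' \<in> obj C \<Longrightarrow> Y'' \<in> obj D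
    \<Longrightarrow> f \<in> carrier (Hom C X X') \<Longrightarrow> g \<in> carrier (Hom D Y Y')
    \<Longrightarrow> f' \<in> carrier (Hom C X' X'') \<Longrightarrow> g' \<in> carrier (Hom D Y' Y'')
    \<Longrightarrow> onmor F (X, Y) (X'', Y'') (cmp C X X' X'' f' f, cmp D Y Y' Y'' g' g)
      = cmp E (onobj F (X, Y)) (onobj F (X', Y')) (onobj F (X'', Y''))
          (onmor F (X', Y') (X'', Y'') (f', g')) (onmor F (X, Y) (X', Y') (f, g))"
  using biadd_ftor unfolding biadditive_ftor_def is_ftor_def prod_cat_def by (auto simp: DirProd_def)

lemma onmor_hom_left: "X \<in> obj C \<Longrightarrow> Y \<in> obj D \<Longrightarrow> X' \<in> obj C \<Longrightarrow> Y' \<in> obj D \<Longrightarrow> g \<in> carrier (Hom D Y Y')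
    \<Longrightarrow> (\<lambda>f. onmor F (X, Y) (X', Y') (f, g)) \<in> hom (Hom C X X') (Hom E (onobj F (X, Y)) (onobj F (X', Y')))"
  and onmor_hom_right: "X \<in> obj C \<Longrightarrow> Y \<in> obj D \<Longrightarrow> X' \<in> obj C \<Longrightarrow> Y' \<in> obj D \<Longrightarrow> f \<in> carrier (Hom C X X')
    \<Longrightarrow> (\<lambda>g. onmor F (X, Y) (X', Y') (f, g)) \<in> hom (Hom D Y Y') (Hom E (onobj F (X, Y)) (onobj F (X', Y')))"
  using biadd_ftor unfolding biadditive_ftor_def by auto

text \<open>Freezing one argument, with its identity as morphism, turns a biadditive functor into an
  additive one, to which the results on relations and zero objects apply.\<close>

definition left_ftor :: "'p \<Rightarrow> ('o, 'm, 'r, 's) ftor" where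
  "left_ftor Y = \<lparr>onobj = (\<lambda>X. onobj F (X, Y)), onmor = (\<lambda>X X' f. onmor F (X, Y) (X', Y) (f, idt D Y))\<rparr>"

definition right_ftor :: "'o \<Rightarrow> ('p, 'n, 'r, 's) ftor" where
  "right_ftor X = \<lparr>onobj = (\<lambda>Y. onobj F (X, Y)), onmor = (\<lambda>Y Y' g. onmor F (X, Y) (X, Y') (idt C X, g))\<rparr>"

lemma left_ftor: "Y \<in> obj D \<Longrightarrow> add_ftor C E (left_ftor Y)"
  by unfold_locales
    (auto simp: additive_ftor_def is_ftor_def left_ftor_def onobj_closed onmor_idt D.idt_closed onmor_closed
      onmor_hom_left onmor_cmp[where Y = Y and Y' = Y and Y'' = Y and g = "idt D Y" and g' = "idt D Y", simplified D.idt_left D.idt_closed] D.idt_left)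

lemma right_ftor: "X \<in> obj C \<Longrightarrow> add_ftor D E (right_ftor X)"
  by unfold_locales
    (auto simp: additive_ftor_def is_ftor_def right_ftor_def onobj_closed onmor_idt C.idt_closed onmor_closed
      onmor_hom_right onmor_cmp[where X = X and X' = X and X'' = X and f = "idt C X" and f' = "idt C X", simplified C.idt_left C.idt_closed] C.idt_left)

lemma zero_left: "zero_obj C X \<Longrightarrow> Y \<in> obj D \<Longrightarrow> zero_obj E (onobj F (X, Y))"
  using add_ftor.ftor_zero[OF left_ftor] by (simp add: left_ftor_def)

lemma zero_right: "X \<in> obj C \<Longrightarrow> zero_obj D Y \<Longrightarrow> zero_obj E (onobj F (X, Y))"
  using add_ftor.ftor_zero[OF right_ftor] by (simp add: right_ftor_def)

lemma bobj_spn_left: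
  assumes "p \<in> spn (K0_rels C)" "Poly_Mapping.keys q \<subseteq> obj D"
  shows "bobj F p q \<in> spn (K0_rels E)"
  unfolding bobj_swap
proof (rule frag_extend_pointwise_spn[OF assms(2)])
  fix b assume "b \<in> obj D"
  from add_ftor.fobj_spn[OF left_ftor[OF this] assms(1)]
  show "frag_extend (\<lambda>a. frag_of (onobj F (a, b))) p \<in> spn (K0_rels E)"
    by (simp add: fobj_def left_ftor_def)
qed

lemma bobj_spn_right:
  assumes "q \<in> spn (K0_rels D)" "Poly_Mapping.keys p \<subseteq> obj C"
  shows "bobj F p q \<in> spn (K0_rels E)"
  unfolding bobj_def
proof (rule frag_extend_pointwise_spn[OF assms(2)])
  fix a assume "a \<in> obj C"
  from add_ftor.fobj_spn[OF right_ftor[OF this] assms(1)]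
  show "frag_extend (\<lambda>b. frag_of (onobj F (a, b))) q \<in> spn (K0_rels E)"
    by (simp add: fobj_def right_ftor_def)
qed

lemma keys_bobj:
  "Poly_Mapping.keys p \<subseteq> obj C \<Longrightarrow> Poly_Mapping.keys q \<subseteq> obj D \<Longrightarrow> Poly_Mapping.keys (bobj F p q) \<subseteq> obj E"
  unfolding bobj_def by (erule keys_frag_extend_subset, erule keys_frag_extend_subset) (simp add: onobj_closed)

text \<open>Relations are supported on objects, so a class with one representative made of objects
  has only such representatives; the unions in \<open>K0_bimap\<close> meet nothing else.\<close>

lemma keys_cong: "Poly_Mapping.keys p \<subseteq> obj D \<Longrightarrow> q - p \<in> spn (K0_rels D) \<Longrightarrow> Poly_Mapping.keys q \<subseteq> obj D"
  using keys_K0_spn[of "q - p"] keys_add[of "q - p" p] by auto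

lemma bobj_cong:
  assumes "p - p' \<in> spn (K0_rels C)" "q - q' \<in> spn (K0_rels D)"
    "Poly_Mapping.keys p' \<subseteq> obj C" "Poly_Mapping.keys q' \<subseteq> obj D"
  shows "bobj F p q - bobj F p' q' \<in> spn (K0_rels E)"
proof -
  have "bobj F (p - p') q + bobj F p' (q - q') \<in> spn (K0_rels E)"
    by (rule spn_add[OF bobj_spn_left[OF assms(1) keys_cong[OF assms(4,2)]]
          bobj_spn_right[OF assms(2,3)]])
  then show ?thesis by simp
qed

lemma K0_bimap_cls:
  assumes "Poly_Mapping.keys p \<subseteq> obj C" "Poly_Mapping.keys q \<subseteq> obj D"
  shows "K0_bimap E F (cls (K0_rels C) p) (cls (K0_rels D) q) = cls (K0_rels E) (bobj F p q)"
  unfolding K0_bimap_def K0_class_eq bobj_def[symmetric]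
proof (intro UN_cls_const)
  fix x y assume "x \<in> cls (K0_rels C) p" "y \<in> cls (K0_rels D) q"
  then show "cls (K0_rels E) (bobj F x y) = cls (K0_rels E) (bobj F p q)"
    using bobj_cong assms by (simp add: cls_eq_iff in_cls_iff)
qed (use self_in_cls in blast)+

lemma K0_bimap_closed: "X \<in> carrier (K0 C) \<Longrightarrow> Y \<in> carrier (K0 D) \<Longrightarrow> K0_bimap E F X Y \<in> carrier (K0 E)"
  by (elim K0_E) (simp add: K0_bimap_cls cls_in_K0 keys_bobj)

lemma K0_bimap_mult_left: "X \<in> carrier (K0 C) \<Longrightarrow> X' \<in> carrier (K0 C) \<Longrightarrow> Y \<in> carrier (K0 D)
    \<Longrightarrow> K0_bimap E F (X \<otimes>\<^bsub>K0 C\<^esub> X') Y = K0_bimap E F X Y \<otimes>\<^bsub>K0 E\<^esub> K0_bimap E F X' Y"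
  by (elim K0_E) (simp add: K0_bimap_cls mult_K0 order_trans[OF keys_add])

lemma K0_bimap_mult_right: "X \<in> carrier (K0 C) \<Longrightarrow> Y \<in> carrier (K0 D) \<Longrightarrow> Y' \<in> carrier (K0 D)
    \<Longrightarrow> K0_bimap E F X (Y \<otimes>\<^bsub>K0 D\<^esub> Y') = K0_bimap E F X Y \<otimes>\<^bsub>K0 E\<^esub> K0_bimap E F X Y'"
  by (elim K0_E) (simp add: K0_bimap_cls mult_K0 order_trans[OF keys_add])

end

section \<open>The category of graded copies and its Grothendieck group\<close>

section \<open>Graded copies of a category\<close>

lemma copies_sel:
  "obj (copies C) = {L. (\<forall>n. L n \<in> obj C) \<and> finite {n. \<not> zero_obj C (L n)}}"
  "carrier (Hom (copies C) L M) = {f. \<forall>n. f n \<in> carrier (Hom C (L n) (M n))}"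
  "f \<otimes>\<^bsub>Hom (copies C) L M\<^esub> g = (\<lambda>n. f n \<otimes>\<^bsub>Hom C (L n) (M n)\<^esub> g n)"
  "\<one>\<^bsub>Hom (copies C) L M\<^esub> = (\<lambda>n. \<one>\<^bsub>Hom C (L n) (M n)\<^esub>)"
  "idt (copies C) L = (\<lambda>n. idt C (L n))"
  "cmp (copies C) L M N g' f' = (\<lambda>n. cmp C (L n) (M n) (N n) (g' n) (f' n))"
  by (simp_all add: copies_def)

context preadd
begin

lemma copies_obj: "L \<in> obj (copies C) \<Longrightarrow> L n \<in> obj C"
  by (simp add: copies_sel)

lemma comm_group_Hom_copies:
  assumes "L \<in> obj (copies C)" "M \<in> obj (copies C)"
  shows "comm_group (Hom (copies C) L M)"
proof -
  have G: "comm_group (Hom C (L n) (M n))" for n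
    using assms copies_obj hom_group by blast
  note m = comm_group.axioms(1)[OF G] comm_group.axioms(2)[OF G] comm_monoid.axioms(1)[OF comm_group.axioms(1)[OF G]]
  show ?thesis
  proof (rule comm_groupI)
    fix x assume x: "x \<in> carrier (Hom (copies C) L M)"
    show "\<exists>y\<in>carrier (Hom (copies C) L M). y \<otimes>\<^bsub>Hom (copies C) L M\<^esub> x = \<one>\<^bsub>Hom (copies C) L M\<^esub>"
      by (rule bexI[of _ "\<lambda>n. inv\<^bsub>Hom C (L n) (M n)\<^esub> x n"])
        (use x in \<open>auto simp: copies_sel group.l_inv[OF m(2)] intro: group.inv_closed[OF m(2)]\<close>)
  qed (auto simp: copies_sel fun_eq_iff intro: monoid.m_closed[OF m(3)] monoid.one_closed[OF m(3)]
      monoid.m_assoc[OF m(3)] comm_monoid.m_comm[OF m(1)] monoid.l_one[OF m(3)])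
qed

lemma copies_preadd: "preadd (copies C)"
  unfolding preadd_def preadditive_def
  by (intro conjI ballI comm_group_Hom_copies)
    (auto simp: copies_sel fun_eq_iff idt_closed cmp_closed idt_left idt_right assoc cmp_mult_right cmp_mult_left)

interpretation copies: preadd "copies C"
  by (rule copies_preadd)

lemma zero_obj_copies: "zero_obj (copies C) L \<longleftrightarrow> (\<forall>n. zero_obj C (L n))"
  unfolding copies.zero_obj_iff zero_obj_iff by (auto simp: copies_sel fun_eq_iff zero_obj_iff)

text \<open>Evaluation at \<open>n\<close> is a homomorphism of morphism groups, and homomorphisms
  commute with finite products.\<close>

lemma finprod_copies:
  assumes "L \<in> obj (copies C)" "M \<in> obj (copies C)" "\<And>j. j \<in> J \<Longrightarrow> f j \<in> carrier (Hom (copies C) L M)"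
  shows "finprod (Hom (copies C) L M) f J n = finprod (Hom C (L n) (M n)) (\<lambda>j. f j n) J"
  by (rule hom_finprod[where h = "\<lambda>f. f n"])
    (use assms in \<open>auto intro!: comm_group_Hom_copies hom_group homI simp: copies_sel\<close>)

lemma copies_biproductI:
  assumes "finite J" "\<And>j. j \<in> J \<Longrightarrow> X j \<in> obj (copies C)" "Z \<in> obj (copies C)"
    and b: "\<And>n. is_biproduct C J (\<lambda>j. X j n) (Z n) (\<lambda>j. \<iota> j n) (\<lambda>j. \<pi> j n)"
  shows "is_biproduct (copies C) J X Z \<iota> \<pi>"
proof -
  note m = bip_in[OF b] bip_pr[OF b] bip_X[OF b] bip_Z[OF b]
  have "finprod (Hom (copies C) Z Z) (\<lambda>j. cmp (copies C) Z (X j) Z (\<iota> j) (\<pi> j)) J = idt (copies C) Z"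
  proof
    fix n
    have "finprod (Hom (copies C) Z Z) (\<lambda>j. cmp (copies C) Z (X j) Z (\<iota> j) (\<pi> j)) J n
      = finprod (Hom C (Z n) (Z n)) (\<lambda>j. cmp (copies C) Z (X j) Z (\<iota> j) (\<pi> j) n) J"
      by (rule finprod_copies) (use assms m in \<open>auto simp: copies_sel intro!: cmp_closed\<close>)
    then show "finprod (Hom (copies C) Z Z) (\<lambda>j. cmp (copies C) Z (X j) Z (\<iota> j) (\<pi> j)) J n = idt (copies C) Z n"
      using bip_sum[OF b] by (simp add: copies_sel)
  qed
  then show ?thesis
    unfolding is_biproduct_def using assms m bip_idt[OF b] bip_one[OF b] by (auto simp: copies_sel)
qed

end

context additive_cat
begin

text \<open>Guarantees that a biproduct of two families is again zero in almost all degrees, as the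
  objects of \<open>copies C\<close> must be.\<close>

lemma biproduct_zero:
  assumes "is_biproduct C UNIV (case_bool X Y) Z \<iota> \<pi>" "zero_obj C X" "zero_obj C Y"
  shows "zero_obj C Z"
proof -
  note c = bip_X[OF assms(1), of True, simplified] bip_X[OF assms(1), of False, simplified] bip_Z[OF assms(1)]
    bip_in[OF assms(1)] bip_pr[OF assms(1)]
  have "cmp C Z (case b of True \<Rightarrow> X | False \<Rightarrow> Y) Z (\<iota> b) (\<pi> b) = \<one>\<^bsub>Hom C Z Z\<^esub>" for b
  proof -
    have z: "zero_obj C (case b of True \<Rightarrow> X | False \<Rightarrow> Y)" using assms by (cases b) auto
    have "\<pi> b = \<one>\<^bsub>Hom C Z (case b of True \<Rightarrow> X | False \<Rightarrow> Y)\<^esub>"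
      by (rule zero_hom_to[OF z c(3)]) (use c(5) in simp)
    then show ?thesis
      using cmp_one_right[of Z "case b of True \<Rightarrow> X | False \<Rightarrow> Y" Z "\<iota> b"] c(3,4) zero_obj_obj[OF z] by simp
  qed
  then have "idt C Z = \<one>\<^bsub>Hom C Z Z\<^esub>"
    unfolding bip_sum[OF assms(1), symmetric] by (intro comm_monoid.finprod_one_eqI hom_monoid c(3)) auto
  then show ?thesis using c(3) zero_obj_iff by blast
qed

lemma copies_additive: "additive_cat (copies C)"
proof (intro additive_cat.intro additive_cat_axioms.intro copies_preadd)
  obtain z where "zero_obj C z" using zero_ex by blast
  then show "\<exists>Z. zero_obj (copies C) Z" by (auto simp: zero_obj_copies intro!: exI[of _ "\<lambda>_. z"])
next
  fix X Y assume XY: "X \<in> obj (copies C)" "Y \<in> obj (copies C)"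
  have "\<forall>n. \<exists>Z \<iota> \<pi>. is_biproduct C UNIV (case_bool (X n) (Y n)) Z \<iota> \<pi>"
    using XY bip_ex copies_obj by blast
  then obtain Z \<iota> \<pi> where b: "\<And>n. is_biproduct C UNIV (case_bool (X n) (Y n)) (Z n) (\<iota> n) (\<pi> n)"
    by metis
  have e: "(\<lambda>j. (case j of True \<Rightarrow> X | False \<Rightarrow> Y) n) = case_bool (X n) (Y n)" for n
    by (auto split: bool.split)
  have "{n. \<not> zero_obj C (Z n)} \<subseteq> {n. \<not> zero_obj C (X n)} \<union> {n. \<not> zero_obj C (Y n)}"
    using biproduct_zero[OF b] by auto
  then have Z: "Z \<in> obj (copies C)"
    using XY bip_Z[OF b] by (auto simp: copies_sel intro: finite_subset)
  have "is_biproduct (copies C) UNIV (case_bool X Y) Z (\<lambda>j n. \<iota> n j) (\<lambda>j n. \<pi> n j)"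
    by (rule copies_biproductI) (use XY Z b in \<open>auto simp: e split: bool.split\<close>)
  then show "\<exists>Z \<iota> \<pi>. is_biproduct (copies C) UNIV (case_bool X Y) Z \<iota> \<pi>" by blast
qed

end

subsection \<open>Functors between copies\<close>

context preadd
begin

lemma shift_add_ftor: "add_ftor (copies C) (copies C) (shift s)"
proof (intro add_ftor.intro add_ftor_axioms.intro copies_preadd)
  have "L \<in> obj (copies C) \<Longrightarrow> (\<lambda>n. L (n - s)) \<in> obj (copies C)" for L
  proof -
    assume L: "L \<in> obj (copies C)"
    have "{n. \<not> zero_obj C (L (n - s))} = (\<lambda>n. n + s) ` {n. \<not> zero_obj C (L n)}"
      by (auto simp: image_iff intro!: exI[of _ "_ - s"])
    then show ?thesis using L by (auto simp: copies_sel)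
  qed
  then show "additive_ftor (copies C) (copies C) (shift s)"
    unfolding additive_ftor_def is_ftor_def shift_def
    by (intro conjI ballI homI) (auto simp: copies_sel)
qed

lemma copy_proj_add_ftor: "add_ftor (copies C) C (copy_proj n)"
  by (intro add_ftor.intro add_ftor_axioms.intro copies_preadd preadd_axioms) (auto simp: additive_ftor_def is_ftor_def copy_proj_def copies_sel intro!: homI)

end

lemma (in add_ftor) ftor_copies_add_ftor: "add_ftor (copies C) (copies D) (ftor_copies F)"
proof (intro add_ftor.intro add_ftor_axioms.intro C.copies_preadd D.copies_preadd)
  have o: "(\<lambda>n. onobj F (L n)) \<in> obj (copies D)" if "L \<in> obj (copies C)" for L
  proof -
    have "{n. \<not> zero_obj D (onobj F (L n))} \<subseteq> {n. \<not> zero_obj C (L n)}" using ftor_zero by blast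
    then show ?thesis using that onobj_closed by (auto simp: copies_sel intro: finite_subset)
  qed
  have m: "onmor F X Y (f \<otimes>\<^bsub>Hom C X Y\<^esub> g) = onmor F X Y f \<otimes>\<^bsub>Hom D (onobj F X) (onobj F Y)\<^esub> onmor F X Y g"
    if "X \<in> obj C" "Y \<in> obj C" "f \<in> carrier (Hom C X Y)" "g \<in> carrier (Hom C X Y)" for X Y f g
    using hom_mult[OF onmor_hom] that by blast
  show "additive_ftor (copies C) (copies D) (ftor_copies F)"
    unfolding additive_ftor_def is_ftor_def ftor_copies_def
    by (intro conjI ballI homI)
      (use o in \<open>auto simp: copies_sel fun_eq_iff onmor_idt onmor_closed onmor_cmp m\<close>)
qed

lemma hom_comp: "h \<in> hom G H \<Longrightarrow> g \<in> hom H K \<Longrightarrow> (\<lambda>x. g (h x)) \<in> hom G K"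
  by (rule homI) (simp_all add: hom_in_carrier hom_mult)

lemma ftor_comp_add_ftor:
  assumes "add_ftor C D F" "add_ftor D E G"
  shows "add_ftor C E (ftor_comp G F)"
proof -
  interpret F: add_ftor C D F by fact
  interpret G: add_ftor D E G by fact
  have "(\<lambda>f. onmor G (onobj F X) (onobj F Y) (onmor F X Y f)) \<in> hom (Hom C X Y) (Hom E (onobj G (onobj F X)) (onobj G (onobj F Y)))"
    if "X \<in> obj C" "Y \<in> obj C" for X Y
    using that by (intro hom_comp[OF F.onmor_hom G.onmor_hom] F.onobj_closed)
  then show ?thesis
    by unfold_locales (simp add: additive_ftor_def is_ftor_def ftor_comp_def F.onobj_closed G.onobj_closed F.onmor_idt G.onmor_idt
      F.onmor_closed G.onmor_closed F.onmor_cmp G.onmor_cmp)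
qed

lemma ftor_comp_biadd_ftor:
  assumes "biadd_ftor C D E F" "add_ftor E E' G"
  shows "biadd_ftor C D E' (ftor_comp G F)"
proof -
  interpret F: biadd_ftor C D E F by fact
  interpret G: add_ftor E E' G by fact
  have comp: "(\<lambda>f. onmor G Z Z' (h f)) \<in> hom K (Hom E' (onobj G Z) (onobj G Z'))"
    if "h \<in> hom K (Hom E Z Z')" "Z \<in> obj E" "Z' \<in> obj E" for h Z Z' and K :: "'z monoid"
    using that by (intro hom_comp[OF _ G.onmor_hom])
  show ?thesis
  proof unfold_locales
    have "is_ftor (prod_cat C D) E' (ftor_comp G F)"
      unfolding is_ftor_def prod_cat_def ftor_comp_def
      by (auto simp: DirProd_def F.onobj_closed G.onobj_closed F.onmor_idt G.onmor_idt
          F.onmor_closed G.onmor_closed F.onmor_cmp G.onmor_cmp)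
    then show "biadditive_ftor C D E' (ftor_comp G F)"
      unfolding biadditive_ftor_def
      by (auto simp: ftor_comp_def intro!: comp F.onmor_hom_left F.onmor_hom_right F.onobj_closed)
  qed
qed

lemma fobj_comp: "fobj (ftor_comp G F) p = fobj G (fobj F p)"
  by (induction p rule: frag_induct) (auto simp: ftor_comp_def)

lemma bobj_comp: "bobj (ftor_comp G F) p q = fobj G (bobj F p q)"
proof (induction p rule: frag_induct)
  case (one a)
  show ?case by (induction q rule: frag_induct) (auto simp: ftor_comp_def)
qed auto

subsection \<open>The Grothendieck group of the copies\<close>

definition zro :: "('o, 'm) cat \<Rightarrow> 'o" where
  "zro C = (SOME Z. zero_obj C Z)"

text \<open>Outside degree \<open>n\<close> the morphism is the identity of a zero object; it is
  also the zero morphism there, so the assignment respects both composition and addition.\<close>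

definition insert_copy :: "('o, 'm) cat \<Rightarrow> int \<Rightarrow> ('o, 'm, int \<Rightarrow> 'o, int \<Rightarrow> 'm) ftor" where
  "insert_copy C n = \<lparr>onobj = (\<lambda>X m. if m = n then X else zro C),
     onmor = (\<lambda>X Y f m. if m = n then f else idt C (zro C))\<rparr>"

text \<open>The argument \<open>C\<close> only fixes the type of morphisms, which \<open>copy_proj\<close> alone leaves undetermined.\<close>

abbreviation cproj :: "('o, 'm) cat \<Rightarrow> int \<Rightarrow> (int \<Rightarrow> 'o, int \<Rightarrow> 'm, 'o, 'm) ftor" where
  "cproj C n \<equiv> copy_proj n"

abbreviation gr_proj :: "('o, 'm) cat \<Rightarrow> int \<Rightarrow> ((int \<Rightarrow> 'o) \<Rightarrow>\<^sub>0 int) set \<Rightarrow> ('o \<Rightarrow>\<^sub>0 int) set" where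
  "gr_proj C n \<equiv> K0_map C (cproj C n)"

abbreviation gr_incl :: "('o, 'm) cat \<Rightarrow> int \<Rightarrow> ('o \<Rightarrow>\<^sub>0 int) set \<Rightarrow> ((int \<Rightarrow> 'o) \<Rightarrow>\<^sub>0 int) set" where
  "gr_incl C n \<equiv> K0_map (copies C) (insert_copy C n)"

text \<open>The situation in one fixed degree \<open>m\<close> when a family is written as the sum
  of its components: at most one summand is nonzero. If \<open>m\<close> lies outside
  \<open>N\<close>, then \<open>Z\<close> itself is zero.\<close>

lemma (in preadd) trivial_biproduct:
  assumes "finite N" "Z \<in> obj C" "m \<in> N \<or> zero_obj C Z" "m \<in> N \<Longrightarrow> X m = Z"
    and z: "\<And>n. n \<in> N \<Longrightarrow> n \<noteq> m \<Longrightarrow> zero_obj C (X n)"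
  shows "is_biproduct C N X Z (\<lambda>n. if n = m then idt C Z else \<one>\<^bsub>Hom C (X n) Z\<^esub>)
    (\<lambda>n. if n = m then idt C Z else \<one>\<^bsub>Hom C Z (X n)\<^esub>)"
proof -
  have X: "X n \<in> obj C" if "n \<in> N" for n using that assms zero_obj_obj by (cases "n = m") auto
  have "finprod (Hom C Z Z) (\<lambda>j. cmp C Z (X j) Z (if j = m then idt C Z else \<one>\<^bsub>Hom C (X j) Z\<^esub>)
      (if j = m then idt C Z else \<one>\<^bsub>Hom C Z (X j)\<^esub>)) N
    = finprod (Hom C Z Z) (\<lambda>j. if j = m then idt C Z else \<one>\<^bsub>Hom C Z Z\<^esub>) N"
    by (rule finprod_hom_cong)
      (use assms X idt_closed one_closed cmp_one_right[OF _ _ _ one_closed] in \<open>auto simp: idt_left\<close>)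
  also have "\<dots> = (if m \<in> N then idt C Z else \<one>\<^bsub>Hom C Z Z\<^esub>)"
    by (rule comm_monoid.finprod_delta) (use assms idt_closed hom_monoid in auto)
  also have "\<dots> = idt C Z" using assms(3) zero_obj_iff by auto
  finally have s: "finprod (Hom C Z Z) (\<lambda>j. cmp C Z (X j) Z (if j = m then idt C Z else \<one>\<^bsub>Hom C (X j) Z\<^esub>)
      (if j = m then idt C Z else \<one>\<^bsub>Hom C Z (X j)\<^esub>)) N = idt C Z" .
  show ?thesis
    unfolding is_biproduct_def
  proof (intro conjI ballI impI)
    fix j k assume jk: "j \<in> N" "k \<in> N" "j \<noteq> k"
    then have zz: "zero_obj C (X j) \<or> zero_obj C (X k)" using z by metis
    have "cmp C (X j) Z (X k) (if k = m then idt C Z else \<one>\<^bsub>Hom C Z (X k)\<^esub>) (if j = m then idt C Z else \<one>\<^bsub>Hom C (X j) Z\<^esub>)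
      \<in> carrier (Hom C (X j) (X k))"
      using jk assms X idt_closed one_closed by (auto intro!: cmp_closed)
    then show "cmp C (X j) Z (X k) (if k = m then idt C Z else \<one>\<^bsub>Hom C Z (X k)\<^esub>) (if j = m then idt C Z else \<one>\<^bsub>Hom C (X j) Z\<^esub>)
      = \<one>\<^bsub>Hom C (X j) (X k)\<^esub>"
      using zz zero_hom_to zero_hom_from X jk by metis
  next
    fix j assume j: "j \<in> N"
    show "cmp C (X j) Z (X j) (if j = m then idt C Z else \<one>\<^bsub>Hom C Z (X j)\<^esub>) (if j = m then idt C Z else \<one>\<^bsub>Hom C (X j) Z\<^esub>)
      = idt C (X j)"
    proof (cases "j = m")
      case True
      then show ?thesis using j assms idt_closed by (simp add: idt_left)
    next
      case False
      then have "zero_obj C (X j)" using z j by blast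
      then show ?thesis using False j X assms(2) cmp_one_right[OF _ _ _ one_closed] by (simp add: zero_obj_iff)
    qed
  qed (use assms X s idt_closed one_closed in auto)
qed

context additive_cat
begin

interpretation copies: additive_cat "copies C"
  by (rule copies_additive)

lemma zro: "zero_obj C (zro C)"
  unfolding zro_def using zero_ex by (rule someI_ex)

lemma insert_copy_obj: "X \<in> obj C \<Longrightarrow> onobj (insert_copy C n) X \<in> obj (copies C)"
proof -
  assume "X \<in> obj C"
  moreover have "finite {m. \<not> zero_obj C (if m = n then X else zro C)}"
    by (rule finite_subset[of _ "{n}"]) (use zro in auto)
  ultimately show ?thesis
    using zero_obj_obj[OF zro] by (simp add: insert_copy_def copies_sel)
qed

lemma insert_copy_add_ftor: "add_ftor C (copies C) (insert_copy C n)"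
proof unfold_locales
  have z: "zro C \<in> obj C" "idt C (zro C) = \<one>\<^bsub>Hom C (zro C) (zro C)\<^esub>" using zro zero_obj_iff by auto
  have z2: "idt C (zro C) \<otimes>\<^bsub>Hom C (zro C) (zro C)\<^esub> idt C (zro C) = idt C (zro C)"
    using z monoid.r_one[OF group.is_monoid[OF hom_grp]] one_closed by simp
  show "additive_ftor C (copies C) (insert_copy C n)"
    unfolding additive_ftor_def is_ftor_def
    by (intro conjI ballI homI insert_copy_obj)
      (use z(1) in \<open>auto simp: insert_copy_def copies_sel fun_eq_iff idt_closed idt_left z2\<close>)
qed

lemma biproduct_copies_insert:
  assumes L: "L \<in> obj (copies C)" and N: "finite N" "{n. \<not> zero_obj C (L n)} \<subseteq> N"
  shows "frag_of L - (\<Sum>n\<in>N. frag_of (onobj (insert_copy C n) (L n))) \<in> spn (K0_rels (copies C))"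
proof (rule copies.K0_biproduct, rule copies_biproductI)
  fix m
  show "is_biproduct C N (\<lambda>n. onobj (insert_copy C n) (L n) m) (L m)
      (\<lambda>n. if n = m then idt C (L m) else \<one>\<^bsub>Hom C (onobj (insert_copy C n) (L n) m) (L m)\<^esub>)
      (\<lambda>n. if n = m then idt C (L m) else \<one>\<^bsub>Hom C (L m) (onobj (insert_copy C n) (L n) m)\<^esub>)"
    by (rule trivial_biproduct) (use L N zro copies_obj in \<open>auto simp: insert_copy_def\<close>)
qed (use L N copies_obj insert_copy_obj in auto)

lemma proj_insert_same: "fobj (cproj C n) (fobj (insert_copy C n) p) = p"
  by (induction p rule: frag_induct) (auto simp: copy_proj_def insert_copy_def)

lemma proj_insert_diff: "m \<noteq> n \<Longrightarrow> fobj (cproj C m) (fobj (insert_copy C n) p) \<in> spn (K0_rels C)"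
  by (induction p rule: frag_induct)
    (auto simp: copy_proj_def insert_copy_def spn_zero intro: spn_diff K0_zero zro)

text \<open>Stated for all large enough index sets, since a formal difference needs a common index
  set for both parts.\<close>

lemma K0_copies_decomp:
  assumes "Poly_Mapping.keys p \<subseteq> obj (copies C)"
  shows "\<exists>N. finite N \<and> (\<forall>N'. finite N' \<longrightarrow> N \<subseteq> N' \<longrightarrow>
    p - (\<Sum>n\<in>N'. fobj (insert_copy C n) (fobj (cproj C n) p)) \<in> spn (K0_rels (copies C)))"
  using assms
proof (rule free_Abelian_group_induct)
  fix x y :: "(int \<Rightarrow> 'o) \<Rightarrow>\<^sub>0 int"
  assume "\<exists>N. finite N \<and> (\<forall>N'. finite N' \<longrightarrow> N \<subseteq> N' \<longrightarrow>
      x - (\<Sum>n\<in>N'. fobj (insert_copy C n) (fobj (cproj C n) x)) \<in> spn (K0_rels (copies C)))"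
    and "\<exists>N. finite N \<and> (\<forall>N'. finite N' \<longrightarrow> N \<subseteq> N' \<longrightarrow>
      y - (\<Sum>n\<in>N'. fobj (insert_copy C n) (fobj (cproj C n) y)) \<in> spn (K0_rels (copies C)))"
  then obtain N M where N: "finite N" "\<And>N'. finite N' \<Longrightarrow> N \<subseteq> N' \<Longrightarrow>
      x - (\<Sum>n\<in>N'. fobj (insert_copy C n) (fobj (cproj C n) x)) \<in> spn (K0_rels (copies C))"
    and M: "finite M" "\<And>N'. finite N' \<Longrightarrow> M \<subseteq> N' \<Longrightarrow>
      y - (\<Sum>n\<in>N'. fobj (insert_copy C n) (fobj (cproj C n) y)) \<in> spn (K0_rels (copies C))" by blast
  show "\<exists>N. finite N \<and> (\<forall>N'. finite N' \<longrightarrow> N \<subseteq> N' \<longrightarrow>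
      (x - y) - (\<Sum>n\<in>N'. fobj (insert_copy C n) (fobj (cproj C n) (x - y))) \<in> spn (K0_rels (copies C)))"
  proof (intro exI[of _ "N \<union> M"] conjI allI impI)
    fix N' assume "finite N'" "N \<union> M \<subseteq> N'"
    then have "x - (\<Sum>n\<in>N'. fobj (insert_copy C n) (fobj (cproj C n) x))
      - (y - (\<Sum>n\<in>N'. fobj (insert_copy C n) (fobj (cproj C n) y))) \<in> spn (K0_rels (copies C))"
      by (intro spn_diff N(2) M(2)) auto
    then show "(x - y) - (\<Sum>n\<in>N'. fobj (insert_copy C n) (fobj (cproj C n) (x - y))) \<in> spn (K0_rels (copies C))"
      by (simp add: sum_subtractf algebra_simps)
  qed (use N M in simp)
next
  fix L assume L: "L \<in> obj (copies C)"
  show "\<exists>N. finite N \<and> (\<forall>N'. finite N' \<longrightarrow> N \<subseteq> N' \<longrightarrow>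
      frag_of L - (\<Sum>n\<in>N'. fobj (insert_copy C n) (fobj (cproj C n) (frag_of L))) \<in> spn (K0_rels (copies C)))"
    by (rule exI[of _ "{n. \<not> zero_obj C (L n)}"])
      (use L biproduct_copies_insert[OF L] in \<open>auto simp: copy_proj_def copies_sel(1)\<close>)
qed (auto simp: spn_zero intro!: exI[of _ "{}"])

text \<open>The graded pieces detect zero, because a class is the sum of its own pieces by the
  decomposition.\<close>

lemma K0_copies_zeroI:
  assumes "Poly_Mapping.keys p \<subseteq> obj (copies C)" and "\<And>n. fobj (cproj C n) p \<in> spn (K0_rels C)"
  shows "p \<in> spn (K0_rels (copies C))"
proof -
  obtain N where N: "finite N" "p - (\<Sum>n\<in>N. fobj (insert_copy C n) (fobj (cproj C n) p)) \<in> spn (K0_rels (copies C))"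
    using K0_copies_decomp[OF assms(1)] by blast
  have "(\<Sum>n\<in>N. fobj (insert_copy C n) (fobj (cproj C n) p)) \<in> spn (K0_rels (copies C))"
    by (intro spn_sum add_ftor.fobj_spn[OF insert_copy_add_ftor] assms)
  then show ?thesis by (rule spn_diff_mem[OF N(2)])
qed

lemma gr_proj_closed: "X \<in> carrier (K0 (copies C)) \<Longrightarrow> gr_proj C n X \<in> carrier (K0 C)"
  by (rule add_ftor.K0_map_closed[OF copy_proj_add_ftor])

lemma gr_incl_closed: "x \<in> carrier (K0 C) \<Longrightarrow> gr_incl C n x \<in> carrier (K0 (copies C))"
  by (rule add_ftor.K0_map_closed[OF insert_copy_add_ftor])

lemmas gr_proj_cls = add_ftor.K0_map_cls[OF copy_proj_add_ftor]
lemmas gr_incl_cls = add_ftor.K0_map_cls[OF insert_copy_add_ftor]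
lemmas gr_proj_mult = add_ftor.K0_map_mult[OF copy_proj_add_ftor]
lemmas gr_incl_mult = add_ftor.K0_map_mult[OF insert_copy_add_ftor]

lemma gr_proj_one: "gr_proj C n \<one>\<^bsub>K0 (copies C)\<^esub> = \<one>\<^bsub>K0 C\<^esub>"
  by (simp add: one_K0 gr_proj_cls)

lemma gr_proj_incl: "x \<in> carrier (K0 C) \<Longrightarrow> gr_proj C m (gr_incl C n x) = (if m = n then x else \<one>\<^bsub>K0 C\<^esub>)"
  by (erule K0_E) (auto simp: gr_proj_cls gr_incl_cls proj_insert_same one_K0 cls_eq_iff intro: proj_insert_diff)

lemma gr_eqI:
  assumes "X \<in> carrier (K0 (copies C))" "Y \<in> carrier (K0 (copies C))" "\<And>n. gr_proj C n X = gr_proj C n Y"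
  shows "X = Y"
proof -
  obtain p q where p: "Poly_Mapping.keys p \<subseteq> obj (copies C)" "X = cls (K0_rels (copies C)) p"
    and q: "Poly_Mapping.keys q \<subseteq> obj (copies C)" "Y = cls (K0_rels (copies C)) q"
    using assms(1,2) K0_E by metis
  have "p - q \<in> spn (K0_rels (copies C))"
    by (rule K0_copies_zeroI) (use p q assms(3) keys_diff[of p q] in \<open>auto simp: gr_proj_cls cls_eq_iff\<close>)
  then show ?thesis using p q by (simp add: cls_eq_iff)
qed

text \<open>Additive statements about the Grothendieck group of the copies are afterwards checked
  only on elements concentrated in one degree.\<close>

lemma gr_induct [consumes 1, case_names incl mult]:
  assumes "X \<in> carrier (K0 (copies C))"
    and "\<And>n x. x \<in> carrier (K0 C) \<Longrightarrow> P (gr_incl C n x)"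
    and "\<And>X Y. X \<in> carrier (K0 (copies C)) \<Longrightarrow> Y \<in> carrier (K0 (copies C)) \<Longrightarrow> P X \<Longrightarrow> P Y \<Longrightarrow> P (X \<otimes>\<^bsub>K0 (copies C)\<^esub> Y)"
  shows "P X"
proof -
  obtain p where p: "Poly_Mapping.keys p \<subseteq> obj (copies C)" "X = cls (K0_rels (copies C)) p"
    using assms(1) K0_E by metis
  obtain N where N: "finite N" "p - (\<Sum>n\<in>N. fobj (insert_copy C n) (fobj (cproj C n) p)) \<in> spn (K0_rels (copies C))"
    using K0_copies_decomp[OF p(1)] by blast
  have k: "Poly_Mapping.keys (fobj (cproj C n) p) \<subseteq> obj C" for n
    using add_ftor.keys_fobj[OF copy_proj_add_ftor p(1)] .
  have g: "P (cls (K0_rels (copies C)) (fobj (insert_copy C n) q))" if "Poly_Mapping.keys q \<subseteq> obj C" for n q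
    using assms(2)[OF cls_in_K0[OF that], of n] by (simp add: gr_incl_cls)
  have c: "cls (K0_rels (copies C)) (fobj (insert_copy C n) q) \<in> carrier (K0 (copies C))" if "Poly_Mapping.keys q \<subseteq> obj C" for n q
    using cls_in_K0[OF add_ftor.keys_fobj[OF insert_copy_add_ftor that]] .
  have "P (cls (K0_rels (copies C)) (\<Sum>n\<in>N'. fobj (insert_copy C n) (fobj (cproj C n) p)))
    \<and> cls (K0_rels (copies C)) (\<Sum>n\<in>N'. fobj (insert_copy C n) (fobj (cproj C n) p)) \<in> carrier (K0 (copies C))" for N'
  proof (induction N' rule: infinite_finite_induct)
    case (insert n N')
    then show ?case
      using assms(3)[OF c[OF k] conjunct2[OF insert.IH] g[OF k] conjunct1[OF insert.IH], of n n]
        monoid.m_closed[OF comm_monoid.axioms(1)[OF comm_group.axioms(1)[OF comm_group_K0]] c[OF k] conjunct2[OF insert.IH], of n n]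
      by (simp add: mult_K0)
  qed (use g[of 0 0] c[of 0 0] in auto)
  moreover have "X = cls (K0_rels (copies C)) (\<Sum>n\<in>N. fobj (insert_copy C n) (fobj (cproj C n) p))"
    using N p by (simp add: cls_eq_iff)
  ultimately show ?thesis by simp
qed

text \<open>Surjectivity onto families of finite support. With \<open>gr_eqI\<close>, elements
  correspond to such families, that is, to Laurent polynomials whose coefficients are
  classes.\<close>

lemma gr_family_ex:
  assumes "finite N" "\<And>n. y n \<in> carrier (K0 C)" "\<And>n. n \<notin> N \<Longrightarrow> y n = \<one>\<^bsub>K0 C\<^esub>"
  shows "\<exists>X\<in>carrier (K0 (copies C)). \<forall>n. gr_proj C n X = y n"
proof -
  have "\<exists>p. Poly_Mapping.keys p \<subseteq> obj C \<and> y n = cls (K0_rels C) p" for n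
    using assms(2)[of n] K0_E by metis
  then obtain p where p: "\<And>n. Poly_Mapping.keys (p n) \<subseteq> obj C" "\<And>n. y n = cls (K0_rels C) (p n)" by metis
  define q where "q = (\<Sum>n\<in>N. fobj (insert_copy C n) (p n))"
  have "Poly_Mapping.keys q \<subseteq> obj (copies C)"
    unfolding q_def using keys_sum[of "\<lambda>n. fobj (insert_copy C n) (p n)" N]
      add_ftor.keys_fobj[OF insert_copy_add_ftor p(1)] by blast
  moreover have d: "fobj (cproj C m) q - (if m \<in> N then p m else 0) \<in> spn (K0_rels C)" for m
  proof -
    have "fobj (cproj C m) q - (if m \<in> N then p m else 0)
      = (\<Sum>n\<in>N. fobj (cproj C m) (fobj (insert_copy C n) (p n)) - (if n = m then p n else 0))"
      using assms(1) by (simp add: q_def fobj_sum sum_subtractf)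
    also have "\<dots> \<in> spn (K0_rels C)"
      by (rule spn_sum) (auto simp: proj_insert_same spn_zero intro: proj_insert_diff)
    finally show ?thesis .
  qed
  have "gr_proj C m (cls (K0_rels (copies C)) q) = y m" for m
    unfolding gr_proj_cls using assms(3)[of m] p(2)[of m] d[of m] by (cases "m \<in> N") (auto simp: cls_eq_iff one_K0 intro: spn_diff)
  ultimately show ?thesis using cls_in_K0 by blast
qed

lemma gr_proj_shift:
  "X \<in> carrier (K0 (copies C)) \<Longrightarrow> gr_proj C n (K0_map (copies C) (shift s :: (int \<Rightarrow> 'o, int \<Rightarrow> 'm, _, int \<Rightarrow> 'm) ftor) X) = gr_proj C (n - s) X"
proof (erule K0_E)
  fix p
  have "fobj (copy_proj n :: (_, int \<Rightarrow> 'm, _, 'm) ftor) (fobj (shift s :: (int \<Rightarrow> 'o, int \<Rightarrow> 'm, _, int \<Rightarrow> 'm) ftor) p)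
     = fobj (copy_proj (n - s) :: (_, int \<Rightarrow> 'm, _, 'm) ftor) p"
    by (induction p rule: frag_induct) (auto simp: copy_proj_def shift_def)
  then show "X = cls (K0_rels (copies C)) p \<Longrightarrow>
    gr_proj C n (K0_map (copies C) (shift s :: (int \<Rightarrow> 'o, int \<Rightarrow> 'm, _, int \<Rightarrow> 'm) ftor) X) = gr_proj C (n - s) X"
    by (simp add: gr_proj_cls add_ftor.K0_map_cls[OF shift_add_ftor])
qed

lemma gr_shift_closed: "X \<in> carrier (K0 (copies C)) \<Longrightarrow>
   K0_map (copies C) (shift s :: (int \<Rightarrow> 'o, int \<Rightarrow> 'm, _, int \<Rightarrow> 'm) ftor) X \<in> carrier (K0 (copies C))"
  by (rule add_ftor.K0_map_closed[OF shift_add_ftor])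

lemma gr_shift_incl: "x \<in> carrier (K0 C) \<Longrightarrow>
   K0_map (copies C) (shift s :: (int \<Rightarrow> 'o, int \<Rightarrow> 'm, _, int \<Rightarrow> 'm) ftor) (gr_incl C n x) = gr_incl C (n + s) x"
  by (rule gr_eqI) (auto simp: gr_shift_closed gr_incl_closed gr_proj_shift gr_proj_incl)

end

lemma K0_map_comp:
  assumes "add_ftor C D F" "add_ftor D E G" "X \<in> carrier (K0 C)"
  shows "K0_map E (ftor_comp G F) X = K0_map E G (K0_map D F X)"
  using assms(3)
  by (rule K0_E) (simp add: add_ftor.K0_map_cls[OF ftor_comp_add_ftor[OF assms(1,2)]]
      add_ftor.K0_map_cls[OF assms(1)] add_ftor.K0_map_cls[OF assms(2)] fobj_comp)

lemma K0_bimap_comp: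
  assumes "biadd_ftor C D E F" "add_ftor E E' G" "X \<in> carrier (K0 C)" "Y \<in> carrier (K0 D)"
  shows "K0_bimap E' (ftor_comp G F) X Y = K0_map E' G (K0_bimap E F X Y)"
proof -
  obtain p q where "Poly_Mapping.keys p \<subseteq> obj C" "X = cls (K0_rels C) p" "Poly_Mapping.keys q \<subseteq> obj D" "Y = cls (K0_rels D) q"
    using assms(3,4) K0_E by metis
  then show ?thesis
    by (simp add: biadd_ftor.K0_bimap_cls[OF ftor_comp_biadd_ftor[OF assms(1,2)]]
      biadd_ftor.K0_bimap_cls[OF assms(1)] add_ftor.K0_map_cls[OF assms(2)] bobj_comp)
qed

text \<open>The two objects may differ, since \<open>F\<close> need not send the chosen zero object
  of \<open>C\<close> to the chosen one of \<open>D\<close>. They agree modulo relations, which is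
  checked one degree at a time.\<close>

lemma gr_ftor_copies_incl:
  assumes "additive_cat C" "additive_cat D" "add_ftor C D F" "x \<in> carrier (K0 C)"
  shows "K0_map (copies D) (ftor_copies F) (gr_incl C n x) = gr_incl D n (K0_map D F x)"
proof -
  interpret C: additive_cat C by fact
  interpret D: additive_cat D by fact
  interpret F: add_ftor C D F by fact
  interpret cF: add_ftor "copies C" "copies D" "ftor_copies F" by (rule F.ftor_copies_add_ftor)
  obtain p where p: "Poly_Mapping.keys p \<subseteq> obj C" "x = cls (K0_rels C) p"
    using assms(4) K0_E by metis
  have "fobj (ftor_copies F) (fobj (insert_copy C n) p) - fobj (insert_copy D n) (fobj F p) \<in> spn (K0_rels (copies D))"
  proof (rule D.K0_copies_zeroI)
    show "Poly_Mapping.keys (fobj (ftor_copies F) (fobj (insert_copy C n) p) - fobj (insert_copy D n) (fobj F p)) \<subseteq> obj (copies D)"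
      using cF.keys_fobj[OF add_ftor.keys_fobj[OF C.insert_copy_add_ftor p(1), of n]]
        add_ftor.keys_fobj[OF D.insert_copy_add_ftor F.keys_fobj[OF p(1)], of n]
      by (intro order_trans[OF keys_diff] Un_least)
    have z: "frag_of (onobj F (zro C)) - frag_of (zro D) \<in> spn (K0_rels D)"
      by (intro spn_diff D.K0_zero F.ftor_zero C.zro D.zro)
    show "fobj (cproj D m) (fobj (ftor_copies F) (fobj (insert_copy C n) p) - fobj (insert_copy D n) (fobj F p)) \<in> spn (K0_rels D)" for m
    proof (induction p rule: frag_induct)
      case (one a)
      then show ?case using z by (auto simp: copy_proj_def ftor_copies_def insert_copy_def spn_zero)
    next
      case (diff a b)
      from spn_diff[OF this] show ?case by (simp add: algebra_simps)
    qed (simp add: spn_zero)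
  qed
  then show ?thesis
    using p by (simp add: C.gr_incl_cls D.gr_incl_cls F.K0_map_cls cF.K0_map_cls cls_eq_iff)
qed

section \<open>The convolution of a biadditive functor over graded copies\<close>

subsection \<open>The convolution functor\<close>

locale conv_ftor = C: additive_cat C + D: additive_cat D + E: additive_cat E + F: biadd_ftor C D E F
  for C :: "('o, 'm) cat" and D :: "('p, 'n) cat" and E :: "('r, 's) cat"
    and F :: "('o \<times> 'p, 'm \<times> 'n, 'r, 's) ftor"
begin

definition cobj :: "(int \<Rightarrow> 'o) \<times> (int \<Rightarrow> 'p) \<Rightarrow> int \<Rightarrow> 'r" where
  "cobj P k = fst (conv_sum C D E F P k)"

definition cin :: "(int \<Rightarrow> 'o) \<times> (int \<Rightarrow> 'p) \<Rightarrow> int \<Rightarrow> int \<Rightarrow> 's" where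
  "cin P k = fst (snd (conv_sum C D E F P k))"

definition cpr :: "(int \<Rightarrow> 'o) \<times> (int \<Rightarrow> 'p) \<Rightarrow> int \<Rightarrow> int \<Rightarrow> 's" where
  "cpr P k = snd (snd (conv_sum C D E F P k))"

abbreviation "J \<equiv> conv_index C D"

abbreviation X :: "(int \<Rightarrow> 'o) \<times> (int \<Rightarrow> 'p) \<Rightarrow> int \<Rightarrow> int \<Rightarrow> 'o \<times> 'p" where
  "X P k n \<equiv> (fst P n, snd P (k - n))"

abbreviation FX :: "(int \<Rightarrow> 'o) \<times> (int \<Rightarrow> 'p) \<Rightarrow> int \<Rightarrow> int \<Rightarrow> 'r" where
  "FX P k n \<equiv> onobj F (X P k n)"

abbreviation m :: "(int \<Rightarrow> 'o) \<times> (int \<Rightarrow> 'p) \<Rightarrow> (int \<Rightarrow> 'o) \<times> (int \<Rightarrow> 'p)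
    \<Rightarrow> (int \<Rightarrow> 'm) \<times> (int \<Rightarrow> 'n) \<Rightarrow> int \<Rightarrow> int \<Rightarrow> 's" where
  "m P P' f k n \<equiv> onmor F (X P k n) (X P' k n) (fst f n, snd f (k - n))"

text \<open>A diagonal entry of the induced morphism between two direct sums; there are no
  off-diagonal entries because morphisms of families preserve the index.\<close>

definition cterm :: "(int \<Rightarrow> 'o) \<times> (int \<Rightarrow> 'p) \<Rightarrow> (int \<Rightarrow> 'o) \<times> (int \<Rightarrow> 'p)
    \<Rightarrow> (int \<Rightarrow> 'm) \<times> (int \<Rightarrow> 'n) \<Rightarrow> int \<Rightarrow> int \<Rightarrow> 's" where
  "cterm P P' f k n = cmp E (cobj P k) (FX P' k n) (cobj P' k) (cin P' k n)
     (cmp E (cobj P k) (FX P k n) (FX P' k n) (m P P' f k n) (cpr P k n))"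

lemma onobj_conv: "onobj (conv C D E F) P = cobj P"
  by (simp add: conv_def cobj_def fun_eq_iff)

lemma onmor_conv: "onmor (conv C D E F) P P' f =
    (\<lambda>k. finprod (Hom E (cobj P k) (cobj P' k)) (cterm P P' f k) (J P k \<inter> J P' k))"
  by (simp add: conv_def cobj_def cin_def cpr_def cterm_def[abs_def] case_prod_beta Let_def fun_eq_iff)

abbreviation ok :: "(int \<Rightarrow> 'o) \<times> (int \<Rightarrow> 'p) \<Rightarrow> bool" where
  "ok P \<equiv> fst P \<in> obj (copies C) \<and> snd P \<in> obj (copies D)"

lemma okD: "ok P \<Longrightarrow> fst P n \<in> obj C" "ok P \<Longrightarrow> snd P n \<in> obj D"
  using C.copies_obj D.copies_obj by blast+

lemma O_closed: "ok P \<Longrightarrow> FX P k n \<in> obj E"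
  by (simp add: F.onobj_closed okD)

lemma finite_J: "ok P \<Longrightarrow> finite (J P k)"
  by (rule finite_subset[of _ "{n. \<not> zero_obj C (fst P n)}"]) (auto simp: conv_index_def copies_sel)

lemma conv_bip: "ok P \<Longrightarrow> is_biproduct E (J P k) (FX P k) (cobj P k) (cin P k) (cpr P k)"
proof -
  assume P: "ok P"
  obtain Z i p where b: "is_biproduct E (J P k) (FX P k) Z i p"
    using E.biproduct_exists[OF finite_J[OF P], where X = "FX P k"] O_closed[OF P] by blast
  have "case conv_sum C D E F P k of (Z, i, p) \<Rightarrow> is_biproduct E (J P k) (FX P k) Z i p"
    unfolding conv_sum_def chosen_biproduct_def
    by (rule someI[of _ "(Z, i, p)"]) (use b in simp)
  then show ?thesis by (simp add: cobj_def cin_def cpr_def case_prod_beta)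
qed

lemma cobj_closed: "ok P \<Longrightarrow> cobj P k \<in> obj E"
  using E.bip_Z[OF conv_bip] .

lemmas cin_closed = E.bip_in[OF conv_bip]
lemmas cpr_closed = E.bip_pr[OF conv_bip]

text \<open>A degree with nonzero sum must be a sum of two indices at which both families are
  nonzero, and there are finitely many such pairs.\<close>

lemma cobj_copies: "ok P \<Longrightarrow> cobj P \<in> obj (copies E)"
proof -
  assume P: "ok P"
  let ?A = "{n. \<not> zero_obj C (fst P n)}" and ?B = "{n. \<not> zero_obj D (snd P n)}"
  have "{k. \<not> zero_obj E (cobj P k)} \<subseteq> (\<lambda>(a, b). a + b) ` (?A \<times> ?B)"
  proof
    fix k assume "k \<in> {k. \<not> zero_obj E (cobj P k)}"
    then have "J P k \<noteq> {}" using conv_bip[OF P, of k] by (auto simp: E.biproduct_empty_iff)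
    then obtain n where "n \<in> ?A" "k - n \<in> ?B" by (auto simp: conv_index_def)
    then show "k \<in> (\<lambda>(a, b). a + b) ` (?A \<times> ?B)" by (intro image_eqI[of _ _ "(n, k - n)"]) auto
  qed
  moreover have "finite ((\<lambda>(a, b). a + b) ` (?A \<times> ?B))" using P by (auto simp: copies_sel)
  ultimately have "finite {k. \<not> zero_obj E (cobj P k)}" by (rule finite_subset)
  then show ?thesis using cobj_closed[OF P] by (simp add: copies_sel)
qed

context
  fixes P P' f
  assumes P: "ok P" and P': "ok P'"
    and f: "fst f \<in> carrier (Hom (copies C) (fst P) (fst P'))" "snd f \<in> carrier (Hom (copies D) (snd P) (snd P'))"
begin

lemma m_closed: "m P P' f k n \<in> carrier (Hom E (FX P k n) (FX P' k n))"
  by (rule F.onmor_closed[OF okD(1)[OF P] okD(2)[OF P] okD(1)[OF P'] okD(2)[OF P']])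
    (use f in \<open>auto simp: copies_sel\<close>)

lemma cmpr_closed: "n \<in> J P k \<Longrightarrow>
    cmp E (cobj P k) (FX P k n) (FX P' k n) (m P P' f k n) (cpr P k n) \<in> carrier (Hom E (cobj P k) (FX P' k n))"
  by (intro E.cmp_closed m_closed cpr_closed P cobj_closed O_closed P')

lemma cterm_closed: "n \<in> J P k \<Longrightarrow> n \<in> J P' k \<Longrightarrow> cterm P P' f k n \<in> carrier (Hom E (cobj P k) (cobj P' k))"
  unfolding cterm_def by (intro E.cmp_closed cmpr_closed cin_closed P cobj_closed O_closed P')

lemma onmor_conv_closed: "onmor (conv C D E F) P P' f k \<in> carrier (Hom E (cobj P k) (cobj P' k))"
  unfolding onmor_conv by (intro E.finprod_hom_closed cobj_closed P P') (auto intro: cterm_closed)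

text \<open>Orthogonality isolates the component at \<open>j\<close>; an index that occurs only in
  the target receives the zero morphism.\<close>

lemma cpr_onmor:
  assumes "j \<in> J P' k"
  shows "cmp E (cobj P k) (cobj P' k) (FX P' k j) (cpr P' k j) (onmor (conv C D E F) P P' f k)
    = (if j \<in> J P k then cmp E (cobj P k) (FX P k j) (FX P' k j) (m P P' f k j) (cpr P k j)
       else \<one>\<^bsub>Hom E (cobj P k) (FX P' k j)\<^esub>)"
proof -
  have "cmp E (cobj P k) (cobj P' k) (FX P' k j) (cpr P' k j) (onmor (conv C D E F) P P' f k)
    = (if j \<in> J P k \<inter> J P' k then cmp E (cobj P k) (FX P k j) (FX P' k j) (m P P' f k j) (cpr P k j)
       else \<one>\<^bsub>Hom E (cobj P k) (FX P' k j)\<^esub>)"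
    unfolding onmor_conv cterm_def
    by (rule E.bip_proj_finprod[OF conv_bip[OF P']]) (use assms cobj_closed[OF P] cmpr_closed in auto)
  then show ?thesis using assms by simp
qed

end

lemma zero_O: "ok P \<Longrightarrow> n \<notin> J P k \<Longrightarrow> zero_obj E (FX P k n)"
  using F.zero_left F.zero_right okD by (auto simp: conv_index_def)

lemma conv_idt:
  assumes P: "ok P"
  shows "onmor (conv C D E F) P P (idt (copies C) (fst P), idt (copies D) (snd P)) = idt (copies E) (cobj P)"
proof
  fix k
  let ?f = "(idt (copies C) (fst P), idt (copies D) (snd P))"
  have "finprod (Hom E (cobj P k) (cobj P k)) (cterm P P ?f k) (J P k)
    = finprod (Hom E (cobj P k) (cobj P k)) (\<lambda>n. cmp E (cobj P k) (FX P k n) (cobj P k) (cin P k n) (cpr P k n)) (J P k)"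
  proof (rule E.finprod_hom_cong)
    fix n assume n: "n \<in> J P k"
    have "m P P ?f k n = idt E (FX P k n)"
      using F.onmor_idt[OF okD(1)[OF P] okD(2)[OF P]] by (simp add: copies_sel)
    then show "cterm P P ?f k n = cmp E (cobj P k) (FX P k n) (cobj P k) (cin P k n) (cpr P k n)"
      unfolding cterm_def using E.idt_left[OF cobj_closed[OF P] O_closed[OF P] cpr_closed[OF P n]] by simp
    show "cmp E (cobj P k) (FX P k n) (cobj P k) (cin P k n) (cpr P k n) \<in> carrier (Hom E (cobj P k) (cobj P k))"
      by (intro E.cmp_closed cobj_closed O_closed cin_closed cpr_closed P n)
  qed (use cobj_closed[OF P] in auto)
  then show "onmor (conv C D E F) P P ?f k = idt (copies E) (cobj P) k"
    using E.bip_sum[OF conv_bip[OF P]] by (simp add: onmor_conv copies_sel)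
qed

text \<open>The obstacle is that the three objects have different index sets. An index absent from
  the middle set contributes a morphism through a zero object, which makes the sums
  comparable.\<close>

lemma conv_cmp:
  assumes P: "ok P" "ok P'" "ok P''"
    and f: "fst f \<in> carrier (Hom (copies C) (fst P) (fst P'))" "snd f \<in> carrier (Hom (copies D) (snd P) (snd P'))"
    and g: "fst g \<in> carrier (Hom (copies C) (fst P') (fst P''))" "snd g \<in> carrier (Hom (copies D) (snd P') (snd P''))"
  shows "onmor (conv C D E F) P P'' (cmp (copies C) (fst P) (fst P') (fst P'') (fst g) (fst f),
      cmp (copies D) (snd P) (snd P') (snd P'') (snd g) (snd f))
    = cmp (copies E) (cobj P) (cobj P') (cobj P'') (onmor (conv C D E F) P' P'' g) (onmor (conv C D E F) P P' f)"
proof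
  fix k
  let ?gf = "(cmp (copies C) (fst P) (fst P') (fst P'') (fst g) (fst f), cmp (copies D) (snd P) (snd P') (snd P'') (snd g) (snd f))"
  note c = cobj_closed[OF P(1), of k] cobj_closed[OF P(2), of k] cobj_closed[OF P(3), of k]
    O_closed[OF P(1), where k = k] O_closed[OF P(2), where k = k] O_closed[OF P(3), where k = k]
  note mf = m_closed[OF P(1,2) f] and mg = m_closed[OF P(2,3) g]
  have gf: "fst ?gf \<in> carrier (Hom (copies C) (fst P) (fst P''))" "snd ?gf \<in> carrier (Hom (copies D) (snd P) (snd P''))"
    using f g okD P by (auto simp: copies_sel intro!: C.cmp_closed D.cmp_closed)
  define s where "s n = cmp E (cobj P k) (FX P'' k n) (cobj P'' k) (cin P'' k n)
    (cmp E (cobj P k) (FX P' k n) (FX P'' k n) (m P' P'' g k n)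
      (cmp E (cobj P k) (FX P k n) (FX P' k n) (m P P' f k n) (cpr P k n)))" for n
  have s: "s n \<in> carrier (Hom E (cobj P k) (cobj P'' k))" if "n \<in> J P k" "n \<in> J P'' k" for n
    unfolding s_def by (intro E.cmp_closed c mf mg cin_closed cpr_closed P that)
  have l: "cterm P P'' ?gf k n = s n" if n: "n \<in> J P k" for n
  proof -
    have "m P P'' ?gf k n = cmp E (FX P k n) (FX P' k n) (FX P'' k n) (m P' P'' g k n) (m P P' f k n)"
      using F.onmor_cmp[OF okD(1)[OF P(1)] okD(2)[OF P(1)] okD(1)[OF P(2)] okD(2)[OF P(2)] okD(1)[OF P(3)] okD(2)[OF P(3)],
          of "fst f n" n n "snd f (k - n)" "k - n" "k - n" "fst g n" n "snd g (k - n)" "k - n"] f g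
      by (simp add: copies_sel)
    then show ?thesis
      unfolding cterm_def s_def
      using E.assoc[OF c(1) c(4)[of n] c(5)[of n] c(6)[of n] cpr_closed[OF P(1) n] mf mg] by simp
  qed
  have r: "cmp E (cobj P k) (cobj P' k) (cobj P'' k) (cterm P' P'' g k n) (onmor (conv C D E F) P P' f k)
    = (if n \<in> J P k then s n else \<one>\<^bsub>Hom E (cobj P k) (cobj P'' k)\<^esub>)" if n: "n \<in> J P' k" "n \<in> J P'' k" for n
  proof -
    note on = onmor_conv_closed[OF P(1,2) f, of k]
    have "cmp E (cobj P k) (cobj P' k) (cobj P'' k) (cterm P' P'' g k n) (onmor (conv C D E F) P P' f k)
      = cmp E (cobj P k) (FX P'' k n) (cobj P'' k) (cin P'' k n)
         (cmp E (cobj P k) (cobj P' k) (FX P'' k n)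
            (cmp E (cobj P' k) (FX P' k n) (FX P'' k n) (m P' P'' g k n) (cpr P' k n)) (onmor (conv C D E F) P P' f k))"
      unfolding cterm_def
      by (rule E.assoc[symmetric]) (use c on cmpr_closed[OF P(2,3) g n(1)] cin_closed[OF P(3) n(2)] in auto)
    also have "cmp E (cobj P k) (cobj P' k) (FX P'' k n)
            (cmp E (cobj P' k) (FX P' k n) (FX P'' k n) (m P' P'' g k n) (cpr P' k n)) (onmor (conv C D E F) P P' f k)
       = cmp E (cobj P k) (FX P' k n) (FX P'' k n) (m P' P'' g k n)
            (cmp E (cobj P k) (cobj P' k) (FX P' k n) (cpr P' k n) (onmor (conv C D E F) P P' f k))"
      by (rule E.assoc[symmetric]) (use c on mg cpr_closed[OF P(2) n(1)] in auto)
    finally show ?thesis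
      unfolding cpr_onmor[OF P(1,2) f n(1)] s_def
      using c mg cin_closed[OF P(3) n(2)] by (simp add: E.cmp_one_right)
  qed
  have z: "s n = \<one>\<^bsub>Hom E (cobj P k) (cobj P'' k)\<^esub>" if n: "n \<in> J P k" "n \<in> J P'' k" "n \<notin> J P' k" for n
  proof -
    have "cmp E (cobj P k) (FX P k n) (FX P' k n) (m P P' f k n) (cpr P k n) = \<one>\<^bsub>Hom E (cobj P k) (FX P' k n)\<^esub>"
      by (rule E.zero_hom_to[OF zero_O[OF P(2) n(3)] c(1) cmpr_closed[OF P(1,2) f n(1)]])
    then show ?thesis
      unfolding s_def using c mg cin_closed[OF P(3) n(2)] by (simp add: E.cmp_one_right)
  qed
  have "onmor (conv C D E F) P P'' ?gf k = finprod (Hom E (cobj P k) (cobj P'' k)) s (J P k \<inter> J P'' k)"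
    unfolding onmor_conv by (rule E.finprod_hom_cong) (use c s l in auto)
  \<comment> \<open>The two sums differ only in neutral terms: on the left at indices outside the
    middle set, on the right at indices outside the first one.\<close>
  also have "\<dots> = finprod (Hom E (cobj P k) (cobj P'' k))
      (\<lambda>n. if n \<in> J P k then s n else \<one>\<^bsub>Hom E (cobj P k) (cobj P'' k)\<^esub>) (J P' k \<inter> J P'' k)"
    by (rule comm_monoid.finprod_mono_neutral_cong[OF E.hom_monoid])
      (use c s z finite_J[OF P(1)] finite_J[OF P(2)] E.one_closed in auto)
  also have "\<dots> = finprod (Hom E (cobj P k) (cobj P'' k))
      (\<lambda>n. cmp E (cobj P k) (cobj P' k) (cobj P'' k) (cterm P' P'' g k n) (onmor (conv C D E F) P P' f k)) (J P' k \<inter> J P'' k)"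
    by (rule E.finprod_hom_cong[symmetric]) (use c r s E.one_closed in auto)
  also have "\<dots> = cmp E (cobj P k) (cobj P' k) (cobj P'' k) (onmor (conv C D E F) P' P'' g k) (onmor (conv C D E F) P P' f k)"
    unfolding onmor_conv[of P' P'' g]
    by (rule E.cmp_finprod_left[symmetric]) (use c onmor_conv_closed[OF P(1,2) f] cterm_closed[OF P(2,3) g] in auto)
  finally show "onmor (conv C D E F) P P'' ?gf k
    = cmp (copies E) (cobj P) (cobj P') (cobj P'') (onmor (conv C D E F) P' P'' g) (onmor (conv C D E F) P P' f) k"
    by (simp add: copies_sel)
qed

text \<open>Additivity is assumed only for the entries, so that the same argument serves either
  variable of \<open>F\<close> with the other one fixed.\<close>

lemma onmor_conv_mult:
  assumes P: "ok P" "ok P'"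
    and f: "fst f \<in> carrier (Hom (copies C) (fst P) (fst P'))" "snd f \<in> carrier (Hom (copies D) (snd P) (snd P'))"
    and g: "fst g \<in> carrier (Hom (copies C) (fst P) (fst P'))" "snd g \<in> carrier (Hom (copies D) (snd P) (snd P'))"
    and h: "\<And>k n. m P P' h k n = m P P' f k n \<otimes>\<^bsub>Hom E (FX P k n) (FX P' k n)\<^esub> m P P' g k n"
  shows "onmor (conv C D E F) P P' h
    = onmor (conv C D E F) P P' f \<otimes>\<^bsub>Hom (copies E) (cobj P) (cobj P')\<^esub> onmor (conv C D E F) P P' g"
proof
  fix k
  note c = cobj_closed[OF P(1), of k] cobj_closed[OF P(2), of k] O_closed[OF P(1), where k = k] O_closed[OF P(2), where k = k]
  note mf = m_closed[OF P f, where k = k] and mg = m_closed[OF P g, where k = k]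
  interpret H: comm_monoid "Hom E (cobj P k) (cobj P' k)" by (rule E.hom_monoid[OF c(1,2)])
  have "cterm P P' h k n = cterm P P' f k n \<otimes>\<^bsub>Hom E (cobj P k) (cobj P' k)\<^esub> cterm P P' g k n"
    if "n \<in> J P k \<inter> J P' k" for n
    unfolding cterm_def h
    using that c mf mg cmpr_closed[OF P f] cmpr_closed[OF P g] cpr_closed[OF P(1)] cin_closed[OF P(2)]
    by (simp add: E.cmp_mult_left E.cmp_mult_right)
  then have "finprod (Hom E (cobj P k) (cobj P' k)) (cterm P P' h k) (J P k \<inter> J P' k)
    = finprod (Hom E (cobj P k) (cobj P' k)) (\<lambda>n. cterm P P' f k n \<otimes>\<^bsub>Hom E (cobj P k) (cobj P' k)\<^esub> cterm P P' g k n) (J P k \<inter> J P' k)"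
    by (intro E.finprod_hom_cong) (use c cterm_closed[OF P f] cterm_closed[OF P g] in auto)
  also have "\<dots> = finprod (Hom E (cobj P k) (cobj P' k)) (cterm P P' f k) (J P k \<inter> J P' k)
      \<otimes>\<^bsub>Hom E (cobj P k) (cobj P' k)\<^esub> finprod (Hom E (cobj P k) (cobj P' k)) (cterm P P' g k) (J P k \<inter> J P' k)"
    by (rule H.finprod_multf) (use cterm_closed[OF P f] cterm_closed[OF P g] in auto)
  finally show "onmor (conv C D E F) P P' h k
    = (onmor (conv C D E F) P P' f \<otimes>\<^bsub>Hom (copies E) (cobj P) (cobj P')\<^esub> onmor (conv C D E F) P P' g) k"
    by (simp add: onmor_conv copies_sel)
qed

lemma conv_biadd_ftor: "biadd_ftor (copies C) (copies D) (copies E) (conv C D E F)"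
proof (intro biadd_ftor.intro biadd_ftor_axioms.intro C.copies_preadd D.copies_preadd E.copies_preadd)
  have "is_ftor (prod_cat (copies C) (copies D)) (copies E) (conv C D E F)"
    unfolding is_ftor_def
  proof (intro conjI ballI)
    fix P assume "P \<in> obj (prod_cat (copies C) (copies D))"
    then have P: "ok P" by (auto simp: prod_cat_def)
    show "onobj (conv C D E F) P \<in> obj (copies E)" using cobj_copies[OF P] by (simp add: onobj_conv)
    show "onmor (conv C D E F) P P (idt (prod_cat (copies C) (copies D)) P) = idt (copies E) (onobj (conv C D E F) P)"
      using conv_idt[OF P] by (simp add: prod_cat_def onobj_conv)
  next
    fix P P' f assume "P \<in> obj (prod_cat (copies C) (copies D))" "P' \<in> obj (prod_cat (copies C) (copies D))"
      "f \<in> carrier (Hom (prod_cat (copies C) (copies D)) P P')"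
    then show "onmor (conv C D E F) P P' f \<in> carrier (Hom (copies E) (onobj (conv C D E F) P) (onobj (conv C D E F) P'))"
      using onmor_conv_closed[of P P' f] by (auto simp: prod_cat_def DirProd_def onobj_conv copies_sel(2)[of E])
  next
    fix P P' P'' f g assume "P \<in> obj (prod_cat (copies C) (copies D))" "P' \<in> obj (prod_cat (copies C) (copies D))"
      "P'' \<in> obj (prod_cat (copies C) (copies D))"
      "f \<in> carrier (Hom (prod_cat (copies C) (copies D)) P P')" "g \<in> carrier (Hom (prod_cat (copies C) (copies D)) P' P'')"
    then show "onmor (conv C D E F) P P'' (cmp (prod_cat (copies C) (copies D)) P P' P'' g f)
      = cmp (copies E) (onobj (conv C D E F) P) (onobj (conv C D E F) P') (onobj (conv C D E F) P'')
          (onmor (conv C D E F) P' P'' g) (onmor (conv C D E F) P P' f)"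
      using conv_cmp[of P P' P'' f g] by (auto simp: prod_cat_def DirProd_def onobj_conv)
  qed
  moreover have "(\<lambda>f. onmor (conv C D E F) (L, M) (L', M') (f, g)) \<in> hom (Hom (copies C) L L') (Hom (copies E) (cobj (L, M)) (cobj (L', M')))"
    if o: "L \<in> obj (copies C)" "L' \<in> obj (copies C)" "M \<in> obj (copies D)" "M' \<in> obj (copies D)"
      "g \<in> carrier (Hom (copies D) M M')" for L L' M M' g
  proof (rule homI)
    fix f assume f: "f \<in> carrier (Hom (copies C) L L')"
    show "onmor (conv C D E F) (L, M) (L', M') (f, g) \<in> carrier (Hom (copies E) (cobj (L, M)) (cobj (L', M')))"
      using onmor_conv_closed[of "(L, M)" "(L', M')" "(f, g)"] o f by (auto simp: copies_sel(2)[of E])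
    fix f' assume f': "f' \<in> carrier (Hom (copies C) L L')"
    show "onmor (conv C D E F) (L, M) (L', M') (f \<otimes>\<^bsub>Hom (copies C) L L'\<^esub> f', g)
      = onmor (conv C D E F) (L, M) (L', M') (f, g) \<otimes>\<^bsub>Hom (copies E) (cobj (L, M)) (cobj (L', M'))\<^esub> onmor (conv C D E F) (L, M) (L', M') (f', g)"
    proof (rule onmor_conv_mult)
      fix k n
      have "(\<lambda>f. onmor F (L n, M (k - n)) (L' n, M' (k - n)) (f, g (k - n)))
        \<in> hom (Hom C (L n) (L' n)) (Hom E (onobj F (L n, M (k - n))) (onobj F (L' n, M' (k - n))))"
        by (rule F.onmor_hom_left) (use o in \<open>auto simp: copies_sel\<close>)
      from hom_mult[OF this, of "f n" "f' n"] f f'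
      show "m (L, M) (L', M') (f \<otimes>\<^bsub>Hom (copies C) L L'\<^esub> f', g) k n = m (L, M) (L', M') (f, g) k n
        \<otimes>\<^bsub>Hom E (FX (L, M) k n) (FX (L', M') k n)\<^esub> m (L, M) (L', M') (f', g) k n"
        by (simp add: copies_sel)
    qed (use o f f' in auto)
  qed
  moreover have "(\<lambda>g. onmor (conv C D E F) (L, M) (L', M') (f, g)) \<in> hom (Hom (copies D) M M') (Hom (copies E) (cobj (L, M)) (cobj (L', M')))"
    if o: "L \<in> obj (copies C)" "L' \<in> obj (copies C)" "M \<in> obj (copies D)" "M' \<in> obj (copies D)"
      "f \<in> carrier (Hom (copies C) L L')" for L L' M M' f
  proof (rule homI)
    fix g assume g: "g \<in> carrier (Hom (copies D) M M')"
    show "onmor (conv C D E F) (L, M) (L', M') (f, g) \<in> carrier (Hom (copies E) (cobj (L, M)) (cobj (L', M')))"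
      using onmor_conv_closed[of "(L, M)" "(L', M')" "(f, g)"] o g by (auto simp: copies_sel(2)[of E])
    fix g' assume g': "g' \<in> carrier (Hom (copies D) M M')"
    show "onmor (conv C D E F) (L, M) (L', M') (f, g \<otimes>\<^bsub>Hom (copies D) M M'\<^esub> g')
      = onmor (conv C D E F) (L, M) (L', M') (f, g) \<otimes>\<^bsub>Hom (copies E) (cobj (L, M)) (cobj (L', M'))\<^esub> onmor (conv C D E F) (L, M) (L', M') (f, g')"
    proof (rule onmor_conv_mult)
      fix k n
      have "(\<lambda>g. onmor F (L n, M (k - n)) (L' n, M' (k - n)) (f n, g))
        \<in> hom (Hom D (M (k - n)) (M' (k - n))) (Hom E (onobj F (L n, M (k - n))) (onobj F (L' n, M' (k - n))))"
        by (rule F.onmor_hom_right) (use o in \<open>auto simp: copies_sel\<close>)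
      from hom_mult[OF this, of "g (k - n)" "g' (k - n)"] g g'
      show "m (L, M) (L', M') (f, g \<otimes>\<^bsub>Hom (copies D) M M'\<^esub> g') k n = m (L, M) (L', M') (f, g) k n
        \<otimes>\<^bsub>Hom E (FX (L, M) k n) (FX (L', M') k n)\<^esub> m (L, M) (L', M') (f, g') k n"
        by (simp add: copies_sel)
    qed (use o g g' in auto)
  qed
  ultimately show "biadditive_ftor (copies C) (copies D) (copies E) (conv C D E F)"
    unfolding biadditive_ftor_def onobj_conv by blast
qed

text \<open>In degree k the index set is \<open>{n}\<close> if k = n + l and neither object is zero,
  and empty otherwise. In the latter case both sides are zero objects, possibly different ones, so
  the comparison takes place in the Grothendieck group.\<close>

lemma conv_insert_obj:
  assumes A: "A \<in> obj C" and B: "B \<in> obj D"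
  shows "frag_of (onobj (conv C D E F) (onobj (insert_copy C n) A, onobj (insert_copy D l) B))
    - frag_of (onobj (insert_copy E (n + l)) (onobj F (A, B))) \<in> spn (K0_rels (copies E))"
proof (rule E.K0_copies_zeroI)
  let ?P = "(onobj (insert_copy C n) A, onobj (insert_copy D l) B)"
  have P: "ok ?P" using C.insert_copy_obj[OF A] D.insert_copy_obj[OF B] by simp
  have AB: "onobj F (A, B) \<in> obj E" using A B F.onobj_closed by blast
  show "Poly_Mapping.keys (frag_of (onobj (conv C D E F) ?P) - frag_of (onobj (insert_copy E (n + l)) (onobj F (A, B)))) \<subseteq> obj (copies E)"
    using cobj_copies[OF P] E.insert_copy_obj[OF AB] by (auto simp: onobj_conv dest!: subsetD[OF keys_diff])
  fix k
  have b: "frag_of (cobj ?P k) - (\<Sum>j\<in>J ?P k. frag_of (FX ?P k j)) \<in> spn (K0_rels E)"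
    by (rule E.K0_biproduct[OF conv_bip[OF P]])
  have "(\<Sum>j\<in>J ?P k. frag_of (FX ?P k j)) - frag_of (if k = n + l then onobj F (A, B) else zro E) \<in> spn (K0_rels E)"
  proof (cases "k = n + l \<and> \<not> zero_obj C A \<and> \<not> zero_obj D B")
    case True
    then have "J ?P k = {n}" using C.zro D.zro by (auto simp: conv_index_def insert_copy_def)
    then show ?thesis using True by (simp add: insert_copy_def spn_zero)
  next
    case False
    then have "J ?P k = {}" using C.zro D.zro by (auto simp: conv_index_def insert_copy_def split: if_splits)
    moreover have "zero_obj E (if k = n + l then onobj F (A, B) else zro E)"
      using False F.zero_left F.zero_right A B E.zro by auto
    ultimately show ?thesis using E.K0_zero spn_uminus by fastforce
  qed
  from spn_diff_trans[OF b this]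
  show "fobj (cproj E k) (frag_of (onobj (conv C D E F) ?P) - frag_of (onobj (insert_copy E (n + l)) (onobj F (A, B)))) \<in> spn (K0_rels E)"
    by (simp add: copy_proj_def onobj_conv insert_copy_def)
qed

lemma conv_insert:
  assumes "Poly_Mapping.keys p \<subseteq> obj C" "Poly_Mapping.keys q \<subseteq> obj D"
  shows "bobj (conv C D E F) (fobj (insert_copy C n) p) (fobj (insert_copy D l) q)
    - fobj (insert_copy E (n + l)) (bobj F p q) \<in> spn (K0_rels (copies E))"
  using assms(1)
proof (rule free_Abelian_group_induct)
  fix A assume A: "A \<in> obj C"
  show "bobj (conv C D E F) (fobj (insert_copy C n) (frag_of A)) (fobj (insert_copy D l) q)
    - fobj (insert_copy E (n + l)) (bobj F (frag_of A) q) \<in> spn (K0_rels (copies E))"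
    using assms(2)
  proof (rule free_Abelian_group_induct)
    fix x y :: "'p \<Rightarrow>\<^sub>0 int"
    assume "bobj (conv C D E F) (fobj (insert_copy C n) (frag_of A)) (fobj (insert_copy D l) x)
        - fobj (insert_copy E (n + l)) (bobj F (frag_of A) x) \<in> spn (K0_rels (copies E))"
      "bobj (conv C D E F) (fobj (insert_copy C n) (frag_of A)) (fobj (insert_copy D l) y)
        - fobj (insert_copy E (n + l)) (bobj F (frag_of A) y) \<in> spn (K0_rels (copies E))"
    from spn_diff[OF this] show "bobj (conv C D E F) (fobj (insert_copy C n) (frag_of A)) (fobj (insert_copy D l) (x - y))
        - fobj (insert_copy E (n + l)) (bobj F (frag_of A) (x - y)) \<in> spn (K0_rels (copies E))"
      by (simp add: algebra_simps)
  qed (use conv_insert_obj[OF A] in \<open>simp_all add: spn_zero\<close>)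
next
  fix x y :: "'o \<Rightarrow>\<^sub>0 int"
  assume "bobj (conv C D E F) (fobj (insert_copy C n) x) (fobj (insert_copy D l) q)
      - fobj (insert_copy E (n + l)) (bobj F x q) \<in> spn (K0_rels (copies E))"
    "bobj (conv C D E F) (fobj (insert_copy C n) y) (fobj (insert_copy D l) q)
      - fobj (insert_copy E (n + l)) (bobj F y q) \<in> spn (K0_rels (copies E))"
  from spn_diff[OF this] show "bobj (conv C D E F) (fobj (insert_copy C n) (x - y)) (fobj (insert_copy D l) q)
      - fobj (insert_copy E (n + l)) (bobj F (x - y) q) \<in> spn (K0_rels (copies E))"
    by (simp add: algebra_simps)
qed (simp add: spn_zero)

lemma gr_conv_incl:
  assumes "x \<in> carrier (K0 C)" "y \<in> carrier (K0 D)"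
  shows "K0_bimap (copies E) (conv C D E F) (gr_incl C n x) (gr_incl D l y) = gr_incl E (n + l) (K0_bimap E F x y)"
proof -
  obtain p q where p: "Poly_Mapping.keys p \<subseteq> obj C" "x = cls (K0_rels C) p"
    and q: "Poly_Mapping.keys q \<subseteq> obj D" "y = cls (K0_rels D) q"
    using assms K0_E by metis
  have pp: "Poly_Mapping.keys (fobj (insert_copy C n) p) \<subseteq> obj (copies C)"
    and qq: "Poly_Mapping.keys (fobj (insert_copy D l) q) \<subseteq> obj (copies D)"
    using add_ftor.keys_fobj[OF C.insert_copy_add_ftor p(1)] add_ftor.keys_fobj[OF D.insert_copy_add_ftor q(1)] by auto
  show ?thesis
    using conv_insert[OF p(1) q(1), of n l]
    by (simp add: p(2) q(2) C.gr_incl_cls D.gr_incl_cls E.gr_incl_cls F.K0_bimap_cls[OF p(1) q(1)]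
        biadd_ftor.K0_bimap_cls[OF conv_biadd_ftor pp qq] cls_eq_iff)
qed

end

section \<open>Words, the explicit coproduct and its coassociativity\<close>

section \<open>The algebras\<close>

subsection \<open>Linear extension\<close>

lemma pm_induct [case_names zero single add]:
  fixes x :: "'a \<Rightarrow>\<^sub>0 'b::comm_monoid_add"
  assumes "P 0" and "\<And>k c. P (Poly_Mapping.single k c)" and "\<And>x y. P x \<Longrightarrow> P y \<Longrightarrow> P (x + y)"
  shows "P x"
proof -
  have "x = (\<Sum>a\<in>Poly_Mapping.keys x. Poly_Mapping.single a (Poly_Mapping.lookup x a))"
    by (rule poly_mapping_eqI) (simp add: lookup_sum lookup_single when_def in_keys_iff)
  moreover have "P (\<Sum>a\<in>A. Poly_Mapping.single a (Poly_Mapping.lookup x a))" for A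
    by (induction A rule: infinite_finite_induct) (auto intro: assms)
  ultimately show ?thesis by metis
qed

definition lin :: "('a \<Rightarrow> 'k::field) \<Rightarrow> ('a \<Rightarrow>\<^sub>0 'k) \<Rightarrow> 'k" where
  "lin F x = (\<Sum>a\<in>Poly_Mapping.keys x. Poly_Mapping.lookup x a * F a)"

lemma lin_superset:
  "finite A \<Longrightarrow> Poly_Mapping.keys x \<subseteq> A \<Longrightarrow> lin F x = (\<Sum>a\<in>A. Poly_Mapping.lookup x a * F a)"
  unfolding lin_def by (rule sum.mono_neutral_left) (auto simp: in_keys_iff)

lemma lin_zero [simp]: "lin F 0 = 0"
  by (simp add: lin_def)

lemma lin_add [simp]: "lin F (x + y) = lin F x + lin F y"
proof -
  let ?A = "Poly_Mapping.keys x \<union> Poly_Mapping.keys y"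
  have "lin F z = (\<Sum>a\<in>?A. Poly_Mapping.lookup z a * F a)" if "z \<in> {x, y, x + y}" for z
    by (rule lin_superset) (use that keys_add[of x y] in auto)
  then show ?thesis by (simp add: lookup_add distrib_right sum.distrib)
qed

lemma lookup_scal [simp]: "Poly_Mapping.lookup (scal c x) a = c * Poly_Mapping.lookup x a"
  by (simp add: scal_def map.rep_eq when_def)

lemma keys_scal: "Poly_Mapping.keys (scal c x) \<subseteq> Poly_Mapping.keys x"
  by (auto simp: in_keys_iff)

lemma lin_scal [simp]: "lin F (scal c x) = c * lin F x"
proof -
  have "lin F (scal c x) = (\<Sum>a\<in>Poly_Mapping.keys x. Poly_Mapping.lookup (scal c x) a * F a)"
    by (rule lin_superset) (simp_all add: keys_scal)
  then show ?thesis by (simp add: lin_def sum_distrib_left mult.assoc)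
qed

lemma lin_single [simp]: "lin F (Poly_Mapping.single k c) = c * F k"
  by (simp add: lin_def)

lemma lin_sum [simp]: "lin F (sum f I) = (\<Sum>i\<in>I. lin F (f i))"
  by (induction I rule: infinite_finite_induct) auto

lemma lin_diff [simp]: "lin F (x - y) = lin F x - lin F y"
  using lin_add[of F "x - y" y] by simp

lemma lin_fun_add: "lin (\<lambda>a. F a + G a) x = lin F x + lin G x"
  by (simp add: lin_def distrib_left sum.distrib)

lemma lin_fun_scal: "lin (\<lambda>a. c * F a) x = c * lin F x"
  by (simp add: lin_def sum_distrib_left mult.left_commute)

lemma lin_fun_zero [simp]: "lin (\<lambda>a. 0) x = 0"
  by (simp add: lin_def)

lemma lin_cong: "(\<And>a. a \<in> Poly_Mapping.keys x \<Longrightarrow> F a = G a) \<Longrightarrow> lin F x = lin G x"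
  by (simp add: lin_def)

lemma lin_swap: "lin (\<lambda>a. lin (F a) y) x = lin (\<lambda>b. lin (\<lambda>a. F a b) x) y"
  unfolding lin_def
  by (simp add: sum_distrib_left, subst sum.swap) (simp add: mult.left_commute)

lemma lin_delta: "lin (\<lambda>b. if b = a then 1 else 0) x = Poly_Mapping.lookup x a"
  by (simp add: lin_def in_keys_iff if_distrib[where f = "\<lambda>z. _ * z"] cong: if_cong)

text \<open>Identities between finitely supported functions are proved by pairing with an arbitrary
  \<open>F\<close>: such pairings obey linear rules, whereas sums over keys would require tracking
  which coefficients vanish.\<close>

lemma lin_ext: "(\<And>F. lin F x = lin F y) \<Longrightarrow> x = y"
  by (rule poly_mapping_eqI) (metis lin_delta)

definition plin :: "('a \<Rightarrow> 'b \<Rightarrow>\<^sub>0 'k::field) \<Rightarrow> ('a \<Rightarrow>\<^sub>0 'k) \<Rightarrow> ('b \<Rightarrow>\<^sub>0 'k)" where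
  "plin G x = (\<Sum>a\<in>Poly_Mapping.keys x. scal (Poly_Mapping.lookup x a) (G a))"

lemma lin_plin [simp]: "lin F (plin G x) = lin (\<lambda>a. lin F (G a)) x"
  unfolding plin_def by (simp add: lin_def[of "\<lambda>a. lin F (G a)"])

lemma plin_simps [simp]:
  "plin G 0 = 0" "plin G (x + y) = plin G x + plin G y" "plin G (scal c x) = scal c (plin G x)"
  "plin G (Poly_Mapping.single k c) = scal c (G k)"
  by (rule lin_ext, simp)+

lemma scal_simps [simp]:
  "scal c 0 = 0" "scal 0 x = 0" "scal 1 x = x" "scal c (scal d x) = scal (c * d) x"
  "scal c (Poly_Mapping.single k d) = Poly_Mapping.single k (c * d)"
  "scal (- 1) x = - x"
       apply (auto intro!: poly_mapping_eqI simp: lookup_single when_def)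
  done

lemma scal_add: "scal c (x + y) = scal c x + scal c y"
  and scal_diff: "scal c (x - y) = scal c x - scal c y"
  and scal_add_left: "scal (c + d) x = scal c x + scal d x"
  by (rule lin_ext, simp add: algebra_simps)+

lemma scal_sum: "scal c (sum f I) = (\<Sum>i\<in>I. scal c (f i))"
  by (rule lin_ext) (simp add: sum_distrib_left)

lemma lin_times:
  fixes x y :: "'a::monoid_add \<Rightarrow>\<^sub>0 'k::field"
  shows "lin F (x * y) = lin (\<lambda>a. lin (\<lambda>b. F (a + b)) y) x"
proof (induction x rule: pm_induct)
  case (single k c)
  show ?case
    by (induction y rule: pm_induct) (auto simp: mult_single distrib_left algebra_simps)
qed (auto simp: distrib_right)

lemma scal_mult_left: "scal c x * y = scal c (x * y :: 'a::monoid_add \<Rightarrow>\<^sub>0 'k::field)"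
  and scal_mult_right: "x * scal c y = scal c (x * y :: 'a::monoid_add \<Rightarrow>\<^sub>0 'k::field)"
  by (rule lin_ext, simp add: lin_times lin_fun_scal)+

lemma lin_ptensor: "lin F (ptensor x y) = lin (\<lambda>a. lin (\<lambda>b. F (a, b)) y) x"
  unfolding ptensor_def
  by (simp add: lin_def[of _ x] lin_def[of _ y] sum_distrib_left mult.assoc)

subsection \<open>Degrees and words\<close>

lemma deg_add: "deg (x + y) = deg x + deg y"
  by (rule ext) (simp add: deg_def plus_word_def plus_fun_def)

lemma deg_zero [simp]: "deg 0 = 0"
  by (rule ext) (simp add: deg_def zero_word_def zero_fun_def)

lemma word_cases [case_names zero Cons]:
  obtains "w = 0" | i u where "w = Word [i] + u"
proof (cases w)
  case (Word l)
  show ?thesis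
  proof (cases l)
    case Nil
    then show ?thesis using that(1) Word by (simp add: zero_word_def)
  next
    case (Cons i m)
    then show ?thesis using that(2)[of i "Word m"] Word by (simp add: plus_word_def)
  qed
qed

lemma word_induct [case_names zero Cons]:
  assumes "P 0" and "\<And>i w. P w \<Longrightarrow> P (Word [i] + w)"
  shows "P w"
proof -
  have "P (Word l)" for l
  proof (induction l)
    case Nil
    then show ?case using assms(1) by (simp add: zero_word_def)
  next
    case (Cons i l)
    then show ?case using assms(2)[of "Word l" i] by (simp add: plus_word_def)
  qed
  then show ?thesis by (cases w) simp
qed

lemma word_add_eq_zero [simp]: "x + y = (0::'i word) \<longleftrightarrow> x = 0 \<and> y = 0"
  by (cases x; cases y) (simp add: plus_word_def zero_word_def)

lemma word_single_neq [simp]: "Word [i] \<noteq> 0" "0 \<noteq> Word [i]"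
  by (simp_all add: zero_word_def)

lemma word_Cons_eq_single [simp]: "Word [i] + w = Word [j] \<longleftrightarrow> i = j \<and> w = 0"
  by (cases w) (simp add: plus_word_def zero_word_def)

lemma word_add_eq_single:
  "x + y = Word [j] \<longleftrightarrow> x = Word [j] \<and> y = 0 \<or> x = 0 \<and> y = Word [j]"
  by (cases x; cases y) (auto simp: plus_word_def zero_word_def append_eq_Cons_conv)

lemma letters_simps [simp]: "letters 0 = []" "letters (Word [i] + w) = i # letters w"
  by (simp_all add: plus_word_def zero_word_def)

lemma ang_add:
  "ang_form \<Omega> (a + b) c = ang_form \<Omega> a c + ang_form \<Omega> b c"
  "ang_form \<Omega> a (b + c) = ang_form \<Omega> a b + ang_form \<Omega> a c"
  by (simp_all add: ang_form_def sum.distrib algebra_simps)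

lemma sq_add:
  "sq_form \<Omega> (a + b) c = sq_form \<Omega> a c + sq_form \<Omega> b c"
  "sq_form \<Omega> a (b + c) = sq_form \<Omega> a b + sq_form \<Omega> a c"
  by (simp_all add: sq_form_def sum.distrib[symmetric] algebra_simps)

lemma form_zero [simp]: "ang_form \<Omega> 0 c = 0" "ang_form \<Omega> c 0 = 0" "sq_form \<Omega> 0 c = 0" "sq_form \<Omega> c 0 = 0"
  by (simp_all add: ang_form_def sq_form_def)

text \<open>The diagonal part of the form is symmetric and drops out of the difference; only the
  contribution of \<open>ang_form\<close>, with reversed sign, is left.\<close>

lemma sq_ang: "sq_form \<Omega> a b - sq_form \<Omega> b a = ang_form \<Omega> b a - ang_form \<Omega> a b"
proof -
  define s where "s = (\<Sum>i\<in>UNIV. \<Sum>j\<in>UNIV. int (a i) * int (b j) * (if i = j then 2 * \<Omega> i i else 0))"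
  have "s = (\<Sum>i\<in>UNIV. int (a i) * int (b i) * (2 * \<Omega> i i))"
    unfolding s_def by (simp add: if_distrib[where f = "\<lambda>z. _ * z"] cong: if_cong)
  moreover have "(\<Sum>i\<in>UNIV. \<Sum>j\<in>UNIV. int (b i) * int (a j) * (if i = j then 2 * \<Omega> i i else 0))
    = (\<Sum>i\<in>UNIV. int (a i) * int (b i) * (2 * \<Omega> i i))"
    by (simp add: if_distrib[where f = "\<lambda>z. _ * z"] mult.commute cong: if_cong)
  ultimately have "sq_form \<Omega> a b = s - ang_form \<Omega> a b" "sq_form \<Omega> b a = s - ang_form \<Omega> b a"
    by (simp_all add: sq_form_def ang_form_def s_def right_diff_distrib sum_subtractf)
  then show ?thesis by simp
qed

subsection \<open>The comultiplication\<close>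

text \<open>The factor incurred in the twisted product when an element of degree \<open>a\<close> in
  a first slot moves past one of degree \<open>b\<close> in a second slot.\<close>

definition chi :: "('i::finite \<Rightarrow> 'i \<Rightarrow> int) \<Rightarrow> 'k::field \<Rightarrow> 'k \<Rightarrow> ('i \<Rightarrow> nat) \<Rightarrow> ('i \<Rightarrow> nat) \<Rightarrow> 'k" where
  "chi \<Omega> v t a b = v powi (- dot_form \<Omega> a b) * t powi (ang_form \<Omega> a b - ang_form \<Omega> b a)"

text \<open>Left multiplication of r(l) by theta_i tensor 1 plus 1 tensor theta_i. In the second
  term the existing first factor has to pass theta_i, hence the factor \<open>chi\<close>.\<close>

primrec comult_list ::
  "('i::finite \<Rightarrow> 'i \<Rightarrow> int) \<Rightarrow> 'k::field \<Rightarrow> 'k \<Rightarrow> 'i list \<Rightarrow> ('i, 'k) free_alg2" where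
  "comult_list \<Omega> v t [] = Poly_Mapping.single (0, 0) 1"
| "comult_list \<Omega> v t (i # l) =
     plin (\<lambda>p. Poly_Mapping.single (Word [i] + fst p, snd p) 1
       + Poly_Mapping.single (fst p, Word [i] + snd p) (chi \<Omega> v t (deg (fst p)) (deg (Word [i]))))
       (comult_list \<Omega> v t l)"

text \<open>
  \<open>rsum w F\<close> is the sum of \<open>F(w\<^sub>1, w\<^sub>2)\<close> over the terms \<open>w\<^sub>1 \<otimes> w\<^sub>2\<close> of \<open>r(w)\<close>. Identities for \<open>r\<close> and
  for the form are all proved in this shape, by induction on \<open>w\<close> for arbitrary \<open>F\<close>.
\<close>

definition rsum ::
  "('i::finite \<Rightarrow> 'i \<Rightarrow> int) \<Rightarrow> 'k::field \<Rightarrow> 'k \<Rightarrow> 'i word \<Rightarrow> ('i word \<Rightarrow> 'i word \<Rightarrow> 'k) \<Rightarrow> 'k" where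
  "rsum \<Omega> v t w F = lin (\<lambda>p. F (fst p) (snd p)) (comult_list \<Omega> v t (letters w))"

locale free_bialg =
  fixes \<Omega> :: "'i::finite \<Rightarrow> 'i \<Rightarrow> int" and v t :: "'k::field"
  assumes v0: "v \<noteq> 0" and t0: "t \<noteq> 0"
begin

abbreviation "\<chi> \<equiv> chi \<Omega> v t"
abbreviation "S \<equiv> rsum \<Omega> v t"

lemma chi_add: "\<chi> (a + b) c = \<chi> a c * \<chi> b c" "\<chi> a (b + c) = \<chi> a b * \<chi> a c"
  using v0 t0
  by (simp_all add: chi_def dot_form_def ang_add power_int_add[symmetric] algebra_simps)

lemma chi_zero [simp]: "\<chi> 0 a = 1" "\<chi> a 0 = 1"
  by (simp_all add: chi_def dot_form_def)

lemma S_zero [simp]: "S 0 F = F 0 0"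
  by (simp add: rsum_def)

lemma S_Cons: "S (Word [i] + w) F = S w (\<lambda>a b. F (Word [i] + a) b + \<chi> (deg a) (deg (Word [i])) * F a (Word [i] + b))"
  by (simp add: rsum_def)

lemma S_single: "S (Word [i]) F = F (Word [i]) 0 + F 0 (Word [i])"
  using S_Cons[of i 0 F] by simp

lemma S_add: "S w (\<lambda>a b. F a b + G a b) = S w F + S w G"
  and S_scal: "S w (\<lambda>a b. c * F a b) = c * S w F"
  and S_null: "S w (\<lambda>a b. 0) = 0"
  by (simp_all add: rsum_def lin_fun_add lin_fun_scal)

lemma S_lin: "S w (\<lambda>a b. lin (G a b) y) = lin (\<lambda>k. S w (\<lambda>a b. G a b k)) y"
  unfolding rsum_def by (rule lin_swap)

lemma S_swap: "S w (\<lambda>a b. S u (\<lambda>c d. G a b c d)) = S u (\<lambda>c d. S w (\<lambda>a b. G a b c d))"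
  unfolding rsum_def by (rule lin_swap)

text \<open>The coproduct preserves the total degree, and congruence may use this; it is how degree
  relations enter the exponents of t.\<close>

lemma S_cong: "(\<And>a b. deg a + deg b = deg w \<Longrightarrow> F a b = G a b) \<Longrightarrow> S w F = S w G"
proof (induction w arbitrary: F G rule: word_induct)
  case (Cons i w)
  show ?case
    unfolding S_Cons
  proof (rule Cons.IH)
    fix a b assume ab: "deg a + deg b = deg w"
    have 1: "F (Word [i] + a) b = G (Word [i] + a) b"
      by (rule Cons.prems) (simp add: deg_add ab[symmetric] ac_simps)
    have "F a (Word [i] + b) = G a (Word [i] + b)"
      by (rule Cons.prems) (simp add: deg_add ab[symmetric] ac_simps)
    with 1 show "F (Word [i] + a) b + \<chi> (deg a) (deg (Word [i])) * F a (Word [i] + b) =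
      G (Word [i] + a) b + \<chi> (deg a) (deg (Word [i])) * G a (Word [i] + b)" by simp
  qed
qed simp

text \<open>Among the terms of the coproduct only 1 tensor \<open>x\<close> has an empty first
  factor, and its coefficient is one.\<close>

lemma S_counit_left: "S x (\<lambda>a b. if a = 0 then G b else 0) = G x"
proof (induction x arbitrary: G rule: word_induct)
  case (Cons i w)
  have "S (Word [i] + w) (\<lambda>a b. if a = 0 then G b else 0) = S w (\<lambda>a b. if a = 0 then G (Word [i] + b) else 0)"
    unfolding S_Cons by (rule S_cong) auto
  then show ?case using Cons by simp
qed simp

text \<open>Since \<open>chi\<close> is multiplicative in each argument, passing a product costs the
  product of the factors; this makes r multiplicative, here in summed form.\<close>

lemma S_append:
  "S (x + y) F = S x (\<lambda>x1 x2. S y (\<lambda>y1 y2. \<chi> (deg y1) (deg x2) * F (x1 + y1) (x2 + y2)))"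
proof (induction x arbitrary: F rule: word_induct)
  case (Cons i w)
  let ?i = "Word [i]"
  have "S (?i + w + y) F = S (w + y) (\<lambda>a b. F (?i + a) b + \<chi> (deg a) (deg ?i) * F a (?i + b))"
    by (simp add: add.assoc S_Cons)
  also have "\<dots> = S w (\<lambda>x1 x2. S y (\<lambda>y1 y2. \<chi> (deg y1) (deg x2) *
      (F (?i + (x1 + y1)) (x2 + y2) + \<chi> (deg (x1 + y1)) (deg ?i) * F (x1 + y1) (?i + (x2 + y2)))))"
    by (rule Cons)
  also have "\<dots> = S w (\<lambda>x1 x2. S y (\<lambda>y1 y2. \<chi> (deg y1) (deg x2) * F (?i + x1 + y1) (x2 + y2))
     + \<chi> (deg x1) (deg ?i) * S y (\<lambda>y1 y2. \<chi> (deg y1) (deg (?i + x2)) * F (x1 + y1) (?i + x2 + y2)))"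
    by (simp add: S_add[symmetric] S_scal[symmetric] deg_add chi_add algebra_simps)
  also have "\<dots> = S (?i + w) (\<lambda>x1 x2. S y (\<lambda>y1 y2. \<chi> (deg y1) (deg x2) * F (x1 + y1) (x2 + y2)))"
    by (simp add: S_Cons add.assoc)
  finally show ?case .
qed simp

text \<open>A new first letter may land in any of three tensor positions, and both sides assign the
  same factor to each of them.\<close>

lemma S_coassoc: "S w (\<lambda>a u. S u (\<lambda>b c. F a b c)) = S w (\<lambda>u c. S u (\<lambda>a b. F a b c))"
proof (induction w arbitrary: F rule: word_induct)
  case (Cons i w)
  let ?i = "Word [i]"
  let ?\<chi> = "\<lambda>a. \<chi> (deg a) (deg ?i)"
  have "S (?i + w) (\<lambda>a u. S u (\<lambda>b c. F a b c)) =
    S w (\<lambda>a u. S u (\<lambda>b c. F (?i + a) b c + ?\<chi> a * F a (?i + b) c + ?\<chi> a * ?\<chi> b * F a b (?i + c)))"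
    unfolding S_Cons
    by (simp add: S_add[symmetric] S_scal[symmetric] algebra_simps)
  also have "\<dots> = S w (\<lambda>u c. S u (\<lambda>a b. F (?i + a) b c + ?\<chi> a * F a (?i + b) c + ?\<chi> a * ?\<chi> b * F a b (?i + c)))"
    by (rule Cons)
  \<comment> \<open>For a letter in the third position one side lets \<open>a\<close> and
    \<open>b\<close> pass separately, the other lets \<open>u\<close> pass as a whole; the factors
    agree because the degree of \<open>u\<close> is the sum.\<close>
  also have "\<dots> = S w (\<lambda>u c. S u (\<lambda>a b. F (?i + a) b c + ?\<chi> a * F a (?i + b) c) + ?\<chi> u * S u (\<lambda>a b. F a b (?i + c)))"
  proof (rule S_cong)
    fix u c
    have "S u (\<lambda>a b. ?\<chi> a * ?\<chi> b * F a b (?i + c)) = S u (\<lambda>a b. ?\<chi> u * F a b (?i + c))"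
      by (rule S_cong) (auto simp: chi_add(1)[symmetric])
    then show "S u (\<lambda>a b. F (?i + a) b c + ?\<chi> a * F a (?i + b) c + ?\<chi> a * ?\<chi> b * F a b (?i + c)) =
      S u (\<lambda>a b. F (?i + a) b c + ?\<chi> a * F a (?i + b) c) + ?\<chi> u * S u (\<lambda>a b. F a b (?i + c))"
      by (simp add: S_add S_scal)
  qed
  also have "\<dots> = S (?i + w) (\<lambda>u c. S u (\<lambda>a b. F a b c))"
    unfolding S_Cons by simp
  finally show ?case .
qed simp

lemma lin_tmult:
  "lin F (tmult \<Omega> v t z z') = lin (\<lambda>p. lin (\<lambda>q. \<chi> (deg (fst q)) (deg (snd p)) * F (fst p + fst q, snd p + snd q)) z') z"
  unfolding tmult_def chi_def
  by (simp add: case_prod_beta lin_def[of _ z] lin_def[of _ z'] sum_distrib_left mult_ac)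

definition comult' :: "('i, 'k) free_alg \<Rightarrow> ('i, 'k) free_alg2" where
  "comult' = plin (\<lambda>w. comult_list \<Omega> v t (letters w))"

lemma lin_comult': "lin F (comult' x) = lin (\<lambda>w. S w (\<lambda>a b. F (a, b))) x"
  by (simp add: comult'_def rsum_def)

lemma single_one_eq: "(1 :: ('i, 'k) free_alg) = Poly_Mapping.single 0 1"
  by simp

lemma is_comult': "is_comult \<Omega> v t comult'"
  unfolding is_comult_def
proof (intro conjI allI)
  show "comult' (x * y) = tmult \<Omega> v t (comult' x) (comult' y)" for x y
  proof (rule lin_ext)
    fix F
    have "lin F (comult' (x * y)) = lin (\<lambda>a. lin (\<lambda>b. S a (\<lambda>x1 x2. S b
        (\<lambda>y1 y2. \<chi> (deg y1) (deg x2) * F (x1 + y1, x2 + y2)))) y) x"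
      by (simp add: lin_comult' lin_times S_append)
    also have "\<dots> = lin F (tmult \<Omega> v t (comult' x) (comult' y))"
      by (simp add: lin_tmult lin_comult' S_lin[symmetric])
    finally show "lin F (comult' (x * y)) = lin F (tmult \<Omega> v t (comult' x) (comult' y))" .
  qed
qed (rule lin_ext; simp add: lin_comult' lin_ptensor \<theta>_def S_single del: single_one add: single_one_eq)+

lemma comult_unique:
  assumes "is_comult \<Omega> v t r"
  shows "r = comult'"
proof
  fix x
  have w: "r (Poly_Mapping.single w 1) = comult' (Poly_Mapping.single w 1)" for w
  proof (induction w rule: word_induct)
    case zero
    then show ?case using assms is_comult' by (simp add: is_comult_def)
  next
    case (Cons i w)
    have "Poly_Mapping.single (Word [i] + w) (1::'k) = \<theta> i * Poly_Mapping.single w 1"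
      by (simp add: \<theta>_def mult_single)
    then show ?case using Cons assms is_comult' by (simp add: is_comult_def)
  qed
  have sc: "r (scal c y) = scal c (r y)" "comult' (scal c y) = scal c (comult' y)" for c y
    using assms is_comult' by (simp_all add: is_comult_def)
  show "r x = comult' x"
  proof (induction x rule: pm_induct)
    case zero
    then show ?case using sc[of 0 0] by simp
  next
    case (single k c)
    then show ?case using sc[of c "Poly_Mapping.single k 1"] w by simp
  next
    case (add x y)
    then show ?case using assms is_comult' by (simp add: is_comult_def)
  qed
qed

text \<open>Existence and uniqueness of r turn the description in \<open>comult\<close> into the
  explicit recursion on words.\<close>

lemma comult_eq: "comult \<Omega> v t = comult'"
  unfolding comult_def by (rule the_equality) (auto intro: is_comult' comult_unique)

lemma lin_comult: "lin F (comult \<Omega> v t x) = lin (\<lambda>w. S w (\<lambda>a b. F (a, b))) x"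
  by (simp add: comult_eq lin_comult')

lemma comult_simps: "comult \<Omega> v t 0 = 0" "comult \<Omega> v t (x + y) = comult \<Omega> v t x + comult \<Omega> v t y"
  "comult \<Omega> v t (scal c x) = scal c (comult \<Omega> v t x)"
  by (simp_all add: comult_eq comult'_def)

end

section \<open>The bilinear form, its two adjunctions and its uniqueness\<close>

subsection \<open>The form\<close>

text \<open>Computes (x, y) with the letters of y as list argument: the adjunction (x, theta_j y) =
  (r(x), theta_j tensor y) serves as recursion, and only the terms of r(x) with first factor theta_j
  survive.\<close>

primrec form_list ::
  "('i::finite \<Rightarrow> 'i \<Rightarrow> int) \<Rightarrow> 'k::field \<Rightarrow> 'k \<Rightarrow> 'i list \<Rightarrow> 'i word \<Rightarrow> 'k" where
  "form_list \<Omega> v t [] x = (if x = 0 then 1 else 0)"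
| "form_list \<Omega> v t (j # l) x = rsum \<Omega> v t x (\<lambda>a u. if a = Word [j]
     then inverse (1 - sub_i \<Omega> v j powi (-2)) * t powi (2 * sq_form \<Omega> (deg (Word [j])) (deg u)) * form_list \<Omega> v t l u
     else 0)"

definition wform ::
  "('i::finite \<Rightarrow> 'i \<Rightarrow> int) \<Rightarrow> 'k::field \<Rightarrow> 'k \<Rightarrow> 'i word \<Rightarrow> 'i word \<Rightarrow> 'k" where
  "wform \<Omega> v t x y = form_list \<Omega> v t (letters y) x"

context free_bialg
begin

abbreviation "W \<equiv> wform \<Omega> v t"
abbreviation "cc j \<equiv> inverse (1 - sub_i \<Omega> v j powi (-2))"
abbreviation "\<sigma> a b \<equiv> t powi (2 * sq_form \<Omega> (deg a) (deg b))"

lemma sigma_add: "\<sigma> (a + b) c = \<sigma> a c * \<sigma> b c" "\<sigma> a (b + c) = \<sigma> a b * \<sigma> a c"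
  using t0 by (simp_all add: deg_add sq_add power_int_add distrib_left)

lemma sigma_deg:
  assumes "deg a + deg b = deg c"
  shows "\<sigma> c d = \<sigma> a d * \<sigma> b d" "\<sigma> d c = \<sigma> d a * \<sigma> d b"
  unfolding assms[symmetric] using t0 by (simp_all add: sq_add power_int_add distrib_left)

lemma W_zero: "W x 0 = (if x = 0 then 1 else 0)"
  by (simp add: wform_def)

lemma W_Cons: "W x (Word [j] + y) = S x (\<lambda>a u. if a = Word [j] then cc j * \<sigma> (Word [j]) u * W u y else 0)"
  by (simp add: wform_def cong: if_cong)

text \<open>Each step of the recursion removes the same letter from both arguments, so a difference
  of degrees persists to the end.\<close>

lemma W_deg: "deg x \<noteq> deg y \<Longrightarrow> W x y = 0"
proof (induction y arbitrary: x rule: word_induct)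
  case zero
  then show ?case by (auto simp: W_zero)
next
  case (Cons j y)
  have "W x (Word [j] + y) = S x (\<lambda>a u. 0)"
    unfolding W_Cons
  proof (rule S_cong)
    fix a u assume "deg a + deg u = deg x"
    then have "deg u \<noteq> deg y" if "a = Word [j]" using Cons.prems that by (metis deg_add)
    then show "(if a = Word [j] then cc j * \<sigma> (Word [j]) u * W u y else 0) = 0"
      using Cons.IH by simp
  qed
  then show ?case by (simp add: S_null)
qed

text \<open>The recursion is the case of a single letter; coassociativity extends it to all words.
  The powers of t agree since both bracketings collect one factor for each pair among the three
  tensor positions.\<close>

lemma W_append_right: "W x (y + y') = S x (\<lambda>a b. \<sigma> a b * W a y * W b y')"
proof (induction y arbitrary: x rule: word_induct)
  case zero
  have "S x (\<lambda>a b. \<sigma> a b * W a 0 * W b y') = S x (\<lambda>a b. if a = 0 then W b y' else 0)"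
    by (rule S_cong) (simp add: W_zero)
  then show ?case by (simp add: S_counit_left)
next
  case (Cons j y)
  let ?j = "Word [j]"
  let ?K = "\<lambda>a b d. if a = ?j then cc j * \<sigma> a b * \<sigma> a d * \<sigma> b d * W b y * W d y' else 0"
  have "W x (?j + y + y') = S x (\<lambda>a u. S u (\<lambda>b d. ?K a b d))"
    unfolding add.assoc W_Cons
  proof (rule S_cong)
    fix a u
    show "(if a = ?j then cc j * \<sigma> ?j u * W u (y + y') else 0) = S u (\<lambda>b d. ?K a b d)"
    proof (cases "a = ?j")
      case True
      have "cc j * \<sigma> ?j u * S u (\<lambda>b d. \<sigma> b d * W b y * W d y') = S u (\<lambda>b d. cc j * \<sigma> ?j u * (\<sigma> b d * W b y * W d y'))"
        by (simp add: S_scal)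
      also have "\<dots> = S u (\<lambda>b d. ?K a b d)"
        by (rule S_cong) (simp add: True sigma_deg(2)[of _ _ u])
      finally show ?thesis using True Cons by simp
    qed (simp add: S_null)
  qed
  also have "\<dots> = S x (\<lambda>u d. S u (\<lambda>a b. ?K a b d))" by (rule S_coassoc)
  also have "\<dots> = S x (\<lambda>u d. \<sigma> u d * W u (?j + y) * W d y')"
  proof (rule S_cong)
    fix u d
    have "\<sigma> u d * W u (?j + y) * W d y' = S u (\<lambda>a b. \<sigma> u d * W d y' * (if a = ?j then cc j * \<sigma> ?j b * W b y else 0))"
      unfolding W_Cons S_scal by simp
    also have "\<dots> = S u (\<lambda>a b. ?K a b d)"
      by (rule S_cong) (auto simp: sigma_deg(1)[of _ _ u])
    finally show "S u (\<lambda>a b. ?K a b d) = \<sigma> u d * W u (?j + y) * W d y'" by simp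
  qed
  finally show ?case .
qed

text \<open>By \<open>sq_ang\<close> the antisymmetry of the doubled form cancels that of the
  exponent of t in \<open>chi\<close>. The symmetry is what allows a letter to be taken from the
  right factor in \<open>W_append_left\<close>.\<close>

lemma chi_sigma: "\<chi> (deg a) (deg b) * \<sigma> a b = \<chi> (deg b) (deg a) * \<sigma> b a"
proof -
  have "ang_form \<Omega> (deg a) (deg b) - ang_form \<Omega> (deg b) (deg a) + 2 * sq_form \<Omega> (deg a) (deg b)
    = ang_form \<Omega> (deg b) (deg a) - ang_form \<Omega> (deg a) (deg b) + 2 * sq_form \<Omega> (deg b) (deg a)"
    using sq_ang[of \<Omega> "deg a" "deg b"] by simp
  moreover have "t powi (m + n) = t powi m * t powi n" for m n
    using t0 by (simp add: power_int_add)
  ultimately have "t powi (ang_form \<Omega> (deg a) (deg b) - ang_form \<Omega> (deg b) (deg a)) * \<sigma> a b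
    = t powi (ang_form \<Omega> (deg b) (deg a) - ang_form \<Omega> (deg a) (deg b)) * \<sigma> b a"
    by metis
  then show ?thesis by (simp add: chi_def dot_form_def add.commute)
qed

text \<open>This adjunction is not built into the recursion. The first letter of \<open>y\<close> is
  matched either inside \<open>x\<close> or inside \<open>x'\<close>; in the second case it has to
  pass \<open>x\<close>, and \<open>chi_sigma\<close> converts the resulting factor.\<close>

lemma W_append_left: "W (x + x') y = S y (\<lambda>a b. \<sigma> x x' * W x a * W x' b)"
proof (induction y arbitrary: x x' rule: word_induct)
  case zero
  then show ?case by (auto simp: W_zero)
next
  case (Cons j l)
  let ?j = "Word [j]"
  let ?H = "\<lambda>u. cc j * \<sigma> ?j u * W u l"
  let ?A = "S x (\<lambda>x1 x2. if x1 = ?j then ?H (x2 + x') else 0)"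
  let ?B = "\<chi> (deg ?j) (deg x) * S x' (\<lambda>y1 y2. if y1 = ?j then ?H (x + y2) else 0)"
  have "W (x + x') (?j + l) = S x (\<lambda>x1 x2. S x' (\<lambda>y1 y2. \<chi> (deg y1) (deg x2) * (if x1 + y1 = ?j then ?H (x2 + y2) else 0)))"
    unfolding W_Cons S_append by simp
  \<comment> \<open>The word \<open>x1 + y1\<close> is the single letter j exactly when one part is
    that letter and the other is empty, which yields the two summands.\<close>
  also have "\<dots> = S x (\<lambda>x1 x2. S x' (\<lambda>y1 y2. if y1 = 0 then (if x1 = ?j then ?H (x2 + y2) else 0) else 0)
      + (if x1 = 0 then S x' (\<lambda>y1 y2. if y1 = ?j then \<chi> (deg ?j) (deg x2) * ?H (x2 + y2) else 0) else 0))"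
  proof (rule S_cong)
    fix x1 x2
    show "S x' (\<lambda>y1 y2. \<chi> (deg y1) (deg x2) * (if x1 + y1 = ?j then ?H (x2 + y2) else 0)) =
      S x' (\<lambda>y1 y2. if y1 = 0 then (if x1 = ?j then ?H (x2 + y2) else 0) else 0)
      + (if x1 = 0 then S x' (\<lambda>y1 y2. if y1 = ?j then \<chi> (deg ?j) (deg x2) * ?H (x2 + y2) else 0) else 0)"
    proof (cases "x1 = 0")
      case True
      then show ?thesis
        by (simp add: S_null if_distrib[where f = "\<lambda>z. _ * z"] cong: if_cong)
    next
      case False
      then show ?thesis
        by (simp add: word_add_eq_single) (rule S_cong, auto)
    qed
  qed
  also have "\<dots> = ?A + ?B"
  proof -
    have "S x (\<lambda>x1 x2. S x' (\<lambda>y1 y2. if y1 = 0 then (if x1 = ?j then ?H (x2 + y2) else 0) else 0)) = ?A"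
      by (simp add: S_counit_left)
    moreover have "S x (\<lambda>x1 x2. if x1 = 0 then S x' (\<lambda>y1 y2. if y1 = ?j then \<chi> (deg ?j) (deg x2) * ?H (x2 + y2) else 0) else 0)
      = S x' (\<lambda>y1 y2. if y1 = ?j then \<chi> (deg ?j) (deg x) * ?H (x + y2) else 0)"
      by (rule S_counit_left)
    moreover have "\<dots> = ?B"
      unfolding S_scal[symmetric] by (rule S_cong) auto
    ultimately show ?thesis by (simp only: S_add)
  qed
  also have "?A = S l (\<lambda>a b. \<sigma> x x' * W x (?j + a) * W x' b)"
  proof -
    have "S l (\<lambda>a b. \<sigma> x x' * W x (?j + a) * W x' b)
      = S l (\<lambda>a b. S x (\<lambda>x1 x2. if x1 = ?j then \<sigma> x x' * W x' b * (cc j * \<sigma> ?j x2 * W x2 a) else 0))"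
    proof (rule S_cong)
      fix a b
      have "\<sigma> x x' * W x (?j + a) * W x' b = S x (\<lambda>x1 x2. \<sigma> x x' * W x' b * (if x1 = ?j then cc j * \<sigma> ?j x2 * W x2 a else 0))"
        unfolding W_Cons S_scal by simp
      also have "\<dots> = S x (\<lambda>x1 x2. if x1 = ?j then \<sigma> x x' * W x' b * (cc j * \<sigma> ?j x2 * W x2 a) else 0)"
        by (rule S_cong) auto
      finally show "\<sigma> x x' * W x (?j + a) * W x' b
        = S x (\<lambda>x1 x2. if x1 = ?j then \<sigma> x x' * W x' b * (cc j * \<sigma> ?j x2 * W x2 a) else 0)" .
    qed
    also have "\<dots> = S x (\<lambda>x1 x2. S l (\<lambda>a b. if x1 = ?j then \<sigma> x x' * W x' b * (cc j * \<sigma> ?j x2 * W x2 a) else 0))"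
      by (rule S_swap)
    also have "\<dots> = ?A"
    proof (rule S_cong)
      fix x1 x2 assume d: "deg x1 + deg x2 = deg x"
      show "S l (\<lambda>a b. if x1 = ?j then \<sigma> x x' * W x' b * (cc j * \<sigma> ?j x2 * W x2 a) else 0)
        = (if x1 = ?j then ?H (x2 + x') else 0)"
      proof (cases "x1 = ?j")
        case True
        have "?H (x2 + x') = S l (\<lambda>a b. cc j * \<sigma> ?j (x2 + x') * (\<sigma> x2 x' * W x2 a * W x' b))"
          unfolding Cons.IH S_scal by simp
        also have "\<dots> = S l (\<lambda>a b. \<sigma> x x' * W x' b * (cc j * \<sigma> ?j x2 * W x2 a))"
          by (rule S_cong) (use d True in \<open>simp add: sigma_add sigma_deg(1)[of x1 x2 x] mult_ac\<close>)
        finally show ?thesis using True by simp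
      qed (simp add: S_null)
    qed
    finally show ?thesis by simp
  qed
  also have "?B = S l (\<lambda>a b. \<chi> (deg a) (deg ?j) * (\<sigma> x x' * W x a * W x' (?j + b)))"
  proof -
    have "S l (\<lambda>a b. \<chi> (deg a) (deg ?j) * (\<sigma> x x' * W x a * W x' (?j + b)))
      = S l (\<lambda>a b. S x' (\<lambda>y1 y2. if y1 = ?j then \<chi> (deg x) (deg ?j) * \<sigma> x x' * W x a * (cc j * \<sigma> ?j y2 * W y2 b) else 0))"
    proof (rule S_cong)
      fix a b
      \<comment> \<open>Words of different degrees are orthogonal, so the degree of \<open>a\<close>
        may be replaced by that of \<open>x\<close>, which no longer varies with the term.\<close>
      have "\<chi> (deg a) (deg ?j) * (\<sigma> x x' * W x a * W x' (?j + b))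
        = \<chi> (deg x) (deg ?j) * \<sigma> x x' * W x a * W x' (?j + b)"
        using W_deg[of x a] by (cases "deg x = deg a") auto
      also have "\<dots> = S x' (\<lambda>y1 y2. \<chi> (deg x) (deg ?j) * \<sigma> x x' * W x a * (if y1 = ?j then cc j * \<sigma> ?j y2 * W y2 b else 0))"
        unfolding W_Cons S_scal by simp
      also have "\<dots> = S x' (\<lambda>y1 y2. if y1 = ?j then \<chi> (deg x) (deg ?j) * \<sigma> x x' * W x a * (cc j * \<sigma> ?j y2 * W y2 b) else 0)"
        by (rule S_cong) auto
      finally show "\<chi> (deg a) (deg ?j) * (\<sigma> x x' * W x a * W x' (?j + b)) =
        S x' (\<lambda>y1 y2. if y1 = ?j then \<chi> (deg x) (deg ?j) * \<sigma> x x' * W x a * (cc j * \<sigma> ?j y2 * W y2 b) else 0)" .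
    qed
    also have "\<dots> = S x' (\<lambda>y1 y2. S l (\<lambda>a b. if y1 = ?j then \<chi> (deg x) (deg ?j) * \<sigma> x x' * W x a * (cc j * \<sigma> ?j y2 * W y2 b) else 0))"
      by (rule S_swap)
    also have "\<dots> = S x' (\<lambda>y1 y2. \<chi> (deg ?j) (deg x) * (if y1 = ?j then ?H (x + y2) else 0))"
    proof (rule S_cong)
      fix y1 y2 assume d: "deg y1 + deg y2 = deg x'"
      show "S l (\<lambda>a b. if y1 = ?j then \<chi> (deg x) (deg ?j) * \<sigma> x x' * W x a * (cc j * \<sigma> ?j y2 * W y2 b) else 0)
        = \<chi> (deg ?j) (deg x) * (if y1 = ?j then ?H (x + y2) else 0)"
      proof (cases "y1 = ?j")
        case True
        have "\<chi> (deg ?j) (deg x) * ?H (x + y2) = S l (\<lambda>a b. \<chi> (deg ?j) (deg x) * cc j * \<sigma> ?j (x + y2) * (\<sigma> x y2 * W x a * W y2 b))"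
          unfolding Cons.IH S_scal by simp
        also have "\<dots> = S l (\<lambda>a b. \<chi> (deg x) (deg ?j) * \<sigma> x x' * W x a * (cc j * \<sigma> ?j y2 * W y2 b))"
          by (rule S_cong)
            (use d True chi_sigma[of ?j x] in \<open>simp add: sigma_add sigma_deg(2)[of y1 y2 x'] mult_ac\<close>)
        finally show ?thesis using True by simp
      qed (simp add: S_null)
    qed
    finally show ?thesis by (simp add: S_scal)
  qed
  also have "S l (\<lambda>a b. \<sigma> x x' * W x (?j + a) * W x' b)
      + S l (\<lambda>a b. \<chi> (deg a) (deg ?j) * (\<sigma> x x' * W x a * W x' (?j + b)))
    = S (?j + l) (\<lambda>a b. \<sigma> x x' * W x a * W x' b)"
    unfolding S_Cons S_add ..
  finally show ?case .
qed

definition bform' :: "('i, 'k) free_alg \<Rightarrow> ('i, 'k) free_alg \<Rightarrow> 'k" where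
  "bform' x y = lin (\<lambda>a. lin (\<lambda>b. W a b) y) x"

lemma lin_tform:
  "tform \<Omega> t B z z' = lin (\<lambda>p. lin (\<lambda>q. \<sigma> (fst p) (snd p)
     * B (Poly_Mapping.single (fst p) 1) (Poly_Mapping.single (fst q) 1)
     * B (Poly_Mapping.single (snd p) 1) (Poly_Mapping.single (snd q) 1)) z') z"
  unfolding tform_def
  by (simp add: case_prod_beta lin_def[of _ z] lin_def[of _ z'] sum_distrib_left mult_ac)

lemma is_form': "is_form \<Omega> v t bform'"
  unfolding is_form_def
proof (intro conjI allI)
  show "bform' x (y' * y'') = tform \<Omega> t bform' (comult \<Omega> v t x) (ptensor y' y'')" for x y' y''
    by (simp add: bform'_def lin_tform lin_comult lin_ptensor lin_times W_append_right S_lin)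
  have "W (a + b) = (\<lambda>w. S w (\<lambda>p q. \<sigma> a b * W a p * W b q))" for a b
    by (rule ext) (rule W_append_left)
  then show "bform' (x' * x'') y = tform \<Omega> t bform' (ptensor x' x'') (comult \<Omega> v t y)" for x' x'' y
    by (simp add: bform'_def lin_tform lin_comult lin_ptensor lin_times)
  show "bform' (\<theta> i) (\<theta> j) = (if i = j then inverse (1 - sub_i \<Omega> v i powi (-2)) else 0)" for i j
    using W_Cons[of "Word [i]" j 0]
    by (auto simp: bform'_def \<theta>_def S_single W_zero)
qed (simp_all add: bform'_def lin_fun_add lin_fun_scal W_zero del: single_one add: single_one_eq)

text \<open>The adjunctions force the pairing of any word with a single letter, and then the
  recursion on the second argument leaves no freedom.\<close>

lemma is_form_unique:
  assumes B: "is_form \<Omega> v t B"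
  shows "B = bform'"
proof (intro ext)
  fix x y
  define Bs where "Bs a b = B (Poly_Mapping.single a 1) (Poly_Mapping.single b 1)" for a b
  have add: "B (x + x') y = B x y + B x' y" "B x (y + y') = B x y + B x y'"
    and sc: "B (scal c x) y = c * B x y" "B x (scal c y) = c * B x y" for x x' y y' c
    using B by (auto simp: is_form_def)
  have R: "Bs w (a + b) = S w (\<lambda>p q. \<sigma> p q * Bs p a * Bs q b)" for w a b
  proof -
    have "Bs w (a + b) = B (Poly_Mapping.single w 1) (Poly_Mapping.single a 1 * Poly_Mapping.single b 1)"
      by (simp add: Bs_def mult_single)
    also have "\<dots> = tform \<Omega> t B (comult \<Omega> v t (Poly_Mapping.single w 1)) (ptensor (Poly_Mapping.single a 1) (Poly_Mapping.single b 1))"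
      using B by (simp add: is_form_def)
    finally show ?thesis by (simp add: lin_tform lin_comult lin_ptensor Bs_def)
  qed
  have L: "Bs (a + b) w = S w (\<lambda>p q. \<sigma> a b * Bs a p * Bs b q)" for w a b
  proof -
    have "Bs (a + b) w = B (Poly_Mapping.single a 1 * Poly_Mapping.single b 1) (Poly_Mapping.single w 1)"
      by (simp add: Bs_def mult_single)
    also have "\<dots> = tform \<Omega> t B (ptensor (Poly_Mapping.single a 1) (Poly_Mapping.single b 1)) (comult \<Omega> v t (Poly_Mapping.single w 1))"
      using B by (simp add: is_form_def)
    finally show ?thesis by (simp add: lin_tform lin_comult lin_ptensor Bs_def)
  qed
  have 00: "Bs 0 0 = 1" using B by (simp add: Bs_def is_form_def)
  have ij: "Bs (Word [i]) (Word [j]) = (if i = j then cc i else 0)" for i j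
    using B by (simp add: Bs_def is_form_def \<theta>_def)
  \<comment> \<open>Pairing a letter with 1 = 1 * 1 gives b = b + b, hence b = 0; the inequality of
    2 and 1 is what excludes any other solution.\<close>
  have two: "(2::'k) \<noteq> 1" by (metis add_cancel_right_right one_add_one zero_neq_one)
  have i0: "Bs (Word [i]) 0 = 0" for i
    using R[of "Word [i]" 0 0] two by (simp add: S_single 00)
  have j0: "Bs 0 (Word [j]) = 0" for j
    using L[of 0 0 "Word [j]"] two by (simp add: S_single 00)
  have w0: "Bs w 0 = (if w = 0 then 1 else 0)" for w
    by (cases w rule: word_cases) (auto simp: 00 L i0)
  have wj: "Bs w (Word [j]) = (if w = Word [j] then cc j else 0)" for w j
  proof (cases w rule: word_cases)
    case (Cons i u)
    show ?thesis
    proof (cases "u = 0")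
      case False
      then show ?thesis by (simp add: Cons L S_single i0 w0)
    qed (use Cons ij in auto)
  qed (simp add: j0)
  have BsW: "Bs x y = W x y" for x y
  proof (induction y arbitrary: x rule: word_induct)
    case zero
    then show ?case by (simp add: w0 W_zero)
  next
    case (Cons j y)
    show ?case
      unfolding R W_Cons by (rule S_cong) (simp add: wj Cons)
  qed
  have "B x y = lin (\<lambda>a. lin (\<lambda>b. Bs a b) y) x" for x y
  proof (induction x rule: pm_induct)
    case zero
    then show ?case using sc(1)[of 0 0 y] by simp
  next
    case (single k c)
    have "B (Poly_Mapping.single k 1) y = lin (Bs k) y"
    proof (induction y rule: pm_induct)
      case zero
      then show ?case using sc(2)[of _ 0 0] by simp
    next
      case (single l d)
      then show ?case using sc(2)[of "Poly_Mapping.single k 1" d "Poly_Mapping.single l 1"] by (simp add: Bs_def)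
    qed (simp add: add)
    then show ?case using sc(1)[of c "Poly_Mapping.single k 1" y] by simp
  qed (simp add: add)
  then show "B x y = bform' x y" by (simp add: BsW bform'_def)
qed

lemma bform_eq: "bform \<Omega> v t = bform'"
  unfolding bform_def by (rule the_equality) (auto intro: is_form' is_form_unique)

subsection \<open>The radical and the quotient\<close>

abbreviation "rad \<equiv> radical \<Omega> v t"

lemma radical_iff: "x \<in> rad \<longleftrightarrow> (\<forall>w. lin (\<lambda>a. W a w) x = 0)"
proof
  assume "x \<in> rad"
  then have "bform' x (Poly_Mapping.single w 1) = 0" for w by (simp add: radical_def bform_eq)
  then show "\<forall>w. lin (\<lambda>a. W a w) x = 0" by (simp add: bform'_def)
next
  assume "\<forall>w. lin (\<lambda>a. W a w) x = 0"
  then have "bform' x y = 0" for y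
    unfolding bform'_def by (subst lin_swap) simp
  then show "x \<in> rad" by (simp add: radical_def bform_eq)
qed

lemma rad_zero [simp]: "0 \<in> rad"
  and rad_add: "x \<in> rad \<Longrightarrow> y \<in> rad \<Longrightarrow> x + y \<in> rad"
  and rad_diff: "x \<in> rad \<Longrightarrow> y \<in> rad \<Longrightarrow> x - y \<in> rad"
  and rad_scal: "x \<in> rad \<Longrightarrow> scal c x \<in> rad"
  by (simp_all add: radical_iff)

text \<open>\<open>W_append_left\<close> carries a power of t depending on \<open>z1\<close> and
  \<open>x1\<close>. Orthogonality lets it be read off from the two parts of \<open>w\<close>
  instead, after which the inner expression is linear in \<open>x\<close> and vanishes.\<close>

lemma rad_mult_left:
  assumes "x \<in> rad"
  shows "z * x \<in> rad"
  unfolding radical_iff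
proof
  fix w
  have "lin (\<lambda>a. W a w) (z * x) = lin (\<lambda>z1. lin (\<lambda>x1. S w (\<lambda>p q. \<sigma> p q * W z1 p * W x1 q)) x) z"
  proof (simp only: lin_times, intro lin_cong)
    fix z1 x1
    show "W (z1 + x1) w = S w (\<lambda>p q. \<sigma> p q * W z1 p * W x1 q)"
      unfolding W_append_left
    proof (rule S_cong)
      fix a b
      show "\<sigma> z1 x1 * W z1 a * W x1 b = \<sigma> a b * W z1 a * W x1 b"
        using W_deg[of z1 a] W_deg[of x1 b] by (cases "deg z1 = deg a"; cases "deg x1 = deg b") auto
    qed
  qed
  also have "\<dots> = 0"
    using assms by (simp add: S_lin[symmetric] lin_fun_scal radical_iff S_null)
  finally show "lin (\<lambda>a. W a w) (z * x) = 0" .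
qed

lemma rad_mult_right:
  assumes "x \<in> rad"
  shows "x * z \<in> rad"
  unfolding radical_iff
proof
  fix w
  have "lin (\<lambda>a. W a w) (x * z) = lin (\<lambda>z1. lin (\<lambda>x1. S w (\<lambda>p q. \<sigma> p q * W z1 q * W x1 p)) x) z"
  proof (simp only: lin_times, subst lin_swap, intro lin_cong)
    fix z1 x1
    show "W (x1 + z1) w = S w (\<lambda>p q. \<sigma> p q * W z1 q * W x1 p)"
      unfolding W_append_left
    proof (rule S_cong)
      fix a b
      show "\<sigma> x1 z1 * W x1 a * W z1 b = \<sigma> a b * W z1 b * W x1 a"
        using W_deg[of z1 b] W_deg[of x1 a] by (cases "deg z1 = deg b"; cases "deg x1 = deg a") auto
    qed
  qed
  also have "\<dots> = 0"
    using assms by (simp add: S_lin[symmetric] lin_fun_scal radical_iff S_null)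
  finally show "lin (\<lambda>a. W a w) (x * z) = 0" .
qed

abbreviation "pr \<equiv> f_proj \<Omega> v t"

lemma f_proj_def': "pr x = {y. y - x \<in> rad}"
proof -
  have "pr x = {h + x |h. h \<in> rad}"
    by (auto simp: f_proj_def a_r_coset_def r_coset_def free_ring_def)
  also have "\<dots> = {y. y - x \<in> rad}"
    by (auto simp: algebra_simps) (metis add_diff_cancel_left' diff_add_cancel)
  finally show ?thesis .
qed

lemma pr_eq_iff: "pr x = pr y \<longleftrightarrow> x - y \<in> rad"
proof
  assume "pr x = pr y"
  moreover have "x \<in> pr x" by (simp add: f_proj_def')
  ultimately have "x \<in> pr y" by simp
  then show "x - y \<in> rad" by (simp add: f_proj_def')
next
  assume d: "x - y \<in> rad"
  have "z - x \<in> rad \<longleftrightarrow> z - y \<in> rad" for z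
    using rad_add[OF _ d, of "z - x"] rad_diff[OF _ d, of "z - y"] by (auto simp: algebra_simps)
  then show "pr x = pr y" by (simp add: f_proj_def')
qed

lemma self_in_pr [simp]: "x \<in> pr x"
  by (simp add: f_proj_def')

lemma pr_zero: "pr 0 = rad"
  by (simp add: f_proj_def')

lemma f_ring_simps:
  "\<one>\<^bsub>f_ring \<Omega> v t\<^esub> = pr 1" "\<zero>\<^bsub>f_ring \<Omega> v t\<^esub> = pr 0"
  "pr x \<oplus>\<^bsub>f_ring \<Omega> v t\<^esub> pr y = pr (x + y)" "pr x \<otimes>\<^bsub>f_ring \<Omega> v t\<^esub> pr y = pr (x * y)"
proof -
  show "\<one>\<^bsub>f_ring \<Omega> v t\<^esub> = pr 1"
    by (simp add: f_ring_def FactRing_def f_proj_def free_ring_def)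
  show "\<zero>\<^bsub>f_ring \<Omega> v t\<^esub> = pr 0"
    unfolding pr_zero by (simp add: f_ring_def FactRing_def)
  have "pr x \<oplus>\<^bsub>f_ring \<Omega> v t\<^esub> pr y = {a + b |a b. a \<in> pr x \<and> b \<in> pr y}"
    by (auto simp: f_ring_def FactRing_def set_add_def set_mult_def free_ring_def)
  also have "\<dots> = pr (x + y)"
  proof (intro equalityI subsetI)
    fix z assume "z \<in> {a + b |a b. a \<in> pr x \<and> b \<in> pr y}"
    then obtain a b where "z = a + b" "a - x \<in> rad" "b - y \<in> rad" by (auto simp: f_proj_def')
    then show "z \<in> pr (x + y)" using rad_add[of "a - x" "b - y"] by (simp add: f_proj_def' algebra_simps)
  next
    fix z assume "z \<in> pr (x + y)"
    then have "z = (z - y) + y" "z - y \<in> pr x" by (simp_all add: f_proj_def' algebra_simps)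
    then show "z \<in> {a + b |a b. a \<in> pr x \<and> b \<in> pr y}" using self_in_pr by blast
  qed
  finally show "pr x \<oplus>\<^bsub>f_ring \<Omega> v t\<^esub> pr y = pr (x + y)" .
  have "pr x \<otimes>\<^bsub>f_ring \<Omega> v t\<^esub> pr y = (\<Union>a\<in>pr x. \<Union>b\<in>pr y. pr (a * b))"
    by (simp add: f_ring_def FactRing_def rcoset_mult_def f_proj_def free_ring_def)
  also have "\<dots> = pr (x * y)"
  proof (intro UN_cls_const)
    fix a b assume "a \<in> pr x" "b \<in> pr y"
    then have "a - x \<in> rad" "b - y \<in> rad" by (simp_all add: f_proj_def')
    then have "(a - x) * b + x * (b - y) \<in> rad" by (intro rad_add rad_mult_left rad_mult_right)
    then show "pr (a * b) = pr (x * y)" by (simp add: pr_eq_iff algebra_simps)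
  qed (use self_in_pr in blast)+
  finally show "pr x \<otimes>\<^bsub>f_ring \<Omega> v t\<^esub> pr y = pr (x * y)" .
qed

lemma f_scal_pr: "f_scal \<Omega> v t c (pr x) = pr (scal c x)"
  unfolding f_scal_def
proof (rule UN_cls_const)
  fix y assume "y \<in> pr x"
  then show "pr (scal c y) = pr (scal c x)"
    using rad_scal[of "y - x" c] by (simp add: f_proj_def'[of x] pr_eq_iff scal_diff)
qed (use self_in_pr in blast)

subsection \<open>Homogeneous components\<close>

definition hcomp :: "('i \<Rightarrow> nat) \<Rightarrow> ('i, 'k) free_alg \<Rightarrow> ('i, 'k) free_alg" where
  "hcomp \<nu> = plin (\<lambda>w. if deg w = \<nu> then Poly_Mapping.single w 1 else 0)"

end

definition homog :: "('i \<Rightarrow> nat) \<Rightarrow> ('i word \<Rightarrow>\<^sub>0 'k::zero) \<Rightarrow> bool" where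
  "homog \<nu> x \<longleftrightarrow> (\<forall>w\<in>Poly_Mapping.keys x. deg w = \<nu>)"

context free_bialg
begin

lemma lookup_hcomp: "Poly_Mapping.lookup (hcomp \<nu> x) w = (if deg w = \<nu> then Poly_Mapping.lookup x w else 0)"
proof -
  have "Poly_Mapping.lookup (hcomp \<nu> x) w = lin (\<lambda>b. if b = w then 1 else 0) (hcomp \<nu> x)"
    by (rule lin_delta[symmetric])
  also have "\<dots> = lin (\<lambda>b. if b = w then (if deg w = \<nu> then 1 else 0) else 0) x"
    unfolding hcomp_def lin_plin by (rule lin_cong) auto
  finally show ?thesis
    by (cases "deg w = \<nu>") (simp_all add: lin_delta)
qed

lemma homog_iff: "homog \<nu> x \<longleftrightarrow> hcomp \<nu> x = x"
  by (auto simp: homog_def poly_mapping_eq_iff fun_eq_iff lookup_hcomp in_keys_iff)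

lemma hcomp_homog: "homog \<mu> x \<Longrightarrow> hcomp \<nu> x = (if \<mu> = \<nu> then x else 0)"
  by (rule poly_mapping_eqI) (auto simp: lookup_hcomp homog_def in_keys_iff)

lemma homog_hcomp: "homog \<nu> (hcomp \<nu> x)"
  by (auto simp: homog_def in_keys_iff lookup_hcomp split: if_splits)

lemma hcomp_simps [simp]: "hcomp \<nu> 0 = 0" "hcomp \<nu> (x + y) = hcomp \<nu> x + hcomp \<nu> y"
  "hcomp \<nu> (scal c x) = scal c (hcomp \<nu> x)" "hcomp \<nu> (x - y) = hcomp \<nu> x - hcomp \<nu> y"
  by (auto intro!: poly_mapping_eqI simp: lookup_hcomp lookup_add lookup_minus)

lemma homog_simps:
  fixes x y :: "('i, 'k) free_alg"
  shows "homog \<nu> (0 :: ('i, 'k) free_alg)" "homog \<nu> x \<Longrightarrow> homog \<nu> y \<Longrightarrow> homog \<nu> (x + y)"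
  "homog \<nu> x \<Longrightarrow> homog \<nu> (scal c x)" "homog \<nu> x \<Longrightarrow> homog \<nu> y \<Longrightarrow> homog \<nu> (x - y)"
  by (simp_all add: homog_iff)

lemma homog_mult: "homog \<tau> x \<Longrightarrow> homog \<omega> y \<Longrightarrow> homog (\<tau> + \<omega>) (x * y)"
  using keys_mult[of x y] by (fastforce simp: homog_def deg_add)

lemma hcomp_sum_degrees: "x = (\<Sum>\<nu>\<in>deg ` Poly_Mapping.keys x. hcomp \<nu> x)"
  by (rule poly_mapping_eqI) (auto simp: lookup_sum lookup_hcomp in_keys_iff intro!: sum.neutral
      simp: sum.delta)

text \<open>Pairing a component with \<open>w\<close> gives either zero or the pairing of the whole
  element, because different degrees are orthogonal.\<close>

lemma rad_hcomp: "x \<in> rad \<Longrightarrow> hcomp \<nu> x \<in> rad"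
proof -
  assume x: "x \<in> rad"
  have "lin (\<lambda>a. W a w) (hcomp \<nu> x) = 0" for w
  proof -
    have "lin (\<lambda>a. W a w) (hcomp \<nu> x) = lin (\<lambda>a. (if deg w = \<nu> then 1 else 0) * W a w) x"
      unfolding hcomp_def lin_plin by (rule lin_cong) (use W_deg in auto)
    then show ?thesis using x unfolding lin_fun_scal by (simp add: radical_iff)
  qed
  then show ?thesis by (simp add: radical_iff)
qed

lemma carrier_f_comp: "carrier (f_comp \<Omega> v t \<nu>) = pr ` {x. homog \<nu> x}"
  by (simp add: f_comp_def homog_def)

lemma f_comp_simps:
  "\<zero>\<^bsub>f_comp \<Omega> v t \<nu>\<^esub> = pr 0" "pr x \<oplus>\<^bsub>f_comp \<Omega> v t \<nu>\<^esub> pr y = pr (x + y)"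
  "c \<odot>\<^bsub>f_comp \<Omega> v t \<nu>\<^esub> pr x = pr (scal c x)"
  by (simp_all add: f_comp_def f_ring_simps f_scal_pr)

lemma int_comp_simps:
  "\<zero>\<^bsub>int_comp \<Omega> v t \<nu>\<^esub> = pr 0" "pr x \<oplus>\<^bsub>int_comp \<Omega> v t \<nu>\<^esub> pr y = pr (x + y)"
  "c \<odot>\<^bsub>int_comp \<Omega> v t \<nu>\<^esub> pr x = pr (scal c x)"
  by (simp_all add: int_comp_def f_comp_def f_ring_simps f_scal_pr)

lemma carrier_int_comp: "carrier (int_comp \<Omega> v t \<nu>) = int_form \<Omega> v t \<inter> pr ` {x. homog \<nu> x}"
  by (simp add: int_comp_def carrier_f_comp)

lemma tensor_pair_f_comp: "tensor_pair (subring_of UNIV) (f_comp \<Omega> v t \<tau>) (f_comp \<Omega> v t \<omega>)"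
  by unfold_locales (auto simp: carrier_f_comp f_comp_simps intro!: imageI homog_simps)

end

subsection \<open>Laurent polynomials\<close>

definition laurent_eval :: "'k::field \<Rightarrow> 'k \<Rightarrow> (int \<times> int \<Rightarrow>\<^sub>0 int) \<Rightarrow> 'k" where
  "laurent_eval v t p = (\<Sum>k\<in>Poly_Mapping.keys p. of_int (Poly_Mapping.lookup p k) * v powi fst k * t powi snd k)"

lemma laurent_eq: "laurent v t = range (laurent_eval v t)"
  by (auto simp: laurent_def laurent_eval_def case_prod_beta)

lemma laurent_eval_add: "laurent_eval v t (p + q) = laurent_eval v t p + laurent_eval v t q"
  unfolding laurent_eval_def
  by (rule setsum_keys_plus_distrib) (auto simp: distrib_right)

lemma laurent_monom: "of_int c * v powi a * t powi b \<in> laurent v t"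
proof -
  have "of_int c * v powi a * t powi b = laurent_eval v t (Poly_Mapping.single (a, b) c)"
    by (simp add: laurent_eval_def)
  then show ?thesis unfolding laurent_eq by blast
qed

lemma laurent_add: "x \<in> laurent v t \<Longrightarrow> y \<in> laurent v t \<Longrightarrow> x + y \<in> laurent v t"
  unfolding laurent_eq by (auto simp flip: laurent_eval_add)

lemma laurent_induct [consumes 1, case_names zero monom add]:
  assumes "x \<in> laurent v t" and "P 0" and "\<And>c a b. P (of_int c * v powi a * t powi b)"
    and "\<And>x y. P x \<Longrightarrow> P y \<Longrightarrow> P (x + y)"
  shows "P x"
proof -
  have "P (laurent_eval v t p)" for p
  proof (induction p rule: pm_induct)
    case zero
    then show ?case using assms(2) by (simp add: laurent_eval_def)
  next
    case (single k c)
    then show ?case using assms(3)[of c "fst k" "snd k"] assms(2) by (simp add: laurent_eval_def)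
  next
    case (add p q)
    then show ?case using assms(4) by (simp add: laurent_eval_add)
  qed
  then show ?thesis using assms(1) unfolding laurent_eq by blast
qed

lemma laurent_zero: "0 \<in> laurent v t"
  using laurent_monom[of 0] by simp

lemma laurent_one: "1 \<in> laurent v t"
  using laurent_monom[of 1 v 0 t 0] by simp

lemma laurent_powi: "v powi a \<in> laurent v t" "t powi a \<in> laurent v t"
  using laurent_monom[of 1 v a t 0] laurent_monom[of 1 v 0 t a] by simp_all

lemma laurent_mult:
  assumes "v \<noteq> 0" "t \<noteq> 0" "x \<in> laurent v t" "y \<in> laurent v t"
  shows "x * y \<in> laurent v t"
  using assms(3)
proof (induction rule: laurent_induct)
  case (monom c a b)
  show ?case
    using assms(4)
  proof (induction rule: laurent_induct)
    case (monom c' a' b')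
    have "of_int c * v powi a * t powi b * (of_int c' * v powi a' * t powi b')
      = of_int (c * c') * v powi (a + a') * t powi (b + b')"
      using assms(1,2) by (simp add: power_int_add)
    then show ?case using laurent_monom[of "c * c'" v "a + a'" t "b + b'"] by (simp only:)
  qed (auto simp: laurent_zero distrib_left intro: laurent_add)
qed (auto simp: laurent_zero distrib_right intro: laurent_add)

lemma laurent_uminus: "x \<in> laurent v t \<Longrightarrow> - x \<in> laurent v t"
proof (induction rule: laurent_induct)
  case (monom c a b)
  then show ?case using laurent_monom[of "- c" v a t b] by simp
qed (auto simp: laurent_zero intro: laurent_add[of "- _" _ _ "- _", simplified])

lemma cring_laurent:
  assumes "v \<noteq> 0" "t \<noteq> 0"
  shows "cring (subring_of (laurent v t))"
proof (rule cringI)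
  show "abelian_group (subring_of (laurent v t))"
    by (rule abelian_groupI)
      (auto simp: subring_of_def laurent_add laurent_zero ac_simps
        intro!: bexI[of _ "- _"] laurent_uminus)
  show "comm_monoid (subring_of (laurent v t))"
    by (rule comm_monoidI) (auto simp: subring_of_def laurent_mult[OF assms] laurent_one ac_simps)
qed (simp add: subring_of_def distrib_right)

section \<open>Passage from Q(v) to Q(v,t) and the rescaling of words\<close>

section \<open>Extension of scalars and twisting\<close>

lemma emb_zero [simp]: "emb 0 = 0"
  and emb_one [simp]: "emb 1 = 1"
  and emb_add [simp]: "emb (a + b) = emb a + emb b"
  and emb_mult [simp]: "emb (a * b) = emb a * emb b"
  and emb_uminus [simp]: "emb (- a) = - emb a"
  and emb_diff [simp]: "emb (a - b) = emb a - emb b"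
  by (simp_all add: emb_def fract_collapse one_pCons[symmetric] mult.commute)

lemma emb_eq_0_iff [simp]: "emb a = 0 \<longleftrightarrow> a = 0"
  by (simp add: emb_def Zero_fract_def eq_fract)

lemma emb_inverse [simp]: "emb (inverse a) = inverse (emb a)"
proof (cases "a = 0")
  case False
  then have "emb a * emb (inverse a) = 1" by (simp flip: emb_mult)
  then show ?thesis using inverse_unique by metis
qed simp

lemma emb_divide [simp]: "emb (a / b) = emb a / emb b"
  by (simp add: divide_inverse)

lemma emb_power [simp]: "emb (a ^ n) = emb a ^ n"
  by (induction n) auto

lemma emb_powi [simp]: "emb (a powi n) = emb a powi n"
  by (simp add: power_int_def)

lemma emb_of_int [simp]: "emb (of_int n) = of_int n"
proof -
  have "emb (of_nat k) = of_nat k" for k by (induction k) auto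
  then show ?thesis by (cases n rule: int_cases2) auto
qed

lemma qt_neq_0 [simp]: "qt \<noteq> 0"
  unfolding qt_def Zero_fract_def by (subst eq_fract) simp_all

lemma qv_neq_0 [simp]: "qv \<noteq> 0"
  unfolding qv_def Zero_fract_def by (subst eq_fract) simp_all

lemma qt_powi_add: "qt powi (m + n) = qt powi m * qt powi n"
  by (simp add: power_int_add)

lemma qt_power_emb: "qt ^ k * emb a = Fract (monom a k) 1"
proof -
  have "qt ^ k = Fract (monom 1 k) 1"
    by (induction k) (simp_all add: qt_def fract_collapse monom_Suc)
  then show ?thesis by (simp add: emb_def smult_monom mult.commute[of "monom 1 k"])
qed

lemma Fract_sum: "(\<Sum>k\<in>N. Fract (f k) 1) = Fract (\<Sum>k\<in>N. f k) (1 :: 'a::idom)"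
  by (induction N rule: infinite_finite_induct) (auto simp: fract_collapse)

text \<open>Multiplication by a power of t turns the relation into one between honest polynomials in
  t, whose coefficients can be compared.\<close>

lemma qt_independent:
  assumes "finite N" and "(\<Sum>n\<in>N. qt powi n * emb (a n)) = 0" and "n \<in> N"
  shows "a n = 0"
proof -
  \<comment> \<open>Moves the lowest exponent to 0.\<close>
  define m where "m = - Min N"
  have m: "n + m \<ge> 0" if "n \<in> N" for n
    using assms(1) that by (simp add: m_def)
  have "0 = qt powi m * (\<Sum>n\<in>N. qt powi n * emb (a n))" using assms(2) by simp
  also have "\<dots> = (\<Sum>n\<in>N. qt ^ nat (n + m) * emb (a n))"
    unfolding sum_distrib_left
  proof (rule sum.cong)
    fix n assume "n \<in> N"
    then have "qt ^ nat (n + m) = qt powi (n + m)" using m by (simp add: power_int_def)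
    then show "qt powi m * (qt powi n * emb (a n)) = qt ^ nat (n + m) * emb (a n)"
      by (simp add: qt_powi_add)
  qed simp
  also have "\<dots> = Fract (\<Sum>n\<in>N. monom (a n) (nat (n + m))) 1"
    by (simp add: qt_power_emb Fract_sum)
  finally have "(\<Sum>n\<in>N. monom (a n) (nat (n + m))) = 0"
    by (simp add: Zero_fract_def eq_fract)
  then have "0 = coeff (\<Sum>k\<in>N. monom (a k) (nat (k + m))) (nat (n + m))" by simp
  also have "\<dots> = (\<Sum>k\<in>N. if k = n then a k else 0)"
    unfolding coeff_sum
    by (rule sum.cong) (use m assms(3) in \<open>auto simp: nat_eq_iff2\<close>)
  also have "\<dots> = a n" using assms(1,3) by simp
  finally show ?thesis by simp
qed

lemma emb_laurent: "a \<in> laurent v 1 \<Longrightarrow> emb a \<in> laurent (emb v) qt"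
proof (induction rule: laurent_induct)
  case (monom c a b)
  then show ?case using laurent_monom[of c "emb v" a qt 0] by simp
qed (auto simp: laurent_zero intro: laurent_add)

definition ext_scal :: "('a \<Rightarrow>\<^sub>0 Qv) \<Rightarrow> ('a \<Rightarrow>\<^sub>0 Qvt)" where
  "ext_scal = Poly_Mapping.map emb"

lemma lookup_ext_scal [simp]: "Poly_Mapping.lookup (ext_scal x) a = emb (Poly_Mapping.lookup x a)"
  by (simp add: ext_scal_def map.rep_eq when_def)

lemma keys_ext_scal [simp]: "Poly_Mapping.keys (ext_scal x) = Poly_Mapping.keys x"
  by (auto simp: in_keys_iff)

lemma ext_scal_simps [simp]: "ext_scal 0 = 0" "ext_scal (x + y) = ext_scal x + ext_scal y"
  "ext_scal (x - y) = ext_scal x - ext_scal y" "ext_scal (scal c x) = scal (emb c) (ext_scal x)"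
  "ext_scal (Poly_Mapping.single a c) = Poly_Mapping.single a (emb c)"
  by (auto intro!: poly_mapping_eqI simp: lookup_add lookup_minus lookup_single when_def)

lemma ext_scal_mult: "ext_scal (x * y :: 'a::monoid_add \<Rightarrow>\<^sub>0 Qv) = ext_scal x * ext_scal y"
proof (induction x rule: pm_induct)
  case (single k c)
  show ?case
    by (induction y rule: pm_induct) (auto simp: mult_single distrib_left)
qed (auto simp: distrib_right)

lemma lin_ext_scal: "lin (\<lambda>a. emb (f a)) (ext_scal x) = emb (lin f x)"
  by (induction x rule: pm_induct) auto

primrec twist_list :: "('i::finite \<Rightarrow> 'i \<Rightarrow> int) \<Rightarrow> 'i list \<Rightarrow> int" where
  "twist_list \<Omega> [] = 0"
| "twist_list \<Omega> (i # l) = twist_list \<Omega> l + sq_form \<Omega> (deg (Word [i])) (deg (Word l))"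

text \<open>\<open>twist_exp \<Omega> (i\<^sub>1\<dots>i\<^sub>n)\<close> is the sum of \<open>[i\<^sub>a, i\<^sub>b]\<close> over \<open>a < b\<close>.\<close>

definition twist_exp :: "('i::finite \<Rightarrow> 'i \<Rightarrow> int) \<Rightarrow> 'i word \<Rightarrow> int" where
  "twist_exp \<Omega> w = twist_list \<Omega> (letters w)"

lemma twist_exp_zero [simp]: "twist_exp \<Omega> 0 = 0"
  by (simp add: twist_exp_def)

lemma twist_exp_Cons: "twist_exp \<Omega> (Word [i] + w) = twist_exp \<Omega> w + sq_form \<Omega> (deg (Word [i])) (deg w)"
  by (simp add: twist_exp_def)

lemma twist_exp_single [simp]: "twist_exp \<Omega> (Word [i]) = 0"
  using twist_exp_Cons[of \<Omega> i 0] by simp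

text \<open>Every pair of positions lies within \<open>x\<close>, within \<open>y\<close>, or
  across; the pairs across add up to the value of the bilinear form on the degrees.\<close>

lemma twist_exp_add: "twist_exp \<Omega> (x + y) = twist_exp \<Omega> x + twist_exp \<Omega> y + sq_form \<Omega> (deg x) (deg y)"
  by (induction x rule: word_induct) (simp_all add: twist_exp_Cons add.assoc deg_add sq_add del: plus_fun_apply zero_fun_apply)

definition twisted :: "('i::finite \<Rightarrow> 'i \<Rightarrow> int) \<Rightarrow> ('i, Qv) free_alg \<Rightarrow> ('i, Qvt) free_alg" where
  "twisted \<Omega> x = plin (\<lambda>w. Poly_Mapping.single w (qt powi (- twist_exp \<Omega> w))) (ext_scal x)"

locale twisting =
  fixes \<Omega> :: "'i::finite \<Rightarrow> 'i \<Rightarrow> int"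
begin

sublocale A: free_bialg \<Omega> qv "1 :: Qv"
  by unfold_locales simp_all

sublocale B: free_bialg \<Omega> "emb qv" qt
  by unfold_locales simp_all

abbreviation "c \<equiv> twist_exp \<Omega>"
abbreviation "\<Phi> \<equiv> twisted \<Omega>"

lemma B_chi: "B.\<chi> a b = emb (A.\<chi> a b) * qt powi (ang_form \<Omega> a b - ang_form \<Omega> b a)"
  by (simp add: chi_def)

text \<open>The weight is the exponent of \<open>a + b\<close> minus that of \<open>w\<close>, the
  change caused by splitting a word and joining its parts again. When a new letter goes to the
  second factor, \<open>a\<close> has to pass it, and by \<open>sq_ang\<close> the change of weight
  cancels the power of t in \<open>chi\<close>.\<close>

lemma S_twist:
  "B.S w (\<lambda>a b. qt powi (c a + c b + sq_form \<Omega> (deg a) (deg b) - c w) * emb (F a b)) = emb (A.S w F)"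
proof (induction w arbitrary: F rule: word_induct)
  case (Cons i w)
  let ?i = "Word [i]"
  let ?e = "\<lambda>w a b. c a + c b + sq_form \<Omega> (deg a) (deg b) - c w"
  have "B.S (?i + w) (\<lambda>a b. qt powi ?e (?i + w) a b * emb (F a b)) =
    B.S w (\<lambda>a b. qt powi ?e w a b * emb (F (?i + a) b + A.\<chi> (deg a) (deg ?i) * F a (?i + b)))"
    unfolding B.S_Cons
  proof (rule B.S_cong)
    fix a b assume d: "deg a + deg b = deg w"
    have 1: "?e (?i + w) (?i + a) b = ?e w a b"
      by (simp add: twist_exp_Cons deg_add sq_add d[symmetric])
    have "ang_form \<Omega> (deg a) (deg ?i) - ang_form \<Omega> (deg ?i) (deg a) + ?e (?i + w) a (?i + b) = ?e w a b"
      using sq_ang[of \<Omega> "deg a" "deg ?i"]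
      by (simp add: twist_exp_Cons deg_add sq_add d[symmetric])
    then have "qt powi (ang_form \<Omega> (deg a) (deg ?i) - ang_form \<Omega> (deg ?i) (deg a)) * qt powi ?e (?i + w) a (?i + b)
      = qt powi ?e w a b"
      by (simp only: qt_powi_add[symmetric])
    then have 2: "B.\<chi> (deg a) (deg ?i) * qt powi ?e (?i + w) a (?i + b) = emb (A.\<chi> (deg a) (deg ?i)) * qt powi ?e w a b"
      by (simp add: B_chi mult.assoc)
    show "qt powi ?e (?i + w) (?i + a) b * emb (F (?i + a) b) +
        B.\<chi> (deg a) (deg ?i) * (qt powi ?e (?i + w) a (?i + b) * emb (F a (?i + b))) =
      qt powi ?e w a b * emb (F (?i + a) b + A.\<chi> (deg a) (deg ?i) * F a (?i + b))"
      unfolding 1 using arg_cong[OF 2, of "\<lambda>z. z * emb (F a (?i + b))"]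
      by (simp add: distrib_left mult_ac)
  qed
  then show ?case by (simp only: Cons.IH A.S_Cons)
qed simp

text \<open>Recursion on the second argument, with \<open>S_twist\<close> absorbing the change of
  the coproduct.\<close>

lemma W_twist: "B.W x y = qt powi (c x + c y) * emb (A.W x y)"
proof (induction y arbitrary: x rule: word_induct)
  case zero
  then show ?case by (simp add: A.W_zero B.W_zero)
next
  case (Cons j y)
  let ?j = "Word [j]"
  have cc: "B.cc j = emb (A.cc j)" by (simp add: sub_i_def)
  have "B.W x (?j + y) = B.S x (\<lambda>a u. qt powi (c x + c (?j + y)) *
     (qt powi (c a + c u + sq_form \<Omega> (deg a) (deg u) - c x) * emb (if a = ?j then A.cc j * A.W u y else 0)))"
    unfolding B.W_Cons
  proof (rule B.S_cong)
    fix a u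
    show "(if a = ?j then B.cc j * B.\<sigma> ?j u * B.W u y else 0) = qt powi (c x + c (?j + y)) *
     (qt powi (c a + c u + sq_form \<Omega> (deg a) (deg u) - c x) * emb (if a = ?j then A.cc j * A.W u y else 0))"
    \<comment> \<open>Other terms vanish. If the degrees agree, the value of the form on the letter
      and \<open>u\<close> occurs once in \<open>c (?j + y)\<close> and once in the weight of
      \<open>S_twist\<close>; together they give the doubled exponent in
      \<open>B.\<sigma>\<close>.\<close>
    proof (cases "a = ?j \<and> deg u = deg y")
      case True
      have "c x + c (?j + y) + (c a + c u + sq_form \<Omega> (deg a) (deg u) - c x)
        = 2 * sq_form \<Omega> (deg ?j) (deg u) + (c u + c y)"
        using True by (simp add: twist_exp_Cons)
      then have "qt powi (c x + c (?j + y)) * qt powi (c a + c u + sq_form \<Omega> (deg a) (deg u) - c x)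
        = B.\<sigma> ?j u * qt powi (c u + c y)"
        by (simp only: qt_powi_add[symmetric])
      from arg_cong[OF this, of "\<lambda>z. z * (B.cc j * emb (A.W u y))"]
      show ?thesis using True by (simp only: Cons cc emb_mult mult_ac if_True simp_thms)
    next
      case False
      then show ?thesis using A.W_deg[of u y] by (auto simp: Cons)
    qed
  qed
  also have "\<dots> = qt powi (c x + c (?j + y)) * emb (A.S x (\<lambda>a u. if a = ?j then A.cc j * A.W u y else 0))"
    by (simp only: B.S_scal S_twist)
  finally show ?case by (simp add: A.W_Cons cong: if_cong)
qed

lemma lookup_twisted: "Poly_Mapping.lookup (\<Phi> x) w = qt powi (- c w) * emb (Poly_Mapping.lookup x w)"
proof -
  have "Poly_Mapping.lookup (\<Phi> x) w = lin (\<lambda>b. if b = w then 1 else 0) (\<Phi> x)"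
    by (rule lin_delta[symmetric])
  also have "\<dots> = lin (\<lambda>a. qt powi (- c w) * (if a = w then 1 else 0)) (ext_scal x)"
    unfolding twisted_def lin_plin by (rule lin_cong) simp
  finally show ?thesis by (simp add: lin_fun_scal lin_delta)
qed

lemma keys_twisted [simp]: "Poly_Mapping.keys (\<Phi> x) = Poly_Mapping.keys x"
  by (auto simp: in_keys_iff lookup_twisted)

lemma twisted_simps [simp]: "\<Phi> 0 = 0" "\<Phi> (x + y) = \<Phi> x + \<Phi> y" "\<Phi> (x - y) = \<Phi> x - \<Phi> y"
  "\<Phi> (scal a x) = scal (emb a) (\<Phi> x)"
  "\<Phi> (Poly_Mapping.single w a) = Poly_Mapping.single w (qt powi (- c w) * emb a)"
  by (auto intro!: poly_mapping_eqI
      simp: lookup_twisted lookup_add lookup_minus lookup_single when_def distrib_left right_diff_distrib)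

lemma twisted_sum: "\<Phi> (sum f I) = (\<Sum>i\<in>I. \<Phi> (f i))"
  by (induction I rule: infinite_finite_induct) auto

lemma twisted_one: "\<Phi> 1 = 1"
  unfolding single_one[symmetric] by (simp del: single_one)

lemma homog_twisted [simp]: "homog \<nu> (\<Phi> x) \<longleftrightarrow> homog \<nu> x"
  by (simp add: homog_def)

lemma hcomp_twisted: "B.hcomp \<nu> (\<Phi> x) = \<Phi> (A.hcomp \<nu> x)"
  by (rule poly_mapping_eqI) (simp add: B.lookup_hcomp A.lookup_hcomp lookup_twisted)

text \<open>For words of fixed degrees the correction in \<open>twist_exp_add\<close> is the same
  for all terms and can be pulled out as a scalar.\<close>

lemma twisted_mult:
  assumes "homog \<tau> x" "homog \<omega> y"
  shows "\<Phi> x * \<Phi> y = scal (qt powi sq_form \<Omega> \<tau> \<omega>) (\<Phi> (x * y))"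
proof (rule lin_ext)
  fix F
  have "lin F (\<Phi> x * \<Phi> y) = lin (\<lambda>a. lin (\<lambda>b. qt powi (- c a) * (qt powi (- c b) * F (a + b))) (ext_scal y)) (ext_scal x)"
    by (simp add: lin_times twisted_def lin_fun_scal)
  also have "\<dots> = lin (\<lambda>a. lin (\<lambda>b. qt powi sq_form \<Omega> \<tau> \<omega> * (qt powi (- c (a + b)) * F (a + b))) (ext_scal y)) (ext_scal x)"
  proof (intro lin_cong)
    fix a b assume "a \<in> Poly_Mapping.keys (ext_scal x)" "b \<in> Poly_Mapping.keys (ext_scal y)"
    then have "deg a = \<tau>" "deg b = \<omega>" using assms by (auto simp: homog_def)
    then have "- c a + - c b = sq_form \<Omega> \<tau> \<omega> + - c (a + b)" by (simp add: twist_exp_add)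
    then have "qt powi (- c a) * qt powi (- c b) = qt powi sq_form \<Omega> \<tau> \<omega> * qt powi (- c (a + b))"
      by (simp only: qt_powi_add[symmetric])
    then show "qt powi (- c a) * (qt powi (- c b) * F (a + b)) = qt powi sq_form \<Omega> \<tau> \<omega> * (qt powi (- c (a + b)) * F (a + b))"
      by (simp only: mult.assoc[symmetric])
  qed
  also have "\<dots> = lin F (scal (qt powi sq_form \<Omega> \<tau> \<omega>) (\<Phi> (x * y)))"
    by (simp add: twisted_def ext_scal_mult lin_times lin_fun_scal)
  finally show "lin F (\<Phi> x * \<Phi> y) = lin F (scal (qt powi sq_form \<Omega> \<tau> \<omega>) (\<Phi> (x * y)))" .
qed

text \<open>Rescaling the first argument cancels its share of the exponent. The remaining power of t
  depends only on the test word and is invertible, so the rescaling preserves and reflects the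
  radical.\<close>

lemma lin_W_twisted: "lin (\<lambda>a. B.W a w) (\<Phi> x) = qt powi c w * emb (lin (\<lambda>a. A.W a w) x)"
proof -
  have "lin (\<lambda>a. B.W a w) (\<Phi> x) = lin (\<lambda>a. qt powi (- c a) * B.W a w) (ext_scal x)"
    by (simp add: twisted_def)
  also have "\<dots> = lin (\<lambda>a. qt powi c w * emb (A.W a w)) (ext_scal x)"
  proof (rule lin_cong)
    fix a
    have "qt powi (- c a) * qt powi (c a + c w) = qt powi c w" by (simp flip: qt_powi_add)
    then show "qt powi (- c a) * B.W a w = qt powi c w * emb (A.W a w)"
      by (simp add: W_twist flip: mult.assoc)
  qed
  finally show ?thesis by (simp add: lin_fun_scal lin_ext_scal)
qed

section \<open>Expansions in powers of t, the radical and denominators\<close>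

subsection \<open>Laurent polynomials in \<open>t\<close> with coefficients in the algebra over \<open>\<rat>(v)\<close>\<close>

text \<open>A finitely supported family stands for a Laurent polynomial in t with coefficients over
  Q(v). Not every element over Q(v,t) has this form, since its coefficients may have denominators
  involving t.\<close>

definition expand :: "(int \<Rightarrow>\<^sub>0 ('i, Qv) free_alg) \<Rightarrow> ('i, Qvt) free_alg" where
  "expand xs = (\<Sum>n\<in>Poly_Mapping.keys xs. scal (qt powi n) (\<Phi> (Poly_Mapping.lookup xs n)))"

lemma expand_zero [simp]: "expand 0 = 0"
  by (simp add: expand_def)

lemma expand_add [simp]: "expand (xs + ys) = expand xs + expand ys"
  unfolding expand_def by (rule setsum_keys_plus_distrib) (auto simp: scal_add)

lemma expand_single [simp]: "expand (Poly_Mapping.single n x) = scal (qt powi n) (\<Phi> x)"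
  by (simp add: expand_def)

text \<open>Up to a power of t, pairing with a word gives a Laurent polynomial in t over Q(v), and
  by \<open>qt_independent\<close> it vanishes only if all its coefficients do.\<close>

lemma rad_expand: "expand xs \<in> B.rad \<longleftrightarrow> (\<forall>n. Poly_Mapping.lookup xs n \<in> A.rad)"
proof -
  let ?L = "\<lambda>w n. lin (\<lambda>a. A.W a w) (Poly_Mapping.lookup xs n)"
  have e: "lin (\<lambda>a. B.W a w) (expand xs) = qt powi c w * (\<Sum>n\<in>Poly_Mapping.keys xs. qt powi n * emb (?L w n))" for w
    by (simp add: expand_def lin_W_twisted sum_distrib_left mult_ac)
  show ?thesis
  proof
    assume "expand xs \<in> B.rad"
    then have "(\<Sum>n\<in>Poly_Mapping.keys xs. qt powi n * emb (?L w n)) = 0" for w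
      using e[of w] by (simp add: B.radical_iff)
    then have "?L w n = 0" if "n \<in> Poly_Mapping.keys xs" for w n
      using qt_independent[of "Poly_Mapping.keys xs" "?L w" n] that by auto
    then show "\<forall>n. Poly_Mapping.lookup xs n \<in> A.rad"
      by (metis A.radical_iff A.rad_zero in_keys_iff)
  next
    assume "\<forall>n. Poly_Mapping.lookup xs n \<in> A.rad"
    then show "expand xs \<in> B.rad" by (simp add: B.radical_iff e A.radical_iff)
  qed
qed

lemma rad_twisted: "x \<in> A.rad \<Longrightarrow> scal (qt powi n) (\<Phi> x) \<in> B.rad"
  using rad_expand[of "Poly_Mapping.single n x"] by (simp add: lookup_single when_def)

lemma expand_uminus [simp]: "expand (- xs) = - expand xs"
  using expand_add[of xs "- xs"] by (simp add: eq_neg_iff_add_eq_0 add.commute)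

lemma expand_sum: "expand (sum f I) = (\<Sum>i\<in>I. expand (f i))"
  by (induction I rule: infinite_finite_induct) auto

lemma expand_poly_scal: "scal (Fract p 1) (expand xs) \<in> range expand"
proof -
  have "scal (Fract p 1) (scal (qt powi n) (\<Phi> x)) \<in> range expand" for n x
  proof -
    have "Fract p 1 = (\<Sum>k\<le>Polynomial.degree p. qt ^ k * emb (coeff p k))"
      by (subst poly_as_sum_of_monoms[of p, symmetric]) (simp only: qt_power_emb Fract_sum)
    then have "scal (Fract p 1) (scal (qt powi n) (\<Phi> x))
      = (\<Sum>k\<le>Polynomial.degree p. scal (qt powi (int k + n)) (\<Phi> (scal (coeff p k) x)))"
      by (intro lin_ext) (simp add: sum_distrib_left sum_distrib_right qt_powi_add mult_ac)
    also have "\<dots> = expand (\<Sum>k\<le>Polynomial.degree p. Poly_Mapping.single (int k + n) (scal (coeff p k) x))"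
      by (simp add: expand_sum)
    finally show ?thesis by simp
  qed
  then show ?thesis
  proof (induction xs rule: pm_induct)
    case zero
    show ?case by (rule range_eqI[of _ _ 0]) simp
  next
    case (add xs ys)
    then obtain us vs where "scal (Fract p 1) (expand xs) = expand us" "scal (Fract p 1) (expand ys) = expand vs"
      by auto
    then have "scal (Fract p 1) (expand (xs + ys)) = expand (us + vs)" by (simp add: scal_add)
    then show ?case by (metis rangeI)
  qed simp
qed

text \<open>Reaches all elements over Q(v,t) from expansions, at the price of a scalar that is
  divided out again in \<open>comult_rad_B\<close>.\<close>

lemma clear_denominators: "\<exists>p xs. p \<noteq> 0 \<and> scal (Fract p 1) x = expand xs"
proof (induction x rule: pm_induct)
  case zero
  show ?case by (rule exI[of _ 1], rule exI[of _ 0]) simp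
next
  case (single w a)
  obtain p q where a: "a = Fract p q" "q \<noteq> 0" by (cases a) auto
  \<comment> \<open>The exponent \<open>c w\<close> undoes the rescaling of the word
    \<open>w\<close>.\<close>
  have "scal (Fract p 1) (expand (Poly_Mapping.single (c w) (Poly_Mapping.single w 1))) = Poly_Mapping.single w (Fract p 1)"
    by (simp flip: qt_powi_add)
  moreover have "Fract q 1 * a = Fract p 1" using a by (simp add: eq_fract)
  ultimately have "scal (Fract q 1) (Poly_Mapping.single w a) \<in> range expand"
    using expand_poly_scal[of p "Poly_Mapping.single (c w) (Poly_Mapping.single w 1)"] by simp
  then show ?case using a(2) by blast
next
  case (add x y)
  then obtain p xs q ys where p: "p \<noteq> 0" "scal (Fract p 1) x = expand xs" and q: "q \<noteq> 0" "scal (Fract q 1) y = expand ys"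
    by blast
  obtain us vs where u: "scal (Fract q 1) (expand xs) = expand us" "scal (Fract p 1) (expand ys) = expand vs"
    using expand_poly_scal by (metis rangeE)
  have "Fract (q * p) 1 = Fract q 1 * Fract p (1::Qv poly)" "Fract (q * p) 1 = Fract p 1 * Fract q (1::Qv poly)"
    by (simp_all add: mult.commute)
  then have "scal (Fract (q * p) 1) (x + y) = scal (Fract q 1) (scal (Fract p 1) x) + scal (Fract p 1) (scal (Fract q 1) y)"
    by (simp add: scal_add)
  then have "scal (Fract (q * p) 1) (x + y) = expand (us + vs)" using p q u by simp
  then show ?case using p q by (metis mult_eq_0_iff)
qed

lemma hcomp_expand:
  "B.hcomp \<nu> (expand xs) = expand (Poly_Mapping.map (A.hcomp \<nu>) xs)"
proof (induction xs rule: pm_induct)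
  case (single n x)
  then show ?case by (simp add: hcomp_twisted)
next
  case (add xs ys)
  have "Poly_Mapping.map (A.hcomp \<nu>) (xs + ys) = Poly_Mapping.map (A.hcomp \<nu>) xs + Poly_Mapping.map (A.hcomp \<nu>) ys"
    by (rule poly_mapping_eqI) (simp add: map.rep_eq lookup_add when_def, metis A.hcomp_simps(1,2))
  then show ?case using add by simp
next
  case zero
  have "Poly_Mapping.map (A.hcomp \<nu>) (0 :: int \<Rightarrow>\<^sub>0 _) = 0" by (rule poly_mapping_eqI) (simp add: map.rep_eq)
  then show ?case by simp
qed

end

section \<open>Integral forms and divided powers\<close>

subsection \<open>The integral form\<close>

context free_bialg
begin

abbreviation "intf \<equiv> int_form \<Omega> v t"

lemma int_form_pr: "X \<in> intf \<Longrightarrow> \<exists>x. X = pr x"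
proof (induction rule: int_form.induct)
  case (mult X Y)
  then show ?case using f_ring_simps(4) by metis
next
  case (add X Y)
  then show ?case using f_ring_simps(3) by metis
next
  case (smult a X)
  then show ?case using f_scal_pr by metis
qed (use f_ring_simps(1) in blast)+

lemma intf_add: "pr x \<in> intf \<Longrightarrow> pr y \<in> intf \<Longrightarrow> pr (x + y) \<in> intf"
  using int_form.add f_ring_simps(3) by metis

lemma intf_mult: "pr x \<in> intf \<Longrightarrow> pr y \<in> intf \<Longrightarrow> pr (x * y) \<in> intf"
  using int_form.mult f_ring_simps(4) by metis

lemma intf_scal: "a \<in> laurent v t \<Longrightarrow> pr x \<in> intf \<Longrightarrow> pr (scal a x) \<in> intf"
  using int_form.smult f_scal_pr by metis

lemma intf_one: "pr 1 \<in> intf"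
  using int_form.one f_ring_simps(1) by metis

lemma intf_zero: "pr 0 \<in> intf"
  using intf_scal[OF laurent_zero intf_one] by simp

lemma intf_sum: "(\<And>i. i \<in> I \<Longrightarrow> pr (f i) \<in> intf) \<Longrightarrow> pr (sum f I) \<in> intf"
  by (induction I rule: infinite_finite_induct) (auto intro: intf_zero intf_add)

lemma divided_power: "pr (scal (inverse (qfact (sub_i \<Omega> v i) (sub_i \<Omega> t i) n)) (\<theta> i ^ n)) \<in> intf"
  by (rule int_form.divided_power)

lemma theta_power: "\<theta> i ^ n = (Poly_Mapping.single (Word (replicate n i)) 1 :: ('i, 'k) free_alg)"
proof (induction n)
  case 0
  then show ?case by (simp add: zero_word_def[symmetric])
next
  case (Suc n)
  then show ?case by (simp add: \<theta>_def mult_single plus_word_def)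
qed

lemma hcomp_sum: "hcomp \<nu> (sum f I) = (\<Sum>i\<in>I. hcomp \<nu> (f i))"
  by (induction I rule: infinite_finite_induct) auto

lemma homog_sum:
  fixes f :: "'z \<Rightarrow> ('i, 'k) free_alg"
  shows "(\<And>i. i \<in> I \<Longrightarrow> homog \<nu> (f i)) \<Longrightarrow> homog \<nu> (sum f I)"
  by (induction I rule: infinite_finite_induct) (auto intro: homog_simps)

lemma hcomp_mult:
  "hcomp \<nu> (x * y) = (\<Sum>\<tau>\<in>deg ` Poly_Mapping.keys x. \<Sum>\<omega>\<in>deg ` Poly_Mapping.keys y.
     if \<tau> + \<omega> = \<nu> then hcomp \<tau> x * hcomp \<omega> y else 0)"
proof -
  have "hcomp \<nu> (x * y) = hcomp \<nu> ((\<Sum>\<tau>\<in>deg ` Poly_Mapping.keys x. hcomp \<tau> x) * (\<Sum>\<omega>\<in>deg ` Poly_Mapping.keys y. hcomp \<omega> y))"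
    by (simp flip: hcomp_sum_degrees)
  also have "\<dots> = (\<Sum>\<tau>\<in>deg ` Poly_Mapping.keys x. \<Sum>\<omega>\<in>deg ` Poly_Mapping.keys y. hcomp \<nu> (hcomp \<tau> x * hcomp \<omega> y))"
    by (simp add: sum_product hcomp_sum)
  finally show ?thesis
    by (simp add: hcomp_homog[OF homog_mult[OF homog_hcomp homog_hcomp]])
qed

lemma pr_hcomp: "pr x = pr y \<Longrightarrow> pr (hcomp \<nu> x) = pr (hcomp \<nu> y)"
  using rad_hcomp[of "x - y" \<nu>] by (simp add: pr_eq_iff)

lemma homog_single: "homog (deg w) (Poly_Mapping.single w (a :: 'k))"
  by (simp add: homog_def)

text \<open>The generators are homogeneous, so the integral form is graded. The representative
  \<open>x\<close> can be arbitrary because the radical is graded as well.\<close>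

lemma int_form_hcomp: "X \<in> intf \<Longrightarrow> X = pr x \<Longrightarrow> pr (hcomp \<nu> x) \<in> intf"
proof (induction arbitrary: x \<nu> rule: int_form.induct)
  case one
  then have "pr (hcomp \<nu> x) = pr (hcomp \<nu> 1)" using pr_hcomp f_ring_simps(1) by metis
  moreover have "hcomp \<nu> 1 = (if 0 = \<nu> then 1 else 0)"
    using hcomp_homog[of 0 1 \<nu>] by (simp add: homog_def)
  ultimately show ?case using intf_one intf_zero by auto
next
  case (divided_power i n)
  let ?y = "scal (inverse (qfact (sub_i \<Omega> v i) (sub_i \<Omega> t i) n)) (\<theta> i ^ n)"
  have "homog (deg (Word (replicate n i))) ?y"
    by (simp add: theta_power homog_single)
  then have "hcomp \<nu> ?y = ?y \<or> hcomp \<nu> ?y = 0" using hcomp_homog by metis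
  moreover have "pr (hcomp \<nu> x) = pr (hcomp \<nu> ?y)" using divided_power pr_hcomp by metis
  ultimately show ?case using int_form.divided_power[of \<Omega> v t i n] intf_zero by auto
next
  case (mult X Y)
  obtain y z where yz: "X = pr y" "Y = pr z" using mult.hyps int_form_pr by metis
  then have "pr (hcomp \<nu> x) = pr (hcomp \<nu> (y * z))" using mult.prems pr_hcomp f_ring_simps(4) by metis
  moreover have "pr (hcomp \<nu> (y * z)) \<in> intf"
    unfolding hcomp_mult
  proof (intro intf_sum)
    fix \<tau> \<omega>
    show "pr (if \<tau> + \<omega> = \<nu> then hcomp \<tau> y * hcomp \<omega> z else 0) \<in> intf"
      using mult.IH yz intf_mult intf_zero by auto
  qed
  ultimately show ?case by simp
next
  case (add X Y)
  obtain y z where yz: "X = pr y" "Y = pr z" using add.hyps int_form_pr by metis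
  then have "pr (hcomp \<nu> x) = pr (hcomp \<nu> (y + z))" using add.prems pr_hcomp f_ring_simps(3) by metis
  then show ?case using add.IH yz intf_add by simp
next
  case (smult a X)
  obtain y where y: "X = pr y" using smult.hyps int_form_pr by metis
  then have "pr (hcomp \<nu> x) = pr (hcomp \<nu> (scal a y))" using smult.prems pr_hcomp f_scal_pr by metis
  then show ?case using smult y intf_scal by simp
qed

end

context twisting
begin

text \<open>The k-th factor of the quantum factorial contributes (k - 1) times the diagonal entry of
  the datum to the exponent of t, and [i,i] equals that same entry; summed up to n, both give the
  exponent of the word i...i.\<close>

lemma qfact_twist:
  "qfact (sub_i \<Omega> (emb qv) i) (sub_i \<Omega> qt i) n
    = qt powi c (Word (replicate n i)) * emb (qfact (sub_i \<Omega> qv i) (sub_i \<Omega> 1 i) n)"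
proof (induction n)
  case 0
  then show ?case by (simp add: qfact_def twist_exp_def)
next
  case (Suc n)
  have "sq_form \<Omega> (deg (Word [i])) (deg (Word (replicate n i))) = int n * \<Omega> i i"
  proof (induction n)
    case 0
    have "Word (replicate 0 i) = 0" by (simp add: zero_word_def)
    then show ?case by (simp only: deg_zero form_zero of_nat_0 mult_zero_left)
  next
    case (Suc n)
    have "sq_form \<Omega> (deg (Word [i])) (deg (Word [i]))
      = (\<Sum>k\<in>UNIV. \<Sum>j\<in>UNIV. if k = i then (if j = i then \<Omega> i i else 0) else 0)"
      unfolding sq_form_def by (intro sum.cong) (auto simp: deg_def)
    moreover have "(\<Sum>j\<in>UNIV. if k = i then (if j = i then \<Omega> i i else 0) else 0) = (if k = i then \<Omega> i i else 0)" for k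
      by simp
    ultimately have "sq_form \<Omega> (deg (Word [i])) (deg (Word [i])) = \<Omega> i i"
      by simp
    moreover have "Word (replicate (Suc n) i) = Word [i] + Word (replicate n i)" by (simp add: plus_word_def)
    ultimately show ?case using Suc by (simp add: deg_add sq_add distrib_right del: plus_fun_apply)
  qed
  then have c: "c (Word (replicate (Suc n) i)) = c (Word (replicate n i)) + \<Omega> i i * int n"
    by (simp add: twist_exp_def)
  have "qint (sub_i \<Omega> (emb qv) i) (sub_i \<Omega> qt i) (Suc n) = qt powi (\<Omega> i i * int n) * emb (qint (sub_i \<Omega> qv i) (sub_i \<Omega> 1 i) (Suc n))"
    by (simp add: qint_def sub_i_def power_int_mult)
  then show ?case using Suc by (simp add: qfact_def c[simplified] qt_powi_add prod.nat_ivl_Suc' mult_ac)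
qed

lemma twisted_divided_power:
  "\<Phi> (scal (inverse (qfact (sub_i \<Omega> qv i) (sub_i \<Omega> 1 i) n)) (\<theta> i ^ n))
    = scal (inverse (qfact (sub_i \<Omega> (emb qv) i) (sub_i \<Omega> qt i) n)) (\<theta> i ^ n)"
  unfolding qfact_twist
  by (simp add: A.theta_power B.theta_power power_int_minus mult.commute)

lemma twisted_sum_degrees: "\<Phi> x = (\<Sum>\<nu>\<in>deg ` Poly_Mapping.keys x. \<Phi> (A.hcomp \<nu> x))"
  using arg_cong[OF A.hcomp_sum_degrees[of x], of \<Phi>] unfolding twisted_sum .

lemma twisted_hcomp_mult:
  "\<Phi> (A.hcomp \<nu> (x * y)) = (\<Sum>\<tau>\<in>deg ` Poly_Mapping.keys x. \<Sum>\<omega>\<in>deg ` Poly_Mapping.keys y.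
     if \<tau> + \<omega> = \<nu> then scal (qt powi (- sq_form \<Omega> \<tau> \<omega>)) (\<Phi> (A.hcomp \<tau> x) * \<Phi> (A.hcomp \<omega> y)) else 0)"
  unfolding A.hcomp_mult twisted_sum twisted_mult[OF A.homog_hcomp A.homog_hcomp]
  by (intro sum.cong) (auto simp flip: qt_powi_add)

lemma B_pr_cong: "A.pr x = A.pr y \<Longrightarrow> B.pr (scal (qt powi n) (\<Phi> x)) = B.pr (scal (qt powi n) (\<Phi> y))"
  using rad_twisted[of "x - y" n] by (simp add: A.pr_eq_iff B.pr_eq_iff scal_diff)

text \<open>The rescaling respects products only on homogeneous elements and up to powers of t,
  which are units of the coefficient ring; so the induction carries all homogeneous components at
  once.\<close>

lemma int_form_twisted: "X \<in> A.intf \<Longrightarrow> X = A.pr x \<Longrightarrow> B.pr (\<Phi> (A.hcomp \<nu> x)) \<in> B.intf"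
proof (induction arbitrary: x \<nu> rule: int_form.induct)
  case one
  then have "B.pr (\<Phi> (A.hcomp \<nu> x)) = B.pr (\<Phi> (A.hcomp \<nu> 1))"
    using B_pr_cong[of _ _ 0] A.pr_hcomp A.f_ring_simps(1) by (metis power_int_0_right scal_simps(3))
  moreover have "A.hcomp \<nu> 1 = (if 0 = \<nu> then 1 else 0)"
    using A.hcomp_homog[of 0 1 \<nu>] by (simp add: homog_def)
  ultimately show ?case using B.intf_one B.intf_zero by (auto simp: twisted_one)
next
  case (divided_power i n)
  let ?y = "scal (inverse (qfact (sub_i \<Omega> qv i) (sub_i \<Omega> 1 i) n)) (\<theta> i ^ n)"
  have "homog (deg (Word (replicate n i))) ?y"
    by (simp add: A.theta_power A.homog_single)
  then have "A.hcomp \<nu> ?y = ?y \<or> A.hcomp \<nu> ?y = 0" using A.hcomp_homog by metis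
  moreover have "B.pr (\<Phi> (A.hcomp \<nu> x)) = B.pr (\<Phi> (A.hcomp \<nu> ?y))"
    using divided_power A.pr_hcomp B_pr_cong[of _ _ 0] by (metis power_int_0_right scal_simps(3))
  moreover have "B.pr (\<Phi> ?y) \<in> B.intf"
    unfolding twisted_divided_power by (rule B.divided_power)
  ultimately show ?case by (metis B.intf_zero twisted_simps(1))
next
  case (mult X Y)
  obtain y z where yz: "X = A.pr y" "Y = A.pr z" using mult.hyps A.int_form_pr by metis
  then have "B.pr (\<Phi> (A.hcomp \<nu> x)) = B.pr (\<Phi> (A.hcomp \<nu> (y * z)))"
    using mult.prems A.pr_hcomp A.f_ring_simps(4) B_pr_cong[of _ _ 0] by (metis power_int_0_right scal_simps(3))
  moreover have "B.pr (\<Phi> (A.hcomp \<nu> (y * z))) \<in> B.intf"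
    unfolding twisted_hcomp_mult
  proof (intro B.intf_sum)
    fix \<tau> \<omega>
    show "B.pr (if \<tau> + \<omega> = \<nu> then scal (qt powi (- sq_form \<Omega> \<tau> \<omega>)) (\<Phi> (A.hcomp \<tau> y) * \<Phi> (A.hcomp \<omega> z)) else 0) \<in> B.intf"
      using B.intf_mult[OF mult.IH(1)[OF yz(1)] mult.IH(2)[OF yz(2)], of \<tau> \<omega>]
      by (auto intro: B.intf_scal laurent_powi(2) B.intf_zero)
  qed
  ultimately show ?case by simp
next
  case (add X Y)
  obtain y z where yz: "X = A.pr y" "Y = A.pr z" using add.hyps A.int_form_pr by metis
  then have "B.pr (\<Phi> (A.hcomp \<nu> x)) = B.pr (\<Phi> (A.hcomp \<nu> (y + z)))"
    using add.prems A.pr_hcomp A.f_ring_simps(3) B_pr_cong[of _ _ 0] by (metis power_int_0_right scal_simps(3))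
  then show ?case using add.IH yz B.intf_add by simp
next
  case (smult a X)
  obtain y where y: "X = A.pr y" using smult.hyps A.int_form_pr by metis
  then have "B.pr (\<Phi> (A.hcomp \<nu> x)) = B.pr (\<Phi> (A.hcomp \<nu> (scal a y)))"
    using smult.prems A.pr_hcomp A.f_scal_pr B_pr_cong[of _ _ 0] by (metis power_int_0_right scal_simps(3))
  then show ?case using smult y B.intf_scal emb_laurent by simp
qed

text \<open>The expansions whose coefficients are integral over Q(v) contain the generators and are
  closed under products, sums and scalars, so they exhaust the integral form.\<close>

lemma int_form_B_expand:
  assumes "X \<in> B.intf"
  shows "\<exists>xs. X = B.pr (expand xs) \<and> (\<forall>n. A.pr (Poly_Mapping.lookup xs n) \<in> A.intf)"
proof -
  define G where "G = {expand xs |xs. \<forall>n. A.pr (Poly_Mapping.lookup xs n) \<in> A.intf}"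
  have gen: "scal (qt powi n) (\<Phi> x) \<in> G" if "A.pr x \<in> A.intf" for n x
    unfolding G_def
    by (rule CollectI, rule exI[of _ "Poly_Mapping.single n x"])
      (auto simp: lookup_single when_def that A.intf_zero)
  have add: "x + y \<in> G" if xy: "x \<in> G" "y \<in> G" for x y
  proof -
    obtain xs ys where "x = expand xs" "y = expand ys" "\<forall>n. A.pr (Poly_Mapping.lookup xs n) \<in> A.intf"
      "\<forall>n. A.pr (Poly_Mapping.lookup ys n) \<in> A.intf" using xy unfolding G_def by blast
    then show ?thesis unfolding G_def
      by (intro CollectI exI[of _ "xs + ys"]) (auto simp: lookup_add A.intf_add)
  qed
  have zero: "0 \<in> G" using gen[OF A.intf_zero] by simp
  have sum: "sum f I \<in> G" if "\<And>i. i \<in> I \<Longrightarrow> f i \<in> G" for f :: "'z \<Rightarrow> _" and I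
    using that by (induction I rule: infinite_finite_induct) (auto intro: zero add)
  \<comment> \<open>An induction principle for \<open>G\<close>: single powers of t, zero and sums
    suffice.\<close>
  have G_gen: "P x" if x: "x \<in> G" and g: "\<And>n x. A.pr x \<in> A.intf \<Longrightarrow> P (scal (qt powi n) (\<Phi> x))"
    and "P 0" "\<And>x y. P x \<Longrightarrow> P y \<Longrightarrow> P (x + y)" for P x
  proof -
    obtain xs where xs: "x = expand xs" "\<forall>n. A.pr (Poly_Mapping.lookup xs n) \<in> A.intf" using x unfolding G_def by blast
    have "P (\<Sum>n\<in>N. scal (qt powi n) (\<Phi> (Poly_Mapping.lookup xs n)))" for N
      by (induction N rule: infinite_finite_induct) (use g xs that in auto)
    then show ?thesis by (simp add: xs expand_def)
  qed
  have mult: "x * y \<in> G" if "x \<in> G" "y \<in> G" for x y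
    using that(1)
  proof (rule G_gen)
    fix n x assume x: "A.pr x \<in> A.intf"
    show "scal (qt powi n) (\<Phi> x) * y \<in> G"
      using that(2)
    proof (rule G_gen)
      fix m y assume y: "A.pr y \<in> A.intf"
      \<comment> \<open>Both factors are split by degree, since the power of t produced by
        \<open>twisted_mult\<close> depends on the pair of degrees.\<close>
      have "\<Phi> x * \<Phi> y = (\<Sum>\<tau>\<in>deg ` Poly_Mapping.keys x. \<Sum>\<omega>\<in>deg ` Poly_Mapping.keys y. \<Phi> (A.hcomp \<tau> x) * \<Phi> (A.hcomp \<omega> y))"
        by (subst twisted_sum_degrees[of x], subst twisted_sum_degrees[of y]) (simp add: sum_product)
      then have "scal (qt powi n) (\<Phi> x) * scal (qt powi m) (\<Phi> y) = (\<Sum>\<tau>\<in>deg ` Poly_Mapping.keys x. \<Sum>\<omega>\<in>deg ` Poly_Mapping.keys y.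
          scal (qt powi (n + m + sq_form \<Omega> \<tau> \<omega>)) (\<Phi> (A.hcomp \<tau> x * A.hcomp \<omega> y)))"
        by (simp add: scal_mult_left scal_mult_right scal_sum twisted_mult[OF A.homog_hcomp A.homog_hcomp] qt_powi_add mult_ac)
      also have "\<dots> \<in> G"
        by (intro sum gen A.intf_mult) (use A.int_form_hcomp x y in auto)
      finally show "scal (qt powi n) (\<Phi> x) * scal (qt powi m) (\<Phi> y) \<in> G" .
    qed (auto simp: zero add distrib_left)
  qed (auto simp: zero add distrib_right)
  have smult: "scal a x \<in> G" if a: "a \<in> laurent (emb qv) qt" and x: "x \<in> G" for a x
    using a
  proof (induction rule: laurent_induct)
    case (monom k a b)
    show ?case
      using x
    proof (rule G_gen)
      fix n x assume x: "A.pr x \<in> A.intf"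
      have "scal (of_int k * emb qv powi a * qt powi b) (scal (qt powi n) (\<Phi> x))
        = scal (qt powi (b + n)) (\<Phi> (scal (of_int k * qv powi a) x))"
        by (simp add: qt_powi_add mult_ac)
      also have "\<dots> \<in> G"
        by (intro gen A.intf_scal x) (use laurent_monom[of k qv a 1 0] in simp)
      finally show "scal (of_int k * emb qv powi a * qt powi b) (scal (qt powi n) (\<Phi> x)) \<in> G" .
    qed (auto simp: zero add scal_add)
  qed (auto simp: zero add scal_add_left)
  have "\<exists>x\<in>G. X = B.pr x"
    using assms
  proof (induction rule: int_form.induct)
    case one
    then show ?case using gen[OF A.intf_one, of 0] by (auto simp: B.f_ring_simps twisted_one)
  next
    case (divided_power i n)
    then show ?case using gen[OF A.divided_power, of 0 i n] unfolding twisted_divided_power by auto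
  next
    case (mult X Y)
    then show ?case using \<open>\<And>x y. x \<in> G \<Longrightarrow> y \<in> G \<Longrightarrow> x * y \<in> G\<close> by (auto simp: B.f_ring_simps)
  next
    case (add X Y)
    then show ?case using \<open>\<And>x y. x \<in> G \<Longrightarrow> y \<in> G \<Longrightarrow> x + y \<in> G\<close> by (auto simp: B.f_ring_simps)
  next
    case (smult a X)
    then show ?case using \<open>\<And>a x. a \<in> laurent (emb qv) qt \<Longrightarrow> x \<in> G \<Longrightarrow> scal a x \<in> G\<close> by (auto simp: B.f_scal_pr)
  qed
  then show ?thesis by (auto simp: G_def)
qed

definition good :: "('i \<Rightarrow> nat) \<Rightarrow> (int \<Rightarrow>\<^sub>0 ('i, Qv) free_alg) \<Rightarrow> bool" where
  "good \<nu> xs \<longleftrightarrow> (\<forall>n. A.pr (Poly_Mapping.lookup xs n) \<in> A.intf \<and> homog \<nu> (Poly_Mapping.lookup xs n))"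

text \<open>Taking homogeneous parts in the expansion from \<open>int_form_B_expand\<close> puts
  every coefficient into the given degree; the reverse inclusion comes from
  \<open>int_form_twisted\<close>.\<close>

lemma carrier_int_comp_B: "carrier (int_comp \<Omega> (emb qv) qt \<nu>) = {B.pr (expand xs) |xs. good \<nu> xs}"
proof (intro equalityI subsetI)
  fix X assume "X \<in> carrier (int_comp \<Omega> (emb qv) qt \<nu>)"
  then obtain y where X: "X \<in> B.intf" "X = B.pr y" "homog \<nu> y" by (auto simp: B.carrier_int_comp)
  obtain xs where xs: "X = B.pr (expand xs)" "\<forall>n. A.pr (Poly_Mapping.lookup xs n) \<in> A.intf"
    using int_form_B_expand[OF X(1)] by blast
  have "X = B.pr (B.hcomp \<nu> (expand xs))"
    using B.pr_hcomp[of y "expand xs" \<nu>] X xs B.homog_iff by metis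
  then have "X = B.pr (expand (Poly_Mapping.map (A.hcomp \<nu>) xs))" by (simp add: hcomp_expand)
  moreover have "good \<nu> (Poly_Mapping.map (A.hcomp \<nu>) xs)"
    using xs A.int_form_hcomp A.intf_zero by (auto simp: good_def map.rep_eq when_def A.homog_hcomp A.homog_simps(1))
  ultimately show "X \<in> {B.pr (expand xs) |xs. good \<nu> xs}" by blast
next
  fix X assume "X \<in> {B.pr (expand xs) |xs. good \<nu> xs}"
  then obtain xs where xs: "X = B.pr (expand xs)" "good \<nu> xs" by blast
  have "B.pr (scal (qt powi n) (\<Phi> (Poly_Mapping.lookup xs n))) \<in> B.intf" for n
    using xs(2) int_form_twisted[of "A.pr (Poly_Mapping.lookup xs n)" "Poly_Mapping.lookup xs n" \<nu>]
    by (auto simp: good_def A.homog_iff intro!: B.intf_scal laurent_powi)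
  then have "X \<in> B.intf" unfolding xs(1) expand_def by (intro B.intf_sum)
  moreover have "homog \<nu> (expand xs)"
    unfolding expand_def
    by (rule B.homog_sum) (use xs(2) in \<open>auto simp: good_def intro: B.homog_simps\<close>)
  ultimately show "X \<in> carrier (int_comp \<Omega> (emb qv) qt \<nu>)" using xs(1) by (auto simp: B.carrier_int_comp)
qed

end

section \<open>Well-definedness of the coproduct on the quotient over Q(v,t)\<close>

subsection \<open>The comultiplication of the quotient\<close>

context free_bialg
begin

abbreviation "trels \<tau> \<omega> \<equiv> tensor_rels (subring_of UNIV) (f_comp \<Omega> v t \<tau>) (f_comp \<Omega> v t \<omega>)"

definition pairs :: "('i \<Rightarrow> nat) \<Rightarrow> ('i \<Rightarrow> nat) \<Rightarrow> ('i word \<times> 'i word) set" where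
  "pairs \<tau> \<omega> = {p. deg (fst p) = \<tau> \<and> deg (snd p) = \<omega>}"

definition tterm :: "('i, 'k) free_alg2 \<Rightarrow> 'i word \<times> 'i word
    \<Rightarrow> (('i, 'k) free_alg set \<times> ('i, 'k) free_alg set \<Rightarrow>\<^sub>0 int)" where
  "tterm z p = frag_of (pr (Poly_Mapping.single (fst p) (Poly_Mapping.lookup z p)), pr (Poly_Mapping.single (snd p) 1))"

text \<open>Kept as a formal integer combination of pairs to match \<open>f_comult_comp\<close>; it
  is additive only modulo the tensor relations.\<close>

definition tpart :: "('i \<Rightarrow> nat) \<Rightarrow> ('i \<Rightarrow> nat) \<Rightarrow> ('i, 'k) free_alg2
    \<Rightarrow> (('i, 'k) free_alg set \<times> ('i, 'k) free_alg set \<Rightarrow>\<^sub>0 int)" where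
  "tpart \<tau> \<omega> z = (\<Sum>p\<in>Poly_Mapping.keys z \<inter> pairs \<tau> \<omega>. tterm z p)"

lemma f_comult_comp_eq:
  "f_comult_comp \<Omega> v t \<tau> \<omega> X = (\<Union>x\<in>X. cls (trels \<tau> \<omega>) (tpart \<tau> \<omega> (comult \<Omega> v t x)))"
proof -
  have "{(a, b) \<in> Poly_Mapping.keys z. deg a = \<tau> \<and> deg b = \<omega>} = Poly_Mapping.keys z \<inter> pairs \<tau> \<omega>" for z :: "('i, 'k) free_alg2"
    by (auto simp: pairs_def)
  then show ?thesis
    by (simp add: f_comult_comp_def tensor_pair.tensor_class_eq[OF tensor_pair_f_comp] tpart_def tterm_def case_prod_beta)
qed

lemma pr_single_in_f_comp: "deg w = \<nu> \<Longrightarrow> pr (Poly_Mapping.single w a) \<in> carrier (f_comp \<Omega> v t \<nu>)"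
  using homog_single[of w a] by (auto simp: carrier_f_comp)

text \<open>Writing 0 = 0 + 0 in the first factor makes the additivity relation read minus this
  pair.\<close>

lemma trels_zero_left:
  assumes "Y \<in> carrier (f_comp \<Omega> v t \<omega>)"
  shows "frag_of (pr 0, Y) \<in> spn (trels \<tau> \<omega>)"
proof -
  have 0: "pr 0 \<in> carrier (f_comp \<Omega> v t \<tau>)" using homog_simps(1) by (auto simp: carrier_f_comp)
  from tensor_pair.tensor_add_left[OF tensor_pair_f_comp 0 0 assms]
  have "- frag_of (pr 0, Y) \<in> spn (trels \<tau> \<omega>)" by (simp add: f_comp_simps)
  then show ?thesis using spn_uminus by fastforce
qed

text \<open>Cancellation changes the set of keys, so sums for different elements run over different
  sets. Extra pairs have coefficient zero and lie in the relations, which permits a common index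
  set.\<close>

lemma tpart_superset:
  assumes K: "finite K" "Poly_Mapping.keys z \<inter> pairs \<tau> \<omega> \<subseteq> K" "K \<subseteq> pairs \<tau> \<omega>"
  shows "tpart \<tau> \<omega> z - (\<Sum>p\<in>K. tterm z p) \<in> spn (trels \<tau> \<omega>)"
proof -
  have "tpart \<tau> \<omega> z - (\<Sum>p\<in>K. tterm z p) = - (\<Sum>p\<in>K - (Poly_Mapping.keys z \<inter> pairs \<tau> \<omega>). tterm z p)"
    unfolding tpart_def by (subst sum.subset_diff[OF K(2,1)]) simp
  moreover have "tterm z p \<in> spn (trels \<tau> \<omega>)" if "p \<in> K - (Poly_Mapping.keys z \<inter> pairs \<tau> \<omega>)" for p
    using that K(3) by (auto simp: tterm_def in_keys_iff pairs_def intro!: trels_zero_left pr_single_in_f_comp)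
  ultimately show ?thesis by (metis spn_uminus spn_sum)
qed

lemma tpart_zero [simp]: "tpart \<tau> \<omega> 0 = 0"
  by (simp add: tpart_def)

lemma tpart_add: "tpart \<tau> \<omega> (z + z') - (tpart \<tau> \<omega> z + tpart \<tau> \<omega> z') \<in> spn (trels \<tau> \<omega>)"
proof -
  define K where "K = (Poly_Mapping.keys z \<union> Poly_Mapping.keys z') \<inter> pairs \<tau> \<omega>"
  have K: "finite K" "K \<subseteq> pairs \<tau> \<omega>" "Poly_Mapping.keys (z + z') \<inter> pairs \<tau> \<omega> \<subseteq> K"
    "Poly_Mapping.keys z \<inter> pairs \<tau> \<omega> \<subseteq> K" "Poly_Mapping.keys z' \<inter> pairs \<tau> \<omega> \<subseteq> K"
    using keys_add[of z z'] by (auto simp: K_def)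
  have "(\<Sum>p\<in>K. tterm (z + z') p) - ((\<Sum>p\<in>K. tterm z p) + (\<Sum>p\<in>K. tterm z' p))
    = (\<Sum>p\<in>K. tterm (z + z') p - (tterm z p + tterm z' p))"
    by (simp add: sum_subtractf sum.distrib)
  also have "\<dots> \<in> spn (trels \<tau> \<omega>)"
  proof (rule spn_sum)
    fix p assume "p \<in> K"
    then have p: "deg (fst p) = \<tau>" "deg (snd p) = \<omega>" using K(2) by (auto simp: pairs_def)
    show "tterm (z + z') p - (tterm z p + tterm z' p) \<in> spn (trels \<tau> \<omega>)"
      using tensor_pair.tensor_add_left[OF tensor_pair_f_comp
          pr_single_in_f_comp[OF p(1), of "Poly_Mapping.lookup z p"]
          pr_single_in_f_comp[OF p(1), of "Poly_Mapping.lookup z' p"] pr_single_in_f_comp[OF p(2), of 1]]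
      by (simp add: f_comp_simps tterm_def lookup_add single_add)
  qed
  finally have "(\<Sum>p\<in>K. tterm (z + z') p) - ((\<Sum>p\<in>K. tterm z p) + (\<Sum>p\<in>K. tterm z' p)) \<in> spn (trels \<tau> \<omega>)" .
  from spn_diff_trans[OF tpart_superset[OF K(1,3,2)] this]
    spn_diff_add[OF tpart_superset[OF K(1,4,2)] tpart_superset[OF K(1,5,2)]]
  show ?thesis by (blast intro: spn_diff_trans spn_diff_sym)
qed

lemma tpart_sum: "tpart \<tau> \<omega> (sum f I) - (\<Sum>i\<in>I. tpart \<tau> \<omega> (f i)) \<in> spn (trels \<tau> \<omega>)"
proof (induction I rule: infinite_finite_induct)
  case (insert i I)
  have "tpart \<tau> \<omega> (f i) + tpart \<tau> \<omega> (sum f I) - (tpart \<tau> \<omega> (f i) + (\<Sum>i\<in>I. tpart \<tau> \<omega> (f i))) \<in> spn (trels \<tau> \<omega>)"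
    using insert by simp
  with spn_diff_trans[OF tpart_add this] insert show ?case by simp
qed (simp_all add: spn_zero)

text \<open>Scalar multiplication on the tensor product over the field, placed on the first factor;
  it serves to divide by a denominator.\<close>

definition tscal :: "'k \<Rightarrow> (('i, 'k) free_alg set \<times> ('i, 'k) free_alg set \<Rightarrow>\<^sub>0 int)
    \<Rightarrow> (('i, 'k) free_alg set \<times> ('i, 'k) free_alg set \<Rightarrow>\<^sub>0 int)" where
  "tscal a = frag_extend (\<lambda>p. frag_of (f_scal \<Omega> v t a (fst p), snd p))"

lemma tscal_spn:
  assumes "p \<in> spn (trels \<tau> \<omega>)"
  shows "tscal a p \<in> spn (trels \<tau> \<omega>)"
  unfolding tscal_def
proof (rule tensor_pair.rels_hom[OF tensor_pair_f_comp assms])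
  note tp = tensor_pair_f_comp[of \<tau> \<omega>]
  have sc: "f_scal \<Omega> v t a X \<in> carrier (f_comp \<Omega> v t \<nu>)" if "X \<in> carrier (f_comp \<Omega> v t \<nu>)" for X \<nu>
    using that by (auto simp: carrier_f_comp f_scal_pr homog_simps)
  have scx: "f_scal \<Omega> v t a (x \<oplus>\<^bsub>f_comp \<Omega> v t \<tau>\<^esub> x') = f_scal \<Omega> v t a x \<oplus>\<^bsub>f_comp \<Omega> v t \<tau>\<^esub> f_scal \<Omega> v t a x'"
    "f_scal \<Omega> v t a (b \<odot>\<^bsub>f_comp \<Omega> v t \<tau>\<^esub> x) = b \<odot>\<^bsub>f_comp \<Omega> v t \<tau>\<^esub> f_scal \<Omega> v t a x"
    if "x \<in> carrier (f_comp \<Omega> v t \<tau>)" "x' \<in> carrier (f_comp \<Omega> v t \<tau>)" for x x' b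
    using that by (auto simp: carrier_f_comp f_scal_pr f_comp_simps scal_add mult.commute)
  show "frag_of (f_scal \<Omega> v t a (fst (x \<oplus>\<^bsub>f_comp \<Omega> v t \<tau>\<^esub> x', y)), snd (x \<oplus>\<^bsub>f_comp \<Omega> v t \<tau>\<^esub> x', y)) -
       (frag_of (f_scal \<Omega> v t a (fst (x, y)), snd (x, y)) + frag_of (f_scal \<Omega> v t a (fst (x', y)), snd (x', y))) \<in> spn (trels \<tau> \<omega>)"
    if "x \<in> carrier (f_comp \<Omega> v t \<tau>)" "x' \<in> carrier (f_comp \<Omega> v t \<tau>)" "y \<in> carrier (f_comp \<Omega> v t \<omega>)" for x x' y
    using tensor_pair.tensor_add_left[OF tp sc[OF that(1)] sc[OF that(2)] that(3)] scx(1) that by simp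
  show "frag_of (f_scal \<Omega> v t a (fst (x, y \<oplus>\<^bsub>f_comp \<Omega> v t \<omega>\<^esub> y')), snd (x, y \<oplus>\<^bsub>f_comp \<Omega> v t \<omega>\<^esub> y')) -
       (frag_of (f_scal \<Omega> v t a (fst (x, y)), snd (x, y)) + frag_of (f_scal \<Omega> v t a (fst (x, y')), snd (x, y'))) \<in> spn (trels \<tau> \<omega>)"
    if "x \<in> carrier (f_comp \<Omega> v t \<tau>)" "y \<in> carrier (f_comp \<Omega> v t \<omega>)" "y' \<in> carrier (f_comp \<Omega> v t \<omega>)" for x y y'
    using tensor_pair.tensor_add_right[OF tp sc[OF that(1)] that(2,3)] by simp
  show "frag_of (f_scal \<Omega> v t a (fst (b \<odot>\<^bsub>f_comp \<Omega> v t \<tau>\<^esub> x, y)), snd (b \<odot>\<^bsub>f_comp \<Omega> v t \<tau>\<^esub> x, y)) -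
       frag_of (f_scal \<Omega> v t a (fst (x, b \<odot>\<^bsub>f_comp \<Omega> v t \<omega>\<^esub> y)), snd (x, b \<odot>\<^bsub>f_comp \<Omega> v t \<omega>\<^esub> y)) \<in> spn (trels \<tau> \<omega>)"
    if "b \<in> carrier (subring_of UNIV)" "x \<in> carrier (f_comp \<Omega> v t \<tau>)" "y \<in> carrier (f_comp \<Omega> v t \<omega>)" for b x y
    using tensor_pair.tensor_smult[OF tp that(1) sc[OF that(2)] that(3)] scx(2) that by simp
qed

text \<open>A nonzero scalar leaves the set of keys unchanged, so the equality holds already for
  formal combinations.\<close>

lemma tscal_tpart: "a \<noteq> 0 \<Longrightarrow> tscal a (tpart \<tau> \<omega> z) = tpart \<tau> \<omega> (scal a z)"
proof -
  assume a: "a \<noteq> 0"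
  then have "Poly_Mapping.keys (scal a z) = Poly_Mapping.keys z" by (auto simp: in_keys_iff)
  then show ?thesis
    by (simp add: tpart_def tscal_def frag_extend_sum tterm_def f_scal_pr)
qed

end

context twisting
begin

text \<open>The coefficient at \<open>(a, b)\<close> is the summed form evaluated at the indicator
  of that pair, to which \<open>S_twist\<close> applies; the exponent of the word that is split
  cancels against its rescaling.\<close>

lemma lookup_comult_twisted:
  "Poly_Mapping.lookup (comult \<Omega> (emb qv) qt (\<Phi> x)) (a, b)
    = qt powi (- (c a + c b + sq_form \<Omega> (deg a) (deg b))) * emb (Poly_Mapping.lookup (comult \<Omega> qv 1 x) (a, b))"
proof -
  let ?e = "\<lambda>a b. c a + c b + sq_form \<Omega> (deg a) (deg b)"
  let ?d = "\<lambda>p q. if (p, q) = (a, b) then 1 else (0::Qv)"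
  have S: "B.S w (\<lambda>p q. if (p, q) = (a, b) then 1 else 0) = qt powi (c w - ?e a b) * emb (A.S w ?d)" for w
  proof -
    have "B.S w (\<lambda>p q. if (p, q) = (a, b) then 1 else 0)
      = B.S w (\<lambda>p q. qt powi (c w - ?e a b) * (qt powi (?e p q - c w) * emb (?d p q)))"
    proof (rule B.S_cong)
      fix p q
      have "qt powi (c w - ?e a b) * qt powi (?e a b - c w) = 1" by (simp flip: qt_powi_add)
      then show "(if (p, q) = (a, b) then 1 else 0) = qt powi (c w - ?e a b) * (qt powi (?e p q - c w) * emb (?d p q))"
        by auto
    qed
    then show ?thesis by (simp only: B.S_scal S_twist)
  qed
  have "Poly_Mapping.lookup (comult \<Omega> (emb qv) qt (\<Phi> x)) (a, b)
    = lin (\<lambda>w. qt powi (- c w) * (qt powi (c w - ?e a b) * emb (A.S w ?d))) (ext_scal x)"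
    unfolding lin_delta[symmetric, of _ "(a, b)"] B.lin_comult S twisted_def by simp
  also have "\<dots> = lin (\<lambda>w. qt powi (- ?e a b) * emb (A.S w ?d)) (ext_scal x)"
  proof (rule lin_cong)
    fix w
    have "qt powi (- c w) * qt powi (c w - ?e a b) = qt powi (- ?e a b)" by (simp add: algebra_simps flip: qt_powi_add)
    then show "qt powi (- c w) * (qt powi (c w - ?e a b) * emb (A.S w ?d)) = qt powi (- ?e a b) * emb (A.S w ?d)"
      by (simp only: mult.assoc[symmetric])
  qed
  also have "\<dots> = qt powi (- ?e a b) * emb (lin (\<lambda>w. A.S w ?d) x)"
    unfolding lin_fun_scal lin_ext_scal ..
  also have "lin (\<lambda>w. A.S w ?d) x = Poly_Mapping.lookup (comult \<Omega> qv 1 x) (a, b)"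
    unfolding lin_delta[symmetric, of _ "(a, b)"] A.lin_comult ..
  finally show ?thesis .
qed

text \<open>The map induced on the quotient by t^m times the rescaling; \<open>Em_pr\<close> shows
  that the choice of representative is immaterial.\<close>

definition Em :: "int \<Rightarrow> ('i, Qv) free_alg set \<Rightarrow> ('i, Qvt) free_alg set" where
  "Em m X = B.pr (scal (qt powi m) (\<Phi> (SOME x. A.pr x = X)))"

lemma Em_pr: "Em m (A.pr x) = B.pr (scal (qt powi m) (\<Phi> x))"
  unfolding Em_def by (rule B_pr_cong) (rule someI[of "\<lambda>y. A.pr y = A.pr x"], simp)

lemma Em_f_comp: "X \<in> carrier (f_comp \<Omega> qv 1 \<nu>) \<Longrightarrow> Em m X \<in> carrier (f_comp \<Omega> (emb qv) qt \<nu>)"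
  by (auto simp: A.carrier_f_comp B.carrier_f_comp Em_pr B.homog_simps)

text \<open>Only the first factor receives the power of t, as t may be moved across the tensor
  sign.\<close>

definition Th :: "int \<Rightarrow> (('i, Qv) free_alg set \<times> ('i, Qv) free_alg set \<Rightarrow>\<^sub>0 int)
    \<Rightarrow> (('i, Qvt) free_alg set \<times> ('i, Qvt) free_alg set \<Rightarrow>\<^sub>0 int)" where
  "Th m = frag_extend (\<lambda>p. frag_of (Em m (fst p), Em 0 (snd p)))"

lemma Th_spn:
  assumes "p \<in> spn (A.trels \<tau> \<omega>)"
  shows "Th m p \<in> spn (B.trels \<tau> \<omega>)"
  unfolding Th_def
proof (rule tensor_pair.rels_hom[OF A.tensor_pair_f_comp assms])
  note tp = B.tensor_pair_f_comp[of \<tau> \<omega>]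
  note E = Em_f_comp
  have add: "Em m (x \<oplus>\<^bsub>f_comp \<Omega> qv 1 \<nu>\<^esub> x') = Em m x \<oplus>\<^bsub>f_comp \<Omega> (emb qv) qt \<nu>\<^esub> Em m x'"
    if "x \<in> carrier (f_comp \<Omega> qv 1 \<nu>)" "x' \<in> carrier (f_comp \<Omega> qv 1 \<nu>)" for m x x' \<nu>
    using that by (auto simp: A.carrier_f_comp A.f_comp_simps B.f_comp_simps Em_pr scal_add)
  have smult: "Em m (b \<odot>\<^bsub>f_comp \<Omega> qv 1 \<nu>\<^esub> x) = emb b \<odot>\<^bsub>f_comp \<Omega> (emb qv) qt \<nu>\<^esub> Em m x"
    if "x \<in> carrier (f_comp \<Omega> qv 1 \<nu>)" for m x \<nu> b
    using that by (auto simp: A.carrier_f_comp A.f_comp_simps B.f_comp_simps Em_pr mult.commute)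
  show "frag_of (Em m (fst (x \<oplus>\<^bsub>f_comp \<Omega> qv 1 \<tau>\<^esub> x', y)), Em 0 (snd (x \<oplus>\<^bsub>f_comp \<Omega> qv 1 \<tau>\<^esub> x', y))) -
       (frag_of (Em m (fst (x, y)), Em 0 (snd (x, y))) + frag_of (Em m (fst (x', y)), Em 0 (snd (x', y)))) \<in> spn (B.trels \<tau> \<omega>)"
    if "x \<in> carrier (f_comp \<Omega> qv 1 \<tau>)" "x' \<in> carrier (f_comp \<Omega> qv 1 \<tau>)" "y \<in> carrier (f_comp \<Omega> qv 1 \<omega>)" for x x' y
    using tensor_pair.tensor_add_left[OF tp E E E, OF that] that by (simp add: add)
  show "frag_of (Em m (fst (x, y \<oplus>\<^bsub>f_comp \<Omega> qv 1 \<omega>\<^esub> y')), Em 0 (snd (x, y \<oplus>\<^bsub>f_comp \<Omega> qv 1 \<omega>\<^esub> y'))) -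
       (frag_of (Em m (fst (x, y)), Em 0 (snd (x, y))) + frag_of (Em m (fst (x, y')), Em 0 (snd (x, y')))) \<in> spn (B.trels \<tau> \<omega>)"
    if "x \<in> carrier (f_comp \<Omega> qv 1 \<tau>)" "y \<in> carrier (f_comp \<Omega> qv 1 \<omega>)" "y' \<in> carrier (f_comp \<Omega> qv 1 \<omega>)" for x y y'
    using tensor_pair.tensor_add_right[OF tp E E E, OF that] that by (simp add: add)
  show "frag_of (Em m (fst (b \<odot>\<^bsub>f_comp \<Omega> qv 1 \<tau>\<^esub> x, y)), Em 0 (snd (b \<odot>\<^bsub>f_comp \<Omega> qv 1 \<tau>\<^esub> x, y))) -
       frag_of (Em m (fst (x, b \<odot>\<^bsub>f_comp \<Omega> qv 1 \<omega>\<^esub> y)), Em 0 (snd (x, b \<odot>\<^bsub>f_comp \<Omega> qv 1 \<omega>\<^esub> y))) \<in> spn (B.trels \<tau> \<omega>)"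
    if "b \<in> carrier (subring_of UNIV)" "x \<in> carrier (f_comp \<Omega> qv 1 \<tau>)" "y \<in> carrier (f_comp \<Omega> qv 1 \<omega>)" for b x y
    using tensor_pair.tensor_smult[OF tp _ E E, OF _ that(2,3), of "emb b"] that
    by (simp add: smult subring_of_def)
qed

text \<open>By \<open>lookup_comult_twisted\<close> a term a tensor b carries the exponents of
  \<open>a\<close> and \<open>b\<close> and the constant [tau,omega]. The constant goes into the
  index of \<open>Th\<close>, the exponent of \<open>a\<close> stays on the left, and the exponent
  of \<open>b\<close> crosses to the right factor.\<close>

lemma tpart_twisted:
  "B.tpart \<tau> \<omega> (comult \<Omega> (emb qv) qt (scal (qt powi n) (\<Phi> x)))
    - Th (n - sq_form \<Omega> \<tau> \<omega>) (A.tpart \<tau> \<omega> (comult \<Omega> qv 1 x)) \<in> spn (B.trels \<tau> \<omega>)"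
proof -
  define z where "z = comult \<Omega> qv 1 x"
  define z' where "z' = comult \<Omega> (emb qv) qt (scal (qt powi n) (\<Phi> x))"
  have l: "Poly_Mapping.lookup z' (a, b) = qt powi (n - (c a + c b + sq_form \<Omega> (deg a) (deg b))) * emb (Poly_Mapping.lookup z (a, b))" for a b
    by (simp add: z'_def z_def B.comult_simps lookup_comult_twisted qt_powi_add[of n "- _", simplified])
  have k: "Poly_Mapping.keys z' = Poly_Mapping.keys z"
    by (auto simp: in_keys_iff l)
  let ?K = "Poly_Mapping.keys z \<inter> B.pairs \<tau> \<omega>"
  have "B.tpart \<tau> \<omega> z' - Th (n - sq_form \<Omega> \<tau> \<omega>) (A.tpart \<tau> \<omega> z) =
    (\<Sum>p\<in>?K. B.tterm z' p - Th (n - sq_form \<Omega> \<tau> \<omega>) (A.tterm z p))"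
    by (simp add: B.tpart_def A.tpart_def k Th_def frag_extend_sum sum_subtractf)
  also have "\<dots> \<in> spn (B.trels \<tau> \<omega>)"
  proof (rule spn_sum)
    fix p assume "p \<in> ?K"
    then obtain a b where p: "p = (a, b)" "deg a = \<tau>" "deg b = \<omega>" by (cases p) (auto simp: B.pairs_def)
    let ?l = "emb (Poly_Mapping.lookup z (a, b))"
    let ?X = "B.pr (Poly_Mapping.single a (qt powi (n - sq_form \<Omega> \<tau> \<omega> + - c a) * ?l))"
    have X: "?X \<in> carrier (f_comp \<Omega> (emb qv) qt \<tau>)" and Y: "B.pr (Poly_Mapping.single b 1) \<in> carrier (f_comp \<Omega> (emb qv) qt \<omega>)"
      using p B.pr_single_in_f_comp by auto
    have 1: "B.tterm z' p = frag_of (qt powi (- c b) \<odot>\<^bsub>f_comp \<Omega> (emb qv) qt \<tau>\<^esub> ?X, B.pr (Poly_Mapping.single b 1))"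
      using p by (simp add: B.tterm_def l B.f_comp_simps algebra_simps flip: qt_powi_add mult.assoc)
    have 2: "Th (n - sq_form \<Omega> \<tau> \<omega>) (A.tterm z p) = frag_of (?X, qt powi (- c b) \<odot>\<^bsub>f_comp \<Omega> (emb qv) qt \<omega>\<^esub> B.pr (Poly_Mapping.single b 1))"
      by (simp add: p Th_def A.tterm_def Em_pr B.f_comp_simps qt_powi_add power_int_diff power_int_minus field_simps)
    show "B.tterm z' p - Th (n - sq_form \<Omega> \<tau> \<omega>) (A.tterm z p) \<in> spn (B.trels \<tau> \<omega>)"
      unfolding 1 2
      by (rule tensor_pair.tensor_smult[OF B.tensor_pair_f_comp _ X Y]) (simp add: subring_of_def)
  qed
  finally show ?thesis by (simp only: z_def z'_def)
qed

text \<open>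
  That \<open>r\<close> maps the radical over \<open>\<rat>(v)\<close> into the relations of the tensor square of the quotient is part
  of what a categorification provides: in its last clause the union over representatives is one class.
\<close>

lemma comult_rad_A:
  assumes "f_comult_comp \<Omega> qv 1 \<tau> \<omega> (A.pr 0) = cls (A.trels \<tau> \<omega>) p" and "x \<in> A.rad"
  shows "A.tpart \<tau> \<omega> (comult \<Omega> qv 1 x) \<in> spn (A.trels \<tau> \<omega>)"
proof -
  have *: "A.tpart \<tau> \<omega> (comult \<Omega> qv 1 y) - p \<in> spn (A.trels \<tau> \<omega>)" if "y \<in> A.rad" for y
    by (rule UN_cls_eqD[OF assms(1)[unfolded A.f_comult_comp_eq]]) (use that in \<open>simp add: A.pr_zero\<close>)
  show ?thesis
    using spn_diff[OF *[OF assms(2)] *[OF A.rad_zero]] by (simp add: A.comult_simps)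
qed

end

text \<open>Isolates the consequence of the given categorification on which well-definedness of the
  coproduct over Q(v,t) is built.\<close>

locale twisting_comult = twisting +
  assumes comult_rad: "x \<in> A.rad \<Longrightarrow> A.tpart \<tau> \<omega> (comult \<Omega> qv 1 x) \<in> spn (A.trels \<tau> \<omega>)"
begin

text \<open>After clearing denominators the coefficients of the expansion are radical over Q(v),
  where the property is known; \<open>tpart_twisted\<close> transports it, and division by the
  denominator recovers \<open>x\<close>.\<close>

lemma comult_rad_B:
  assumes "x \<in> B.rad"
  shows "B.tpart \<tau> \<omega> (comult \<Omega> (emb qv) qt x) \<in> spn (B.trels \<tau> \<omega>)"
proof -
  obtain p xs where p: "p \<noteq> 0" "scal (Fract p 1) x = expand xs" using clear_denominators by blast
  let ?d = "Fract p 1 :: Qvt"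
  have d: "?d \<noteq> 0" using p(1) by (simp add: Zero_fract_def eq_fract)
  have cs: "comult \<Omega> (emb qv) qt (sum f I) = (\<Sum>i\<in>I. comult \<Omega> (emb qv) qt (f i))" for f :: "int \<Rightarrow> _" and I
    by (induction I rule: infinite_finite_induct) (auto simp: B.comult_simps)
  have "expand xs \<in> B.rad" using B.rad_scal[OF assms, of ?d] p(2) by simp
  then have r: "Poly_Mapping.lookup xs n \<in> A.rad" for n using rad_expand by blast
  have "B.tpart \<tau> \<omega> (comult \<Omega> (emb qv) qt (scal (qt powi n) (\<Phi> (Poly_Mapping.lookup xs n)))) \<in> spn (B.trels \<tau> \<omega>)" for n
    by (rule spn_diff_mem[OF tpart_twisted Th_spn[OF comult_rad[OF r]]])
  then have "B.tpart \<tau> \<omega> (comult \<Omega> (emb qv) qt (scal ?d x)) \<in> spn (B.trels \<tau> \<omega>)"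
    unfolding p(2) expand_def cs by (intro spn_diff_mem[OF B.tpart_sum spn_sum])
  from B.tscal_spn[OF this, of "inverse ?d"] d show ?thesis
    by (simp add: B.tscal_tpart B.comult_simps del: inverse_fract)
qed

lemma f_comult_comp_B:
  "f_comult_comp \<Omega> (emb qv) qt \<tau> \<omega> (B.pr x) = cls (B.trels \<tau> \<omega>) (B.tpart \<tau> \<omega> (comult \<Omega> (emb qv) qt x))"
  unfolding B.f_comult_comp_eq
proof (rule UN_cls_const)
  fix y assume "y \<in> B.pr x"
  then have "y - x \<in> B.rad" by (simp add: B.f_proj_def')
  from comult_rad_B[OF this] have "B.tpart \<tau> \<omega> (comult \<Omega> (emb qv) qt (y - x)) \<in> spn (B.trels \<tau> \<omega>)" .
  moreover have "B.tpart \<tau> \<omega> (comult \<Omega> (emb qv) qt y)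
    - (B.tpart \<tau> \<omega> (comult \<Omega> (emb qv) qt (y - x)) + B.tpart \<tau> \<omega> (comult \<Omega> (emb qv) qt x)) \<in> spn (B.trels \<tau> \<omega>)"
    using B.tpart_add[of \<tau> \<omega> "comult \<Omega> (emb qv) qt (y - x)" "comult \<Omega> (emb qv) qt x"]
    by (simp flip: B.comult_simps)
  ultimately have "B.tpart \<tau> \<omega> (comult \<Omega> (emb qv) qt y) - B.tpart \<tau> \<omega> (comult \<Omega> (emb qv) qt x) \<in> spn (B.trels \<tau> \<omega>)"
    using spn_add by fastforce
  then show "cls (B.trels \<tau> \<omega>) (B.tpart \<tau> \<omega> (comult \<Omega> (emb qv) qt y)) = cls (B.trels \<tau> \<omega>) (B.tpart \<tau> \<omega> (comult \<Omega> (emb qv) qt x))"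
    by (simp add: cls_eq_iff)
qed (use B.self_in_pr in blast)

lemma f_comult_comp_B_add:
  assumes "f_comult_comp \<Omega> (emb qv) qt \<tau> \<omega> (B.pr x) = cls (B.trels \<tau> \<omega>) p"
    and "f_comult_comp \<Omega> (emb qv) qt \<tau> \<omega> (B.pr y) = cls (B.trels \<tau> \<omega>) q"
  shows "f_comult_comp \<Omega> (emb qv) qt \<tau> \<omega> (B.pr (x + y)) = cls (B.trels \<tau> \<omega>) (p + q)"
  using assms spn_diff_trans[OF B.tpart_add spn_diff_add]
  by (simp add: f_comult_comp_B cls_eq_iff B.comult_simps)

lemma f_comult_comp_B_twisted:
  assumes "f_comult_comp \<Omega> qv 1 \<tau> \<omega> (A.pr x) = cls (A.trels \<tau> \<omega>) p"
  shows "f_comult_comp \<Omega> (emb qv) qt \<tau> \<omega> (B.pr (scal (qt powi n) (\<Phi> x))) = cls (B.trels \<tau> \<omega>) (Th (n - sq_form \<Omega> \<tau> \<omega>) p)"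
proof -
  have "A.tpart \<tau> \<omega> (comult \<Omega> qv 1 x) - p \<in> spn (A.trels \<tau> \<omega>)"
    by (rule UN_cls_eqD[OF assms[unfolded A.f_comult_comp_eq]]) simp
  from Th_spn[OF this] have "Th m (A.tpart \<tau> \<omega> (comult \<Omega> qv 1 x)) - Th m p \<in> spn (B.trels \<tau> \<omega>)" for m
    by (simp add: Th_def frag_extend_diff)
  from spn_diff_trans[OF tpart_twisted this] show ?thesis
    by (simp add: f_comult_comp_B cls_eq_iff)
qed

end

section \<open>The isomorphism, the action and the functors over Laurent polynomials in v and
  t\<close>

section \<open>The categorification over \<open>\<int>[v\<^sup>\<plusminus>\<^sup>1, t\<^sup>\<plusminus>\<^sup>1]\<close>\<close>

lemma K0_module_sel:
  "carrier (K0_module C act) = carrier (K0 C)" "x \<oplus>\<^bsub>K0_module C act\<^esub> y = x \<otimes>\<^bsub>K0 C\<^esub> y"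
  "\<zero>\<^bsub>K0_module C act\<^esub> = \<one>\<^bsub>K0 C\<^esub>" "a \<odot>\<^bsub>K0_module C act\<^esub> x = act a x"
  by (simp_all add: K0_module_def)

lemma subring_of_sel:
  "carrier (subring_of S) = S" "a \<otimes>\<^bsub>subring_of S\<^esub> b = a * b" "a \<oplus>\<^bsub>subring_of S\<^esub> b = a + b"
  "\<one>\<^bsub>subring_of S\<^esub> = 1" "\<zero>\<^bsub>subring_of S\<^esub> = 0"
  by (simp_all add: subring_of_def)

lemma K0_group: "group (K0 C)" "comm_monoid (K0 C)" "monoid (K0 C)"
  using comm_group_K0 comm_group.axioms comm_monoid.axioms(1) by blast+

lemma K0_mult_closed: "x \<in> carrier (K0 C) \<Longrightarrow> y \<in> carrier (K0 C) \<Longrightarrow> x \<otimes>\<^bsub>K0 C\<^esub> y \<in> carrier (K0 C)"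
  and K0_one_closed: "\<one>\<^bsub>K0 C\<^esub> \<in> carrier (K0 C)"
  using monoid.m_closed[OF K0_group(3)] monoid.one_closed[OF K0_group(3)] by blast+

lemma abelian_group_K0_module: "abelian_group (K0_module C act)"
proof -
  interpret comm_group "K0 C" by (rule comm_group_K0)
  show ?thesis
    by (rule abelian_groupI) (auto simp: K0_module_sel m_ac intro: l_inv inv_closed)
qed

lemma idem_one:
  assumes "group G" "x \<in> carrier G" "x \<otimes>\<^bsub>G\<^esub> x = x"
  shows "x = \<one>\<^bsub>G\<^esub>"
  using assms group.l_cancel_one'[of G x x] by metis

text \<open>Agreement on generators propagates by additivity. Neither map is given as a linear
  extension, and both are controlled only on elements supported on \<open>S\<close>.\<close>

lemma frag_hom_eqI:
  assumes H: "group H" and p: "Poly_Mapping.keys p \<subseteq> S"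
    and f: "\<And>x. Poly_Mapping.keys x \<subseteq> S \<Longrightarrow> f x \<in> carrier H"
      "\<And>x y. Poly_Mapping.keys x \<subseteq> S \<Longrightarrow> Poly_Mapping.keys y \<subseteq> S \<Longrightarrow> f (x + y) = f x \<otimes>\<^bsub>H\<^esub> f y"
    and g: "\<And>x. Poly_Mapping.keys x \<subseteq> S \<Longrightarrow> g x \<in> carrier H"
      "\<And>x y. Poly_Mapping.keys x \<subseteq> S \<Longrightarrow> Poly_Mapping.keys y \<subseteq> S \<Longrightarrow> g (x + y) = g x \<otimes>\<^bsub>H\<^esub> g y"
    and eq: "\<And>a. a \<in> S \<Longrightarrow> f (frag_of a) = g (frag_of a)"
  shows "f p = g p"
proof -
  interpret group H by fact
  have "Poly_Mapping.keys p \<subseteq> S \<and> f p = g p"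
    using p
  proof (rule free_Abelian_group_induct)
    have "f 0 = \<one>\<^bsub>H\<^esub>" "g 0 = \<one>\<^bsub>H\<^esub>"
      using f(1)[of 0] f(2)[of 0 0] g(1)[of 0] g(2)[of 0 0] by (auto intro!: idem_one[OF H])
    then show "Poly_Mapping.keys 0 \<subseteq> S \<and> f 0 = g 0" by simp
  next
    fix x y assume "Poly_Mapping.keys x \<subseteq> S" "Poly_Mapping.keys y \<subseteq> S"
      and e: "Poly_Mapping.keys x \<subseteq> S \<and> f x = g x" "Poly_Mapping.keys y \<subseteq> S \<and> f y = g y"
    then have k: "Poly_Mapping.keys (x - y) \<subseteq> S" using keys_diff[of x y] by auto
    have "f (x - y) \<otimes>\<^bsub>H\<^esub> f y = g (x - y) \<otimes>\<^bsub>H\<^esub> f y"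
      using f(2)[OF k, of y] g(2)[OF k, of y] e by simp
    then show "Poly_Mapping.keys (x - y) \<subseteq> S \<and> f (x - y) = g (x - y)"
      using k e f(1)[OF k] g(1)[OF k] f(1)[of y] by simp
  qed (use eq in auto)
  then show ?thesis ..
qed

lemma frak_sel:
  "Cat (frak \<Omega> Q) \<nu> = copies (Cat Q \<nu>)"
  "Act (frak \<Omega> Q) \<nu> = (SOME act'. is_copies_action (Cat Q \<nu>) (Act Q \<nu>) act')"
  "Prod (frak \<Omega> Q) \<tau> \<omega> = copies (Prod Q \<tau> \<omega>)"
  "Ext (frak \<Omega> Q) \<tau> \<omega> = conv (Cat Q \<tau>) (Cat Q \<omega>) (Prod Q \<tau> \<omega>) (Ext Q \<tau> \<omega>)"
  "Ind (frak \<Omega> Q) \<tau> \<omega> = ftor_comp (shift (sq_form \<Omega> \<tau> \<omega>)) (conv (Cat Q \<tau>) (Cat Q \<omega>) (Cat Q (\<tau> + \<omega>)) (Ind Q \<tau> \<omega>))"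
  "Res (frak \<Omega> Q) \<tau> \<omega> = ftor_comp (shift (- sq_form \<Omega> \<tau> \<omega>)) (ftor_copies (Res Q \<tau> \<omega>))"
  by (simp_all add: frak_def)

locale categ_ext = twisting \<Omega> for \<Omega> :: "'i::finite \<Rightarrow> 'i \<Rightarrow> int" +
  fixes Q :: "('i, Qv, 'o, 'm, 'p, 'n) categ"
    and \<kappa> :: "('i \<Rightarrow> nat) \<Rightarrow> ('i \<Rightarrow> nat) \<Rightarrow> (('o \<Rightarrow>\<^sub>0 int) set \<times> ('o \<Rightarrow>\<^sub>0 int) set \<Rightarrow>\<^sub>0 int) set \<Rightarrow> ('p \<Rightarrow>\<^sub>0 int) set"
    and \<phi> :: "('i \<Rightarrow> nat) \<Rightarrow> ('i, Qv) free_alg set \<Rightarrow> ('o \<Rightarrow>\<^sub>0 int) set"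
  assumes data: "categ_data (laurent qv 1) Q"
    and kappa: "is_kappa (laurent qv 1) Q \<kappa>"
    and phi: "bialgebra_iso \<Omega> qv 1 Q \<kappa> \<phi>"
begin

abbreviation "K \<nu> \<equiv> K0 (Cat Q \<nu>)"
abbreviation "K' \<nu> \<equiv> K0 (copies (Cat Q \<nu>))"
abbreviation "IA \<nu> \<equiv> carrier (int_comp \<Omega> qv 1 \<nu>)"
abbreviation "IB \<nu> \<equiv> carrier (int_comp \<Omega> (emb qv) qt \<nu>)"
abbreviation "RA \<equiv> subring_of (laurent qv 1)"
abbreviation "RB \<equiv> subring_of (laurent (emb qv) qt)"
abbreviation "inc \<nu> \<equiv> gr_incl (Cat Q \<nu>)"
abbreviation "prj \<nu> \<equiv> gr_proj (Cat Q \<nu>)"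

subsection \<open>The given categorification\<close>

lemma cat_additive: "additive_cat (Cat Q \<nu>)"
  and prod_additive: "additive_cat (Prod Q \<tau> \<omega>)"
  using data by (auto simp: categ_data_def additive_category_iff)

lemma mod_Q: "Module.module RA (K0_of Q \<nu>)"
  using data by (simp add: categ_data_def)

lemmas additive_preadd = additive_cat.axioms(1)

lemma ext_conv: "conv_ftor (Cat Q \<tau>) (Cat Q \<omega>) (Prod Q \<tau> \<omega>) (Ext Q \<tau> \<omega>)"
  and ind_conv: "conv_ftor (Cat Q \<tau>) (Cat Q \<omega>) (Cat Q (\<tau> + \<omega>)) (Ind Q \<tau> \<omega>)"
  using data
  by (auto simp: categ_data_def
      intro!: conv_ftor.intro cat_additive prod_additive biadd_ftor.intro biadd_ftor_axioms.intro additive_preadd)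

lemma res_add_ftor: "add_ftor (Cat Q (\<tau> + \<omega>)) (Prod Q \<tau> \<omega>) (Res Q \<tau> \<omega>)"
  using data
  by (auto simp: categ_data_def intro!: add_ftor.intro add_ftor_axioms.intro cat_additive prod_additive additive_preadd)

lemma act_closed: "a \<in> laurent qv 1 \<Longrightarrow> x \<in> carrier (K \<nu>) \<Longrightarrow> Act Q \<nu> a x \<in> carrier (K \<nu>)"
  and act_mult: "a \<in> laurent qv 1 \<Longrightarrow> x \<in> carrier (K \<nu>) \<Longrightarrow> y \<in> carrier (K \<nu>)
    \<Longrightarrow> Act Q \<nu> a (x \<otimes>\<^bsub>K \<nu>\<^esub> y) = Act Q \<nu> a x \<otimes>\<^bsub>K \<nu>\<^esub> Act Q \<nu> a y"
  using module.smult_closed[OF mod_Q, of a x \<nu>] module.smult_r_distr[OF mod_Q, of a x \<nu> y]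
  by (simp_all add: K0_module_sel subring_of_sel)

lemma act_one: "a \<in> laurent qv 1 \<Longrightarrow> Act Q \<nu> a \<one>\<^bsub>K \<nu>\<^esub> = \<one>\<^bsub>K \<nu>\<^esub>"
  using act_mult[of a "\<one>\<^bsub>K \<nu>\<^esub>" \<nu> "\<one>\<^bsub>K \<nu>\<^esub>"] act_closed[of a "\<one>\<^bsub>K \<nu>\<^esub>" \<nu>] K0_one_closed[of "Cat Q \<nu>"]
  by (intro idem_one[OF K0_group(1)]) (simp_all add: monoid.l_one[OF K0_group(3)])

lemma IA_I: "A.pr a \<in> A.intf \<Longrightarrow> homog \<nu> a \<Longrightarrow> A.pr a \<in> IA \<nu>"
  by (auto simp: A.carrier_int_comp)

lemma IA_E:
  assumes "X \<in> IA \<nu>"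
  obtains a where "X = A.pr a" "A.pr a \<in> A.intf" "homog \<nu> a"
  using assms by (auto simp: A.carrier_int_comp)

lemma phi_bij: "bij_betw (\<phi> \<nu>) (IA \<nu>) (carrier (K \<nu>))"
  using phi by (simp add: bialgebra_iso_def K0_module_sel)

lemma phi_closed: "X \<in> IA \<nu> \<Longrightarrow> \<phi> \<nu> X \<in> carrier (K \<nu>)"
  by (rule bij_betw_apply[OF phi_bij])

lemma phi_add: "A.pr a \<in> IA \<nu> \<Longrightarrow> A.pr b \<in> IA \<nu> \<Longrightarrow> \<phi> \<nu> (A.pr (a + b)) = \<phi> \<nu> (A.pr a) \<otimes>\<^bsub>K \<nu>\<^esub> \<phi> \<nu> (A.pr b)"
  using phi by (simp add: bialgebra_iso_def K0_module_sel flip: A.int_comp_simps(2)[where \<nu> = \<nu>])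

lemma phi_scal: "s \<in> laurent qv 1 \<Longrightarrow> A.pr a \<in> IA \<nu> \<Longrightarrow> \<phi> \<nu> (A.pr (scal s a)) = Act Q \<nu> s (\<phi> \<nu> (A.pr a))"
  using phi by (simp add: bialgebra_iso_def K0_module_sel flip: A.int_comp_simps(3)[where \<nu> = \<nu>])

lemma pr_zero_IA: "A.pr 0 \<in> IA \<nu>"
  by (intro IA_I A.intf_zero A.homog_simps)

lemma phi_zero: "\<phi> \<nu> (A.pr 0) = \<one>\<^bsub>K \<nu>\<^esub>"
  by (intro idem_one[OF K0_group(1)] phi_closed pr_zero_IA) (simp flip: phi_add add: pr_zero_IA)

subsection \<open>The isomorphism\<close>

text \<open>Makes the coefficients of an expansion, modulo the radical over Q(v), a function of the
  element; this is what lets \<open>psi\<close> be defined coefficientwise.\<close>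

lemma expand_coeff: "B.pr (expand xs) = B.pr (expand ys) \<Longrightarrow> A.pr (Poly_Mapping.lookup xs n) = A.pr (Poly_Mapping.lookup ys n)"
proof -
  assume "B.pr (expand xs) = B.pr (expand ys)"
  then have "expand (xs + - ys) \<in> B.rad" unfolding B.pr_eq_iff by (simp only: expand_add expand_uminus) simp
  then show ?thesis using rad_expand[of "xs + - ys"] by (simp add: lookup_minus A.pr_eq_iff)
qed

text \<open>Applies \<open>\<phi>\<close> to each Laurent coefficient and places the result in the
  copy of the same index. It is specified through its graded pieces, for all expansions of
  \<open>X\<close> at once.\<close>

definition psi :: "('i \<Rightarrow> nat) \<Rightarrow> ('i, Qvt) free_alg set \<Rightarrow> ((int \<Rightarrow> 'o) \<Rightarrow>\<^sub>0 int) set" where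
  "psi \<nu> X = (SOME Y. Y \<in> carrier (K' \<nu>) \<and> (\<forall>xs. good \<nu> xs \<longrightarrow> X = B.pr (expand xs) \<longrightarrow>
     (\<forall>n. prj \<nu> n Y = \<phi> \<nu> (A.pr (Poly_Mapping.lookup xs n)))))"

lemma good_IA: "good \<nu> xs \<Longrightarrow> A.pr (Poly_Mapping.lookup xs n) \<in> IA \<nu>"
  by (auto simp: good_def intro: IA_I)

lemma good_add: "good \<nu> xs \<Longrightarrow> good \<nu> ys \<Longrightarrow> good \<nu> (xs + ys)"
  by (simp add: good_def lookup_add A.intf_add A.homog_simps)

lemma good_single: "A.pr a \<in> A.intf \<Longrightarrow> homog \<nu> a \<Longrightarrow> good \<nu> (Poly_Mapping.single n a)"
  by (simp add: good_def lookup_single when_def A.intf_zero A.homog_simps)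

lemma psi_props:
  assumes "good \<nu> xs"
  shows "psi \<nu> (B.pr (expand xs)) \<in> carrier (K' \<nu>)"
    and "prj \<nu> n (psi \<nu> (B.pr (expand xs))) = \<phi> \<nu> (A.pr (Poly_Mapping.lookup xs n))"
proof -
  obtain Y where Y: "Y \<in> carrier (K' \<nu>)" "\<And>n. prj \<nu> n Y = \<phi> \<nu> (A.pr (Poly_Mapping.lookup xs n))"
    using additive_cat.gr_family_ex[OF cat_additive finite_keys[of xs], of "\<lambda>n. \<phi> \<nu> (A.pr (Poly_Mapping.lookup xs n))" \<nu>]
      phi_closed[OF good_IA[OF assms]] by (auto simp: in_keys_iff phi_zero)
  have "\<exists>Y. Y \<in> carrier (K' \<nu>) \<and> (\<forall>ys. good \<nu> ys \<longrightarrow> B.pr (expand xs) = B.pr (expand ys) \<longrightarrow>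
     (\<forall>n. prj \<nu> n Y = \<phi> \<nu> (A.pr (Poly_Mapping.lookup ys n))))"
  proof (intro exI[of _ Y] conjI allI impI)
    fix ys n assume "B.pr (expand xs) = B.pr (expand ys)"
    from expand_coeff[OF this] show "prj \<nu> n Y = \<phi> \<nu> (A.pr (Poly_Mapping.lookup ys n))" using Y by simp
  qed (rule Y(1))
  from someI_ex[OF this] assms show "psi \<nu> (B.pr (expand xs)) \<in> carrier (K' \<nu>)"
    "prj \<nu> n (psi \<nu> (B.pr (expand xs))) = \<phi> \<nu> (A.pr (Poly_Mapping.lookup xs n))"
    unfolding psi_def by blast+
qed

lemma IB_iff: "X \<in> IB \<nu> \<longleftrightarrow> (\<exists>xs. good \<nu> xs \<and> X = B.pr (expand xs))"
  by (auto simp: carrier_int_comp_B)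

lemma psi_closed: "X \<in> IB \<nu> \<Longrightarrow> psi \<nu> X \<in> carrier (K' \<nu>)"
  using psi_props(1) by (auto simp: IB_iff)

lemma IB_I: "B.pr x \<in> B.intf \<Longrightarrow> homog \<nu> x \<Longrightarrow> B.pr x \<in> IB \<nu>"
  by (auto simp: B.carrier_int_comp)

lemma IB_E:
  assumes "X \<in> IB \<nu>"
  obtains x where "X = B.pr x" "B.pr x \<in> B.intf" "homog \<nu> x"
  using assms by (auto simp: B.carrier_int_comp)

lemma IB_add: "X \<in> IB \<nu> \<Longrightarrow> Y \<in> IB \<nu> \<Longrightarrow> X \<oplus>\<^bsub>int_comp \<Omega> (emb qv) qt \<nu>\<^esub> Y \<in> IB \<nu>"
  by (elim IB_E) (auto simp: B.int_comp_simps intro!: IB_I B.intf_add B.homog_simps)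

lemma IB_scal: "a \<in> laurent (emb qv) qt \<Longrightarrow> X \<in> IB \<nu> \<Longrightarrow> a \<odot>\<^bsub>int_comp \<Omega> (emb qv) qt \<nu>\<^esub> X \<in> IB \<nu>"
  by (elim IB_E) (auto simp: B.int_comp_simps intro!: IB_I B.intf_scal B.homog_simps)

lemma IB_mult: "X \<in> IB \<tau> \<Longrightarrow> Y \<in> IB \<omega> \<Longrightarrow> X \<otimes>\<^bsub>f_ring \<Omega> (emb qv) qt\<^esub> Y \<in> IB (\<tau> + \<omega>)"
  by (elim IB_E) (auto simp: B.f_ring_simps intro!: IB_I B.intf_mult B.homog_mult)

lemma IB_single: "A.pr a \<in> A.intf \<Longrightarrow> homog \<nu> a \<Longrightarrow> B.pr (scal (qt powi n) (\<Phi> a)) \<in> IB \<nu>"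
  using good_single[of a \<nu> n] expand_single[of n a] IB_iff by metis

lemma psi_add:
  assumes "X \<in> IB \<nu>" "Y \<in> IB \<nu>"
  shows "psi \<nu> (X \<oplus>\<^bsub>int_comp \<Omega> (emb qv) qt \<nu>\<^esub> Y) = psi \<nu> X \<otimes>\<^bsub>K' \<nu>\<^esub> psi \<nu> Y"
proof -
  obtain xs ys where xs: "good \<nu> xs" "X = B.pr (expand xs)" and ys: "good \<nu> ys" "Y = B.pr (expand ys)"
    using assms IB_iff by metis
  have XY: "X \<oplus>\<^bsub>int_comp \<Omega> (emb qv) qt \<nu>\<^esub> Y = B.pr (expand (xs + ys))"
    by (simp add: xs ys B.int_comp_simps)
  show ?thesis
  proof (rule additive_cat.gr_eqI[OF cat_additive])
    show "psi \<nu> (X \<oplus>\<^bsub>int_comp \<Omega> (emb qv) qt \<nu>\<^esub> Y) \<in> carrier (K' \<nu>)"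
      by (intro psi_closed IB_add assms)
    show "psi \<nu> X \<otimes>\<^bsub>K' \<nu>\<^esub> psi \<nu> Y \<in> carrier (K' \<nu>)"
      by (intro K0_mult_closed psi_closed assms)
    fix n
    have "prj \<nu> n (psi \<nu> (X \<oplus>\<^bsub>int_comp \<Omega> (emb qv) qt \<nu>\<^esub> Y)) = \<phi> \<nu> (A.pr (Poly_Mapping.lookup xs n + Poly_Mapping.lookup ys n))"
      unfolding XY psi_props(2)[OF good_add[OF xs(1) ys(1)]] by (simp add: lookup_add)
    also have "\<dots> = prj \<nu> n (psi \<nu> X) \<otimes>\<^bsub>K \<nu>\<^esub> prj \<nu> n (psi \<nu> Y)"
      using good_IA[OF xs(1)] good_IA[OF ys(1)] by (simp add: phi_add xs ys psi_props(2))
    also have "\<dots> = prj \<nu> n (psi \<nu> X \<otimes>\<^bsub>K' \<nu>\<^esub> psi \<nu> Y)"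
      by (rule additive_cat.gr_proj_mult[OF cat_additive, symmetric]) (intro psi_closed assms)+
    finally show "prj \<nu> n (psi \<nu> (X \<oplus>\<^bsub>int_comp \<Omega> (emb qv) qt \<nu>\<^esub> Y)) = prj \<nu> n (psi \<nu> X \<otimes>\<^bsub>K' \<nu>\<^esub> psi \<nu> Y)" .
  qed
qed

lemma psi_single:
  assumes "A.pr a \<in> A.intf" "homog \<nu> a"
  shows "psi \<nu> (B.pr (scal (qt powi n) (\<Phi> a))) = inc \<nu> n (\<phi> \<nu> (A.pr a))"
proof (rule additive_cat.gr_eqI[OF cat_additive])
  note g = good_single[OF assms, of n] and a = phi_closed[OF IA_I[OF assms]]
  show "psi \<nu> (B.pr (scal (qt powi n) (\<Phi> a))) \<in> carrier (K' \<nu>)"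
    by (intro psi_closed IB_single assms)
  show "inc \<nu> n (\<phi> \<nu> (A.pr a)) \<in> carrier (K' \<nu>)"
    by (rule additive_cat.gr_incl_closed[OF cat_additive a])
  show "prj \<nu> m (psi \<nu> (B.pr (scal (qt powi n) (\<Phi> a)))) = prj \<nu> m (inc \<nu> n (\<phi> \<nu> (A.pr a)))" for m
    unfolding expand_single[symmetric] psi_props(2)[OF g] additive_cat.gr_proj_incl[OF cat_additive a]
    by (auto simp: lookup_single phi_zero)
qed

lemma psi_inj: "inj_on (psi \<nu>) (IB \<nu>)"
proof (rule inj_onI)
  fix X Y assume "X \<in> IB \<nu>" "Y \<in> IB \<nu>" and e: "psi \<nu> X = psi \<nu> Y"
  then obtain xs ys where xs: "good \<nu> xs" "X = B.pr (expand xs)" and ys: "good \<nu> ys" "Y = B.pr (expand ys)"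
    using IB_iff by metis
  have "\<phi> \<nu> (A.pr (Poly_Mapping.lookup xs n)) = \<phi> \<nu> (A.pr (Poly_Mapping.lookup ys n))" for n
    using psi_props(2)[OF xs(1), of n] psi_props(2)[OF ys(1), of n] e xs ys by simp
  then have "A.pr (Poly_Mapping.lookup xs n) = A.pr (Poly_Mapping.lookup ys n)" for n
    using phi_bij[of \<nu>] good_IA[OF xs(1)] good_IA[OF ys(1)] by (meson bij_betw_imp_inj_on inj_onD)
  then have "expand (xs + - ys) \<in> B.rad" unfolding rad_expand by (simp add: A.pr_eq_iff lookup_minus)
  then have "expand xs - expand ys \<in> B.rad" by (simp only: expand_add expand_uminus) simp
  then show "X = Y" using xs ys by (simp add: B.pr_eq_iff)
qed

lemma inc_eq_psi:
  assumes "x \<in> carrier (K \<nu>)"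
  obtains a where "A.pr a \<in> A.intf" "homog \<nu> a" "x = \<phi> \<nu> (A.pr a)"
    "\<And>n. inc \<nu> n x = psi \<nu> (B.pr (scal (qt powi n) (\<Phi> a)))"
proof -
  obtain X where "X \<in> IA \<nu>" "x = \<phi> \<nu> X" using assms phi_bij[of \<nu>] by (metis bij_betw_imp_surj_on imageE)
  then obtain a where "A.pr a \<in> A.intf" "homog \<nu> a" "x = \<phi> \<nu> (A.pr a)" by (metis IA_E)
  then show ?thesis using that psi_single by simp
qed

lemmas K'_induct [consumes 1, case_names incl mult] = additive_cat.gr_induct[OF cat_additive]

lemma psi_surj: "Y \<in> carrier (K' \<nu>) \<Longrightarrow> \<exists>X\<in>IB \<nu>. Y = psi \<nu> X"
proof (induction rule: K'_induct)
  case (incl n x)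
  then show ?case using inc_eq_psi IB_single by metis
next
  case (mult X Y)
  then show ?case using psi_add IB_add by metis
qed

lemma psi_bij: "bij_betw (psi \<nu>) (IB \<nu>) (carrier (K' \<nu>))"
  unfolding bij_betw_def using psi_inj psi_closed psi_surj by blast

text \<open>Compatibility of \<open>psi\<close> with induction and restriction is tested on single
  powers of t with homogeneous integral coefficients, which generate additively.\<close>

lemma IB_induct [consumes 1, case_names single add]:
  assumes "X \<in> IB \<nu>"
    and single: "\<And>n a. A.pr a \<in> A.intf \<Longrightarrow> homog \<nu> a \<Longrightarrow> P (B.pr (scal (qt powi n) (\<Phi> a)))"
    and add: "\<And>X Y. X \<in> IB \<nu> \<Longrightarrow> Y \<in> IB \<nu> \<Longrightarrow> P X \<Longrightarrow> P Y \<Longrightarrow> P (X \<oplus>\<^bsub>int_comp \<Omega> (emb qv) qt \<nu>\<^esub> Y)"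
  shows "P X"
proof -
  obtain xs where xs: "good \<nu> xs" "X = B.pr (expand xs)" using assms(1) IB_iff by metis
  have l: "A.pr (Poly_Mapping.lookup xs n) \<in> A.intf" "homog \<nu> (Poly_Mapping.lookup xs n)" for n
    using xs(1) by (simp_all add: good_def)
  have "B.pr (\<Sum>n\<in>N. scal (qt powi n) (\<Phi> (Poly_Mapping.lookup xs n))) \<in> IB \<nu>
    \<and> P (B.pr (\<Sum>n\<in>N. scal (qt powi n) (\<Phi> (Poly_Mapping.lookup xs n))))" for N
  proof (induction N rule: infinite_finite_induct)
    case (insert n N)
    then show ?case
      using add[OF IB_single[OF l] _ single[OF l], of "B.pr (\<Sum>n\<in>N. scal (qt powi n) (\<Phi> (Poly_Mapping.lookup xs n)))" n n]
        IB_add[OF IB_single[OF l], of "B.pr (\<Sum>n\<in>N. scal (qt powi n) (\<Phi> (Poly_Mapping.lookup xs n)))" n n]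
      by (simp add: B.int_comp_simps)
  qed (use single[OF A.intf_zero A.homog_simps(1), of 0] IB_single[OF A.intf_zero A.homog_simps(1), where n = 0 and \<nu> = \<nu>] in auto)
  then show ?thesis using xs by (simp add: expand_def)
qed

end

context categ_ext
begin

subsection \<open>The action\<close>

abbreviation "LB \<equiv> laurent (emb qv) qt"

abbreviation shf :: "('i \<Rightarrow> nat) \<Rightarrow> int \<Rightarrow> ((int \<Rightarrow> 'o) \<Rightarrow>\<^sub>0 int) set \<Rightarrow> ((int \<Rightarrow> 'o) \<Rightarrow>\<^sub>0 int) set" where
  "shf \<nu> s \<equiv> K0_map (copies (Cat Q \<nu>)) (shift s :: (int \<Rightarrow> 'o, int \<Rightarrow> 'm, int \<Rightarrow> 'o, int \<Rightarrow> 'm) ftor)"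

text \<open>The module structure is transported along \<open>psi\<close> from the integral form, where it is evident.\<close>

definition act' :: "('i \<Rightarrow> nat) \<Rightarrow> Qvt \<Rightarrow> ((int \<Rightarrow> 'o) \<Rightarrow>\<^sub>0 int) set \<Rightarrow> ((int \<Rightarrow> 'o) \<Rightarrow>\<^sub>0 int) set" where
  "act' \<nu> a X = psi \<nu> (a \<odot>\<^bsub>int_comp \<Omega> (emb qv) qt \<nu>\<^esub> inv_into (IB \<nu>) (psi \<nu>) X)"

lemma act'_psi: "X \<in> IB \<nu> \<Longrightarrow> act' \<nu> a (psi \<nu> X) = psi \<nu> (a \<odot>\<^bsub>int_comp \<Omega> (emb qv) qt \<nu>\<^esub> X)"
  by (simp add: act'_def inv_into_f_f[OF psi_inj])

lemma LB_cring: "cring RB"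
  by (rule cring_laurent) simp_all

lemma act'_module: "Module.module RB (K0_module (copies (Cat Q \<nu>)) (act' \<nu>))"
proof (rule moduleI[OF LB_cring abelian_group_K0_module], unfold K0_module_sel subring_of_sel)
  fix a X assume a: "a \<in> LB" and X: "X \<in> carrier (K' \<nu>)"
  obtain x where x: "x \<in> IB \<nu>" "X = psi \<nu> x" using psi_surj[OF X] by blast
  then obtain y where y: "x = B.pr y" by (elim IB_E)
  show "act' \<nu> a X \<in> carrier (K' \<nu>)"
    using x a by (simp add: act'_psi psi_closed IB_scal)
  fix b assume b: "b \<in> LB"
  show "act' \<nu> (a + b) X = act' \<nu> a X \<otimes>\<^bsub>K' \<nu>\<^esub> act' \<nu> b X"
  proof -
    have "(a + b) \<odot>\<^bsub>int_comp \<Omega> (emb qv) qt \<nu>\<^esub> x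
      = (a \<odot>\<^bsub>int_comp \<Omega> (emb qv) qt \<nu>\<^esub> x) \<oplus>\<^bsub>int_comp \<Omega> (emb qv) qt \<nu>\<^esub> (b \<odot>\<^bsub>int_comp \<Omega> (emb qv) qt \<nu>\<^esub> x)"
      by (simp add: y B.int_comp_simps scal_add_left)
    then show ?thesis using x a b by (simp add: act'_psi psi_add IB_scal)
  qed
  show "act' \<nu> (a * b) X = act' \<nu> a (act' \<nu> b X)"
  proof -
    have "(a * b) \<odot>\<^bsub>int_comp \<Omega> (emb qv) qt \<nu>\<^esub> x = a \<odot>\<^bsub>int_comp \<Omega> (emb qv) qt \<nu>\<^esub> (b \<odot>\<^bsub>int_comp \<Omega> (emb qv) qt \<nu>\<^esub> x)"
      by (simp add: y B.int_comp_simps)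
    then show ?thesis using x b by (simp add: act'_psi IB_scal)
  qed
next
  fix a X Y assume a: "a \<in> LB" and XY: "X \<in> carrier (K' \<nu>)" "Y \<in> carrier (K' \<nu>)"
  obtain x y where x: "x \<in> IB \<nu>" "X = psi \<nu> x" and y: "y \<in> IB \<nu>" "Y = psi \<nu> y"
    using psi_surj[OF XY(1)] psi_surj[OF XY(2)] by blast
  have "a \<odot>\<^bsub>int_comp \<Omega> (emb qv) qt \<nu>\<^esub> (x \<oplus>\<^bsub>int_comp \<Omega> (emb qv) qt \<nu>\<^esub> y)
    = (a \<odot>\<^bsub>int_comp \<Omega> (emb qv) qt \<nu>\<^esub> x) \<oplus>\<^bsub>int_comp \<Omega> (emb qv) qt \<nu>\<^esub> (a \<odot>\<^bsub>int_comp \<Omega> (emb qv) qt \<nu>\<^esub> y)"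
    using x(1) y(1) by (elim IB_E) (simp add: B.int_comp_simps scal_add)
  then show "act' \<nu> a (X \<otimes>\<^bsub>K' \<nu>\<^esub> Y) = act' \<nu> a X \<otimes>\<^bsub>K' \<nu>\<^esub> act' \<nu> a Y"
    using x y a by (simp add: act'_psi psi_add[symmetric] IB_add IB_scal)
next
  fix X assume X: "X \<in> carrier (K' \<nu>)"
  obtain x where x: "x \<in> IB \<nu>" "X = psi \<nu> x" using psi_surj[OF X] by blast
  then obtain y where "x = B.pr y" by (elim IB_E)
  then show "act' \<nu> 1 X = X" using x by (simp add: act'_psi B.int_comp_simps)
qed

lemma act'_inc:
  assumes s: "s \<in> laurent qv 1" and x: "x \<in> carrier (K \<nu>)"
  shows "act' \<nu> (emb s * qt powi m) (inc \<nu> n x) = inc \<nu> (n + m) (Act Q \<nu> s x)"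
proof -
  obtain a where a: "A.pr a \<in> A.intf" "homog \<nu> a" "x = \<phi> \<nu> (A.pr a)" "inc \<nu> n x = psi \<nu> (B.pr (scal (qt powi n) (\<Phi> a)))"
    using inc_eq_psi[OF x] by metis
  have "act' \<nu> (emb s * qt powi m) (inc \<nu> n x) = psi \<nu> (B.pr (scal (qt powi (n + m)) (\<Phi> (scal s a))))"
    unfolding a(4) act'_psi[OF IB_single[OF a(1,2)]] by (simp add: B.int_comp_simps qt_powi_add mult_ac)
  also have "\<dots> = inc \<nu> (n + m) (Act Q \<nu> s x)"
    by (simp only: psi_single[OF A.intf_scal[OF s a(1)] A.homog_simps(3)[OF a(2)]] phi_scal[OF s IA_I[OF a(1,2)]] a(3))
  finally show ?thesis .
qed

context
  fixes \<nu> and \<alpha> :: "Qvt \<Rightarrow> ((int \<Rightarrow> 'o) \<Rightarrow>\<^sub>0 int) set \<Rightarrow> ((int \<Rightarrow> 'o) \<Rightarrow>\<^sub>0 int) set"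
  assumes M: "Module.module RB (K0_module (copies (Cat Q \<nu>)) \<alpha>)"
begin

lemma mod_closed: "a \<in> LB \<Longrightarrow> X \<in> carrier (K' \<nu>) \<Longrightarrow> \<alpha> a X \<in> carrier (K' \<nu>)"
  and mod_add: "a \<in> LB \<Longrightarrow> b \<in> LB \<Longrightarrow> X \<in> carrier (K' \<nu>) \<Longrightarrow> \<alpha> (a + b) X = \<alpha> a X \<otimes>\<^bsub>K' \<nu>\<^esub> \<alpha> b X"
  and mod_mult: "a \<in> LB \<Longrightarrow> X \<in> carrier (K' \<nu>) \<Longrightarrow> Y \<in> carrier (K' \<nu>)
    \<Longrightarrow> \<alpha> a (X \<otimes>\<^bsub>K' \<nu>\<^esub> Y) = \<alpha> a X \<otimes>\<^bsub>K' \<nu>\<^esub> \<alpha> a Y"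
  and mod_assoc: "a \<in> LB \<Longrightarrow> b \<in> LB \<Longrightarrow> X \<in> carrier (K' \<nu>) \<Longrightarrow> \<alpha> (a * b) X = \<alpha> a (\<alpha> b X)"
  and mod_unit: "X \<in> carrier (K' \<nu>) \<Longrightarrow> \<alpha> 1 X = X"
  using module.smult_closed[OF M, of a X] module.smult_l_distr[OF M, of a b X] module.smult_r_distr[OF M, of a X Y]
    module.smult_assoc1[OF M, of a b X] module.smult_one[OF M, of X]
  by (simp_all add: K0_module_sel subring_of_sel)

end

text \<open>The conditions on t and on the coefficients are additive in the class, so elements of
  one copy suffice.\<close>

lemma is_copies_act': "is_copies_action (Cat Q \<nu>) (Act Q \<nu>) (act' \<nu>)"
  unfolding is_copies_action_def
proof (intro conjI ballI allI act'_module)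
  fix L assume L: "L \<in> obj (copies (Cat Q \<nu>))"
  have t: "qt \<in> LB" using laurent_powi(2)[of qt 1 "emb qv"] by simp
  have 1: "1 \<in> laurent qv 1" by (rule laurent_one)
  have "act' \<nu> qt X = shf \<nu> 1 X" if "X \<in> carrier (K' \<nu>)" for X
    using that
  proof (induction rule: K'_induct)
    case (incl n x)
    have "Act Q \<nu> 1 x = x"
      using module.smult_one[OF mod_Q, of x \<nu>] incl by (simp add: K0_module_sel subring_of_sel)
    then show ?case
      using act'_inc[OF 1 incl, of 1 n] additive_cat.gr_shift_incl[OF cat_additive incl, of 1 n] by simp
  next
    case (mult X Y)
    then show ?case
      by (simp add: mod_mult[OF act'_module t]
          add_ftor.K0_map_mult[OF preadd.shift_add_ftor[OF additive_preadd[OF cat_additive]]])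
  qed
  from this[OF cls_in_K0[of "frag_of L"]] L
  show "act' \<nu> qt (K0_class (copies (Cat Q \<nu>)) (frag_of L))
    = K0_class (copies (Cat Q \<nu>)) (frag_of (onobj (shift 1 :: (_, int \<Rightarrow> 'm, _, int \<Rightarrow> 'm) ftor) L))"
    by (simp add: K0_class_eq add_ftor.K0_map_cls[OF preadd.shift_add_ftor[OF additive_preadd[OF cat_additive]]])
next
  fix a X n assume a: "a \<in> laurent qv 1" and X: "X \<in> carrier (K' \<nu>)"
  show "prj \<nu> n (act' \<nu> (emb a) X) = Act Q \<nu> a (prj \<nu> n X)"
    using X
  proof (induction rule: K'_induct)
    case (incl m x)
    then show ?case
      using act'_inc[OF a incl, of 0 m]
      by (simp add: additive_cat.gr_proj_incl[OF cat_additive] act_closed[OF a] act_one[OF a])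
  next
    case (mult X Y)
    note e = emb_laurent[OF a]
    show ?case
      using mult e
      by (simp add: mod_mult[OF act'_module] additive_cat.gr_proj_mult[OF cat_additive] mod_closed[OF act'_module]
          act_mult[OF a] additive_cat.gr_proj_closed[OF cat_additive])
  qed
qed

context
  fixes \<nu> and \<alpha> \<beta> :: "Qvt \<Rightarrow> ((int \<Rightarrow> 'o) \<Rightarrow>\<^sub>0 int) set \<Rightarrow> ((int \<Rightarrow> 'o) \<Rightarrow>\<^sub>0 int) set"
  assumes \<alpha>: "is_copies_action (Cat Q \<nu>) (Act Q \<nu>) \<alpha>" and \<beta>: "is_copies_action (Cat Q \<nu>) (Act Q \<nu>) \<beta>"
begin

text \<open>The action in \<open>frak\<close> is a choice, so computing with it requires that its
  conditions determine it. They do so for Laurent polynomials in v and for t, and the module laws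
  propagate this to the whole ring.\<close>

lemma copies_action_unique:
  assumes "a \<in> LB" "X \<in> carrier (K' \<nu>)"
  shows "\<alpha> a X = \<beta> a X"
proof -
  have M: "Module.module RB (K0_module (copies (Cat Q \<nu>)) \<alpha>)" "Module.module RB (K0_module (copies (Cat Q \<nu>)) \<beta>)"
    using \<alpha> \<beta> by (simp_all add: is_copies_action_def)
  note cl = mod_closed[OF M(1)] mod_closed[OF M(2)]
  define P where "P a \<longleftrightarrow> a \<in> LB \<and> (\<forall>X\<in>carrier (K' \<nu>). \<alpha> a X = \<beta> a X)" for a
  have mult: "P (a * b)" if "P a" "P b" for a b
    using that laurent_mult[of "emb qv" qt a b] by (auto simp: P_def mod_assoc[OF M(1)] mod_assoc[OF M(2)] cl)
  have emb: "P (emb s)" if s: "s \<in> laurent qv 1" for s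
    unfolding P_def
  proof (intro conjI ballI emb_laurent[OF s])
    fix X assume X: "X \<in> carrier (K' \<nu>)"
    have "prj \<nu> n (\<alpha> (emb s) X) = Act Q \<nu> s (prj \<nu> n X)" "prj \<nu> n (\<beta> (emb s) X) = Act Q \<nu> s (prj \<nu> n X)" for n
      using \<alpha>[unfolded is_copies_action_def, THEN conjunct2, THEN conjunct2]
        \<beta>[unfolded is_copies_action_def, THEN conjunct2, THEN conjunct2] s X by blast+
    then show "\<alpha> (emb s) X = \<beta> (emb s) X"
      by (intro additive_cat.gr_eqI[OF cat_additive cl[OF emb_laurent[OF s] X]]) simp
  qed
  have t: "P qt"
    unfolding P_def
  proof (intro conjI ballI)
    show tL: "qt \<in> LB" using laurent_powi(2)[of qt 1 "emb qv"] by simp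
    fix X assume X: "X \<in> carrier (K' \<nu>)"
    then obtain p where p: "Poly_Mapping.keys p \<subseteq> obj (copies (Cat Q \<nu>))" "X = cls (K0_rels (copies (Cat Q \<nu>))) p"
      by (rule K0_E)
    have "\<alpha> qt (cls (K0_rels (copies (Cat Q \<nu>))) p) = \<beta> qt (cls (K0_rels (copies (Cat Q \<nu>))) p)"
    proof (rule frag_hom_eqI[OF K0_group(1) p(1)])
      fix L assume "L \<in> obj (copies (Cat Q \<nu>))"
      then show "\<alpha> qt (cls (K0_rels (copies (Cat Q \<nu>))) (frag_of L)) = \<beta> qt (cls (K0_rels (copies (Cat Q \<nu>))) (frag_of L))"
        using \<alpha> \<beta> by (simp add: is_copies_action_def K0_class_eq)
    qed (auto simp: cl tL cls_in_K0 mod_mult[OF M(1) tL] mod_mult[OF M(2) tL] simp flip: mult_K0)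
    then show "\<alpha> qt X = \<beta> qt X" using p by simp
  qed
  \<comment> \<open>The conditions prescribe the action of t itself; that of its inverse is forced,
    since the module laws make t act invertibly.\<close>
  have t': "P (inverse qt)"
    unfolding P_def
  proof (intro conjI ballI)
    show tL: "inverse qt \<in> LB" using laurent_powi(2)[of qt "-1" "emb qv"] by (simp add: power_int_minus)
    fix X assume X: "X \<in> carrier (K' \<nu>)"
    define Y where "Y = \<beta> (inverse qt) X"
    have Y: "Y \<in> carrier (K' \<nu>)" using X tL cl by (simp add: Y_def)
    have "X = \<beta> qt Y"
      using mod_assoc[OF M(2), of qt "inverse qt" X] mod_unit[OF M(2) X] t tL X by (simp add: Y_def P_def)
    then have "X = \<alpha> qt Y" using t Y by (simp add: P_def)
    then have "\<alpha> (inverse qt) X = Y"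
      using mod_assoc[OF M(1), of "inverse qt" qt Y] mod_unit[OF M(1) Y] t tL Y by (simp add: P_def)
    then show "\<alpha> (inverse qt) X = \<beta> (inverse qt) X" by (simp add: Y_def)
  qed
  have one: "P 1" using emb[OF laurent_one] by simp
  have pw: "P (b ^ n)" if "P b" for b n by (induction n) (auto intro: one mult that)
  have tp: "P (qt powi m)" for m
    using pw[OF t, of "nat m"] pw[OF t', of "nat (- m)"] by (simp add: power_int_def power_inverse)
  have "P a"
    using assms(1)
  proof (induction rule: laurent_induct)
    case zero
    then show ?case using emb[OF laurent_zero] by simp
  next
    case (monom c a b)
    have "of_int c * qv powi a \<in> laurent qv 1" using laurent_monom[of c qv a 1 0] by simp
    from mult[OF emb[OF this] tp[of b]] show ?case by simp
  next
    case (add x y)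
    then show ?case by (auto simp: P_def laurent_add mod_add[OF M(1)] mod_add[OF M(2)])
  qed
  then show ?thesis using assms(2) by (simp add: P_def)
qed

end

abbreviation "ACT \<equiv> Act (frak \<Omega> Q)"

lemma is_copies_ACT: "is_copies_action (Cat Q \<nu>) (Act Q \<nu>) (ACT \<nu>)"
  unfolding frak_sel by (rule someI[of "is_copies_action (Cat Q \<nu>) (Act Q \<nu>)", OF is_copies_act'])

lemmas ACT_eq = copies_action_unique[OF is_copies_ACT is_copies_act']

lemma ACT_module: "Module.module RB (K0_module (copies (Cat Q \<nu>)) (ACT \<nu>))"
  using is_copies_ACT by (simp add: is_copies_action_def)

lemma LB_monom: "s \<in> laurent qv 1 \<Longrightarrow> emb s * qt powi m \<in> LB"
  by (intro laurent_mult emb_laurent laurent_powi) simp_all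

lemma inc_closed: "x \<in> carrier (K \<nu>) \<Longrightarrow> inc \<nu> n x \<in> carrier (K' \<nu>)"
  by (rule additive_cat.gr_incl_closed[OF cat_additive])

lemma ACT_inc:
  "s \<in> laurent qv 1 \<Longrightarrow> x \<in> carrier (K \<nu>) \<Longrightarrow> ACT \<nu> (emb s * qt powi m) (inc \<nu> n x) = inc \<nu> (n + m) (Act Q \<nu> s x)"
  using ACT_eq[OF LB_monom inc_closed] act'_inc by metis

lemma ACT_inc_t: "x \<in> carrier (K \<nu>) \<Longrightarrow> ACT \<nu> (qt powi m) (inc \<nu> n x) = inc \<nu> (n + m) x"
  using ACT_inc[OF laurent_one, of x \<nu> m n] module.smult_one[OF mod_Q, of x \<nu>]
  by (simp add: K0_module_sel subring_of_sel)

lemma psi_scal: "a \<in> LB \<Longrightarrow> X \<in> IB \<nu> \<Longrightarrow> psi \<nu> (a \<odot>\<^bsub>int_comp \<Omega> (emb qv) qt \<nu>\<^esub> X) = ACT \<nu> a (psi \<nu> X)"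
  by (simp add: ACT_eq psi_closed act'_psi)

section \<open>Comparison of the tensor product with the copies of the target category\<close>

subsection \<open>The tensor product of Grothendieck groups\<close>

abbreviation "MB \<nu> \<equiv> K0_module (copies (Cat Q \<nu>)) (ACT \<nu>)"
abbreviation "TA \<tau> \<omega> \<equiv> tensor_rels RA (K0_of Q \<tau>) (K0_of Q \<omega>)"
abbreviation "TB \<tau> \<omega> \<equiv> tensor_rels RB (MB \<tau>) (MB \<omega>)"
abbreviation "KP \<tau> \<omega> \<equiv> K0_rels (copies (Prod Q \<tau> \<omega>))"
abbreviation "bx \<tau> \<omega> \<equiv> K0_bimap (Prod Q \<tau> \<omega>) (Ext Q \<tau> \<omega>)"
abbreviation "bx' \<tau> \<omega> \<equiv> K0_bimap (copies (Prod Q \<tau> \<omega>)) (conv (Cat Q \<tau>) (Cat Q \<omega>) (Prod Q \<tau> \<omega>) (Ext Q \<tau> \<omega>))"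

lemma tpA: "tensor_pair RA (K0_of Q \<tau>) (K0_of Q \<omega>)"
  by unfold_locales (auto simp: K0_module_sel subring_of_sel K0_mult_closed act_closed)

lemma tpB: "tensor_pair RB (MB \<tau>) (MB \<omega>)"
  by unfold_locales (auto simp: K0_module_sel subring_of_sel K0_mult_closed mod_closed[OF ACT_module])

lemmas clsA = tensor_pair.tensor_class_eq[OF tpA]
lemmas clsB = tensor_pair.tensor_class_eq[OF tpB]
lemmas carA = tensor_pair.carrier_tensor[OF tpA, unfolded K0_module_sel]
lemmas carB = tensor_pair.carrier_tensor[OF tpB, unfolded K0_module_sel]
lemmas mulA = tensor_pair.mult_tensor[OF tpA]
lemmas mulB = tensor_pair.mult_tensor[OF tpB]

lemma TB_add_left: "X \<in> carrier (K' \<tau>) \<Longrightarrow> X' \<in> carrier (K' \<tau>) \<Longrightarrow> Y \<in> carrier (K' \<omega>)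
    \<Longrightarrow> frag_of (X \<otimes>\<^bsub>K' \<tau>\<^esub> X', Y) - (frag_of (X, Y) + frag_of (X', Y)) \<in> spn (TB \<tau> \<omega>)"
  and TB_add_right: "X \<in> carrier (K' \<tau>) \<Longrightarrow> Y \<in> carrier (K' \<omega>) \<Longrightarrow> Y' \<in> carrier (K' \<omega>)
    \<Longrightarrow> frag_of (X, Y \<otimes>\<^bsub>K' \<omega>\<^esub> Y') - (frag_of (X, Y) + frag_of (X, Y')) \<in> spn (TB \<tau> \<omega>)"
  and TB_smult: "a \<in> LB \<Longrightarrow> X \<in> carrier (K' \<tau>) \<Longrightarrow> Y \<in> carrier (K' \<omega>)
    \<Longrightarrow> frag_of (ACT \<tau> a X, Y) - frag_of (X, ACT \<omega> a Y) \<in> spn (TB \<tau> \<omega>)"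
  using tensor_pair.tensor_add_left[OF tpB, of X \<tau> X' Y \<omega>] tensor_pair.tensor_add_right[OF tpB, of X \<tau> Y \<omega> Y']
    tensor_pair.tensor_smult[OF tpB, of a X \<tau> Y \<omega>]
  by (simp_all add: K0_module_sel subring_of_sel)

lemma kappa_iso: "\<kappa> \<tau> \<omega> \<in> iso (tensor RA (K0_of Q \<tau>) (K0_of Q \<omega>)) (K0 (Prod Q \<tau> \<omega>))"
  using kappa by (simp add: is_kappa_def)

lemma kappa_frag: "x \<in> carrier (K \<tau>) \<Longrightarrow> y \<in> carrier (K \<omega>) \<Longrightarrow> \<kappa> \<tau> \<omega> (cls (TA \<tau> \<omega>) (frag_of (x, y))) = bx \<tau> \<omega> x y"
  using kappa by (simp add: is_kappa_def clsA)

lemma kappa_closed: "Poly_Mapping.keys z \<subseteq> carrier (K \<tau>) \<times> carrier (K \<omega>) \<Longrightarrow> \<kappa> \<tau> \<omega> (cls (TA \<tau> \<omega>) z) \<in> carrier (K0 (Prod Q \<tau> \<omega>))"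
  using kappa_iso[of \<tau> \<omega>] carA[of \<tau> \<omega>] by (auto simp: iso_def hom_def)

lemma kappa_add:
  assumes "Poly_Mapping.keys z \<subseteq> carrier (K \<tau>) \<times> carrier (K \<omega>)" "Poly_Mapping.keys z' \<subseteq> carrier (K \<tau>) \<times> carrier (K \<omega>)"
  shows "\<kappa> \<tau> \<omega> (cls (TA \<tau> \<omega>) (z + z')) = \<kappa> \<tau> \<omega> (cls (TA \<tau> \<omega>) z) \<otimes>\<^bsub>K0 (Prod Q \<tau> \<omega>)\<^esub> \<kappa> \<tau> \<omega> (cls (TA \<tau> \<omega>) z')"
proof -
  have "\<kappa> \<tau> \<omega> \<in> hom (tensor RA (K0_of Q \<tau>) (K0_of Q \<omega>)) (K0 (Prod Q \<tau> \<omega>))"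
    using kappa_iso by (simp add: iso_def)
  then show ?thesis
    unfolding mulA[symmetric] by (rule hom_mult) (use assms in \<open>auto simp: carA\<close>)
qed

lemma ext_biadd': "biadd_ftor (copies (Cat Q \<tau>)) (copies (Cat Q \<omega>)) (copies (Prod Q \<tau> \<omega>)) (conv (Cat Q \<tau>) (Cat Q \<omega>) (Prod Q \<tau> \<omega>) (Ext Q \<tau> \<omega>))"
  by (rule conv_ftor.conv_biadd_ftor[OF ext_conv])

lemmas bx'_closed = biadd_ftor.K0_bimap_closed[OF ext_biadd']
lemmas bx'_left = biadd_ftor.K0_bimap_mult_left[OF ext_biadd']
lemmas bx'_right = biadd_ftor.K0_bimap_mult_right[OF ext_biadd']
lemmas bx'_inc = conv_ftor.gr_conv_incl[OF ext_conv]

text \<open>Balancedness over the coefficients is not among the requirements on the functor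
  \<open>Ext\<close>; it follows because \<open>\<kappa>\<close> lets the induced pairing factor
  through the tensor product.\<close>

lemma bx_balanced:
  assumes "s \<in> laurent qv 1" "x \<in> carrier (K \<tau>)" "y \<in> carrier (K \<omega>)"
  shows "bx \<tau> \<omega> (Act Q \<tau> s x) y = bx \<tau> \<omega> x (Act Q \<omega> s y)"
proof -
  have "cls (TA \<tau> \<omega>) (frag_of (Act Q \<tau> s x, y)) = cls (TA \<tau> \<omega>) (frag_of (x, Act Q \<omega> s y))"
    using tensor_pair.tensor_smult[OF tpA, of s x \<tau> y \<omega>] assms by (simp add: cls_eq_iff K0_module_sel subring_of_sel)
  then show ?thesis using assms by (metis kappa_frag act_closed)
qed

text \<open>On elements of one copy, t shifts either factor, and both shifts move the convolution by
  the same amount; the coefficients are handled by \<open>bx_balanced\<close>.\<close>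

lemma bx'_balanced:
  assumes "a \<in> LB" "X \<in> carrier (K' \<tau>)" "Y \<in> carrier (K' \<omega>)"
  shows "bx' \<tau> \<omega> (ACT \<tau> a X) Y = bx' \<tau> \<omega> X (ACT \<omega> a Y)"
proof -
  note cl = mod_closed[OF ACT_module]
  \<comment> \<open>Membership of \<open>a\<close> is carried along because the case of a sum needs
    it for both summands.\<close>
  have inc: "a \<in> LB \<and> bx' \<tau> \<omega> (ACT \<tau> a (inc \<tau> n x)) (inc \<omega> l y) = bx' \<tau> \<omega> (inc \<tau> n x) (ACT \<omega> a (inc \<omega> l y))"
    if x: "x \<in> carrier (K \<tau>)" and y: "y \<in> carrier (K \<omega>)" for n l x y
    using assms(1)
  proof (induction rule: laurent_induct)
    case (monom c a b)
    have s: "of_int c * qv powi a \<in> laurent qv 1" using laurent_monom[of c qv a 1 0] by simp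
    have e: "of_int c * emb qv powi a * qt powi b = emb (of_int c * qv powi a) * qt powi b" by simp
    show ?case
      unfolding e using LB_monom[OF s] x y
      by (simp add: ACT_inc[OF s] bx'_inc act_closed[OF s] bx_balanced[OF s] add_ac del: emb_mult)
  next
    case zero
    have 0: "0 \<in> laurent qv 1" by (rule laurent_zero)
    show ?case
      using LB_monom[OF 0, of 0] ACT_inc[OF 0 x, of 0 n] ACT_inc[OF 0 y, of 0 l] x y
      by (simp add: bx'_inc act_closed[OF 0] bx_balanced[OF 0])
  next
    case (add a b)
    then show ?case
      using x y by (auto simp: laurent_add mod_add[OF ACT_module] inc_closed bx'_left bx'_right cl)
  qed
  have 1: "bx' \<tau> \<omega> (ACT \<tau> a X) (inc \<omega> l y) = bx' \<tau> \<omega> X (ACT \<omega> a (inc \<omega> l y))" if y: "y \<in> carrier (K \<omega>)" for l y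
    using assms(2)
  proof (induction rule: K'_induct)
    case (mult X Y)
    then show ?case using y assms(1) by (simp add: mod_mult[OF ACT_module] bx'_left cl inc_closed)
  qed (use inc y in blast)
  show ?thesis
    using assms(3)
  proof (induction rule: K'_induct)
    case (mult Y Z)
    then show ?case using assms(1,2) by (simp add: mod_mult[OF ACT_module] bx'_right cl)
  qed (use 1 in blast)
qed

text \<open>A representative of the class is chosen so that the pairing extends additively to formal
  combinations and can then pass to the tensor product.\<close>

definition bb :: "('i \<Rightarrow> nat) \<Rightarrow> ('i \<Rightarrow> nat) \<Rightarrow> ((int \<Rightarrow> 'o) \<Rightarrow>\<^sub>0 int) set \<times> ((int \<Rightarrow> 'o) \<Rightarrow>\<^sub>0 int) set \<Rightarrow> ((int \<Rightarrow> 'p) \<Rightarrow>\<^sub>0 int)" where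
  "bb \<tau> \<omega> p = (SOME q. Poly_Mapping.keys q \<subseteq> obj (copies (Prod Q \<tau> \<omega>)) \<and> bx' \<tau> \<omega> (fst p) (snd p) = cls (KP \<tau> \<omega>) q)"

lemma bb_props:
  assumes "X \<in> carrier (K' \<tau>)" "Y \<in> carrier (K' \<omega>)"
  shows "Poly_Mapping.keys (bb \<tau> \<omega> (X, Y)) \<subseteq> obj (copies (Prod Q \<tau> \<omega>))" "cls (KP \<tau> \<omega>) (bb \<tau> \<omega> (X, Y)) = bx' \<tau> \<omega> X Y"
proof -
  have "\<exists>q. Poly_Mapping.keys q \<subseteq> obj (copies (Prod Q \<tau> \<omega>)) \<and> bx' \<tau> \<omega> (fst (X, Y)) (snd (X, Y)) = cls (KP \<tau> \<omega>) q"
    using bx'_closed[OF assms] K0_E by (metis fst_conv snd_conv)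
  from someI_ex[OF this] show "Poly_Mapping.keys (bb \<tau> \<omega> (X, Y)) \<subseteq> obj (copies (Prod Q \<tau> \<omega>))"
    "cls (KP \<tau> \<omega>) (bb \<tau> \<omega> (X, Y)) = bx' \<tau> \<omega> X Y"
    unfolding bb_def by simp_all
qed

lemma lift_spn:
  assumes "z \<in> spn (TB \<tau> \<omega>)"
  shows "frag_extend (bb \<tau> \<omega>) z \<in> spn (KP \<tau> \<omega>)"
  by (rule tensor_pair.rels_hom[OF tpB assms])
    (simp_all only: K0_module_sel subring_of_sel flip: cls_eq_iff,
      simp_all add: bb_props K0_mult_closed bx'_left bx'_right mod_closed[OF ACT_module] bx'_balanced flip: mult_K0)

definition kap :: "('i \<Rightarrow> nat) \<Rightarrow> ('i \<Rightarrow> nat)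
    \<Rightarrow> (((int \<Rightarrow> 'o) \<Rightarrow>\<^sub>0 int) set \<times> ((int \<Rightarrow> 'o) \<Rightarrow>\<^sub>0 int) set \<Rightarrow>\<^sub>0 int) set \<Rightarrow> ((int \<Rightarrow> 'p) \<Rightarrow>\<^sub>0 int) set" where
  "kap \<tau> \<omega> Z = (\<Union>z\<in>Z. cls (KP \<tau> \<omega>) (frag_extend (bb \<tau> \<omega>) z))"

lemma kap_cls: "kap \<tau> \<omega> (cls (TB \<tau> \<omega>) z) = cls (KP \<tau> \<omega>) (frag_extend (bb \<tau> \<omega>) z)"
  unfolding kap_def
proof (rule UN_cls_const)
  fix y assume "y \<in> cls (TB \<tau> \<omega>) z"
  from lift_spn[OF this[unfolded in_cls_iff]]
  show "cls (KP \<tau> \<omega>) (frag_extend (bb \<tau> \<omega>) y) = cls (KP \<tau> \<omega>) (frag_extend (bb \<tau> \<omega>) z)"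
    by (simp add: cls_eq_iff frag_extend_diff)
qed (use self_in_cls in blast)

lemma kap_frag: "X \<in> carrier (K' \<tau>) \<Longrightarrow> Y \<in> carrier (K' \<omega>) \<Longrightarrow> kap \<tau> \<omega> (cls (TB \<tau> \<omega>) (frag_of (X, Y))) = bx' \<tau> \<omega> X Y"
  by (simp add: kap_cls bb_props)

lemma kap_add: "kap \<tau> \<omega> (cls (TB \<tau> \<omega>) (z + z'))
    = kap \<tau> \<omega> (cls (TB \<tau> \<omega>) z) \<otimes>\<^bsub>K0 (copies (Prod Q \<tau> \<omega>))\<^esub> kap \<tau> \<omega> (cls (TB \<tau> \<omega>) z')"
  by (simp add: kap_cls mult_K0 frag_extend_add)

lemma kap_closed: "Poly_Mapping.keys z \<subseteq> carrier (K' \<tau>) \<times> carrier (K' \<omega>) \<Longrightarrow> kap \<tau> \<omega> (cls (TB \<tau> \<omega>) z) \<in> carrier (K0 (copies (Prod Q \<tau> \<omega>)))"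
  unfolding kap_cls by (rule cls_in_K0) (erule keys_frag_extend_subset, use bb_props(1) in blast)

text \<open>Normal form of a tensor of total degree \<open>k\<close>: the power of t is carried
  entirely by the first factor.\<close>

definition Tk :: "('i \<Rightarrow> nat) \<Rightarrow> ('i \<Rightarrow> nat) \<Rightarrow> int \<Rightarrow> (('o \<Rightarrow>\<^sub>0 int) set \<times> ('o \<Rightarrow>\<^sub>0 int) set \<Rightarrow>\<^sub>0 int)
    \<Rightarrow> (((int \<Rightarrow> 'o) \<Rightarrow>\<^sub>0 int) set \<times> ((int \<Rightarrow> 'o) \<Rightarrow>\<^sub>0 int) set \<Rightarrow>\<^sub>0 int)" where
  "Tk \<tau> \<omega> k = frag_extend (\<lambda>p. frag_of (inc \<tau> k (fst p), inc \<omega> 0 (snd p)))"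

lemma Tk_simps: "Tk \<tau> \<omega> k 0 = 0" "Tk \<tau> \<omega> k (x + y) = Tk \<tau> \<omega> k x + Tk \<tau> \<omega> k y"
  "Tk \<tau> \<omega> k (x - y) = Tk \<tau> \<omega> k x - Tk \<tau> \<omega> k y"
  by (simp_all add: Tk_def frag_extend_add frag_extend_diff)

lemma inc_mult: "x \<in> carrier (K \<nu>) \<Longrightarrow> y \<in> carrier (K \<nu>) \<Longrightarrow> inc \<nu> n (x \<otimes>\<^bsub>K \<nu>\<^esub> y) = inc \<nu> n x \<otimes>\<^bsub>K' \<nu>\<^esub> inc \<nu> n y"
  by (rule additive_cat.gr_incl_mult[OF cat_additive])

lemma inc_act: "s \<in> laurent qv 1 \<Longrightarrow> x \<in> carrier (K \<nu>) \<Longrightarrow> inc \<nu> n (Act Q \<nu> s x) = ACT \<nu> (emb s) (inc \<nu> n x)"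
  using ACT_inc[of s x \<nu> 0 n] by simp

lemma Tk_spn:
  assumes "z \<in> spn (TA \<tau> \<omega>)"
  shows "Tk \<tau> \<omega> k z \<in> spn (TB \<tau> \<omega>)"
  unfolding Tk_def
  by (rule tensor_pair.rels_hom[OF tpA assms])
    (simp_all add: K0_module_sel subring_of_sel inc_mult inc_act TB_add_left TB_add_right TB_smult inc_closed emb_laurent)

lemma keys_Tk: "Poly_Mapping.keys z \<subseteq> carrier (K \<tau>) \<times> carrier (K \<omega>) \<Longrightarrow> Poly_Mapping.keys (Tk \<tau> \<omega> k z) \<subseteq> carrier (K' \<tau>) \<times> carrier (K' \<omega>)"
  unfolding Tk_def by (erule keys_frag_extend_subset) (auto simp: inc_closed)

text \<open>On a single pair this combines the convolution of inserted classes with the defining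
  property of \<open>\<kappa>\<close>; additivity does the rest.\<close>

lemma kap_Tk:
  assumes "Poly_Mapping.keys z \<subseteq> carrier (K \<tau>) \<times> carrier (K \<omega>)"
  shows "kap \<tau> \<omega> (cls (TB \<tau> \<omega>) (Tk \<tau> \<omega> k z)) = gr_incl (Prod Q \<tau> \<omega>) k (\<kappa> \<tau> \<omega> (cls (TA \<tau> \<omega>) z))"
proof (rule frag_hom_eqI[OF K0_group(1) assms])
  fix p assume "p \<in> carrier (K \<tau>) \<times> carrier (K \<omega>)"
  then obtain x y where p: "p = (x, y)" "x \<in> carrier (K \<tau>)" "y \<in> carrier (K \<omega>)" by auto
  then show "kap \<tau> \<omega> (cls (TB \<tau> \<omega>) (Tk \<tau> \<omega> k (frag_of p))) = gr_incl (Prod Q \<tau> \<omega>) k (\<kappa> \<tau> \<omega> (cls (TA \<tau> \<omega>) (frag_of p)))"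
    by (simp add: Tk_def kap_frag inc_closed bx'_inc kappa_frag)
qed (simp_all add: Tk_simps kap_add kap_closed keys_Tk kappa_add kappa_closed
      additive_cat.gr_incl_mult[OF prod_additive] additive_cat.gr_incl_closed[OF prod_additive])

text \<open>Finite sums of normal forms, one for each power of t. The vanishing of \<open>zs\<close>
  outside \<open>N\<close> allows index sets to be enlarged when two such sums are
  subtracted.\<close>

definition spanned :: "('i \<Rightarrow> nat) \<Rightarrow> ('i \<Rightarrow> nat) \<Rightarrow> (((int \<Rightarrow> 'o) \<Rightarrow>\<^sub>0 int) set \<times> ((int \<Rightarrow> 'o) \<Rightarrow>\<^sub>0 int) set \<Rightarrow>\<^sub>0 int) \<Rightarrow> bool" where
  "spanned \<tau> \<omega> z \<longleftrightarrow> (\<exists>N zs. finite N \<and> (\<forall>k. Poly_Mapping.keys (zs k) \<subseteq> carrier (K \<tau>) \<times> carrier (K \<omega>)) \<and> (\<forall>k. k \<notin> N \<longrightarrow> zs k = 0)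
     \<and> z - (\<Sum>k\<in>N. Tk \<tau> \<omega> k (zs k)) \<in> spn (TB \<tau> \<omega>))"

lemma spanned_diff:
  assumes "spanned \<tau> \<omega> x" "spanned \<tau> \<omega> y"
  shows "spanned \<tau> \<omega> (x - y)"
proof -
  obtain N zs where N: "finite N" "\<And>k. Poly_Mapping.keys (zs k) \<subseteq> carrier (K \<tau>) \<times> carrier (K \<omega>)" "\<And>k. k \<notin> N \<Longrightarrow> zs k = 0"
     "x - (\<Sum>k\<in>N. Tk \<tau> \<omega> k (zs k)) \<in> spn (TB \<tau> \<omega>)" using assms(1) unfolding spanned_def by blast
  obtain M ys where M: "finite M" "\<And>k. Poly_Mapping.keys (ys k) \<subseteq> carrier (K \<tau>) \<times> carrier (K \<omega>)" "\<And>k. k \<notin> M \<Longrightarrow> ys k = 0"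
     "y - (\<Sum>k\<in>M. Tk \<tau> \<omega> k (ys k)) \<in> spn (TB \<tau> \<omega>)" using assms(2) unfolding spanned_def by blast
  have 1: "(\<Sum>k\<in>N. Tk \<tau> \<omega> k (zs k)) = (\<Sum>k\<in>N \<union> M. Tk \<tau> \<omega> k (zs k))"
    by (rule sum.mono_neutral_left) (use N M in \<open>auto simp: Tk_simps\<close>)
  have 2: "(\<Sum>k\<in>M. Tk \<tau> \<omega> k (ys k)) = (\<Sum>k\<in>N \<union> M. Tk \<tau> \<omega> k (ys k))"
    by (rule sum.mono_neutral_left) (use N M in \<open>auto simp: Tk_simps\<close>)
  have "(x - y) - (\<Sum>k\<in>N \<union> M. Tk \<tau> \<omega> k (zs k - ys k)) \<in> spn (TB \<tau> \<omega>)"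
    using spn_diff_diff[OF N(4) M(4)] unfolding 1 2 by (simp add: Tk_simps sum_subtractf)
  moreover have "Poly_Mapping.keys (zs k - ys k) \<subseteq> carrier (K \<tau>) \<times> carrier (K \<omega>)" for k
    using order_trans[OF keys_diff Un_least[OF N(2) M(2)]] .
  ultimately show ?thesis
    unfolding spanned_def
    by (intro exI[of _ "N \<union> M"] exI[of _ "\<lambda>k. zs k - ys k"]) (use N(1,3) M(1,3) in auto)
qed

lemma spanned_spn: "x - y \<in> spn (TB \<tau> \<omega>) \<Longrightarrow> spanned \<tau> \<omega> y \<Longrightarrow> spanned \<tau> \<omega> x"
  unfolding spanned_def by (meson spn_diff_trans)

lemma spanned_zero: "spanned \<tau> \<omega> 0"
  unfolding spanned_def by (intro exI[of _ "{}"] exI[of _ "\<lambda>_. 0"]) (simp add: spn_zero)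

lemma spanned_add: "spanned \<tau> \<omega> x \<Longrightarrow> spanned \<tau> \<omega> y \<Longrightarrow> spanned \<tau> \<omega> (x + y)"
  using spanned_diff[of \<tau> \<omega> x "0 - y"] spanned_diff[OF spanned_zero] by simp

lemma spanned_all:
  assumes "Poly_Mapping.keys z \<subseteq> carrier (K' \<tau>) \<times> carrier (K' \<omega>)"
  shows "spanned \<tau> \<omega> z"
  using assms
proof (rule free_Abelian_group_induct)
  fix p assume "p \<in> carrier (K' \<tau>) \<times> carrier (K' \<omega>)"
  then obtain X Y where p: "p = (X, Y)" and X: "X \<in> carrier (K' \<tau>)" and Y: "Y \<in> carrier (K' \<omega>)" by auto
  have "spanned \<tau> \<omega> (frag_of (inc \<tau> n x, Y))" if x: "x \<in> carrier (K \<tau>)" for n x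
    using Y
  proof (induction rule: K'_induct)
    case (incl m y)
    have t: "qt powi m \<in> LB" by (rule laurent_powi)
    \<comment> \<open>The power t^m moves from the second factor to the first, which turns the
      copies n and m into n + m and 0.\<close>
    have "frag_of (inc \<tau> (n + m) x, inc \<omega> 0 y) - frag_of (inc \<tau> n x, inc \<omega> m y) \<in> spn (TB \<tau> \<omega>)"
      using TB_smult[OF t inc_closed[OF x] inc_closed[OF incl], of n 0] by (simp add: ACT_inc_t x incl)
    then have "frag_of (inc \<tau> n x, inc \<omega> m y) - (\<Sum>k\<in>{n + m}. Tk \<tau> \<omega> k (if k = n + m then frag_of (x, y) else 0)) \<in> spn (TB \<tau> \<omega>)"
      using spn_diff_sym by (auto simp: Tk_def)
    then show ?case
      unfolding spanned_def using x incl
      by (intro exI[of _ "{n + m}"] exI[of _ "\<lambda>k. if k = n + m then frag_of (x, y) else 0"]) auto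
  next
    case (mult Y Y')
    show ?case by (rule spanned_spn[OF TB_add_right[OF inc_closed[OF x] mult(1,2)] spanned_add[OF mult(3,4)]])
  qed
  with X have "spanned \<tau> \<omega> (frag_of (X, Y))"
  proof (induction rule: K'_induct)
    case (mult X X')
    then show ?case using spanned_spn[OF TB_add_left[OF mult(1,2) Y] spanned_add] by blast
  qed blast
  then show "spanned \<tau> \<omega> (frag_of p)" using p by simp
qed (auto intro: spanned_zero spanned_diff)

text \<open>Normal forms with different \<open>k\<close> land in different copies, so projection to
  copy \<open>n\<close> isolates one of them.\<close>

lemma prj_kap:
  assumes "finite N" "\<And>k. Poly_Mapping.keys (zs k) \<subseteq> carrier (K \<tau>) \<times> carrier (K \<omega>)"
  shows "gr_proj (Prod Q \<tau> \<omega>) n (kap \<tau> \<omega> (cls (TB \<tau> \<omega>) (\<Sum>k\<in>N. Tk \<tau> \<omega> k (zs k))))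
    = (if n \<in> N then \<kappa> \<tau> \<omega> (cls (TA \<tau> \<omega>) (zs n)) else \<one>\<^bsub>K0 (Prod Q \<tau> \<omega>)\<^esub>)"
  using assms(1)
proof (induction N)
  case empty
  then show ?case
    using additive_cat.gr_proj_one[OF prod_additive, of \<tau> \<omega> n] by (simp add: kap_cls one_K0)
next
  case (insert k N)
  have ks: "Poly_Mapping.keys (\<Sum>k\<in>N. Tk \<tau> \<omega> k (zs k)) \<subseteq> carrier (K' \<tau>) \<times> carrier (K' \<omega>)"
    using keys_sum[of "\<lambda>k. Tk \<tau> \<omega> k (zs k)" N] keys_Tk[OF assms(2)] by blast
  have kc: "\<kappa> \<tau> \<omega> (cls (TA \<tau> \<omega>) (zs n)) \<in> carrier (K0 (Prod Q \<tau> \<omega>))" for n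
    by (rule kappa_closed[OF assms(2)])
  have "gr_proj (Prod Q \<tau> \<omega>) n (kap \<tau> \<omega> (cls (TB \<tau> \<omega>) (\<Sum>k\<in>insert k N. Tk \<tau> \<omega> k (zs k))))
    = gr_proj (Prod Q \<tau> \<omega>) n (kap \<tau> \<omega> (cls (TB \<tau> \<omega>) (Tk \<tau> \<omega> k (zs k))))
      \<otimes>\<^bsub>K0 (Prod Q \<tau> \<omega>)\<^esub> gr_proj (Prod Q \<tau> \<omega>) n (kap \<tau> \<omega> (cls (TB \<tau> \<omega>) (\<Sum>k\<in>N. Tk \<tau> \<omega> k (zs k))))"
    using insert(1,2) by (simp add: kap_add additive_cat.gr_proj_mult[OF prod_additive] kap_closed[OF ks] kap_closed[OF keys_Tk[OF assms(2)]])
  also have "gr_proj (Prod Q \<tau> \<omega>) n (kap \<tau> \<omega> (cls (TB \<tau> \<omega>) (Tk \<tau> \<omega> k (zs k))))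
    = (if n = k then \<kappa> \<tau> \<omega> (cls (TA \<tau> \<omega>) (zs k)) else \<one>\<^bsub>K0 (Prod Q \<tau> \<omega>)\<^esub>)"
    by (simp add: kap_Tk[OF assms(2)] additive_cat.gr_proj_incl[OF prod_additive kc])
  finally show ?case
    using insert kc by (auto simp: monoid.l_one[OF K0_group(3)] monoid.r_one[OF K0_group(3)] K0_one_closed)
qed

text \<open>For injectivity the difference of two elements with equal image is brought into normal
  form; each piece then lies in the kernel of the injective \<open>\<kappa>\<close>, and
  \<open>Tk_spn\<close> carries the resulting relations back. Surjectivity is inherited from
  \<open>\<kappa>\<close> in each copy.\<close>

lemma kap_iso: "kap \<tau> \<omega> \<in> iso (tensor RB (MB \<tau>) (MB \<omega>)) (K0 (copies (Prod Q \<tau> \<omega>)))"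
proof -
  have hom: "kap \<tau> \<omega> \<in> hom (tensor RB (MB \<tau>) (MB \<omega>)) (K0 (copies (Prod Q \<tau> \<omega>)))"
    by (rule homI) (auto simp: carB kap_closed mulB kap_add)
  have inj: "inj_on (kap \<tau> \<omega>) (carrier (tensor RB (MB \<tau>) (MB \<omega>)))"
  proof (rule inj_onI)
    fix Z Z' assume "Z \<in> carrier (tensor RB (MB \<tau>) (MB \<omega>))" "Z' \<in> carrier (tensor RB (MB \<tau>) (MB \<omega>))" and e: "kap \<tau> \<omega> Z = kap \<tau> \<omega> Z'"
    then obtain z z' where z: "Poly_Mapping.keys z \<subseteq> carrier (K' \<tau>) \<times> carrier (K' \<omega>)" "Z = cls (TB \<tau> \<omega>) z"
      and z': "Poly_Mapping.keys z' \<subseteq> carrier (K' \<tau>) \<times> carrier (K' \<omega>)" "Z' = cls (TB \<tau> \<omega>) z'" by (auto simp: carB)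
    have "Poly_Mapping.keys (z - z') \<subseteq> carrier (K' \<tau>) \<times> carrier (K' \<omega>)"
      by (rule order_trans[OF keys_diff Un_least[OF z(1) z'(1)]])
    from spanned_all[OF this] obtain N zs where N: "finite N" "\<And>k. Poly_Mapping.keys (zs k) \<subseteq> carrier (K \<tau>) \<times> carrier (K \<omega>)"
      "(z - z') - (\<Sum>k\<in>N. Tk \<tau> \<omega> k (zs k)) \<in> spn (TB \<tau> \<omega>)" unfolding spanned_def by auto
    have "cls (TB \<tau> \<omega>) (z - z') = cls (TB \<tau> \<omega>) (\<Sum>k\<in>N. Tk \<tau> \<omega> k (zs k))"
      using N(3) by (simp only: cls_eq_iff)
    then have "kap \<tau> \<omega> (cls (TB \<tau> \<omega>) (\<Sum>k\<in>N. Tk \<tau> \<omega> k (zs k))) = kap \<tau> \<omega> (cls (TB \<tau> \<omega>) (z - z'))"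
      by (simp only:)
    also have "\<dots> = \<one>\<^bsub>K0 (copies (Prod Q \<tau> \<omega>))\<^esub>"
      using e by (simp add: z z' kap_cls frag_extend_diff one_K0 cls_eq_iff)
    finally have k1: "kap \<tau> \<omega> (cls (TB \<tau> \<omega>) (\<Sum>k\<in>N. Tk \<tau> \<omega> k (zs k))) = \<one>\<^bsub>K0 (copies (Prod Q \<tau> \<omega>))\<^esub>" .
    have "Tk \<tau> \<omega> k (zs k) \<in> spn (TB \<tau> \<omega>)" if k: "k \<in> N" for k
    proof -
      have "\<kappa> \<tau> \<omega> (cls (TA \<tau> \<omega>) (zs k)) = \<one>\<^bsub>K0 (Prod Q \<tau> \<omega>)\<^esub>"
        using prj_kap[where zs = zs and n = k, OF N(1,2)] k1 additive_cat.gr_proj_one[OF prod_additive, of \<tau> \<omega> k] k by simp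
      moreover have "\<kappa> \<tau> \<omega> (cls (TA \<tau> \<omega>) 0) = \<one>\<^bsub>K0 (Prod Q \<tau> \<omega>)\<^esub>"
        by (rule idem_one[OF K0_group(1) kappa_closed]) (simp_all flip: kappa_add)
      moreover have "inj_on (\<kappa> \<tau> \<omega>) (carrier (tensor RA (K0_of Q \<tau>) (K0_of Q \<omega>)))"
        using kappa_iso[of \<tau> \<omega>] by (simp add: iso_def bij_betw_def)
      moreover have "cls (TA \<tau> \<omega>) (zs k) \<in> carrier (tensor RA (K0_of Q \<tau>) (K0_of Q \<omega>))"
        "cls (TA \<tau> \<omega>) 0 \<in> carrier (tensor RA (K0_of Q \<tau>) (K0_of Q \<omega>))" using N(2)[of k] by (auto simp: carA)
      ultimately have "cls (TA \<tau> \<omega>) (zs k) = cls (TA \<tau> \<omega>) 0" by (metis inj_onD)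
      then show ?thesis by (intro Tk_spn) (simp add: cls_eq_iff)
    qed
    then have "z - z' \<in> spn (TB \<tau> \<omega>)" by (intro spn_diff_mem[OF N(3)] spn_sum)
    then show "Z = Z'" by (simp add: z z' cls_eq_iff)
  qed
  have "\<exists>Z\<in>carrier (tensor RB (MB \<tau>) (MB \<omega>)). W = kap \<tau> \<omega> Z" if "W \<in> carrier (K0 (copies (Prod Q \<tau> \<omega>)))" for W
    using that
  proof (rule additive_cat.gr_induct[OF prod_additive])
    fix n w assume "w \<in> carrier (K0 (Prod Q \<tau> \<omega>))"
    then obtain Z where "Z \<in> carrier (tensor RA (K0_of Q \<tau>) (K0_of Q \<omega>))" "w = \<kappa> \<tau> \<omega> Z"
      using kappa_iso[of \<tau> \<omega>] by (auto simp: iso_def bij_betw_def)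
    then obtain z where z: "Poly_Mapping.keys z \<subseteq> carrier (K \<tau>) \<times> carrier (K \<omega>)" "w = \<kappa> \<tau> \<omega> (cls (TA \<tau> \<omega>) z)" by (auto simp: carA)
    then show "\<exists>Z\<in>carrier (tensor RB (MB \<tau>) (MB \<omega>)). gr_incl (Prod Q \<tau> \<omega>) n w = kap \<tau> \<omega> Z"
      using kap_Tk[OF z(1), of n] keys_Tk[OF z(1), of n] by (auto simp: carB)
  next
    fix X Y assume "\<exists>Z\<in>carrier (tensor RB (MB \<tau>) (MB \<omega>)). X = kap \<tau> \<omega> Z" "\<exists>Z\<in>carrier (tensor RB (MB \<tau>) (MB \<omega>)). Y = kap \<tau> \<omega> Z"
    then obtain z z' where "Poly_Mapping.keys z \<subseteq> carrier (K' \<tau>) \<times> carrier (K' \<omega>)" "X = kap \<tau> \<omega> (cls (TB \<tau> \<omega>) z)"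
      "Poly_Mapping.keys z' \<subseteq> carrier (K' \<tau>) \<times> carrier (K' \<omega>)" "Y = kap \<tau> \<omega> (cls (TB \<tau> \<omega>) z')" by (auto simp: carB)
    then show "\<exists>Z\<in>carrier (tensor RB (MB \<tau>) (MB \<omega>)). X \<otimes>\<^bsub>K0 (copies (Prod Q \<tau> \<omega>))\<^esub> Y = kap \<tau> \<omega> Z"
      by (intro bexI[of _ "cls (TB \<tau> \<omega>) (z + z')"]) (auto simp: kap_add carB intro!: exI[of _ "z + z'"] dest!: subsetD[OF keys_add])
  qed
  then have "kap \<tau> \<omega> ` carrier (tensor RB (MB \<tau>) (MB \<omega>)) = carrier (K0 (copies (Prod Q \<tau> \<omega>)))"
    using hom by (auto simp: hom_def)
  then show ?thesis using hom inj by (simp add: iso_def bij_betw_def)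
qed

subsection \<open>Compatibility with induction and restriction\<close>

text \<open>On single powers of t the product of rescaled elements contributes [tau,omega] to the
  exponent, and so does the shift in the induction functor; the rest is the given compatibility of
  \<open>\<phi>\<close>. Biadditivity extends this to all elements.\<close>

lemma psi_mult:
  assumes "X \<in> IB \<tau>" "Y \<in> IB \<omega>"
  shows "psi (\<tau> + \<omega>) (X \<otimes>\<^bsub>f_ring \<Omega> (emb qv) qt\<^esub> Y)
    = K0_bimap (copies (Cat Q (\<tau> + \<omega>))) (Ind (frak \<Omega> Q) \<tau> \<omega>) (psi \<tau> X) (psi \<omega> Y)"
proof -
  let ?I = "conv (Cat Q \<tau>) (Cat Q \<omega>) (Cat Q (\<tau> + \<omega>)) (Ind Q \<tau> \<omega>)"
  let ?s = "sq_form \<Omega> \<tau> \<omega>"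
  note ba = conv_ftor.conv_biadd_ftor[OF ind_conv]
  note sh = preadd.shift_add_ftor[OF additive_preadd[OF cat_additive]]
  note F = ftor_comp_biadd_ftor[OF ba sh]
  note l = biadd_ftor.K0_bimap_mult_left[OF F] and r = biadd_ftor.K0_bimap_mult_right[OF F]
  have 1: "psi (\<tau> + \<omega>) (B.pr (scal (qt powi n) (\<Phi> a)) \<otimes>\<^bsub>f_ring \<Omega> (emb qv) qt\<^esub> B.pr (scal (qt powi m) (\<Phi> b)))
    = K0_bimap (copies (Cat Q (\<tau> + \<omega>))) (ftor_comp (shift ?s) ?I) (psi \<tau> (B.pr (scal (qt powi n) (\<Phi> a)))) (psi \<omega> (B.pr (scal (qt powi m) (\<Phi> b))))"
    if a: "A.pr a \<in> A.intf" "homog \<tau> a" and b: "A.pr b \<in> A.intf" "homog \<omega> b" for n m a b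
  proof -
    note ab = A.intf_mult[OF a(1) b(1)] A.homog_mult[OF a(2) b(2)]
    have pa: "\<phi> \<tau> (A.pr a) \<in> carrier (K \<tau>)" and pb: "\<phi> \<omega> (A.pr b) \<in> carrier (K \<omega>)"
      using phi_closed[OF IA_I[OF a]] phi_closed[OF IA_I[OF b]] by auto
    have "A.pr a \<otimes>\<^bsub>f_ring \<Omega> qv 1\<^esub> A.pr b = A.pr (a * b)" by (rule A.f_ring_simps)
    then have ph: "\<phi> (\<tau> + \<omega>) (A.pr (a * b)) = K0_bimap (Cat Q (\<tau> + \<omega>)) (Ind Q \<tau> \<omega>) (\<phi> \<tau> (A.pr a)) (\<phi> \<omega> (A.pr b))"
      using phi IA_I[OF a] IA_I[OF b] unfolding bialgebra_iso_def by metis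
    have Ic: "K0_bimap (Cat Q (\<tau> + \<omega>)) (Ind Q \<tau> \<omega>) (\<phi> \<tau> (A.pr a)) (\<phi> \<omega> (A.pr b)) \<in> carrier (K (\<tau> + \<omega>))"
      using phi_closed[OF IA_I[OF ab]] ph by simp
    have "B.pr (scal (qt powi n) (\<Phi> a)) \<otimes>\<^bsub>f_ring \<Omega> (emb qv) qt\<^esub> B.pr (scal (qt powi m) (\<Phi> b))
      = B.pr (scal (qt powi (n + m + ?s)) (\<Phi> (a * b)))"
      by (simp add: B.f_ring_simps scal_mult_left scal_mult_right twisted_mult[OF a(2) b(2)] qt_powi_add mult_ac)
    then have "psi (\<tau> + \<omega>) (B.pr (scal (qt powi n) (\<Phi> a)) \<otimes>\<^bsub>f_ring \<Omega> (emb qv) qt\<^esub> B.pr (scal (qt powi m) (\<Phi> b)))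
      = inc (\<tau> + \<omega>) (n + m + ?s) (K0_bimap (Cat Q (\<tau> + \<omega>)) (Ind Q \<tau> \<omega>) (\<phi> \<tau> (A.pr a)) (\<phi> \<omega> (A.pr b)))"
      by (simp add: psi_single[OF ab] ph)
    also have "\<dots> = shf (\<tau> + \<omega>) ?s (K0_bimap (copies (Cat Q (\<tau> + \<omega>))) ?I (inc \<tau> n (\<phi> \<tau> (A.pr a))) (inc \<omega> m (\<phi> \<omega> (A.pr b))))"
      by (simp add: conv_ftor.gr_conv_incl[OF ind_conv pa pb] additive_cat.gr_shift_incl[OF cat_additive Ic])
    also have "\<dots> = K0_bimap (copies (Cat Q (\<tau> + \<omega>))) (ftor_comp (shift ?s) ?I) (inc \<tau> n (\<phi> \<tau> (A.pr a))) (inc \<omega> m (\<phi> \<omega> (A.pr b)))"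
      by (rule K0_bimap_comp[OF ba sh inc_closed[OF pa] inc_closed[OF pb], symmetric])
    finally show ?thesis by (simp add: psi_single[OF a] psi_single[OF b])
  qed
  have dist: "(X \<oplus>\<^bsub>int_comp \<Omega> (emb qv) qt \<tau>\<^esub> X') \<otimes>\<^bsub>f_ring \<Omega> (emb qv) qt\<^esub> Y
      = (X \<otimes>\<^bsub>f_ring \<Omega> (emb qv) qt\<^esub> Y) \<oplus>\<^bsub>int_comp \<Omega> (emb qv) qt (\<tau> + \<omega>)\<^esub> (X' \<otimes>\<^bsub>f_ring \<Omega> (emb qv) qt\<^esub> Y)"
      "Z \<otimes>\<^bsub>f_ring \<Omega> (emb qv) qt\<^esub> (Y \<oplus>\<^bsub>int_comp \<Omega> (emb qv) qt \<omega>\<^esub> Y')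
      = (Z \<otimes>\<^bsub>f_ring \<Omega> (emb qv) qt\<^esub> Y) \<oplus>\<^bsub>int_comp \<Omega> (emb qv) qt (\<tau> + \<omega>)\<^esub> (Z \<otimes>\<^bsub>f_ring \<Omega> (emb qv) qt\<^esub> Y')"
    if "X \<in> IB \<tau>" "X' \<in> IB \<tau>" "Z \<in> IB \<tau>" "Y \<in> IB \<omega>" "Y' \<in> IB \<omega>" for X X' Y Y' Z
    using that by (elim IB_E; simp add: B.f_ring_simps B.int_comp_simps distrib_left distrib_right)+
  have 2: "psi (\<tau> + \<omega>) (B.pr (scal (qt powi n) (\<Phi> a)) \<otimes>\<^bsub>f_ring \<Omega> (emb qv) qt\<^esub> Y)
    = K0_bimap (copies (Cat Q (\<tau> + \<omega>))) (ftor_comp (shift ?s) ?I) (psi \<tau> (B.pr (scal (qt powi n) (\<Phi> a)))) (psi \<omega> Y)"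
    if a: "A.pr a \<in> A.intf" "homog \<tau> a" for n a
    using assms(2)
  proof (induction rule: IB_induct)
    case (add Y Y')
    note s = IB_single[OF a, of n]
    show ?case
      using add s by (simp add: dist(2)[OF s s s] psi_add IB_mult r psi_closed del: plus_fun_apply)
  qed (use 1 a in blast)
  show ?thesis
    unfolding frak_sel using assms(1)
  proof (induction rule: IB_induct)
    case (add X X')
    then show ?case
      using assms(2) by (simp add: dist(1)[of X X' X Y Y] psi_add IB_mult l psi_closed del: plus_fun_apply)
  qed (use 2 in blast)
qed

lemma res_A:
  assumes "X \<in> IA (\<tau> + \<omega>)"
  obtains p where "Poly_Mapping.keys p \<subseteq> IA \<tau> \<times> IA \<omega>" "f_comult_comp \<Omega> qv 1 \<tau> \<omega> X = cls (A.trels \<tau> \<omega>) p"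
    "K0_map (Prod Q \<tau> \<omega>) (Res Q \<tau> \<omega>) (\<phi> (\<tau> + \<omega>) X) = \<kappa> \<tau> \<omega> (cls (TA \<tau> \<omega>) (frag_extend (\<lambda>(x, y). frag_of (\<phi> \<tau> x, \<phi> \<omega> y)) p))"
proof -
  have "\<exists>p. Poly_Mapping.keys p \<subseteq> IA \<tau> \<times> IA \<omega> \<and>
      tensor_class (subring_of UNIV) (f_comp \<Omega> qv 1 \<tau>) (f_comp \<Omega> qv 1 \<omega>) p = f_comult_comp \<Omega> qv 1 \<tau> \<omega> X \<and>
      K0_map (Prod Q \<tau> \<omega>) (Res Q \<tau> \<omega>) (\<phi> (\<tau> + \<omega>) X)
        = \<kappa> \<tau> \<omega> (tensor_class RA (K0_of Q \<tau>) (K0_of Q \<omega>) (frag_extend (\<lambda>(x, y). frag_of (\<phi> \<tau> x, \<phi> \<omega> y)) p))"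
    using phi assms unfolding bialgebra_iso_def by blast
  then show ?thesis
    using that unfolding tensor_pair.tensor_class_eq[OF A.tensor_pair_f_comp] clsA by metis
qed

text \<open>The restriction clause is applied to the class of zero, whose representatives are the
  elements of the radical.\<close>

sublocale twisting_comult
proof
  fix x \<tau> \<omega> assume x: "x \<in> A.rad"
  obtain p where "f_comult_comp \<Omega> qv 1 \<tau> \<omega> (A.pr 0) = cls (A.trels \<tau> \<omega>) p"
    using res_A[OF pr_zero_IA] by metis
  then show "A.tpart \<tau> \<omega> (comult \<Omega> qv 1 x) \<in> spn (A.trels \<tau> \<omega>)"
    using x by (rule comult_rad_A)
qed

text \<open>On single powers of t the witness is \<open>Th\<close> of the given one, with index
  lowered by [tau,omega], the amount by which the restriction functor is shifted. Witnesses for a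
  sum are added, which relies on r being well defined on the quotient.\<close>

lemma res_B:
  assumes "X \<in> IB (\<tau> + \<omega>)"
  shows "\<exists>p. Poly_Mapping.keys p \<subseteq> IB \<tau> \<times> IB \<omega> \<and> f_comult_comp \<Omega> (emb qv) qt \<tau> \<omega> X = cls (B.trels \<tau> \<omega>) p \<and>
    K0_map (copies (Prod Q \<tau> \<omega>)) (Res (frak \<Omega> Q) \<tau> \<omega>) (psi (\<tau> + \<omega>) X)
      = kap \<tau> \<omega> (cls (TB \<tau> \<omega>) (frag_extend (\<lambda>(x, y). frag_of (psi \<tau> x, psi \<omega> y)) p))"
proof -
  let ?s = "- sq_form \<Omega> \<tau> \<omega>"
  note rc = add_ftor.ftor_copies_add_ftor[OF res_add_ftor]
  note sh = preadd.shift_add_ftor[OF additive_preadd[OF prod_additive]]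
  note F = ftor_comp_add_ftor[OF rc sh]
  show ?thesis
    unfolding frak_sel(6) using assms
  proof (induction rule: IB_induct)
    case (single n a)
    obtain p where p: "Poly_Mapping.keys p \<subseteq> IA \<tau> \<times> IA \<omega>" "f_comult_comp \<Omega> qv 1 \<tau> \<omega> (A.pr a) = cls (A.trels \<tau> \<omega>) p"
      "K0_map (Prod Q \<tau> \<omega>) (Res Q \<tau> \<omega>) (\<phi> (\<tau> + \<omega>) (A.pr a)) = \<kappa> \<tau> \<omega> (cls (TA \<tau> \<omega>) (frag_extend (\<lambda>(x, y). frag_of (\<phi> \<tau> x, \<phi> \<omega> y)) p))"
      using res_A[OF IA_I[OF single]] by metis
    let ?q = "frag_extend (\<lambda>(x, y). frag_of (\<phi> \<tau> x, \<phi> \<omega> y)) p"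
    have q: "Poly_Mapping.keys ?q \<subseteq> carrier (K \<tau>) \<times> carrier (K \<omega>)"
      by (rule keys_frag_extend_subset[OF p(1)]) (auto simp: phi_closed)
    have Em: "Em m x \<in> IB \<nu>" "psi \<nu> (Em m x) = inc \<nu> m (\<phi> \<nu> x)" if "x \<in> IA \<nu>" for m x \<nu>
      using that by (elim IA_E; simp add: Em_pr IB_single psi_single)+
    have "Poly_Mapping.keys (Th (n - sq_form \<Omega> \<tau> \<omega>) p) \<subseteq> IB \<tau> \<times> IB \<omega>"
      unfolding Th_def by (rule keys_frag_extend_subset[OF p(1)]) (auto simp: Em)
    moreover have "f_comult_comp \<Omega> (emb qv) qt \<tau> \<omega> (B.pr (scal (qt powi n) (\<Phi> a))) = cls (B.trels \<tau> \<omega>) (Th (n - sq_form \<Omega> \<tau> \<omega>) p)"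
      by (rule f_comult_comp_B_twisted[OF p(2)])
    moreover have "K0_map (copies (Prod Q \<tau> \<omega>)) (ftor_comp (shift ?s) (ftor_copies (Res Q \<tau> \<omega>))) (psi (\<tau> + \<omega>) (B.pr (scal (qt powi n) (\<Phi> a))))
      = kap \<tau> \<omega> (cls (TB \<tau> \<omega>) (frag_extend (\<lambda>(x, y). frag_of (psi \<tau> x, psi \<omega> y)) (Th (n - sq_form \<Omega> \<tau> \<omega>) p)))"
    proof -
      have pa: "\<phi> (\<tau> + \<omega>) (A.pr a) \<in> carrier (K (\<tau> + \<omega>))" by (rule phi_closed[OF IA_I[OF single]])
      have "frag_extend (\<lambda>(x, y). frag_of (psi \<tau> x, psi \<omega> y)) (Th m p) = Tk \<tau> \<omega> m ?q" for m
        unfolding Th_def Tk_def using p(1)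
        by (rule free_Abelian_group_induct) (auto simp: frag_extend_diff Em)
      moreover have "K0_map (copies (Prod Q \<tau> \<omega>)) (ftor_comp (shift ?s) (ftor_copies (Res Q \<tau> \<omega>))) (inc (\<tau> + \<omega>) n (\<phi> (\<tau> + \<omega>) (A.pr a)))
        = gr_incl (Prod Q \<tau> \<omega>) (n + ?s) (K0_map (Prod Q \<tau> \<omega>) (Res Q \<tau> \<omega>) (\<phi> (\<tau> + \<omega>) (A.pr a)))"
        using K0_map_comp[OF rc sh inc_closed[OF pa]]
          gr_ftor_copies_incl[OF cat_additive prod_additive res_add_ftor pa]
          additive_cat.gr_shift_incl[OF prod_additive add_ftor.K0_map_closed[OF res_add_ftor pa]] by simp
      ultimately show ?thesis by (simp add: psi_single[OF single] p(3) kap_Tk[OF q])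
    qed
    ultimately show ?case by (intro exI conjI)
  next
    case (add X Y)
    obtain p where p: "Poly_Mapping.keys p \<subseteq> IB \<tau> \<times> IB \<omega>" "f_comult_comp \<Omega> (emb qv) qt \<tau> \<omega> X = cls (B.trels \<tau> \<omega>) p"
      "K0_map (copies (Prod Q \<tau> \<omega>)) (ftor_comp (shift ?s) (ftor_copies (Res Q \<tau> \<omega>))) (psi (\<tau> + \<omega>) X)
        = kap \<tau> \<omega> (cls (TB \<tau> \<omega>) (frag_extend (\<lambda>(x, y). frag_of (psi \<tau> x, psi \<omega> y)) p))"
      using add.IH(1) by (elim exE conjE)
    obtain q where q: "Poly_Mapping.keys q \<subseteq> IB \<tau> \<times> IB \<omega>" "f_comult_comp \<Omega> (emb qv) qt \<tau> \<omega> Y = cls (B.trels \<tau> \<omega>) q"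
      "K0_map (copies (Prod Q \<tau> \<omega>)) (ftor_comp (shift ?s) (ftor_copies (Res Q \<tau> \<omega>))) (psi (\<tau> + \<omega>) Y)
        = kap \<tau> \<omega> (cls (TB \<tau> \<omega>) (frag_extend (\<lambda>(x, y). frag_of (psi \<tau> x, psi \<omega> y)) q))"
      using add.IH(2) by (elim exE conjE)
    obtain x y where xy: "X = B.pr x" "Y = B.pr y" using add.hyps(1,2) by (elim IB_E)
    show ?case
    proof (intro exI[of _ "p + q"] conjI)
      show "Poly_Mapping.keys (p + q) \<subseteq> IB \<tau> \<times> IB \<omega>" by (rule order_trans[OF keys_add Un_least[OF p(1) q(1)]])
      show "f_comult_comp \<Omega> (emb qv) qt \<tau> \<omega> (X \<oplus>\<^bsub>int_comp \<Omega> (emb qv) qt (\<tau> + \<omega>)\<^esub> Y) = cls (B.trels \<tau> \<omega>) (p + q)"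
        using f_comult_comp_B_add p(2) q(2) by (simp add: xy B.int_comp_simps)
      show "K0_map (copies (Prod Q \<tau> \<omega>)) (ftor_comp (shift ?s) (ftor_copies (Res Q \<tau> \<omega>))) (psi (\<tau> + \<omega>) (X \<oplus>\<^bsub>int_comp \<Omega> (emb qv) qt (\<tau> + \<omega>)\<^esub> Y))
        = kap \<tau> \<omega> (cls (TB \<tau> \<omega>) (frag_extend (\<lambda>(x, y). frag_of (psi \<tau> x, psi \<omega> y)) (p + q)))"
        using add(1,2) p(3) q(3)
        by (simp add: psi_add add_ftor.K0_map_mult[OF F] psi_closed frag_extend_add kap_add)
    qed
  qed
qed

lemma frak_categorification: "categorification \<Omega> (emb qv) qt (frak \<Omega> Q)"
  unfolding categorification_def
proof (intro conjI exI)
  note preadds = additive_preadd[OF cat_additive] additive_preadd[OF prod_additive]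
  have "biadditive_ftor (copies (Cat Q \<tau>)) (copies (Cat Q \<omega>)) (copies (Cat Q (\<tau> + \<omega>))) (Ind (frak \<Omega> Q) \<tau> \<omega>)" for \<tau> \<omega>
    unfolding frak_sel
    by (rule biadd_ftor.biadd_ftor[OF ftor_comp_biadd_ftor[OF conv_ftor.conv_biadd_ftor[OF ind_conv] preadd.shift_add_ftor[OF preadds(1)]]])
  moreover have "additive_ftor (copies (Cat Q (\<tau> + \<omega>))) (copies (Prod Q \<tau> \<omega>)) (Res (frak \<Omega> Q) \<tau> \<omega>)" for \<tau> \<omega>
    unfolding frak_sel
    by (rule add_ftor.add_ftor[OF ftor_comp_add_ftor[OF add_ftor.ftor_copies_add_ftor[OF res_add_ftor] preadd.shift_add_ftor[OF preadds(2)]]])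
  moreover have "biadditive_ftor (copies (Cat Q \<tau>)) (copies (Cat Q \<omega>)) (copies (Prod Q \<tau> \<omega>)) (Ext (frak \<Omega> Q) \<tau> \<omega>)" for \<tau> \<omega>
    unfolding frak_sel by (rule biadd_ftor.biadd_ftor[OF ext_biadd'])
  ultimately show "categ_data LB (frak \<Omega> Q)"
    unfolding categ_data_def additive_category_iff frak_sel(1,3)
    using additive_cat.copies_additive[OF cat_additive] additive_cat.copies_additive[OF prod_additive] ACT_module by blast
  show "is_kappa LB (frak \<Omega> Q) kap"
    unfolding is_kappa_def frak_sel(1,3,4) using kap_iso kap_frag by (simp add: clsB)
  show "bialgebra_iso \<Omega> (emb qv) qt (frak \<Omega> Q) kap psi"
    unfolding bialgebra_iso_def frak_sel(1,3)
  proof (intro conjI allI ballI)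
    show "bij_betw (psi \<nu>) (IB \<nu>) (carrier (MB \<nu>))" for \<nu> using psi_bij by (simp add: K0_module_sel)
    show "psi \<nu> (X \<oplus>\<^bsub>int_comp \<Omega> (emb qv) qt \<nu>\<^esub> Y) = psi \<nu> X \<oplus>\<^bsub>MB \<nu>\<^esub> psi \<nu> Y" if "X \<in> IB \<nu>" "Y \<in> IB \<nu>" for \<nu> X Y
      using that by (simp add: psi_add K0_module_sel)
    show "psi \<nu> (a \<odot>\<^bsub>int_comp \<Omega> (emb qv) qt \<nu>\<^esub> X) = a \<odot>\<^bsub>MB \<nu>\<^esub> psi \<nu> X" if "a \<in> LB" "X \<in> IB \<nu>" for \<nu> a X
      using that by (simp add: psi_scal K0_module_sel)
    show "psi (\<tau> + \<omega>) (X \<otimes>\<^bsub>f_ring \<Omega> (emb qv) qt\<^esub> Y)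
        = K0_bimap (copies (Cat Q (\<tau> + \<omega>))) (Ind (frak \<Omega> Q) \<tau> \<omega>) (psi \<tau> X) (psi \<omega> Y)" if "X \<in> IB \<tau>" "Y \<in> IB \<omega>" for \<tau> \<omega> X Y
      using that by (rule psi_mult)
    show "\<exists>p. Poly_Mapping.keys p \<subseteq> IB \<tau> \<times> IB \<omega> \<and>
          tensor_class (subring_of UNIV) (f_comp \<Omega> (emb qv) qt \<tau>) (f_comp \<Omega> (emb qv) qt \<omega>) p = f_comult_comp \<Omega> (emb qv) qt \<tau> \<omega> X \<and>
          K0_map (copies (Prod Q \<tau> \<omega>)) (Res (frak \<Omega> Q) \<tau> \<omega>) (psi (\<tau> + \<omega>) X)
            = kap \<tau> \<omega> (tensor_class RB (MB \<tau>) (MB \<omega>) (frag_extend (\<lambda>(x, y). frag_of (psi \<tau> x, psi \<omega> y)) p))"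
      if "X \<in> IB (\<tau> + \<omega>)" for \<tau> \<omega> X
      using res_B[OF that] unfolding tensor_pair.tensor_class_eq[OF B.tensor_pair_f_comp] clsB by metis
  qed
qed

end

theorem theorem9:
  fixes \<Omega> :: "'i::finite \<Rightarrow> 'i \<Rightarrow> int"
    and Q :: "('i, Qv, 'o, 'm, 'p, 'n) categ"
  assumes "cartan_datum \<Omega>"
    and "categorification \<Omega> qv 1 Q"
  shows "categorification \<Omega> (emb qv) qt (frak \<Omega> Q)"
proof -
  obtain \<kappa> \<phi> where "categ_data (laurent qv 1) Q" "is_kappa (laurent qv 1) Q \<kappa>" "bialgebra_iso \<Omega> qv 1 Q \<kappa> \<phi>"
    using assms(2) unfolding categorification_def by blast
  then interpret categ_ext \<Omega> Q \<kappa> \<phi> by unfold_locales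
  show ?thesis by (rule frak_categorification)
qed

end
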